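(* Assume either $PFA^+$ or $MM$, and let $\delta$ be an inaccessible cardinal. Then there is a tower of ideals of height $\delta$ with critical point $\omega_2$ which is not presaturated; in fact, this tower fails to have the weak Chang property.
   Context: The base theory is ZFC. Forcing axioms. For a class $\Gamma$ of posets and an ordinal $\beta$, $FA^{+\beta}(\Gamma)$ says: for every $\mathbb P\in\Gamma$, every collection $\mathcal D$ of $\omega_1$ many dense subsets of $\mathbb P$, and every sequence $\langle\dot S_\xi:\xi<\beta\rangle$ of $\mathbb P$-names forced to be stationary subsets of $\omega_1$, there is a filter $F\subset\mathbb P$ meeting every $D\in\mathcal D$ such that for every $\xi<\beta$ the set $\{\alpha<\omega_1:\exists q\in F\ q\Vdash\check\alpha\in\dot S_\xi\}$ is stationary. $PFA^+$ is $FA^{+1}$(proper posets); $MM$ is $FA^{+0}$(posets preserving stationary subsets of $\omega_1$). Ideals. For a set $Z$, an ideal $I\subset\wp(Z)$ is always proper, countably complete, fine (for every $b\in\bigcup Z$, $\{M\in Z: b\notin M\}\in I$) and normal (if $S\notin I$ and $g$ is a function on $S$ with $g(M)\in M$ for all $M\in S$, then $g$ is constant on some $S'\subseteq S$ with $S'\notin I$). $I^+=\wp(Z)\setminus I$. The completeness of $I$ is the cardinal $\mu$ such that $I$ is closed under unions of fewer than $\mu$ of its members but not under unions of $\mu$ of its members. If $I\subset\wp(Z)$, $I'\subset\wp(Z')$ and $\bigcup Z\subseteq\bigcup Z'$, then $I$ is the canonical projection of $I'$ to $Z$ iff $I=\{A\subseteq Z:\{M'\in Z': M'\cap\bigcup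 Z\in A\}\in I'\}$. Towers. A tower of ideals of height $\delta$ is a sequence $\vec I=\langle I_\lambda\rangle$, indexed by the regular cardinals $\lambda$ with $\omega_2\le\lambda<\delta$, where $I_\lambda$ is an ideal on $Z_\lambda=\wp_{\omega_2}(H_\lambda)$ and, for $\lambda\le\lambda'$, $I_\lambda$ is the canonical projection of $I_{\lambda'}$ to $Z_\lambda$. If all $I_\lambda$ have the same completeness, it is called the critical point of $\vec I$. $\mathbb P_{\vec I}$ is the poset of pairs $(\lambda,S)$ with $S\in I_\lambda^+$, ordered by $(\lambda',S')\le(\lambda,S)$ iff $\lambda'\ge\lambda$ and $S'\subseteq\{M'\in Z_{\lambda'}: M'\cap H_\lambda\in S\}$. $\vec I$ is presaturated iff $\delta$ remains a regular cardinal in every generic extension of $V$ by $\mathbb P_{\vec I}$. Generic ultrapower. Let $G$ be $(V,\mathbb P_{\vec I})$-generic and $proj(G,\lambda)=\{S:(\lambda,S)\in G\}$. A (partial) function $f\in V$ from $V_\delta$ to $V$ has bounded support if for some $\lambda<\delta$, $f(x)$ depends only on $x\cap H_\lambda$. $ult(V,G)$ is the set of classes $[f]_G$ of functions $f\in V$ with bounded support, where $[f]_G=[g]_G$ (resp. $[f]_G\in[g]_G$) iff $\{M\in Z_\lambda: f(M)=g(M)\}$ (resp. $f(M)\in g(M)$) is in $proj(G,\lambda)$ for all sufficiently large $\lambda<\delta$. The wellfounded part of $ult(V,G)$ is identified with its transitive collapse. A tower of inaccessible height $\delta$ has the weak Chang property iff whenever $G$ is $(V,\mathbb P_{\vec I})$-generic,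 $\delta$ is an element of the wellfounded part of $ult(V,G)$ and $\delta$ is regular in $ult(V,G)$. *)

theory Defs
  imports Main
begin

text \<open>
  The base theory is first-order ZFC. A statement of ZFC is rendered as a statement about an
  arbitrary model \<open>('v, E)\<close> of first-order ZFC, not necessarily wellfounded from outside. Hence
  every quantifier over sets, functions, sequences, names etc. below ranges over elements of \<open>'v\<close>;
  HOL sets of type \<open>'v set\<close> are used only for classes definable in the model.
\<close>

section \<open>Models of ZFC\<close>

text \<open>
  The predicates on assignments of (numbered) variables that are defined by a first-order formula in
  the language of set theory. Parameters are admitted through the assignment.
\<close>

inductive fo_definable :: "('v \<Rightarrow> 'v \<Rightarrow> bool) \<Rightarrow> ((nat \<Rightarrow> 'v) \<Rightarrow> bool) \<Rightarrow> bool"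
  for E :: "'v \<Rightarrow> 'v \<Rightarrow> bool" where
  fo_mem: "fo_definable E (\<lambda>e. E (e i) (e j))"
| fo_eq: "fo_definable E (\<lambda>e. e i = e j)"
| fo_not: "fo_definable E \<phi> \<Longrightarrow> fo_definable E (\<lambda>e. \<not> \<phi> e)"
| fo_and: "fo_definable E \<phi> \<Longrightarrow> fo_definable E \<psi> \<Longrightarrow> fo_definable E (\<lambda>e. \<phi> e \<and> \<psi> e)"
| fo_all: "fo_definable E \<phi> \<Longrightarrow> fo_definable E (\<lambda>e. \<forall>x. \<phi> (e(i := x)))"

locale zfc =
  fixes E :: "'v \<Rightarrow> 'v \<Rightarrow> bool"
  assumes extensionality: "(\<And>z. E z x \<longleftrightarrow> E z y) \<Longrightarrow> x = y"
    and foundation: "E y x \<Longrightarrow> \<exists>m. E m x \<and> (\<forall>z. E z x \<longrightarrow> \<not> E z m)"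
    and pairing: "\<exists>w. \<forall>z. E z w \<longleftrightarrow> z = x \<or> z = y"
    and union: "\<exists>u. \<forall>z. E z u \<longleftrightarrow> (\<exists>y. E y x \<and> E z y)"
    and powerset: "\<exists>w. \<forall>y. E y w \<longleftrightarrow> (\<forall>z. E z y \<longrightarrow> E z x)"
    and infinity: "\<exists>w. (\<exists>n. E n w \<and> (\<forall>z. \<not> E z n)) \<and>
      (\<forall>n. E n w \<longrightarrow> (\<exists>s. E s w \<and> (\<forall>z. E z s \<longleftrightarrow> E z n \<or> z = n)))"
    and separation: "fo_definable E \<phi> \<Longrightarrow> \<exists>y. \<forall>z. E z y \<longleftrightarrow> E z x \<and> \<phi> (e(0 := z))"
    and replacement: "fo_definable E \<phi> \<Longrightarrow> (\<And>u. E u x \<Longrightarrow> \<exists>!v. \<phi> (e(0 := u, 1 := v))) \<Longrightarrow>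
      \<exists>y. \<forall>v. E v y \<longleftrightarrow> (\<exists>u. E u x \<and> \<phi> (e(0 := u, 1 := v)))"
    and choice: "(\<And>y. E y x \<Longrightarrow> \<exists>z. E z y) \<Longrightarrow>
      (\<And>y y' z. E y x \<Longrightarrow> E y' x \<Longrightarrow> E z y \<Longrightarrow> E z y' \<Longrightarrow> y = y') \<Longrightarrow>
      \<exists>c. \<forall>y. E y x \<longrightarrow> (\<exists>!z. E z c \<and> E z y)"

section \<open>Formulas\<close>

text \<open>
  Formulas of set theory with parameters from \<open>'a\<close>, in higher-order abstract syntax. The same formula
  can thus be evaluated in the model, in its generic extensions (parameters are names) and in generic
  ultrapowers (parameters are functions of the ground model).
\<close>

datatype 'a form =
    Mem 'a 'a (infix "\<^bold>\<in>" 50)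
  | Equ 'a 'a (infix "\<^bold>=" 50)
  | Neg "'a form" ("\<^bold>\<not> _" [40] 40)
  | Conj "'a form" "'a form" (infixr "\<^bold>\<and>" 35)
  | All "'a \<Rightarrow> 'a form" (binder "\<^bold>\<forall>" 10)

abbreviation Disj :: "'a form \<Rightarrow> 'a form \<Rightarrow> 'a form" (infixr "\<^bold>\<or>" 30)
  where "\<phi> \<^bold>\<or> \<psi> \<equiv> \<^bold>\<not> (\<^bold>\<not> \<phi> \<^bold>\<and> \<^bold>\<not> \<psi>)"
abbreviation Impl :: "'a form \<Rightarrow> 'a form \<Rightarrow> 'a form" (infixr "\<^bold>\<longrightarrow>" 25)
  where "\<phi> \<^bold>\<longrightarrow> \<psi> \<equiv> \<^bold>\<not> (\<phi> \<^bold>\<and> \<^bold>\<not> \<psi>)"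
abbreviation Iff :: "'a form \<Rightarrow> 'a form \<Rightarrow> 'a form" (infixr "\<^bold>\<longleftrightarrow>" 25)
  where "\<phi> \<^bold>\<longleftrightarrow> \<psi> \<equiv> (\<phi> \<^bold>\<longrightarrow> \<psi>) \<^bold>\<and> (\<psi> \<^bold>\<longrightarrow> \<phi>)"
abbreviation Exi :: "('a \<Rightarrow> 'a form) \<Rightarrow> 'a form" (binder "\<^bold>\<exists>" 10)
  where "\<^bold>\<exists>x. \<phi> x \<equiv> \<^bold>\<not> (\<^bold>\<forall>x. \<^bold>\<not> \<phi> x)"

definition sub_f :: "'a \<Rightarrow> 'a \<Rightarrow> 'a form" where
  "sub_f x y = (\<^bold>\<forall>z. z \<^bold>\<in> x \<^bold>\<longrightarrow> z \<^bold>\<in> y)"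

definition upair_f :: "'a \<Rightarrow> 'a \<Rightarrow> 'a \<Rightarrow> 'a form" where
  "upair_f w x y = (\<^bold>\<forall>z. z \<^bold>\<in> w \<^bold>\<longleftrightarrow> (z \<^bold>= x \<^bold>\<or> z \<^bold>= y))"

definition opair_f :: "'a \<Rightarrow> 'a \<Rightarrow> 'a \<Rightarrow> 'a form" where
  "opair_f w x y = (\<^bold>\<exists>a. \<^bold>\<exists>b. upair_f a x x \<^bold>\<and> upair_f b x y \<^bold>\<and> upair_f w a b)"

definition rel_f :: "'a \<Rightarrow> 'a \<Rightarrow> 'a \<Rightarrow> 'a form" where
  "rel_f r x y = (\<^bold>\<exists>w. opair_f w x y \<^bold>\<and> w \<^bold>\<in> r)"

definition fun_f :: "'a \<Rightarrow> 'a \<Rightarrow> 'a \<Rightarrow> 'a form" where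
  "fun_f f a b =
    ((\<^bold>\<forall>w. w \<^bold>\<in> f \<^bold>\<longrightarrow> (\<^bold>\<exists>x. \<^bold>\<exists>y. x \<^bold>\<in> a \<^bold>\<and> y \<^bold>\<in> b \<^bold>\<and> opair_f w x y)) \<^bold>\<and>
     (\<^bold>\<forall>x. x \<^bold>\<in> a \<^bold>\<longrightarrow> (\<^bold>\<exists>y. rel_f f x y)) \<^bold>\<and>
     (\<^bold>\<forall>x. \<^bold>\<forall>y. \<^bold>\<forall>y'. (rel_f f x y \<^bold>\<and> rel_f f x y') \<^bold>\<longrightarrow> y \<^bold>= y'))"

definition inj_f :: "'a \<Rightarrow> 'a \<Rightarrow> 'a \<Rightarrow> 'a form" where
  "inj_f f a b =
    (fun_f f a b \<^bold>\<and> (\<^bold>\<forall>x. \<^bold>\<forall>x'. \<^bold>\<forall>y. (rel_f f x y \<^bold>\<and> rel_f f x' y) \<^bold>\<longrightarrow> x \<^bold>= x'))"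

definition trans_f :: "'a \<Rightarrow> 'a form" where
  "trans_f x = (\<^bold>\<forall>y. y \<^bold>\<in> x \<^bold>\<longrightarrow> sub_f y x)"

definition ord_f :: "'a \<Rightarrow> 'a form" where
  "ord_f x = (trans_f x \<^bold>\<and> (\<^bold>\<forall>y. y \<^bold>\<in> x \<^bold>\<longrightarrow> trans_f y))"

definition limit_f :: "'a \<Rightarrow> 'a form" where
  "limit_f x = (ord_f x \<^bold>\<and> (\<^bold>\<exists>y. y \<^bold>\<in> x) \<^bold>\<and> (\<^bold>\<forall>y. y \<^bold>\<in> x \<^bold>\<longrightarrow> (\<^bold>\<exists>z. z \<^bold>\<in> x \<^bold>\<and> y \<^bold>\<in> z)))"

definition omega_f :: "'a \<Rightarrow> 'a form" where
  "omega_f w = (limit_f w \<^bold>\<and> (\<^bold>\<forall>n. n \<^bold>\<in> w \<^bold>\<longrightarrow> \<^bold>\<not> limit_f n))"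

definition countable_f :: "'a \<Rightarrow> 'a form" where
  "countable_f x = (\<^bold>\<exists>w. omega_f w \<^bold>\<and> (\<^bold>\<exists>f. inj_f f x w))"

text \<open>Regular cardinals are infinite: limit ordinals without a cofinal map from a smaller ordinal.\<close>

definition regular_f :: "'a \<Rightarrow> 'a form" where
  "regular_f k =
    (limit_f k \<^bold>\<and>
     (\<^bold>\<forall>a. \<^bold>\<forall>f. (a \<^bold>\<in> k \<^bold>\<and> fun_f f a k) \<^bold>\<longrightarrow>
       (\<^bold>\<exists>b. b \<^bold>\<in> k \<^bold>\<and> (\<^bold>\<forall>x. \<^bold>\<forall>y. rel_f f x y \<^bold>\<longrightarrow> y \<^bold>\<in> b))))"

definition club_f :: "'a \<Rightarrow> 'a \<Rightarrow> 'a form" where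
  "club_f C k =
    (sub_f C k \<^bold>\<and>
     (\<^bold>\<forall>a. a \<^bold>\<in> k \<^bold>\<longrightarrow> (\<^bold>\<exists>b. b \<^bold>\<in> C \<^bold>\<and> a \<^bold>\<in> b)) \<^bold>\<and>
     (\<^bold>\<forall>a. (a \<^bold>\<in> k \<^bold>\<and> (\<^bold>\<exists>b. b \<^bold>\<in> a) \<^bold>\<and> (\<^bold>\<forall>b. b \<^bold>\<in> a \<^bold>\<longrightarrow> (\<^bold>\<exists>c. c \<^bold>\<in> C \<^bold>\<and> c \<^bold>\<in> a \<^bold>\<and> b \<^bold>\<in> c))) \<^bold>\<longrightarrow> a \<^bold>\<in> C))"

definition stationary_f :: "'a \<Rightarrow> 'a \<Rightarrow> 'a form" where
  "stationary_f S k =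
    (sub_f S k \<^bold>\<and> (\<^bold>\<forall>C. club_f C k \<^bold>\<longrightarrow> (\<^bold>\<exists>a. a \<^bold>\<in> C \<^bold>\<and> a \<^bold>\<in> S)))"

text \<open>
  Clubs and stationary sets of countable subsets of \<open>A\<close>; closure is under unions of increasing
  \<open>\<omega>\<close>-sequences.
\<close>

definition club_ctbl_f :: "'a \<Rightarrow> 'a \<Rightarrow> 'a form" where
  "club_ctbl_f C A =
    ((\<^bold>\<forall>x. x \<^bold>\<in> C \<^bold>\<longrightarrow> (sub_f x A \<^bold>\<and> countable_f x)) \<^bold>\<and>
     (\<^bold>\<forall>x. (sub_f x A \<^bold>\<and> countable_f x) \<^bold>\<longrightarrow> (\<^bold>\<exists>y. y \<^bold>\<in> C \<^bold>\<and> sub_f x y)) \<^bold>\<and>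
     (\<^bold>\<forall>w. \<^bold>\<forall>f. \<^bold>\<forall>u.
        (omega_f w \<^bold>\<and> fun_f f w C \<^bold>\<and>
         (\<^bold>\<forall>m. \<^bold>\<forall>n. \<^bold>\<forall>x. \<^bold>\<forall>y. (m \<^bold>\<in> n \<^bold>\<and> rel_f f m x \<^bold>\<and> rel_f f n y) \<^bold>\<longrightarrow> sub_f x y) \<^bold>\<and>
         (\<^bold>\<forall>z. z \<^bold>\<in> u \<^bold>\<longleftrightarrow> (\<^bold>\<exists>n. \<^bold>\<exists>x. rel_f f n x \<^bold>\<and> z \<^bold>\<in> x)))
        \<^bold>\<longrightarrow> u \<^bold>\<in> C))"

definition stationary_ctbl_f :: "'a \<Rightarrow> 'a \<Rightarrow> 'a form" where
  "stationary_ctbl_f S A =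
    ((\<^bold>\<forall>x. x \<^bold>\<in> S \<^bold>\<longrightarrow> (sub_f x A \<^bold>\<and> countable_f x)) \<^bold>\<and>
     (\<^bold>\<forall>C. club_ctbl_f C A \<^bold>\<longrightarrow> (\<^bold>\<exists>x. x \<^bold>\<in> C \<^bold>\<and> x \<^bold>\<in> S)))"

context zfc
begin

section \<open>Basic set theory in the model\<close>

primrec sat :: "'v form \<Rightarrow> bool" where
  "sat (x \<^bold>\<in> y) = E x y"
| "sat (x \<^bold>= y) = (x = y)"
| "sat (\<^bold>\<not> \<phi>) = (\<not> sat \<phi>)"
| "sat (\<phi> \<^bold>\<and> \<psi>) = (sat \<phi> \<and> sat \<psi>)"
| "sat (All \<phi>) = (\<forall>x. sat (\<phi> x))"

definition elts :: "'v \<Rightarrow> 'v set" where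
  "elts x = {y. E y x}"

text \<open>Only meaningful for those \<open>A\<close> that are the extension of an element of the model.\<close>

definition vset :: "'v set \<Rightarrow> 'v" where
  "vset A = (THE x. elts x = A)"

definition opair :: "'v \<Rightarrow> 'v \<Rightarrow> 'v" where
  "opair x y = vset {vset {x}, vset {x, y}}"

definition Union :: "'v \<Rightarrow> 'v" where
  "Union x = vset (\<Union>y \<in> elts x. elts y)"

definition Pow :: "'v \<Rightarrow> 'v" where
  "Pow x = vset {y. elts y \<subseteq> elts x}"

definition func :: "'v \<Rightarrow> 'v \<Rightarrow> bool" where
  "func f a \<longleftrightarrow>
    (\<forall>w \<in> elts f. \<exists>x \<in> elts a. \<exists>y. w = opair x y) \<and> (\<forall>x \<in> elts a. \<exists>!y. opair x y \<in> elts f)"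

definition app :: "'v \<Rightarrow> 'v \<Rightarrow> 'v" where
  "app f x = (THE y. opair x y \<in> elts f)"

definition Ord :: "'v \<Rightarrow> bool" where
  "Ord x \<longleftrightarrow> sat (ord_f x)"

definition card_le :: "'v \<Rightarrow> 'v \<Rightarrow> bool" where
  "card_le x y \<longleftrightarrow> (\<exists>f. sat (inj_f f x y))"

definition card_less :: "'v \<Rightarrow> 'v \<Rightarrow> bool" where
  "card_less x y \<longleftrightarrow> card_le x y \<and> \<not> card_le y x"

definition card_eq :: "'v \<Rightarrow> 'v \<Rightarrow> bool" where
  "card_eq x y \<longleftrightarrow> card_le x y \<and> card_le y x"

definition cardinal :: "'v \<Rightarrow> bool" where
  "cardinal k \<longleftrightarrow> Ord k \<and> (\<forall>a \<in> elts k. card_less a k)"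

definition regular :: "'v \<Rightarrow> bool" where
  "regular k \<longleftrightarrow> sat (regular_f k)"

definition omega :: "'v" where
  "omega = (THE w. sat (omega_f w))"

text \<open>The least ordinal that does not inject into \<open>x\<close>.\<close>

definition hartogs :: "'v \<Rightarrow> 'v" where
  "hartogs x = (THE a. Ord a \<and> \<not> card_le a x \<and> (\<forall>b \<in> elts a. card_le b x))"

definition omega1 :: "'v" where
  "omega1 = hartogs omega"

definition omega2 :: "'v" where
  "omega2 = hartogs omega1"

definition inaccessible :: "'v \<Rightarrow> bool" where
  "inaccessible k \<longleftrightarrow>
    regular k \<and> omega \<in> elts k \<and> (\<forall>a \<in> elts k. card_less (Pow a) k)"

text \<open>The level \<open>V\<^sub>a\<close> of the cumulative hierarchy, the union of the power sets of \<open>V\<^sub>c\<close> for \<open>c < a\<close>.\<close>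

definition Vlevel :: "'v \<Rightarrow> 'v" where
  "Vlevel a = (THE x. \<exists>h. func h (vset (insert a (elts a))) \<and>
     (\<forall>b \<in> insert a (elts a). elts (app h b) = {y. \<exists>c \<in> elts b. elts y \<subseteq> elts (app h c)}) \<and>
     x = app h a)"

text \<open>
  \<open>H\<^sub>\<lambda>\<close>: the transitive closure of \<open>x\<close> has size less than \<open>\<lambda>\<close> iff \<open>x\<close> is included in some
  transitive set of size less than \<open>\<lambda>\<close>.
\<close>

definition H :: "'v \<Rightarrow> 'v" where
  "H l = vset {x. \<exists>t. sat (trans_f t) \<and> elts x \<subseteq> elts t \<and> card_less t l}"

definition Z :: "'v \<Rightarrow> 'v" where
  "Z l = vset {M. elts M \<subseteq> elts (H l) \<and> card_less M omega2}"

section \<open>Ideals and towers of ideals\<close>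

definition ideal :: "'v \<Rightarrow> 'v \<Rightarrow> bool" where
  "ideal I X \<longleftrightarrow>
    (\<forall>A \<in> elts I. elts A \<subseteq> elts X) \<and>
    (\<forall>A \<in> elts I. \<forall>B. elts B \<subseteq> elts A \<longrightarrow> B \<in> elts I) \<and>
    \<comment> \<open>proper\<close>
    X \<notin> elts I \<and>
    \<comment> \<open>countably complete\<close>
    (\<forall>F. elts F \<subseteq> elts I \<and> sat (countable_f F) \<longrightarrow> Union F \<in> elts I) \<and>
    \<comment> \<open>fine\<close>
    (\<forall>b \<in> elts (Union X). vset {M \<in> elts X. b \<notin> elts M} \<in> elts I) \<and>
    \<comment> \<open>normal\<close>
    (\<forall>S g. elts S \<subseteq> elts X \<and> S \<notin> elts I \<and> func g S \<and> (\<forall>M \<in> elts S. app g M \<in> elts M) \<longrightarrow>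
      (\<exists>S' c. elts S' \<subseteq> elts S \<and> S' \<notin> elts I \<and> (\<forall>M \<in> elts S'. app g M = c)))"

definition completeness :: "'v \<Rightarrow> 'v \<Rightarrow> bool" where
  "completeness I m \<longleftrightarrow>
    cardinal m \<and>
    (\<forall>F. elts F \<subseteq> elts I \<and> card_less F m \<longrightarrow> Union F \<in> elts I) \<and>
    (\<exists>F. elts F \<subseteq> elts I \<and> card_eq F m \<and> Union F \<notin> elts I)"

definition canonical_projection :: "'v \<Rightarrow> 'v \<Rightarrow> 'v \<Rightarrow> 'v \<Rightarrow> bool" where
  "canonical_projection I X I' X' \<longleftrightarrow>
    elts I = {A. elts A \<subseteq> elts X \<and>
      vset {M' \<in> elts X'. vset (elts M' \<inter> elts (Union X)) \<in> elts A} \<in> elts I'}"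

definition tower_index :: "'v \<Rightarrow> 'v set" where
  "tower_index d = {l \<in> elts d. regular l \<and> elts omega2 \<subseteq> elts l}"

definition tower :: "'v \<Rightarrow> 'v \<Rightarrow> bool" where
  "tower d I \<longleftrightarrow>
    func I (vset (tower_index d)) \<and>
    (\<forall>l \<in> tower_index d. ideal (app I l) (Z l)) \<and>
    (\<forall>l \<in> tower_index d. \<forall>l' \<in> tower_index d. elts l \<subseteq> elts l' \<longrightarrow>
      canonical_projection (app I l) (Z l) (app I l') (Z l'))"

definition critical_point :: "'v \<Rightarrow> 'v \<Rightarrow> 'v \<Rightarrow> bool" where
  "critical_point d I k \<longleftrightarrow> (\<forall>l \<in> tower_index d. completeness (app I l) k)"

definition tower_conditions :: "'v \<Rightarrow> 'v \<Rightarrow> 'v set" where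
  "tower_conditions d I =
    {opair l S | l S. l \<in> tower_index d \<and> elts S \<subseteq> elts (Z l) \<and> S \<notin> elts (app I l)}"

definition tower_poset :: "'v \<Rightarrow> 'v \<Rightarrow> 'v" where
  "tower_poset d I = vset (tower_conditions d I)"

definition tower_order :: "'v \<Rightarrow> 'v \<Rightarrow> 'v" where
  "tower_order d I = vset {opair (opair l' S') (opair l S) | l' S' l S.
     opair l' S' \<in> tower_conditions d I \<and> opair l S \<in> tower_conditions d I \<and>
     elts l \<subseteq> elts l' \<and>
     elts S' \<subseteq> {M' \<in> elts (Z l'). vset (elts M' \<inter> elts (H l)) \<in> elts S}}"

section \<open>Forcing\<close>

text \<open>
  A poset is given by its underlying set \<open>P\<close> and the set \<open>L\<close> of pairs \<open>(q, p)\<close> with \<open>q \<le> p\<close>; a largest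
  element is not required. Truth in all generic extensions is, as usual, understood as being forced
  by every condition.
\<close>

definition poset :: "'v \<Rightarrow> 'v \<Rightarrow> bool" where
  "poset P L \<longleftrightarrow>
    elts P \<noteq> {} \<and>
    (\<forall>w \<in> elts L. \<exists>q \<in> elts P. \<exists>p \<in> elts P. w = opair q p) \<and>
    (\<forall>p \<in> elts P. opair p p \<in> elts L) \<and>
    (\<forall>p q r. opair r q \<in> elts L \<and> opair q p \<in> elts L \<longrightarrow> opair r p \<in> elts L) \<and>
    (\<forall>p q. opair q p \<in> elts L \<and> opair p q \<in> elts L \<longrightarrow> p = q)"

definition below :: "'v \<Rightarrow> 'v \<Rightarrow> 'v \<Rightarrow> 'v set" where
  "below P L p = {q \<in> elts P. opair q p \<in> elts L}"

definition dense :: "'v \<Rightarrow> 'v \<Rightarrow> 'v \<Rightarrow> bool" where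
  "dense P L D \<longleftrightarrow> elts D \<subseteq> elts P \<and> (\<forall>p \<in> elts P. \<exists>q \<in> below P L p. q \<in> elts D)"

definition filter_on :: "'v \<Rightarrow> 'v \<Rightarrow> 'v \<Rightarrow> bool" where
  "filter_on P L F \<longleftrightarrow>
    elts F \<subseteq> elts P \<and> elts F \<noteq> {} \<and>
    (\<forall>q \<in> elts F. \<forall>p \<in> elts P. opair q p \<in> elts L \<longrightarrow> p \<in> elts F) \<and>
    (\<forall>p \<in> elts F. \<forall>q \<in> elts F. \<exists>r \<in> elts F. opair r p \<in> elts L \<and> opair r q \<in> elts L)"

text \<open>
  A \<open>P\<close>-name is hereditarily a set of pairs \<open>(name, condition)\<close>, that is, an element of a set of names
  closed in the following sense.
\<close>

definition name_closed :: "'v \<Rightarrow> 'v \<Rightarrow> bool" where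
  "name_closed P N \<longleftrightarrow>
    (\<forall>x \<in> elts N. \<forall>w \<in> elts x. \<exists>y \<in> elts N. \<exists>p \<in> elts P. w = opair y p)"

definition name :: "'v \<Rightarrow> 'v \<Rightarrow> bool" where
  "name P x \<longleftrightarrow> (\<exists>N. name_closed P N \<and> x \<in> elts N)"

definition name_dom :: "'v \<Rightarrow> 'v set" where
  "name_dom x = {y. \<exists>p. opair y p \<in> elts x}"

text \<open>
  The standard recursion for the forcing relation on atomic formulas, carried out inside the model:
  \<open>Q\<close> and \<open>M\<close> are the sets of all \<open>(p, (a, b))\<close> with \<open>a, b\<close> in the closed set \<open>N\<close> of names such that
  \<open>p\<close> forces \<open>a = b\<close> and \<open>a \<in> b\<close>, respectively.
\<close>

definition forcing_table :: "'v \<Rightarrow> 'v \<Rightarrow> 'v \<Rightarrow> 'v \<Rightarrow> 'v \<Rightarrow> bool" where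
  "forcing_table P L N Q M \<longleftrightarrow>
    name_closed P N \<and>
    (\<forall>p \<in> elts P. \<forall>a \<in> elts N. \<forall>b \<in> elts N.
      (opair p (opair a b) \<in> elts Q \<longleftrightarrow>
        (\<forall>c \<in> name_dom a \<union> name_dom b. \<forall>q \<in> below P L p.
          opair q (opair c a) \<in> elts M \<longleftrightarrow> opair q (opair c b) \<in> elts M)) \<and>
      (opair p (opair a b) \<in> elts M \<longleftrightarrow>
        (\<forall>q \<in> below P L p. \<exists>r \<in> below P L q. \<exists>c s.
          opair c s \<in> elts b \<and> r \<in> below P L s \<and> opair r (opair a c) \<in> elts Q)))"

definition force_eq :: "'v \<Rightarrow> 'v \<Rightarrow> 'v \<Rightarrow> 'v \<Rightarrow> 'v \<Rightarrow> bool" where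
  "force_eq P L a b p \<longleftrightarrow>
    (\<exists>N Q M. forcing_table P L N Q M \<and> a \<in> elts N \<and> b \<in> elts N \<and> opair p (opair a b) \<in> elts Q)"

definition force_mem :: "'v \<Rightarrow> 'v \<Rightarrow> 'v \<Rightarrow> 'v \<Rightarrow> 'v \<Rightarrow> bool" where
  "force_mem P L a b p \<longleftrightarrow>
    (\<exists>N Q M. forcing_table P L N Q M \<and> a \<in> elts N \<and> b \<in> elts N \<and> opair p (opair a b) \<in> elts M)"

text \<open>
  Statements of the forcing language are represented by predicates on conditions (``is forced by'').
  Quantifiers range over classes \<open>D\<close> of the ground model; \<open>fex\<close>, \<open>fimp\<close>, \<open>fiff\<close> abbreviate the usual
  combinations of negation, conjunction and universal quantification.
\<close>

definition fneg :: "'v \<Rightarrow> 'v \<Rightarrow> ('v \<Rightarrow> bool) \<Rightarrow> 'v \<Rightarrow> bool" where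
  "fneg P L \<phi> = (\<lambda>p. \<forall>q \<in> below P L p. \<not> \<phi> q)"

definition fconj :: "('v \<Rightarrow> bool) \<Rightarrow> ('v \<Rightarrow> bool) \<Rightarrow> 'v \<Rightarrow> bool" where
  "fconj \<phi> \<psi> = (\<lambda>p. \<phi> p \<and> \<psi> p)"

definition fall :: "'v set \<Rightarrow> ('v \<Rightarrow> 'v \<Rightarrow> bool) \<Rightarrow> 'v \<Rightarrow> bool" where
  "fall D \<phi> = (\<lambda>p. \<forall>x \<in> D. \<phi> x p)"

definition fimp :: "'v \<Rightarrow> 'v \<Rightarrow> ('v \<Rightarrow> bool) \<Rightarrow> ('v \<Rightarrow> bool) \<Rightarrow> 'v \<Rightarrow> bool" where
  "fimp P L \<phi> \<psi> = fneg P L (fconj \<phi> (fneg P L \<psi>))"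

definition fiff :: "'v \<Rightarrow> 'v \<Rightarrow> ('v \<Rightarrow> bool) \<Rightarrow> ('v \<Rightarrow> bool) \<Rightarrow> 'v \<Rightarrow> bool" where
  "fiff P L \<phi> \<psi> = fconj (fimp P L \<phi> \<psi>) (fimp P L \<psi> \<phi>)"

definition fex :: "'v \<Rightarrow> 'v \<Rightarrow> 'v set \<Rightarrow> ('v \<Rightarrow> 'v \<Rightarrow> bool) \<Rightarrow> 'v \<Rightarrow> bool" where
  "fex P L D \<phi> = fneg P L (fall D (\<lambda>x. fneg P L (\<phi> x)))"

text \<open>
  Forced truth of a formula in a structure of the generic extension whose domain, membership and
  equality are described by the statements \<open>D\<close>, \<open>M\<close>, \<open>Q\<close> of the forcing language.
\<close>

primrec fsat :: "'v \<Rightarrow> 'v \<Rightarrow> ('v \<Rightarrow> 'v \<Rightarrow> bool) \<Rightarrow> ('v \<Rightarrow> 'v \<Rightarrow> 'v \<Rightarrow> bool) \<Rightarrow> ('v \<Rightarrow> 'v \<Rightarrow> 'v \<Rightarrow> bool) \<Rightarrow>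
    'v form \<Rightarrow> 'v \<Rightarrow> bool" where
  "fsat P L D M Q (x \<^bold>\<in> y) = M x y"
| "fsat P L D M Q (x \<^bold>= y) = Q x y"
| "fsat P L D M Q (\<^bold>\<not> \<phi>) = fneg P L (fsat P L D M Q \<phi>)"
| "fsat P L D M Q (\<phi> \<^bold>\<and> \<psi>) = fconj (fsat P L D M Q \<phi>) (fsat P L D M Q \<psi>)"
| "fsat P L D M Q (All \<phi>) = fall UNIV (\<lambda>x. fimp P L (D x) (fsat P L D M Q (\<phi> x)))"

definition forces :: "'v \<Rightarrow> 'v \<Rightarrow> 'v form \<Rightarrow> 'v \<Rightarrow> bool" where
  "forces P L \<phi> = fsat P L (\<lambda>x _. name P x) (force_mem P L) (force_eq P L) \<phi>"

definition forced :: "'v \<Rightarrow> 'v \<Rightarrow> 'v form \<Rightarrow> bool" where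
  "forced P L \<phi> \<longleftrightarrow> (\<forall>p \<in> elts P. forces P L \<phi> p)"

text \<open>The canonical name of \<open>x\<close>, the set of all \<open>(check y, p)\<close> with \<open>y \<in> x\<close> and \<open>p \<in> P\<close>.\<close>

definition check :: "'v \<Rightarrow> 'v \<Rightarrow> 'v" where
  "check P x = (THE c. \<exists>h t. sat (trans_f t) \<and> x \<in> elts t \<and> func h t \<and>
     (\<forall>y \<in> elts t. elts (app h y) = {opair (app h z) p | z p. z \<in> elts y \<and> p \<in> elts P}) \<and>
     c = app h x)"

definition generic_name :: "'v \<Rightarrow> 'v" where
  "generic_name P = vset {opair (check P p) p | p. p \<in> elts P}"

section \<open>Forcing axioms\<close>

text \<open>
  The collection of \<open>\<omega>\<^sub>1\<close> many dense sets is given by an enumeration \<open>D\<close>, and the sequence of names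
  by a function \<open>S\<close> with domain \<open>b\<close>.
\<close>

definition FA_plus :: "'v \<Rightarrow> ('v \<Rightarrow> 'v \<Rightarrow> bool) \<Rightarrow> bool" where
  "FA_plus b \<Gamma> \<longleftrightarrow>
    (\<forall>P L D S. poset P L \<and> \<Gamma> P L \<and>
      func D omega1 \<and> (\<forall>a \<in> elts omega1. dense P L (app D a)) \<and>
      func S b \<and> (\<forall>x \<in> elts b. name P (app S x) \<and>
        forced P L (stationary_f (app S x) (check P omega1))) \<longrightarrow>
      (\<exists>F. filter_on P L F \<and>
        (\<forall>a \<in> elts omega1. elts F \<inter> elts (app D a) \<noteq> {}) \<and>
        (\<forall>x \<in> elts b. sat (stationary_f
          (vset {a \<in> elts omega1. \<exists>q \<in> elts F. forces P L (check P a \<^bold>\<in> app S x) q}) omega1))))"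

definition proper :: "'v \<Rightarrow> 'v \<Rightarrow> bool" where
  "proper P L \<longleftrightarrow>
    (\<forall>k S. cardinal k \<and> omega \<in> elts k \<and> sat (stationary_ctbl_f S k) \<longrightarrow>
      forced P L (stationary_ctbl_f (check P S) (check P k)))"

definition stationary_preserving :: "'v \<Rightarrow> 'v \<Rightarrow> bool" where
  "stationary_preserving P L \<longleftrightarrow>
    (\<forall>S. sat (stationary_f S omega1) \<longrightarrow>
      forced P L (stationary_f (check P S) (check P omega1)))"

definition PFA_plus :: bool where
  "PFA_plus \<longleftrightarrow> FA_plus (vset {vset {}}) proper"

definition MM :: bool where
  "MM \<longleftrightarrow> FA_plus (vset {}) stationary_preserving"

section \<open>Presaturation and the weak Chang property\<close>

definition presaturated :: "'v \<Rightarrow> 'v \<Rightarrow> bool" where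
  "presaturated d I \<longleftrightarrow>
    forced (tower_poset d I) (tower_order d I) (regular_f (check (tower_poset d I) d))"

definition bounded_support :: "'v \<Rightarrow> 'v \<Rightarrow> bool" where
  "bounded_support d f \<longleftrightarrow>
    (\<forall>w \<in> elts f. \<exists>x \<in> elts (Vlevel d). \<exists>y. w = opair x y) \<and>
    (\<forall>x y y'. opair x y \<in> elts f \<and> opair x y' \<in> elts f \<longrightarrow> y = y') \<and>
    (\<exists>l \<in> tower_index d. \<forall>x \<in> elts (Vlevel d). \<forall>x' \<in> elts (Vlevel d).
      elts x \<inter> elts (H l) = elts x' \<inter> elts (H l) \<longrightarrow>
      (\<forall>y. opair x y \<in> elts f \<longleftrightarrow> opair x' y \<in> elts f))"

text \<open>The statement ``\<open>A l \<in> proj(G, l)\<close> for all sufficiently large \<open>l < d\<close>''.\<close>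

definition ult_eventually :: "'v \<Rightarrow> 'v \<Rightarrow> ('v \<Rightarrow> 'v set) \<Rightarrow> 'v \<Rightarrow> bool" where
  "ult_eventually d I A =
    (let P = tower_poset d I; L = tower_order d I in
     fex P L (tower_index d) (\<lambda>l0. fall {l \<in> tower_index d. elts l0 \<subseteq> elts l}
       (\<lambda>l. force_mem P L (check P (opair l (vset (A l)))) (generic_name P))))"

definition ult_eq :: "'v \<Rightarrow> 'v \<Rightarrow> 'v \<Rightarrow> 'v \<Rightarrow> 'v \<Rightarrow> bool" where
  "ult_eq d I f g =
    ult_eventually d I (\<lambda>l. {M \<in> elts (Z l). \<exists>u. opair M u \<in> elts f \<and> opair M u \<in> elts g})"

definition ult_mem :: "'v \<Rightarrow> 'v \<Rightarrow> 'v \<Rightarrow> 'v \<Rightarrow> 'v \<Rightarrow> bool" where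
  "ult_mem d I f g =
    ult_eventually d I
      (\<lambda>l. {M \<in> elts (Z l). \<exists>u v. opair M u \<in> elts f \<and> opair M v \<in> elts g \<and> u \<in> elts v})"

text \<open>
  A partial function represents an element of the ultrapower iff it is defined almost everywhere,
  i.e. \<open>[f] = [f]\<close>.
\<close>

definition ult_dom :: "'v \<Rightarrow> 'v \<Rightarrow> 'v \<Rightarrow> 'v \<Rightarrow> bool" where
  "ult_dom d I f = fconj (\<lambda>_. bounded_support d f) (ult_eq d I f f)"

definition ult_sat :: "'v \<Rightarrow> 'v \<Rightarrow> 'v form \<Rightarrow> 'v \<Rightarrow> bool" where
  "ult_sat d I \<phi> =
    fsat (tower_poset d I) (tower_order d I) (ult_dom d I) (ult_mem d I) (ult_eq d I) \<phi>"

text \<open>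
  The statement ``\<open>[f]\<close> is in the wellfounded part of \<open>ult(V,G)\<close> and its transitive collapse is the
  ordinal \<open>d\<close>''. The witness \<open>R\<close>, in the generic extension, relates each \<open>z \<le> d\<close> to functions \<open>g\<close> such
  that the predecessors of \<open>[g]\<close> are exactly the elements \<open>[g'']\<close> with \<open>R z' g''\<close> for some \<open>z' \<in> z\<close>;
  that is, \<open>R\<close> inverts the collapse on the transitive closure of \<open>{[f]}\<close>. Elements of \<open>d\<close> and
  representing functions are in the ground model, so they are quantified over there.
\<close>

definition ult_collapses_to :: "'v \<Rightarrow> 'v \<Rightarrow> 'v \<Rightarrow> 'v \<Rightarrow> bool" where
  "ult_collapses_to d I f =
    (let P = tower_poset d I; L = tower_order d I; B = {g. bounded_support d g};
         T = insert d (elts d);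
         rel = (\<lambda>R z g. force_mem P L (check P (opair z g)) R) in
     fex P L {R. name P R} (\<lambda>R.
       fconj (rel R d f)
      (fconj (fall T (\<lambda>z. fex P L B (\<lambda>g. rel R z g)))
      (fall T (\<lambda>z. fall B (\<lambda>g. fimp P L (rel R z g)
        (fconj (ult_dom d I g)
          (fall B (\<lambda>g'. fimp P L (ult_dom d I g')
            (fiff P L (ult_mem d I g' g)
              (fex P L (elts z) (\<lambda>z'. fex P L B (\<lambda>g''.
                fconj (rel R z' g'') (ult_eq d I g' g''))))))))))))))"

definition weak_Chang :: "'v \<Rightarrow> 'v \<Rightarrow> bool" where
  "weak_Chang d I \<longleftrightarrow>
    (\<forall>p \<in> elts (tower_poset d I).
      fex (tower_poset d I) (tower_order d I) {f. bounded_support d f}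
        (\<lambda>f. fconj (ult_dom d I f)
          (fconj (ult_collapses_to d I f) (ult_sat d I (regular_f f)))) p)"

end

end

theory Submission imports Defs begin

text \<open>
  Let \<open>\<kappa> < \<delta>\<close> be a successor cardinal above \<open>2\<close> to the power \<open>\<omega>\<^sub>2\<close>, and let an Ulam matrix split the
  ordinals below \<open>\<kappa>\<close> of countable cofinality into stationary sets \<open>T \<zeta>\<close>, \<open>\<zeta> < \<omega>\<^sub>2\<close>. Consider sets
  \<open>M \<subseteq> V\<^sub>\<delta>\<close> of size \<open>\<omega>\<^sub>1\<close> that contain all countable ordinals and are closed under application of
  functions. Such an \<open>M\<close> is good if \<open>sup (M \<inter> \<kappa>) \<in> T (\<epsilon> M)\<close> for some \<open>\<epsilon> M < \<omega>\<^sub>2\<close> above the order types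
  \<open>otp (M \<inter> z)\<close> of all \<open>z \<in> M \<inter> \<delta>\<close>. Every \<open>a \<in> V\<^sub>\<delta>\<close> belongs to a good set: play a game in which one player
  raises \<open>sup (M \<inter> \<kappa>)\<close> and the other extends \<open>M\<close> together with an increasing map from \<open>M \<inter> \<delta>\<close> to \<open>\<zeta>\<close>;
  if the first player won for each \<open>\<zeta>\<close>, playing against all these strategies at once would give an \<open>M\<close>
  whose own order types refute one of them. Hence the traces of the good sets containing a given
  parameter generate normal ideals, which form a tower with critical point \<open>\<omega>\<^sub>2\<close>.

  Let \<open>c z\<close> be the class of \<open>M \<mapsto> otp (M \<inter> z)\<close> in the generic ultrapower. The map \<open>c\<close> is strictly
  increasing from \<open>\<delta>\<close> to the class of \<open>\<epsilon>\<close>. Composing with injections of the \<open>\<epsilon> M\<close> into \<open>\<omega>\<^sub>1\<close> and pressing down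
  gives a function from a subset of \<open>\<omega>\<^sub>1\<close> onto \<open>\<delta>\<close>, so \<open>\<delta>\<close> is no longer regular. If \<open>\<delta>\<close> is in the wellfounded part,
  then its elements \<open>z\<close> are the \<open>c z\<close>. If moreover \<open>\<delta>\<close> is regular in the ultrapower, then it is represented by a
  function whose values are regular and above \<open>\<omega>\<^sub>1\<close>, hence at least \<open>\<omega>\<^sub>2\<close>, so that the class of \<open>\<epsilon>\<close> is
  below \<open>\<delta>\<close> and equal to some \<open>c z\<close>, contradicting goodness at \<open>z\<close>.
\<close>

section \<open>Definable classes\<close>

text \<open>The game answers a conflict of timing. The set \<open>T \<zeta>\<close> that is to
  contain \<open>sup (M \<inter> kappa)\<close> must be chosen before the closure argument that
  builds \<open>M\<close>, whereas the order types are known only once \<open>M\<close> is complete.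
  An increasing map into a \<zeta> fixed in advance controls them at every stage, since the collapse
  is the least increasing map. Countable cofinality matches plays of length omega. The size of
  \<open>kappa\<close> has the same origin: over all \<zeta>, at most 2 to the omega_2 many
  positions share a given \<open>M\<close>, so the demands of all strategies of the first player at
  \<open>M\<close> stay bounded below \<open>kappa\<close>. Normality and completeness rest on
  coding: a family of parameters is a function in V_\<delta>, hence a single parameter, and closure
  of \<open>M\<close> under application returns the values at elements of \<open>M\<close>. The
  model can be ill-founded from outside and has separation and replacement for first-order formulas
  only. Therefore every set, induction and recursion needs a proof that the predicate behind it is
  definable with parameters; the rules \<open>dfn\<close> assemble these proofs.\<close>

text \<open>De Bruijn indices make renaming of variables unproblematic.\<close>

inductive fo_deBruijn :: "('v \<Rightarrow> 'v \<Rightarrow> bool) \<Rightarrow> ((nat \<Rightarrow> 'v) \<Rightarrow> bool) \<Rightarrow> bool"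
  for E :: "'v \<Rightarrow> 'v \<Rightarrow> bool" where
  mem: "fo_deBruijn E (\<lambda>e. E (e i) (e j))"
| eq: "fo_deBruijn E (\<lambda>e. e i = e j)"
| neg: "fo_deBruijn E \<phi> \<Longrightarrow> fo_deBruijn E (\<lambda>e. \<not> \<phi> e)"
| conj: "fo_deBruijn E \<phi> \<Longrightarrow> fo_deBruijn E \<psi> \<Longrightarrow> fo_deBruijn E (\<lambda>e. \<phi> e \<and> \<psi> e)"
| all: "fo_deBruijn E \<phi> \<Longrightarrow> fo_deBruijn E (\<lambda>e. \<forall>x. \<phi> (case_nat x e))"

text \<open>Under a binder the renaming becomes \<open>case_nat 0 (Suc \<circ> r)\<close>, so no
  variable is captured.\<close>

lemma fo_deBruijn_rename: "fo_deBruijn E \<phi> \<Longrightarrow> fo_deBruijn E (\<lambda>e. \<phi> (\<lambda>n. e (r n)))"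
proof (induction arbitrary: r rule: fo_deBruijn.induct)
  case (all \<phi>)
  have "(\<lambda>e. \<phi> (\<lambda>n. e (case_nat 0 (Suc \<circ> r) n))) = (\<lambda>e. \<phi> (case_nat (e 0) (\<lambda>n. e (Suc (r n)))))"
    by (intro ext arg_cong[of _ _ \<phi>]) (auto split: nat.splits)
  with all.IH[of "case_nat 0 (Suc \<circ> r)"]
  have "fo_deBruijn E (\<lambda>e. \<phi> (case_nat (e 0) (\<lambda>n. e (Suc (r n)))))" by simp
  from fo_deBruijn.all[OF this] show ?case by simp
qed (auto intro: fo_deBruijn.intros)

text \<open>A formula mentions finitely many variables. The bound is used to find a fresh named
  variable when a binder is translated to \<open>fo_definable\<close>.\<close>

lemma fo_deBruijn_support:
  "fo_deBruijn E \<phi> \<Longrightarrow> \<exists>m. \<forall>e e'. (\<forall>n<m. e n = e' n) \<longrightarrow> \<phi> e = \<phi> e'"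
proof (induction rule: fo_deBruijn.induct)
  case (mem i j) show ?case by (rule exI[of _ "Suc (max i j)"]) (auto simp: less_Suc_eq_le)
next
  case (eq i j) show ?case by (rule exI[of _ "Suc (max i j)"]) (auto simp: less_Suc_eq_le)
next
  case (neg \<phi>) then show ?case by auto
next
  case (conj \<phi> \<psi>)
  then obtain m k where "\<forall>e e'. (\<forall>n<m. e n = e' n) \<longrightarrow> \<phi> e = \<phi> e'"
    "\<forall>e e'. (\<forall>n<k. e n = e' n) \<longrightarrow> \<psi> e = \<psi> e'" by blast
  then show ?case by (intro exI[of _ "max m k"]) (metis less_max_iff_disj)
next
  case (all \<phi>)
  then obtain m where m: "\<forall>e e'. (\<forall>n<m. e n = e' n) \<longrightarrow> \<phi> e = \<phi> e'" by blast
  have "\<phi> (case_nat x e) = \<phi> (case_nat x e')" if "\<forall>n<m. e n = e' n" for e e' x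
    using that by (intro m[rule_format]) (auto split: nat.splits)
  then show ?case by blast
qed

lemma fo_deBruijn_definable: "fo_deBruijn E \<phi> \<Longrightarrow> fo_definable E (\<lambda>e. \<phi> (\<lambda>n. e (r n)))"
proof (induction arbitrary: r rule: fo_deBruijn.induct)
  case (all \<phi>)
  obtain m where m: "\<forall>e e'. (\<forall>n<m. e n = e' n) \<longrightarrow> \<phi> e = \<phi> e'"
    using fo_deBruijn_support[OF all.hyps] by blast
  \<comment> \<open>A named variable outside the values of \<open>r\<close> on the relevant indices
    can carry the binder without capture.\<close>
  obtain i where i: "i \<notin> r ` {..<m}"
    using ex_new_if_finite[of "r ` {..<m}"] by auto
  have "\<phi> (\<lambda>n. (e(i := x)) (case_nat i r n)) = \<phi> (case_nat x (\<lambda>n. e (r n)))" for e x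
    using i by (intro m[rule_format]) (auto split: nat.splits)
  with fo_all[OF all.IH[of "case_nat i r"], of i] show ?case by simp
qed (auto intro: fo_definable.intros)

named_theorems dfn

context zfc
begin

text \<open>Formulas with parameters: the odd variables are interpreted by the parameters \<open>p\<close>.\<close>

definition mix :: "(nat \<Rightarrow> 'v) \<Rightarrow> (nat \<Rightarrow> 'v) \<Rightarrow> nat \<Rightarrow> 'v" where
  "mix e p n = (if even n then e (n div 2) else p (n div 2))"

definition D :: "((nat \<Rightarrow> 'v) \<Rightarrow> bool) \<Rightarrow> bool" where
  "D \<phi> \<longleftrightarrow> (\<exists>\<psi> p. fo_deBruijn E \<psi> \<and> (\<forall>e. \<phi> e = \<psi> (mix e p)))"

text \<open>The language has no function symbols, so a term is handled through its graph. The value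
  sits at variable 0 and the arguments are shifted by one, ready for the existential quantifier in
  \<open>D_subst\<close>.\<close>

definition Dt :: "((nat \<Rightarrow> 'v) \<Rightarrow> 'v) \<Rightarrow> bool" where
  "Dt t \<longleftrightarrow> D (\<lambda>e. e 0 = t (\<lambda>n. e (Suc n)))"

lemma DI: "fo_deBruijn E \<psi> \<Longrightarrow> (\<And>e. \<phi> e = \<psi> (mix e p)) \<Longrightarrow> D \<phi>"
  unfolding D_def by blast

lemma D_var_mem: "D (\<lambda>e. E (e i) (e j))"
  by (rule DI[OF fo_deBruijn.mem[of E "2*i" "2*j"]]) (simp add: mix_def)

lemma D_var_eq: "D (\<lambda>e. e i = e j)"
  by (rule DI[OF fo_deBruijn.eq[of E "2*i" "2*j"]]) (simp add: mix_def)

lemma D_not [dfn]: "D \<phi> \<Longrightarrow> D (\<lambda>e. \<not> \<phi> e)"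
  unfolding D_def by (metis fo_deBruijn.neg)

lemma D_conj [dfn]: assumes "D \<phi>" "D \<psi>" shows "D (\<lambda>e. \<phi> e \<and> \<psi> e)"
proof -
  obtain f p where f: "fo_deBruijn E f" "\<And>e. \<phi> e = f (mix e p)" using assms(1) D_def by auto
  obtain g q where g: "fo_deBruijn E g" "\<And>e. \<psi> e = g (mix e q)" using assms(2) D_def by auto
  \<comment> \<open>The two parameter sequences are interleaved as \<open>mix p q\<close>: parameter
    m of the first formula moves from variable 2m+1 to 4m+1, that of the second formula to
    4m+3.\<close>
  define r where "r n = (if even n then n else 2 * n - 1)" for n :: nat
  define s where "s n = (if even n then n else 2 * n + 1)" for n :: nat
  have r: "mix e p = (\<lambda>n. mix e (mix p q) (r n))" for e
    proof
    fix n show "mix e p n = mix e (mix p q) (r n)"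
    proof (cases "even n")
      case False then obtain m where "n = 2 * m + 1" by (elim oddE)
      moreover have "(2 * (2 * m + 1) - 1) div 2 = 2 * m" by simp
      ultimately show ?thesis by (simp add: mix_def r_def)
    qed (simp add: mix_def r_def)
  qed
  have s: "mix e q = (\<lambda>n. mix e (mix p q) (s n))" for e
  proof
    fix n show "mix e q n = mix e (mix p q) (s n)"
      proof (cases "even n")
      case False then obtain m where "n = 2 * m + 1" by (elim oddE)
      moreover have "(2 * (2 * m + 1) + 1) div 2 = 2 * m + 1" by simp
      ultimately show ?thesis by (simp add: mix_def s_def)
    qed (simp add: mix_def s_def)
  qed
  show ?thesis
    by (rule DI[OF fo_deBruijn.conj[OF fo_deBruijn_rename[OF f(1), of r]
          fo_deBruijn_rename[OF g(1), of s]], of _ "mix p q"])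
      (simp add: f(2) g(2) r[symmetric] s[symmetric])
qed

lemma D_all: assumes "D \<phi>" shows "D (\<lambda>e. \<forall>x. \<phi> (case_nat x e))"
proof -
  obtain f p where f: "fo_deBruijn E f" "\<And>e. \<phi> e = f (mix e p)" using assms D_def by auto
  \<comment> \<open>The quantifier puts its variable in front of \<open>mix e p\<close>, whereas
    \<open>mix\<close> counts it among the even variables; \<open>r\<close> translates between the
    two numberings.\<close>
  define r where "r n = (if even n then (if n = 0 then 0 else n - 1) else Suc n)" for n :: nat
  have r: "mix (case_nat x e) p = (\<lambda>n. case_nat x (mix e p) (r n))" for e x
  proof
    fix n show "mix (case_nat x e) p n = case_nat x (mix e p) (r n)"
    proof (cases "even n")
      case True then obtain m where "n = 2 * m" by (elim evenE)
      then show ?thesis by (cases m) (simp_all add: mix_def r_def)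
    qed (simp add: mix_def r_def)
  qed
  show ?thesis
    by (rule DI[OF fo_deBruijn.all[OF fo_deBruijn_rename[OF f(1), of r]], of _ p])
      (simp add: f(2) r)
qed

lemma D_rename: assumes "D \<phi>" shows "D (\<lambda>e. \<phi> (\<lambda>n. e (r n)))"
proof -
  obtain f p where f: "fo_deBruijn E f" "\<And>e. \<phi> e = f (mix e p)" using assms D_def by auto
  define s where "s n = (if even n then 2 * r (n div 2) else n)" for n :: nat
  have s: "mix (\<lambda>n. e (r n)) p = (\<lambda>n. mix e p (s n))" for e
    by (rule ext) (simp add: mix_def s_def)
  show ?thesis
    by (rule DI[OF fo_deBruijn_rename[OF f(1), of s], of _ p]) (simp add: f(2) s)
qed

text \<open>An arbitrary element of the model becomes one more parameter at the head of the
  sequence. This is the source of all constants in definable predicates.\<close>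

lemma D_const: assumes "D \<phi>" shows "D (\<lambda>e. \<phi> (case_nat c e))"
proof -
  obtain f p where f: "fo_deBruijn E f" "\<And>e. \<phi> e = f (mix e p)" using assms D_def by auto
  define s where "s n = (if even n then (if n = 0 then 1 else n - 2) else n + 2)" for n :: nat
  have s: "mix (case_nat c e) p = (\<lambda>n. mix e (case_nat c p) (s n))" for e
  proof
    fix n show "mix (case_nat c e) p n = mix e (case_nat c p) (s n)"
    proof (cases "even n")
      case True then obtain m where "n = 2 * m" by (elim evenE)
      then show ?thesis by (cases m) (simp_all add: mix_def s_def)
    qed (simp add: mix_def s_def)
  qed
  show ?thesis
    by (rule DI[OF fo_deBruijn_rename[OF f(1), of s], of _ "case_nat c p"]) (simp add: f(2) s)
qed

lemma D_All [dfn]: "D (\<lambda>e. \<phi> (e 0) (\<lambda>n. e (Suc n))) \<Longrightarrow> D (\<lambda>e. \<forall>x. \<phi> x e)"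
  by (drule D_all) simp

lemma D_Ex [dfn]: "D (\<lambda>e. \<phi> (e 0) (\<lambda>n. e (Suc n))) \<Longrightarrow> D (\<lambda>e. \<exists>x. \<phi> x e)"
  using D_not[OF D_All[of "\<lambda>x e. \<not> \<phi> x e"]] D_not by fastforce

lemma D_imp [dfn]: "D \<phi> \<Longrightarrow> D \<psi> \<Longrightarrow> D (\<lambda>e. \<phi> e \<longrightarrow> \<psi> e)"
  using D_not[OF D_conj[OF _ D_not]] by fastforce

lemma D_disj [dfn]: "D \<phi> \<Longrightarrow> D \<psi> \<Longrightarrow> D (\<lambda>e. \<phi> e \<or> \<psi> e)"
  using D_not[OF D_conj[OF D_not D_not]] by fastforce

lemma D_iff [dfn]: "D \<phi> \<Longrightarrow> D \<psi> \<Longrightarrow> D (\<lambda>e. \<phi> e \<longleftrightarrow> \<psi> e)"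
  using D_conj[OF D_imp D_imp, of \<phi> \<psi> \<psi> \<phi>] by (simp add: iff_conv_conj_imp)

lemma Dt_var [dfn]: "Dt (\<lambda>e. e i)"
  unfolding Dt_def by (rule D_var_eq)

lemma Dt_const [dfn]: "Dt (\<lambda>e. c)"
  unfolding Dt_def using D_const[OF D_var_eq[of 1 0], of c] by simp

lemma D_bool [dfn]: "D (\<lambda>e. b)"
proof (cases b)
  case True then show ?thesis using D_var_eq[of 0 0] by simp
next
  case False then show ?thesis using D_not[OF D_var_eq[of 0 0]] by simp
qed

text \<open>The term is eliminated by quantifying over its value and asserting the graph.\<close>

lemma D_subst: assumes "Dt t" "D \<phi>" shows "D (\<lambda>e. \<phi> (case_nat (t e) e))"
proof -
  have "D (\<lambda>e. \<exists>x. x = t e \<and> \<phi> (case_nat x e))"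
  proof (rule D_Ex, rule D_conj)
    show "D (\<lambda>e. e 0 = t (\<lambda>n. e (Suc n)))" using assms(1) by (simp add: Dt_def)
    have "case_nat (e 0) (\<lambda>n. e (Suc n)) = e" for e :: "nat \<Rightarrow> 'v" by (auto split: nat.splits)
    with assms(2) show "D (\<lambda>e. \<phi> (case_nat (e 0) (\<lambda>n. e (Suc n))))" by simp
  qed
  then show ?thesis by simp
qed

lemma D_compose1: "D (\<lambda>e. P (e 0)) \<Longrightarrow> Dt t \<Longrightarrow> D (\<lambda>e. P (t e))"
  using D_subst[of t "\<lambda>e. P (e 0)"] by simp

lemma Dt_rename: "Dt t \<Longrightarrow> Dt (\<lambda>e. t (\<lambda>n. e (r n)))"
  unfolding Dt_def using D_rename[of "\<lambda>e. e 0 = t (\<lambda>n. e (Suc n))" "case_nat 0 (\<lambda>n. Suc (r n))"] by simp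

lemma D_compose2: assumes "D (\<lambda>e. P (e 0) (e 1))" "Dt s" "Dt t" shows "D (\<lambda>e. P (s e) (t e))"
proof -
  have "D (\<lambda>e. P (e 0) (t (\<lambda>n. e (Suc n))))"
    using D_subst[OF Dt_rename[OF assms(3), of Suc] D_rename[OF assms(1), of "\<lambda>n. case n of 0 \<Rightarrow> 1 | Suc m \<Rightarrow> 0"]]
    by simp
  from D_subst[OF assms(2) this] show ?thesis by simp
qed

lemma D_compose3: assumes "D (\<lambda>e. P (e 0) (e 1) (e 2))" "Dt s" "Dt t" "Dt u" shows "D (\<lambda>e. P (s e) (t e) (u e))"
proof -
  have a: "D (\<lambda>e. P (e 1) (e 2) (e 0))"
    using D_rename[OF assms(1), of "\<lambda>n. case n of 0 \<Rightarrow> 1 | Suc 0 \<Rightarrow> 2 | Suc (Suc m) \<Rightarrow> 0"]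
    by (simp add: eval_nat_numeral)
  have "D (\<lambda>e. P (e 0) (e 1) (u (\<lambda>n. e (Suc (Suc n)))))"
    using D_subst[OF Dt_rename[OF assms(4), of "\<lambda>n. Suc (Suc n)"] a] by (simp add: eval_nat_numeral)
  then have b: "D (\<lambda>e. P (e 1) (e 0) (u (\<lambda>n. e (Suc (Suc n)))))"
    using D_rename[of _ "\<lambda>n. case n of 0 \<Rightarrow> 1 | Suc 0 \<Rightarrow> 0 | Suc (Suc m) \<Rightarrow> Suc (Suc m)"] by force
  have "D (\<lambda>e. P (e 0) (t (\<lambda>n. e (Suc n))) (u (\<lambda>n. e (Suc n))))"
    using D_subst[OF Dt_rename[OF assms(3), of Suc] b] by simp
  from D_subst[OF assms(2) this] show ?thesis by simp
qed

lemma D_E [dfn]: "Dt s \<Longrightarrow> Dt t \<Longrightarrow> D (\<lambda>e. E (s e) (t e))"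
  by (rule D_compose2[where P = E, OF D_var_mem])

lemma D_eq [dfn]: "Dt s \<Longrightarrow> Dt t \<Longrightarrow> D (\<lambda>e. s e = t e)"
  by (rule D_compose2[where P = "(=)", OF D_var_eq])

lemma D_mem [dfn]: "Dt s \<Longrightarrow> Dt t \<Longrightarrow> D (\<lambda>e. s e \<in> elts (t e))"
  by (simp add: elts_def D_E)

text \<open>Any definable characterisation of the value can replace the graph; the definability of
  most set operations below is shown in this way.\<close>

lemma DtI: "D (\<lambda>e. P (e 0) (\<lambda>n. e (Suc n))) \<Longrightarrow> (\<And>x e. x = t e \<longleftrightarrow> P x e) \<Longrightarrow> Dt t"
  by (simp add: Dt_def)

lemma Dt_compose1: assumes "Dt (\<lambda>e. F (e 0))" "Dt t" shows "Dt (\<lambda>e. F (t e))"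
proof -
  have "D (\<lambda>e. e 0 = F (e 1))" using assms(1) by (simp add: Dt_def)
  from D_compose2[of "\<lambda>y x. y = F x", OF this Dt_var Dt_rename[OF assms(2), of Suc], of 0]
  show ?thesis by (simp add: Dt_def)
qed

lemma Dt_compose2: assumes "Dt (\<lambda>e. F (e 0) (e 1))" "Dt s" "Dt t" shows "Dt (\<lambda>e. F (s e) (t e))"
proof -
  have "D (\<lambda>e. e 0 = F (e 1) (e 2))" using assms(1) by (simp add: Dt_def eval_nat_numeral)
  from D_compose3[of "\<lambda>y x z. y = F x z", OF this Dt_var Dt_rename[OF assms(2), of Suc] Dt_rename[OF assms(3), of Suc], of 0]
  show ?thesis by (simp add: Dt_def)
qed

lemma Dt_shift: "Dt t \<Longrightarrow> Dt (\<lambda>e. t (\<lambda>n. e (Suc n)))"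
  by (rule Dt_rename)

lemma D_Ball [dfn]: "Dt t \<Longrightarrow> D (\<lambda>e. \<phi> (e 0) (\<lambda>n. e (Suc n))) \<Longrightarrow> D (\<lambda>e. \<forall>x\<in>elts (t e). \<phi> x e)"
  unfolding Ball_def by (rule D_All, rule D_imp, rule D_mem, rule Dt_var, erule Dt_shift)

lemma D_Bex [dfn]: "Dt t \<Longrightarrow> D (\<lambda>e. \<phi> (e 0) (\<lambda>n. e (Suc n))) \<Longrightarrow> D (\<lambda>e. \<exists>x\<in>elts (t e). \<phi> x e)"
  unfolding Bex_def by (rule D_Ex, rule D_conj, rule D_mem, rule Dt_var, erule Dt_shift)

lemma D_subset [dfn]: assumes "Dt s" "Dt t" shows "D (\<lambda>e. elts (s e) \<subseteq> elts (t e))"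
  unfolding subset_eq using assms(1) by (rule D_Ball) (rule D_mem, rule Dt_var, rule Dt_shift[OF assms(2)])

lemma D_Ex1 [dfn]: "D (\<lambda>e. \<phi> (e 0) (\<lambda>n. e (Suc n))) \<Longrightarrow> D (\<lambda>e. \<exists>!x. \<phi> x e)"
proof -
  assume a: "D (\<lambda>e. \<phi> (e 0) (\<lambda>n. e (Suc n)))"
  have b: "D (\<lambda>e. \<phi> (e 0) (\<lambda>n. e (Suc (Suc n))))"
    using D_rename[OF a, of "case_nat 0 (\<lambda>n. Suc (Suc n))"] by simp
  show ?thesis unfolding Ex1_def by (intro dfn a b)
qed

lemma D_if [dfn]: "D \<phi> \<Longrightarrow> D \<psi> \<Longrightarrow> D \<chi> \<Longrightarrow> D (\<lambda>e. if \<phi> e then \<psi> e else \<chi> e)"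
  by (simp add: if_bool_eq_conj) (intro dfn)

lemma Dt_if [dfn]: "D \<phi> \<Longrightarrow> Dt s \<Longrightarrow> Dt t \<Longrightarrow> Dt (\<lambda>e. if \<phi> e then s e else t e)"
proof -
  assume a: "D \<phi>" "Dt s" "Dt t"
  show ?thesis
    by (rule DtI[where P = "\<lambda>x e. if \<phi> e then x = s e else x = t e"])
      (intro dfn D_rename[OF a(1)] Dt_shift[OF a(2)] Dt_shift[OF a(3)], auto)
qed

section \<open>Classes that are sets: separation and replacement for definable predicates\<close>

lemma elts_inject: "elts x = elts y \<longleftrightarrow> x = y"
  using extensionality[of x y] by (auto simp: elts_def)

lemma elts_eqI: "elts x = elts y \<Longrightarrow> x = y" by (simp add: elts_inject)

definition small :: "'v set \<Rightarrow> bool" where "small A \<longleftrightarrow> (\<exists>x. elts x = A)"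

lemma elts_vset [simp]: "small A \<Longrightarrow> elts (vset A) = A"
  unfolding small_def vset_def by (auto simp: elts_inject)

lemma small_elts [simp]: "small (elts x)" by (auto simp: small_def)

lemma small_sep: assumes "D (\<lambda>e. P (e 0))" shows "small {z \<in> elts x. P z}"
proof -
  obtain f p where f: "fo_deBruijn E f" "\<And>e. P (e 0) = f (mix e p)" using assms D_def by auto
  \<comment> \<open>Only variable 0 matters to \<open>P\<close>, so all even variables may be
    identified with the variable bound by separation; the parameters occupy the other
    places.\<close>
  define r where "r n = (if even n then 0 else Suc (n div 2))" for n :: nat
  have d: "fo_definable E (\<lambda>e. f (\<lambda>n. e (r n)))" using fo_deBruijn_definable[OF f(1)] .
  have "P z = f (\<lambda>n. ((case_nat z p)(0 := z)) (r n))" for z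
  proof -
    have "(\<lambda>n. ((case_nat z p)(0 := z)) (r n)) = mix (\<lambda>_. z) p"
      by (rule ext) (auto simp: mix_def r_def)
    then show ?thesis using f(2)[of "\<lambda>_. z"] by simp
  qed
  moreover have "(case_nat w p)(0 := z) = (case_nat x p)(0 := z)" for w z
    by (rule ext) (auto split: nat.splits)
  ultimately obtain y where "\<And>z. E z y \<longleftrightarrow> E z x \<and> P z"
    using separation[OF d, of x "case_nat x p"] by metis
  then have "elts y = {z \<in> elts x. P z}" by (auto simp: elts_def)
  then show ?thesis by (auto simp: small_def)
qed

lemma small_subset: "A \<subseteq> elts x \<Longrightarrow> D (\<lambda>e. e 0 \<in> A) \<Longrightarrow> small A"
  using small_sep[of "\<lambda>z. z \<in> A" x] by (simp add: Collect_conj_eq inf.absorb2)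

lemma small_Collect: "D (\<lambda>e. P (e 0)) \<Longrightarrow> (\<And>z. P z \<Longrightarrow> z \<in> elts x) \<Longrightarrow> small {z. P z}"
  using small_sep[of P x] by (metis (no_types, lifting) Collect_cong)

lemma small_image: assumes "Dt (\<lambda>e. F (e 0))" shows "small (F ` elts x)"
proof -
  have "D (\<lambda>e. e 1 = F (e 0))"
    using D_eq[OF Dt_var[of 1] Dt_compose1[OF assms Dt_var[of 0]]] .
  then obtain f p where f: "fo_deBruijn E f" "\<And>e. (e 1 = F (e 0)) = f (mix e p)" using D_def by auto
  \<comment> \<open>In the replacement axiom variable 0 is the argument and variable 1 the value.
    The even variables beyond these do not affect the formula and share place 1; the parameters
    start at place 2.\<close>
  define r where "r n = (if even n then (if n = 0 then 0 else 1) else Suc (Suc (n div 2)))" for n :: nat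
  have d: "fo_definable E (\<lambda>e. f (\<lambda>n. e (r n)))" using fo_deBruijn_definable[OF f(1)] .
  define e0 where "e0 n = p (n - 2)" for n
  have fact: "f (\<lambda>n. (e0(0 := u, 1 := v)) (r n)) \<longleftrightarrow> v = F u" for u v
  proof -
    have "(\<lambda>n. (e0(0 := u, 1 := v)) (r n)) = mix (\<lambda>n. if n = 0 then u else v) p"
      by (rule ext) (auto simp: mix_def r_def e0_def)
    then show ?thesis using f(2)[of "\<lambda>n. if n = 0 then u else v"] by simp
  qed
  then obtain y where "\<And>v. E v y \<longleftrightarrow> (\<exists>u. E u x \<and> v = F u)"
    using replacement[OF d, of x e0] unfolding fact by auto
  then have "elts y = F ` elts x" by (auto simp: elts_def)
  then show ?thesis by (auto simp: small_def)
qed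

text \<open>Separation and replacement are applied for one fixed assignment at a time. Freezing all
  but the first variables prepares for this, as is needed for \<open>vset\<close>,
  \<open>img\<close> and \<open>rec\<close> under binders.\<close>

lemma D_fix: assumes "D \<phi>" shows "D (\<lambda>e. \<phi> (\<lambda>n. if n < m then e n else c n))"
proof -
  obtain f p where f: "fo_deBruijn E f" "\<And>e. \<phi> e = f (mix e p)" using assms D_def by auto
  define r where "r n = (if even n \<and> n div 2 < m then n else 2 * n + 1)" for n :: nat
  have "mix (\<lambda>n. if n < m then e n else c n) p = (\<lambda>n. mix e (mix c p) (r n))" for e
  proof
    fix n show "mix (\<lambda>n. if n < m then e n else c n) p n = mix e (mix c p) (r n)"
      by (cases "even n \<and> n div 2 < m") (auto simp: mix_def r_def)
  qed
  then show ?thesis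
    by (intro DI[OF fo_deBruijn_rename[OF f(1), of r], of _ "mix c p"]) (simp add: f(2))
qed

lemma D_fix1: "D (\<lambda>e. \<phi> (e 0) (\<lambda>n. e (Suc n))) \<Longrightarrow> D (\<lambda>e. \<phi> (e 0) c)"
  by (drule D_fix[where m = 1 and c = "\<lambda>n. c (n - 1)"]) simp

lemma Dt_fix1: assumes "Dt (\<lambda>e. F (e 0) (\<lambda>n. e (Suc n)))" shows "Dt (\<lambda>e. F (e 0) c)"
  using assms unfolding Dt_def
  by (drule_tac D_fix[where m = 2 and c = "\<lambda>n. c (n - 2)"]) (simp add: numeral_2_eq_2)

lemma Dt_fix2: assumes "Dt (\<lambda>e. F (e 0) (e 1) (\<lambda>n. e (Suc (Suc n))))" shows "Dt (\<lambda>e. F (e 0) (e 1) c)"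
  using assms unfolding Dt_def
  by (drule_tac D_fix[where m = 3 and c = "\<lambda>n. c (n - 3)"]) (simp add: eval_nat_numeral)

lemma Dt_vset: assumes "D (\<lambda>e. \<phi> (e 0) (\<lambda>n. e (Suc n)))" "\<And>e. small {z. \<phi> z e}"
  shows "Dt (\<lambda>e. vset {z. \<phi> z e})"
proof (rule DtI)
  show "x = vset {z. \<phi> z e} \<longleftrightarrow> (\<forall>z. z \<in> elts x \<longleftrightarrow> \<phi> z e)" for x e
    using assms(2)[of e] by (auto simp: elts_inject[symmetric])
  show "D (\<lambda>e. \<forall>z. z \<in> elts (e 0) \<longleftrightarrow> \<phi> z (\<lambda>n. e (Suc n)))"
    using D_rename[OF assms(1), of "case_nat 0 (\<lambda>n. Suc (Suc n))"] by (intro dfn) simp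
qed

subsection \<open>Basic sets\<close>

lemma small_empty [simp]: "small {}"
  using small_sep[of "\<lambda>z. False"] D_bool by simp

lemma small_pair: "small {a, b}"
proof -
  obtain w where "\<And>z. E z w \<longleftrightarrow> z = a \<or> z = b" using pairing by blast
  then have "elts w = {a, b}" by (auto simp: elts_def)
  then show ?thesis by (auto simp: small_def)
qed

lemma small_Union: "small (\<Union>y\<in>elts x. elts y)"
proof -
  obtain w where "\<And>z. E z w \<longleftrightarrow> (\<exists>y. E y x \<and> E z y)" using union by blast
  then have "elts w = (\<Union>y\<in>elts x. elts y)" by (auto simp: elts_def)
  then show ?thesis by (auto simp: small_def)
qed

lemma small_Pow: "small {y. elts y \<subseteq> elts x}"
proof -
  obtain w where "\<And>y. E y w \<longleftrightarrow> (\<forall>z. E z y \<longrightarrow> E z x)" using powerset by blast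
  then have "elts w = {y. elts y \<subseteq> elts x}" by (auto simp: elts_def)
  then show ?thesis by (auto simp: small_def)
qed

lemma elts_Union [simp]: "elts (Union x) = (\<Union>y\<in>elts x. elts y)"
  by (simp add: Union_def small_Union)

lemma elts_Pow [simp]: "elts (Pow x) = {y. elts y \<subseteq> elts x}"
  by (simp add: Pow_def small_Pow)

lemma small_Un: assumes "small A" "small B" shows "small (A \<union> B)"
proof -
  obtain a b where "elts a = A" "elts b = B" using assms by (auto simp: small_def)
  then have "A \<union> B = elts (Union (vset {a, b}))" by (simp add: small_pair)
  then show ?thesis using small_elts by metis
qed

lemma small_insert [simp]: "small A \<Longrightarrow> small (insert a A)"
  using small_Un[of "{a, a}" A] small_pair[of a a] by simp

definition emp :: 'v where "emp = vset {}"
lemma elts_emp [simp]: "elts emp = {}" by (simp add: emp_def)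
lemma elts_eq_empty [simp]: "elts x = {} \<longleftrightarrow> x = emp" using elts_inject[of x emp] by simp

definition sep :: "'v \<Rightarrow> ('v \<Rightarrow> bool) \<Rightarrow> 'v" where "sep x P = vset {z \<in> elts x. P z}"
definition img :: "'v \<Rightarrow> ('v \<Rightarrow> 'v) \<Rightarrow> 'v" where "img x F = vset (F ` elts x)"
definition un :: "'v \<Rightarrow> 'v \<Rightarrow> 'v" where "un x y = vset (elts x \<union> elts y)"
definition int :: "'v \<Rightarrow> 'v \<Rightarrow> 'v" where "int x y = vset (elts x \<inter> elts y)"
definition succ :: "'v \<Rightarrow> 'v" where "succ x = vset (insert x (elts x))"
definition sing :: "'v \<Rightarrow> 'v" where "sing x = vset {x}"

lemma elts_sep: "D (\<lambda>e. P (e 0)) \<Longrightarrow> elts (sep x P) = {z \<in> elts x. P z}"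
  by (simp add: sep_def small_sep)
lemma elts_img: "Dt (\<lambda>e. F (e 0)) \<Longrightarrow> elts (img x F) = F ` elts x"
  by (simp add: img_def small_image)
lemma elts_un [simp]: "elts (un x y) = elts x \<union> elts y"
  by (simp add: un_def small_Un)
lemma small_int: "small (elts x \<inter> elts y)"
  using small_sep[of "\<lambda>z. z \<in> elts y" x] by (simp add: Int_def dfn)
lemma elts_int [simp]: "elts (int x y) = elts x \<inter> elts y"
  by (simp add: int_def small_int)
lemma vset_int: "vset (elts x \<inter> elts y) = int x y" by (simp add: int_def)

lemma elts_succ [simp]: "elts (succ x) = insert x (elts x)"
  by (simp add: succ_def)
lemma elts_sing [simp]: "elts (sing x) = {x}"
  by (simp add: sing_def)
lemma elts_pair [simp]: "elts (vset {x, y}) = {x, y}"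
  by simp

lemma Dt_Union [THEN Dt_compose1, dfn]: "Dt (\<lambda>e. Union (e 0))"
  by (rule DtI[where P = "\<lambda>x e. \<forall>z. z \<in> elts x \<longleftrightarrow> (\<exists>y\<in>elts (e 0). z \<in> elts y)"])
    (intro dfn, auto simp: elts_inject[symmetric])
lemma Dt_Pow [THEN Dt_compose1, dfn]: "Dt (\<lambda>e. Pow (e 0))"
  by (rule DtI[where P = "\<lambda>x e. \<forall>z. z \<in> elts x \<longleftrightarrow> elts z \<subseteq> elts (e 0)"])
    (intro dfn, auto simp: elts_inject[symmetric])
lemma Dt_un [THEN Dt_compose2, dfn]: "Dt (\<lambda>e. un (e 0) (e 1))"
  by (rule DtI[where P = "\<lambda>x e. \<forall>z. z \<in> elts x \<longleftrightarrow> z \<in> elts (e 0) \<or> z \<in> elts (e 1)"])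
    (intro dfn, auto simp: elts_inject[symmetric])
lemma Dt_int [THEN Dt_compose2, dfn]: "Dt (\<lambda>e. int (e 0) (e 1))"
  by (rule DtI[where P = "\<lambda>x e. \<forall>z. z \<in> elts x \<longleftrightarrow> z \<in> elts (e 0) \<and> z \<in> elts (e 1)"])
    (intro dfn, auto simp: elts_inject[symmetric])
lemma Dt_succ [THEN Dt_compose1, dfn]: "Dt (\<lambda>e. succ (e 0))"
  by (rule DtI[where P = "\<lambda>x e. \<forall>z. z \<in> elts x \<longleftrightarrow> z \<in> elts (e 0) \<or> z = e 0"])
    (intro dfn, auto simp: elts_inject[symmetric])
lemma Dt_sing [THEN Dt_compose1, dfn]: "Dt (\<lambda>e. sing (e 0))"
  by (rule DtI[where P = "\<lambda>x e. \<forall>z. z \<in> elts x \<longleftrightarrow> z = e 0"])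
    (intro dfn, auto simp: elts_inject[symmetric])
lemma Dt_pair [THEN Dt_compose2, dfn]: "Dt (\<lambda>e. vset {e 0, e 1})"
  by (rule DtI[where P = "\<lambda>x e. \<forall>z. z \<in> elts x \<longleftrightarrow> z = e 0 \<or> z = e 1"])
    (intro dfn, auto simp: elts_inject[symmetric])

lemma Dt_sep [dfn]: assumes "Dt t" "D (\<lambda>e. \<phi> (e 0) (\<lambda>n. e (Suc n)))"
  shows "Dt (\<lambda>e. sep (t e) (\<lambda>z. \<phi> z e))"
  unfolding sep_def
  by (rule Dt_vset) (intro dfn Dt_shift[OF assms(1)] assms(2), rule small_sep, rule D_fix1[OF assms(2)])

lemma Dt_img [dfn]: assumes "Dt t" "Dt (\<lambda>e. F (e 0) (\<lambda>n. e (Suc n)))"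
  shows "Dt (\<lambda>e. img (t e) (\<lambda>z. F z e))"
proof -
  have "Dt (\<lambda>e. F (e 0) (\<lambda>n. e (Suc (Suc n))))"
    using Dt_rename[OF assms(2), of "case_nat 0 (\<lambda>n. Suc (Suc n))"] by simp
  then have "D (\<lambda>e. \<exists>z\<in>elts (t (\<lambda>n. e (Suc n))). F z (\<lambda>n. e (Suc n)) = e 0)"
    by (intro dfn Dt_shift[OF assms(1)]) simp
  moreover have "(\<lambda>z. F z e) ` elts (t e) = {y. \<exists>z\<in>elts (t e). F z e = y}" for e by auto
  moreover have "small ((\<lambda>z. F z e) ` elts (t e))" for e
    by (rule small_image[OF Dt_fix1[OF assms(2)]])
  ultimately show ?thesis unfolding img_def by (simp add: Dt_vset)
qed

section \<open>Ordered pairs and functions as sets\<close>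

lemma vset_inject: "small A \<Longrightarrow> small B \<Longrightarrow> vset A = vset B \<longleftrightarrow> A = B"
  by (metis elts_vset)

lemma opair_inject [simp]: "opair x y = opair a b \<longleftrightarrow> x = a \<and> y = b"
  unfolding opair_def by (auto simp: vset_inject doubleton_eq_iff)

lemma Dt_opair [THEN Dt_compose2, dfn]: "Dt (\<lambda>e. opair (e 0) (e 1))"
proof -
  have s: "vset {x} = vset {x, x}" for x by simp
  show ?thesis unfolding opair_def s by (intro dfn)
qed

text \<open>In contrast to \<open>app\<close>, the value is the fixed set \<open>emp\<close> where
  no unique value exists, and not an unspecified description. This makes application a definable
  term on all arguments.\<close>

definition ap :: "'v \<Rightarrow> 'v \<Rightarrow> 'v" where
  "ap f x = (if \<exists>!y. opair x y \<in> elts f then THE y. opair x y \<in> elts f else emp)"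
definition pfst :: "'v \<Rightarrow> 'v" where
  "pfst p = (if \<exists>x y. p = opair x y then THE x. \<exists>y. p = opair x y else emp)"
definition psnd :: "'v \<Rightarrow> 'v" where
  "psnd p = (if \<exists>x y. p = opair x y then THE y. \<exists>x. p = opair x y else emp)"
definition Lam :: "'v \<Rightarrow> ('v \<Rightarrow> 'v) \<Rightarrow> 'v" where
  "Lam a F = img a (\<lambda>x. opair x (F x))"
definition cart :: "'v \<Rightarrow> 'v \<Rightarrow> 'v" where
  "cart a b = Union (img a (\<lambda>x. img b (\<lambda>y. opair x y)))"

lemma pfst_opair [simp]: "pfst (opair x y) = x" and psnd_opair [simp]: "psnd (opair x y) = y"
  by (auto simp: pfst_def psnd_def)

lemma Dt_ap [THEN Dt_compose2, dfn]: "Dt (\<lambda>e. ap (e 0) (e 1))"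
proof (rule DtI)
  show "y = ap (e 0) (e 1) \<longleftrightarrow> (if \<exists>!y. opair (e 1) y \<in> elts (e 0) then opair (e 1) y \<in> elts (e 0) else y = emp)"
    for y and e :: "nat \<Rightarrow> 'v"
  proof (cases "\<exists>!y. opair (e 1) y \<in> elts (e 0)")
    case True
    have "opair (e 1) (ap (e 0) (e 1)) \<in> elts (e 0)" unfolding ap_def using theI'[OF True] True by simp
    with True show ?thesis by auto
  qed (simp add: ap_def)
qed (intro dfn)

lemma Dt_pfst [THEN Dt_compose1, dfn]: "Dt (\<lambda>e. pfst (e 0))"
proof (rule DtI)
  show "x = pfst (e 0) \<longleftrightarrow> (if \<exists>x y. e 0 = opair x y then \<exists>y. e 0 = opair x y else x = emp)"
    for x and e :: "nat \<Rightarrow> 'v"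
  proof (cases "\<exists>x y. e 0 = opair x y")
    case True
    then obtain a b where "e 0 = opair a b" by blast
    then show ?thesis by auto
  qed (simp add: pfst_def)
qed (intro dfn)

lemma Dt_psnd [THEN Dt_compose1, dfn]: "Dt (\<lambda>e. psnd (e 0))"
proof (rule DtI)
  show "y = psnd (e 0) \<longleftrightarrow> (if \<exists>x y. e 0 = opair x y then \<exists>x. e 0 = opair x y else y = emp)"
    for y and e :: "nat \<Rightarrow> 'v"
  proof (cases "\<exists>x y. e 0 = opair x y")
    case True
    then obtain a b where "e 0 = opair a b" by blast
    then show ?thesis by auto
  qed (simp add: psnd_def)
qed (intro dfn)

lemma Dt_Lam [dfn]: "Dt t \<Longrightarrow> Dt (\<lambda>e. F (e 0) (\<lambda>n. e (Suc n))) \<Longrightarrow> Dt (\<lambda>e. Lam (t e) (\<lambda>z. F z e))"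
  unfolding Lam_def by (intro dfn)

lemma Dt_cart [THEN Dt_compose2, dfn]: "Dt (\<lambda>e. cart (e 0) (e 1))"
  unfolding cart_def by (intro dfn)

lemma elts_cart [simp]: "elts (cart a b) = {opair x y | x y. x \<in> elts a \<and> y \<in> elts b}"
proof -
  have "elts (img b (\<lambda>y. opair x y)) = (\<lambda>y. opair x y) ` elts b" for x
    by (rule elts_img) (intro dfn)
  moreover have "elts (img a (\<lambda>x. img b (\<lambda>y. opair x y))) = (\<lambda>x. img b (\<lambda>y. opair x y)) ` elts a"
    by (rule elts_img) (intro dfn)
  ultimately show ?thesis unfolding cart_def by auto
qed

lemma elts_Lam: "Dt (\<lambda>e. F (e 0)) \<Longrightarrow> elts (Lam a F) = {opair x (F x) | x. x \<in> elts a}"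
  unfolding Lam_def by (subst elts_img) (intro dfn, auto)

lemma func_Lam: "Dt (\<lambda>e. F (e 0)) \<Longrightarrow> func (Lam a F) a"
  unfolding func_def by (auto simp: elts_Lam)

lemma ap_Lam: "Dt (\<lambda>e. F (e 0)) \<Longrightarrow> x \<in> elts a \<Longrightarrow> ap (Lam a F) x = F x"
  unfolding ap_def by (auto simp: elts_Lam)

lemma func_app: "func f a \<Longrightarrow> x \<in> elts a \<Longrightarrow> app f x = ap f x"
  unfolding func_def app_def ap_def by auto

lemma func_opair: assumes "func f a" shows "opair x y \<in> elts f \<longleftrightarrow> x \<in> elts a \<and> y = ap f x"
proof (cases "x \<in> elts a")
  case True
  then have ex: "\<exists>!y. opair x y \<in> elts f" using assms by (auto simp: func_def)
  then have "opair x (ap f x) \<in> elts f" unfolding ap_def using theI'[OF ex] by simp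
  with ex True show ?thesis by auto
next
  case False
  then show ?thesis using assms unfolding func_def by (metis opair_inject)
qed

lemma Lam_cong: "(\<And>x. x \<in> elts a \<Longrightarrow> F x = G x) \<Longrightarrow> Lam a F = Lam a G"
  unfolding Lam_def img_def by (metis (no_types, lifting) image_cong)

lemma D_func [THEN D_compose2, dfn]: "D (\<lambda>e. func (e 0) (e 1))"
  unfolding func_def by (intro dfn)

subsection \<open>Choice\<close>

text \<open>The axiom of choice is given for pairwise disjoint families. Tagging the admissible
  values of \<open>x\<close> with \<open>x\<close> makes the sets \<open>S x\<close> disjoint, and a
  selector for them yields the choice function.\<close>

lemma AC: assumes "D (\<lambda>e. R (e 0) (e 1))" "\<And>x. x \<in> elts a \<Longrightarrow> \<exists>y\<in>elts b. R x y"
  obtains f where "func f a" "\<And>x. x \<in> elts a \<Longrightarrow> ap f x \<in> elts b \<and> R x (ap f x)"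
proof -
  note R [dfn] = D_compose2[OF assms(1)]
  define S where "S x = sep (cart (sing x) b) (\<lambda>w. R (pfst w) (psnd w))" for x
  have S: "elts (S x) = {opair x y | y. y \<in> elts b \<and> R x y}" for x
    unfolding S_def by (subst elts_sep) (intro dfn, auto)
  have S_D: "Dt (\<lambda>e. S (e 0))" unfolding S_def by (intro dfn)
  define X where "X = img a S"
  have X: "elts X = S ` elts a" unfolding X_def by (rule elts_img[OF S_D])
  have "\<exists>c. \<forall>y. E y X \<longrightarrow> (\<exists>!z. E z c \<and> E z y)"
  proof (rule choice)
    show "\<exists>z. E z y" if "E y X" for y
    proof -
      have "y \<in> elts X" using that by (simp add: elts_def)
      then obtain x where "x \<in> elts a" "y = S x" using X by auto
      with assms(2)[of x] S obtain z where "z \<in> elts y" by auto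
      then show ?thesis by (auto simp: elts_def)
    qed
    show "y = y'" if "E y X" "E y' X" "E z y" "E z y'" for y y' z
    proof -
      have "y \<in> elts X" "y' \<in> elts X" "z \<in> elts y" "z \<in> elts y'" using that by (simp_all add: elts_def)
      then show ?thesis using X S by auto
    qed
  qed
  then obtain c where c: "\<And>y. y \<in> elts X \<Longrightarrow> \<exists>!z. z \<in> elts c \<and> z \<in> elts y" by (auto simp: elts_def)
  have c': "\<exists>!y. opair x y \<in> elts c \<and> y \<in> elts b \<and> R x y" if "x \<in> elts a" for x
  proof -
    have "\<exists>!z. z \<in> elts c \<and> (\<exists>y. z = opair x y \<and> y \<in> elts b \<and> R x y)"
      using c[of "S x"] X that by (simp add: S)
    then obtain y where "opair x y \<in> elts c" "y \<in> elts b" "R x y"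
      and "\<And>z. z \<in> elts c \<and> (\<exists>y. z = opair x y \<and> y \<in> elts b \<and> R x y) \<Longrightarrow> z = opair x y" by metis
    note y = this
    have "y' = y" if "opair x y' \<in> elts c \<and> y' \<in> elts b \<and> R x y'" for y'
      using y(4)[of "opair x y'"] that by auto
    with y(1-3) show ?thesis by blast
  qed
  define f where "f = sep (cart a b) (\<lambda>w. w \<in> elts c \<and> R (pfst w) (psnd w))"
  have f: "elts f = {opair x y | x y. x \<in> elts a \<and> y \<in> elts b \<and> opair x y \<in> elts c \<and> R x y}"
    unfolding f_def by (subst elts_sep) (intro dfn, auto)
  have "opair x y \<in> elts f \<longleftrightarrow> opair x y \<in> elts c \<and> y \<in> elts b \<and> R x y" if "x \<in> elts a" for x y
    using that by (auto simp: f)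
  then have "\<forall>x\<in>elts a. \<exists>!y. opair x y \<in> elts f" using c' by simp
  moreover have "\<forall>w\<in>elts f. \<exists>x\<in>elts a. \<exists>y. w = opair x y" by (auto simp: f)
  ultimately have fun_f: "func f a" by (simp add: func_def)
  have "ap f x \<in> elts b \<and> R x (ap f x)" if "x \<in> elts a" for x
  proof -
    have "opair x (ap f x) \<in> elts f" using func_opair[OF fun_f] that by auto
    then show ?thesis by (auto simp: f)
  qed
  with fun_f show thesis using that by blast
qed

subsection \<open>Natural numbers and iteration\<close>

lemma foundation': assumes "elts x \<noteq> {}" obtains m where "m \<in> elts x" "elts m \<inter> elts x = {}"
  using assms foundation[of _ x] unfolding elts_def by blast

lemma not_mem_self [simp]: "x \<notin> elts x"
  using foundation'[of "sing x"] by auto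

lemma not_mem_sym: "x \<in> elts y \<Longrightarrow> y \<in> elts x \<Longrightarrow> False"
  using foundation'[of "vset {x, y}"] by auto

lemma succ_inject [simp]: "succ x = succ y \<longleftrightarrow> x = y"
proof
  assume "succ x = succ y"
  then have "x \<in> elts (succ y)" "y \<in> elts (succ x)" by (metis elts_succ insertI1)+
  then show "x = y" using not_mem_sym by auto
qed simp

lemma succ_neq [simp]: "succ x \<noteq> emp" "emp \<noteq> succ x"
  by (metis elts_emp elts_succ insert_not_empty)+

lemma succ_neq_self [simp]: "succ x \<noteq> x" "succ x \<notin> elts x"
  using not_mem_self[of x] not_mem_sym[of x "succ x"] by (metis elts_succ insertI1)+

definition closed_succ :: "'v \<Rightarrow> bool" where
  "closed_succ w \<longleftrightarrow> emp \<in> elts w \<and> (\<forall>n\<in>elts w. succ n \<in> elts w)"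

lemma D_closed_succ [THEN D_compose1, dfn]: "D (\<lambda>e. closed_succ (e 0))"
  unfolding closed_succ_def by (intro dfn)

text \<open>The intersection of all inductive sets; it is identified with \<open>omega\<close> once
  ordinals are available.\<close>

definition om :: 'v where
  "om = vset {n. \<forall>w. closed_succ w \<longrightarrow> n \<in> elts w}"

lemma elts_om: "elts om = {n. \<forall>w. closed_succ w \<longrightarrow> n \<in> elts w}"
proof -
  obtain w where w: "\<exists>n. E n w \<and> (\<forall>z. \<not> E z n)"
    "\<And>n. E n w \<Longrightarrow> \<exists>s. E s w \<and> (\<forall>z. E z s \<longleftrightarrow> E z n \<or> z = n)" using infinity by blast
  have "emp \<in> elts w" using w(1) elts_eq_empty unfolding elts_def by (metis Collect_empty_eq mem_Collect_eq)
  moreover have "succ n \<in> elts w" if n: "n \<in> elts w" for n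
  proof -
    obtain s where "s \<in> elts w" and s: "\<forall>z. E z s \<longleftrightarrow> E z n \<or> z = n"
      using w(2)[of n] n unfolding elts_def mem_Collect_eq by blast
    moreover have "elts s = insert n (elts n)" using s by (auto simp: elts_def)
    ultimately show ?thesis by (metis elts_eqI elts_succ)
  qed
  ultimately have "closed_succ w" by (simp add: closed_succ_def)
  then have "small {n. \<forall>w. closed_succ w \<longrightarrow> n \<in> elts w}"
    by (intro small_Collect[of _ w]) (intro dfn, blast)
  then show ?thesis by (simp add: om_def)
qed

lemma om_0 [simp]: "emp \<in> elts om" by (auto simp: elts_om closed_succ_def)
lemma om_succ [simp]: "n \<in> elts om \<Longrightarrow> succ n \<in> elts om" by (auto simp: elts_om closed_succ_def)

lemma om_induct [consumes 1, case_names D zero succ]: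
  assumes "n \<in> elts om" "D (\<lambda>e. P (e 0))" "P emp" "\<And>n. n \<in> elts om \<Longrightarrow> P n \<Longrightarrow> P (succ n)"
  shows "P n"
proof -
  have "elts (sep om P) = {n \<in> elts om. P n}" by (rule elts_sep[OF assms(2)])
  then have "closed_succ (sep om P)" using assms(3,4) by (auto simp: closed_succ_def)
  then have "n \<in> elts (sep om P)" using assms(1) by (auto simp: elts_om)
  then show ?thesis using \<open>elts (sep om P) = _\<close> by auto
qed

definition Trans :: "'v \<Rightarrow> bool" where "Trans x \<longleftrightarrow> (\<forall>y\<in>elts x. elts y \<subseteq> elts x)"
lemma D_Trans [THEN D_compose1, dfn]: "D (\<lambda>e. Trans (e 0))"
  unfolding Trans_def by (intro dfn)

lemma om_Trans: "n \<in> elts om \<Longrightarrow> Trans n"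
proof (induction n rule: om_induct)
  case D show ?case by (intro dfn)
qed (auto simp: Trans_def)

lemma om_elt: "n \<in> elts om \<Longrightarrow> m \<in> elts n \<Longrightarrow> m \<in> elts om"
proof -
  have "n \<in> elts om \<Longrightarrow> \<forall>m\<in>elts n. m \<in> elts om"
  proof (induction n rule: om_induct)
    case D show ?case by (intro dfn)
  qed auto
  then show "n \<in> elts om \<Longrightarrow> m \<in> elts n \<Longrightarrow> m \<in> elts om" by blast
qed

lemma om_cases: assumes "n \<in> elts om" obtains "n = emp" | m where "m \<in> elts om" "n = succ m"
proof -
  have "n = emp \<or> (\<exists>m\<in>elts om. n = succ m)" using assms
  proof (induction n rule: om_induct)
    case D show ?case by (intro dfn)
  qed auto
  then show thesis using that by blast
qed

lemma om_succ_mono: "n \<in> elts om \<Longrightarrow> m \<in> elts n \<Longrightarrow> succ m \<in> elts (succ n)"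
proof -
  have "n \<in> elts om \<Longrightarrow> \<forall>m\<in>elts n. succ m \<in> elts (succ n)"
  proof (induction n rule: om_induct)
    case D show ?case by (intro dfn)
  qed auto
  then show "n \<in> elts om \<Longrightarrow> m \<in> elts n \<Longrightarrow> succ m \<in> elts (succ n)" by blast
qed

lemma om_0_succ: "n \<in> elts om \<Longrightarrow> emp \<in> elts (succ n)"
proof (induction n rule: om_induct)
  case D show ?case by (intro dfn)
qed auto

definition iter_approx :: "'v \<Rightarrow> ('v \<Rightarrow> 'v) \<Rightarrow> 'v \<Rightarrow> 'v \<Rightarrow> bool" where
  "iter_approx a F h n \<longleftrightarrow> func h (succ n) \<and> ap h emp = a \<and> (\<forall>m\<in>elts n. ap h (succ m) = F (ap h m))"

definition iter :: "'v \<Rightarrow> ('v \<Rightarrow> 'v) \<Rightarrow> 'v \<Rightarrow> 'v" where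
  "iter a F n = (if \<exists>h. n \<in> elts om \<and> iter_approx a F h n
    then ap (SOME h. iter_approx a F h n) n else emp)"

lemma iter_approx_unique:
  assumes "n \<in> elts om" "k \<in> elts om" "iter_approx a F h n" "iter_approx a F g k" "m \<in> elts om"
  shows "m \<in> elts (succ n) \<Longrightarrow> m \<in> elts (succ k) \<Longrightarrow> ap h m = ap g m"
proof -
  have "m \<in> elts (succ n) \<longrightarrow> m \<in> elts (succ k) \<longrightarrow> ap h m = ap g m" using assms(5)
  proof (induction m rule: om_induct)
    case D show ?case by (intro dfn)
  next
    case zero show ?case using assms(3,4) by (simp add: iter_approx_def)
  next
    case (succ m)
    show ?case
    proof (intro impI)
      assume *: "succ m \<in> elts (succ n)" "succ m \<in> elts (succ k)"
      have t: "Trans n" "Trans k" using om_Trans assms(1,2) by auto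
      have "m \<in> elts n" "m \<in> elts k" using * t unfolding Trans_def by auto
      then show "ap h (succ m) = ap g (succ m)"
        using succ assms(3,4) unfolding iter_approx_def by simp
    qed
  qed
  then show "m \<in> elts (succ n) \<Longrightarrow> m \<in> elts (succ k) \<Longrightarrow> ap h m = ap g m" by blast
qed

context
  fixes a :: 'v and F :: "'v \<Rightarrow> 'v" assumes F: "Dt (\<lambda>e. F (e 0))"
begin

lemma D_iter_approx: "D (\<lambda>e. iter_approx a F (e 0) (e 1))"
  unfolding iter_approx_def by (intro dfn Dt_compose1[OF F])

lemma iter_approx_ex: "n \<in> elts om \<Longrightarrow> \<exists>h. iter_approx a F h n"
proof (induction n rule: om_induct)
  case D show ?case by (intro dfn D_compose2[OF D_iter_approx])
next
  case zero
  have "Dt (\<lambda>e. a)" by (intro dfn)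
  then have "iter_approx a F (Lam (succ emp) (\<lambda>_. a)) emp"
    by (auto simp: iter_approx_def func_Lam ap_Lam)
  then show ?case by blast
next
  case (succ n)
  then obtain h where h: "iter_approx a F h n" by blast
  define g where "g = Lam (succ (succ n)) (\<lambda>m. if m = succ n then F (ap h n) else ap h m)"
  have d: "Dt (\<lambda>e. if e 0 = succ n then F (ap h n) else ap h (e 0))" by (intro dfn)
  have g: "ap g m = (if m = succ n then F (ap h n) else ap h m)" if "m \<in> elts (succ (succ n))" for m
    unfolding g_def by (rule ap_Lam[OF d that])
  have ne: "m \<noteq> succ n" if "m \<in> elts n \<or> m = n" for m
  proof
    assume m: "m = succ n"
    have "n \<in> elts m" by (simp add: m)
    with that show False using not_mem_sym not_mem_self by blast
  qed
  have "ap g (succ m) = F (ap g m)" if "m \<in> elts (succ n)" for m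
  proof -
    have m: "m = n \<or> m \<in> elts n" using that by auto
    have "succ m \<in> elts (succ (succ n))" using om_succ_mono[OF om_succ[OF succ(1)] that] .
    moreover have "m \<in> elts n \<Longrightarrow> ap h (succ m) = F (ap h m)" using h by (simp add: iter_approx_def)
    ultimately show ?thesis using m g[of m] g[of "succ m"] ne[of m] that by auto
  qed
  moreover have "ap g emp = a" using g[of emp] h om_0_succ[OF succ(1)] by (simp add: iter_approx_def)
  moreover have "func g (succ (succ n))" unfolding g_def by (rule func_Lam[OF d])
  ultimately have "iter_approx a F g (succ n)" by (simp add: iter_approx_def)
  then show ?case by blast
qed

lemma iter_eq: assumes "n \<in> elts om" "iter_approx a F h n" shows "iter a F n = ap h n"
proof -
  have "iter_approx a F (SOME h. iter_approx a F h n) n" using assms by (rule_tac someI)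
  then have "ap (SOME h. iter_approx a F h n) n = ap h n"
    by (rule iter_approx_unique[OF assms(1,1) _ assms(2) assms(1)]) auto
  then show ?thesis using assms by (auto simp: iter_def)
qed

lemma iter_0 [simp]: "iter a F emp = a"
  using iter_approx_ex[OF om_0] iter_eq[OF om_0] by (auto simp: iter_approx_def)

lemma iter_succ: assumes "n \<in> elts om" shows "iter a F (succ n) = F (iter a F n)"
proof -
  obtain h where h: "iter_approx a F h (succ n)" using iter_approx_ex om_succ assms by blast
  obtain g where g: "iter_approx a F g n" using iter_approx_ex assms by blast
  have "ap h n = ap g n"
    by (rule iter_approx_unique[OF om_succ[OF assms] assms h g assms]) auto
  then show ?thesis
    using iter_eq[OF om_succ[OF assms] h] iter_eq[OF assms g] h by (simp add: iter_approx_def)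
qed

lemma Dt_iter: "Dt (\<lambda>e. iter a F (e 0))"
proof (rule DtI)
  show "y = iter a F (e 0) \<longleftrightarrow> (if e 0 \<in> elts om then \<exists>h. iter_approx a F h (e 0) \<and> y = ap h (e 0) else y = emp)"
    for y and e :: "nat \<Rightarrow> 'v"
  proof (cases "e 0 \<in> elts om")
    case True
    then show ?thesis using iter_approx_ex[OF True] iter_eq[OF True] by metis
  qed (simp add: iter_def)
qed (intro dfn D_compose2[OF D_iter_approx])

end

subsection \<open>Transitive closure, induction and recursion\<close>

lemma Trans_ex: "\<exists>t. Trans t \<and> elts x \<subseteq> elts t"
proof -
  define f where "f = iter x Union"
  have d: "Dt (\<lambda>e. Union (e 0))" by (intro dfn)
  have df: "Dt (\<lambda>e. f (e 0))" unfolding f_def by (rule Dt_iter[OF d])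
  define t where "t = Union (img om f)"
  have t: "elts t = (\<Union>n\<in>elts om. elts (f n))" unfolding t_def by (simp add: elts_img[OF df])
  have "Trans t" unfolding Trans_def
  proof (intro ballI subsetI)
    fix y z assume "y \<in> elts t" "z \<in> elts y"
    then obtain n where "n \<in> elts om" "y \<in> elts (f n)" using t by auto
    then have "z \<in> elts (f (succ n))" using \<open>z \<in> elts y\<close> by (auto simp: f_def iter_succ[OF d])
    then show "z \<in> elts t" using t \<open>n \<in> elts om\<close> om_succ by blast
  qed
  moreover have "f emp = x" by (simp add: f_def iter_0[OF d])
  then have "elts x \<subseteq> elts t" using t om_0 by blast
  ultimately show ?thesis by blast
qed

text \<open>A minimal counterexample is sought inside a transitive set that contains
  \<open>x\<close>. The counterexamples there form a set because \<open>P\<close> is definable,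
  hence the first premise in every induction on membership.\<close>

lemma eps_induct [case_names D step]:
  assumes "D (\<lambda>e. P (e 0))" "\<And>x. (\<And>y. y \<in> elts x \<Longrightarrow> P y) \<Longrightarrow> P x" shows "P x"
proof (rule ccontr)
  assume nP: "\<not> P x"
  obtain t where t: "Trans t" "elts (sing x) \<subseteq> elts t" using Trans_ex by blast
  have s: "elts (sep t (\<lambda>z. \<not> P z)) = {z \<in> elts t. \<not> P z}"
    by (rule elts_sep) (intro dfn D_compose1[OF assms(1)])
  moreover have "elts (sep t (\<lambda>z. \<not> P z)) \<noteq> {}" using nP t s by auto
  then obtain m where "m \<in> elts (sep t (\<lambda>z. \<not> P z))" "elts m \<inter> elts (sep t (\<lambda>z. \<not> P z)) = {}"
    by (rule foundation')
  ultimately have m: "m \<in> elts t" "\<not> P m" "elts m \<inter> {z \<in> elts t. \<not> P z} = {}" by auto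
  have "P m"
  proof (rule assms(2))
    fix y assume "y \<in> elts m"
    then have "y \<in> elts t" using t m by (auto simp: Trans_def)
    then show "P y" using m \<open>y \<in> elts m\<close> by blast
  qed
  with m show False by simp
qed

definition rec_approx :: "('v \<Rightarrow> 'v \<Rightarrow> 'v) \<Rightarrow> 'v \<Rightarrow> 'v \<Rightarrow> bool" where
  "rec_approx G h t \<longleftrightarrow> Trans t \<and> func h t \<and> (\<forall>z\<in>elts t. ap h z = G z (Lam z (\<lambda>w. ap h w)))"

definition rec :: "('v \<Rightarrow> 'v \<Rightarrow> 'v) \<Rightarrow> 'v \<Rightarrow> 'v" where
  "rec G x = (THE y. \<exists>h t. rec_approx G h t \<and> x \<in> elts t \<and> y = ap h x)"

lemma Dt_subst: assumes "Dt t" "Dt F" shows "Dt (\<lambda>e. F (case_nat (t e) e))"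
proof -
  have eq: "(\<lambda>n. e (case n of 0 \<Rightarrow> 0 | Suc n \<Rightarrow> Suc (Suc n))) = case_nat (e 0) (\<lambda>n. e (Suc (Suc n)))"
    for e :: "nat \<Rightarrow> 'v" by (rule ext) (simp split: nat.split)
  have "D (\<lambda>e. e 1 = F (case_nat (e 0) (\<lambda>n. e (Suc (Suc n)))))"
    using D_rename[OF assms(2)[unfolded Dt_def], of "case_nat 1 (case_nat 0 (\<lambda>n. Suc (Suc n)))"]
    by (simp add: eq)
  from D_subst[OF Dt_shift[OF assms(1)] this] show ?thesis by (simp add: Dt_def)
qed

lemma Dt_comp2: assumes "Dt (\<lambda>e. G (e 0) (e 1) (\<lambda>n. e (Suc (Suc n))))" "Dt s" "Dt u"
  shows "Dt (\<lambda>e. G (s e) (u e) (\<lambda>n. e (r n)))"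
proof -
  have "Dt (\<lambda>e. G (e 0) (e 1) (\<lambda>n. e (Suc (Suc (r n)))))"
    using Dt_rename[OF assms(1), of "case_nat 0 (case_nat 1 (\<lambda>n. Suc (Suc (r n))))"] by simp
  from Dt_subst[OF Dt_shift[OF assms(2)] this] Dt_subst[OF assms(3)]
  show ?thesis by force
qed

lemma rec_approx_unique:
  assumes "Dt (\<lambda>e. G (e 0) (e 1))" "rec_approx G h t" "rec_approx G g u"
  shows "z \<in> elts t \<Longrightarrow> z \<in> elts u \<Longrightarrow> ap h z = ap g z"
proof -
  have "z \<in> elts t \<longrightarrow> z \<in> elts u \<longrightarrow> ap h z = ap g z"
  proof (induction z rule: eps_induct)
    show "D (\<lambda>e. e 0 \<in> elts t \<longrightarrow> e 0 \<in> elts u \<longrightarrow> ap h (e 0) = ap g (e 0))" by (intro dfn)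
  next
    case (step z)
    show ?case
    proof (intro impI)
      assume z: "z \<in> elts t" "z \<in> elts u"
      have "Lam z (\<lambda>w. ap h w) = Lam z (\<lambda>w. ap g w)"
      proof (rule Lam_cong)
        fix w assume "w \<in> elts z"
        moreover from this have "w \<in> elts t" "w \<in> elts u"
          using z assms(2,3) by (auto simp: rec_approx_def Trans_def)
        ultimately show "ap h w = ap g w" using step by blast
      qed
      then show "ap h z = ap g z" using z assms(2,3) by (simp add: rec_approx_def)
    qed
  qed
  then show "z \<in> elts t \<Longrightarrow> z \<in> elts u \<Longrightarrow> ap h z = ap g z" by blast
qed

lemma rec_eq: assumes "Dt (\<lambda>e. G (e 0) (e 1))" "rec_approx G h t" "x \<in> elts t" shows "rec G x = ap h x"
  unfolding rec_def using rec_approx_unique[OF assms(1)] assms(2,3) by (intro the_equality) blast+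

lemma D_rec_approx: assumes "Dt (\<lambda>e. G (e 0) (e 1) (\<lambda>n. e (Suc (Suc n))))"
  shows "D (\<lambda>e. rec_approx (\<lambda>x f. G x f (\<lambda>n. e (r n))) (e i) (e j))"
  unfolding rec_approx_def by (intro dfn Dt_comp2[OF assms])

text \<open>Attempts agree where they overlap, so those covering the elements of \<open>x\<close>
  can be glued on a transitive set \<open>U\<close> and extended by one value at
  \<open>x\<close>.\<close>

lemma rec_approx_ex: assumes G: "Dt (\<lambda>e. G (e 0) (e 1))" shows "\<exists>h t. rec_approx G h t \<and> x \<in> elts t"
proof (induction x rule: eps_induct)
  have d: "D (\<lambda>e. rec_approx G (e 0) (e 1))"
    unfolding rec_approx_def by (intro dfn Dt_compose2[OF G])
  then show dd: "D (\<lambda>e. \<exists>h t. rec_approx G h t \<and> e 0 \<in> elts t)" by (intro dfn D_compose2[OF d])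
  case (step x)
  obtain T where T: "Trans T" "elts x \<subseteq> elts T" using Trans_ex by blast
  define U where "U = sep T (\<lambda>x. \<exists>h t. rec_approx G h t \<and> x \<in> elts t)"
  have U: "elts U = {x \<in> elts T. \<exists>h t. rec_approx G h t \<and> x \<in> elts t}"
    unfolding U_def by (rule elts_sep[OF dd])
  have tU: "Trans U" unfolding Trans_def
  proof (intro ballI subsetI)
    fix y z assume yz: "y \<in> elts U" "z \<in> elts y"
    then obtain h t where "rec_approx G h t" "y \<in> elts t" "y \<in> elts T" using U by blast
    then have "z \<in> elts t" "z \<in> elts T" using yz T by (auto simp: rec_approx_def Trans_def)
    then show "z \<in> elts U" using U \<open>rec_approx G h t\<close> by blast
  qed
  have xU: "elts x \<subseteq> elts U" using step T U by blast
  show ?case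
  proof (cases "x \<in> elts U")
    case True then show ?thesis using U by blast
  next
    case False
    have dr: "Dt (\<lambda>e. if \<exists>h t. rec_approx G h t \<and> e 0 \<in> elts t then rec G (e 0) else emp)"
    proof (rule DtI)
      show "y = (if \<exists>h t. rec_approx G h t \<and> e 0 \<in> elts t then rec G (e 0) else emp) \<longleftrightarrow>
        (if \<exists>h t. rec_approx G h t \<and> e 0 \<in> elts t then \<exists>h t. rec_approx G h t \<and> e 0 \<in> elts t \<and> y = ap h (e 0) else y = emp)"
        for y and e :: "nat \<Rightarrow> 'v" using rec_eq[OF G] by metis
    qed (intro dfn D_compose2[OF d])
    \<comment> \<open>The default value makes the glued function definable everywhere; on
      \<open>U\<close> it never occurs.\<close>
    define R where "R z = (if \<exists>h t. rec_approx G h t \<and> z \<in> elts t then rec G z else emp)" for z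
    have R_D: "Dt (\<lambda>e. R (e 0))" unfolding R_def by (rule dr)
    define F where "F z = (if z = x then G x (Lam x R) else R z)" for z
    have F_D: "Dt (\<lambda>e. F (e 0))" unfolding F_def by (intro dfn Dt_compose1[OF R_D])
    define h where "h = Lam (un U (sing x)) F"
    have h: "ap h z = F z" if "z \<in> elts U \<or> z = x" for z
      unfolding h_def using that by (intro ap_Lam[OF F_D]) auto
    have "rec_approx G h (un U (sing x))" unfolding rec_approx_def
    proof (intro conjI ballI)
      show "Trans (un U (sing x))" using tU xU by (auto simp: Trans_def)
      show "func h (un U (sing x))" unfolding h_def by (rule func_Lam[OF F_D])
      fix z assume z: "z \<in> elts (un U (sing x))"
      have zU: "elts z \<subseteq> elts U" using z tU xU by (auto simp: Trans_def)
      then have "x \<notin> elts z" using False by blast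
      have L: "Lam z (\<lambda>w. ap h w) = Lam z R"
      proof (rule Lam_cong)
        fix w assume "w \<in> elts z"
        then show "ap h w = R w" using h[of w] zU False by (auto simp: F_def)
      qed
      show "ap h z = G z (Lam z (\<lambda>w. ap h w))"
      proof (cases "z = x")
        case True then show ?thesis using h[of z] L by (simp add: F_def)
      next
        case F: False
        then have "z \<in> elts U" using z by auto
        then obtain g t where g: "rec_approx G g t" "z \<in> elts t" using U by blast
        have "ap h z = R z" using h[of z] F \<open>z \<in> elts U\<close> by (simp add: F_def)
        also have "\<dots> = ap g z" using g rec_eq[OF G g] by (auto simp: R_def)
        also have "\<dots> = G z (Lam z (\<lambda>w. ap g w))" using g by (simp add: rec_approx_def)
        also have "Lam z (\<lambda>w. ap g w) = Lam z R"
        proof (rule Lam_cong)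
          fix w assume "w \<in> elts z"
          then have "w \<in> elts t" using g by (auto simp: rec_approx_def Trans_def)
          then show "ap g w = R w" using rec_eq[OF G g(1)] g(1) by (auto simp: R_def)
        qed
        finally show ?thesis using L by simp
      qed
    qed
    then show ?thesis by (intro exI[of _ h] exI[of _ "un U (sing x)"]) simp
  qed
qed

lemma rec_unfold: assumes G: "Dt (\<lambda>e. G (e 0) (e 1))" shows "rec G x = G x (Lam x (rec G))"
proof -
  obtain h t where h: "rec_approx G h t" "x \<in> elts t" using rec_approx_ex[OF G] by blast
  have "rec G x = ap h x" by (rule rec_eq[OF G h])
  also have "\<dots> = G x (Lam x (\<lambda>w. ap h w))" using h by (simp add: rec_approx_def)
  also have "Lam x (\<lambda>w. ap h w) = Lam x (rec G)"
  proof (rule Lam_cong)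
    fix w assume "w \<in> elts x"
    then have "w \<in> elts t" using h by (auto simp: rec_approx_def Trans_def)
    then show "ap h w = rec G w" using rec_eq[OF G h(1)] by simp
  qed
  finally show ?thesis .
qed

lemma Dt_rec [dfn]: assumes t: "Dt t" and G: "Dt (\<lambda>e. G (e 0) (e 1) (\<lambda>n. e (Suc (Suc n))))"
  shows "Dt (\<lambda>e. rec (\<lambda>x f. G x f e) (t e))"
proof (rule DtI)
  show "y = rec (\<lambda>x f. G x f e) (t e) \<longleftrightarrow> (\<exists>h u. rec_approx (\<lambda>x f. G x f e) h u \<and> t e \<in> elts u \<and> y = ap h (t e))"
    for y and e :: "nat \<Rightarrow> 'v"
    using rec_approx_ex[OF Dt_fix2[OF G]] rec_eq[OF Dt_fix2[OF G]] by metis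
  show "D (\<lambda>e. \<exists>h u. rec_approx (\<lambda>x f. G x f (\<lambda>n. e (Suc n))) h u \<and> t (\<lambda>n. e (Suc n)) \<in> elts u \<and> e 0 = ap h (t (\<lambda>n. e (Suc n))))"
    by (intro dfn D_rec_approx[OF G] Dt_rename[OF t])
qed

subsection \<open>Ordinals\<close>

lemma sat_trans [simp]: "sat (trans_f x) \<longleftrightarrow> Trans x"
  by (auto simp: trans_f_def sub_f_def Trans_def elts_def)

lemma Ord_iff: "Ord x \<longleftrightarrow> Trans x \<and> (\<forall>y\<in>elts x. Trans y)"
  by (auto simp: Ord_def ord_f_def elts_def)

lemma D_Ord [THEN D_compose1, dfn]: "D (\<lambda>e. Ord (e 0))"
  unfolding Ord_iff by (intro dfn)

lemma Ord_elt: "Ord a \<Longrightarrow> b \<in> elts a \<Longrightarrow> Ord b"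
  unfolding Ord_iff Trans_def by blast

lemma Ord_trans: "Ord a \<Longrightarrow> b \<in> elts a \<Longrightarrow> c \<in> elts b \<Longrightarrow> c \<in> elts a"
  unfolding Ord_iff Trans_def by blast

lemma Ord_emp [simp]: "Ord emp" by (simp add: Ord_iff Trans_def)

lemma Ord_succ [simp]: "Ord a \<Longrightarrow> Ord (succ a)"
  unfolding Ord_iff Trans_def by auto

lemma OrdI: "Trans x \<Longrightarrow> (\<And>y. y \<in> elts x \<Longrightarrow> Ord y) \<Longrightarrow> Ord x"
  unfolding Ord_iff by blast

lemma Ord_Union: "(\<And>y. y \<in> elts x \<Longrightarrow> Ord y) \<Longrightarrow> Ord (Union x)"
  unfolding Ord_iff Trans_def by auto

text \<open>Double induction: for an incomparable pair that is minimal in both coordinates, each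
  element of one ordinal lies in the other, and extensionality makes them equal.\<close>

lemma Ord_linear: assumes "Ord a" "Ord b" shows "a \<in> elts b \<or> a = b \<or> b \<in> elts a"
proof -
  have "Ord a \<longrightarrow> (\<forall>b. Ord b \<longrightarrow> a \<in> elts b \<or> a = b \<or> b \<in> elts a)" for a
  proof (induction a rule: eps_induct)
    show "D (\<lambda>e. Ord (e 0) \<longrightarrow> (\<forall>b. Ord b \<longrightarrow> e 0 \<in> elts b \<or> e 0 = b \<or> b \<in> elts (e 0)))" by (intro dfn)
  next
    case (step a)
    have "Ord a \<longrightarrow> Ord b \<longrightarrow> a \<in> elts b \<or> a = b \<or> b \<in> elts a" for b
    proof (induction b rule: eps_induct)
      show "D (\<lambda>e. Ord a \<longrightarrow> Ord (e 0) \<longrightarrow> a \<in> elts (e 0) \<or> a = e 0 \<or> e 0 \<in> elts a)" by (intro dfn)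
    next
      case stepb: (step b)
      show ?case
      proof (intro impI)
        assume o: "Ord a" "Ord b"
        show "a \<in> elts b \<or> a = b \<or> b \<in> elts a"
        proof (rule ccontr)
          assume n: "\<not> (a \<in> elts b \<or> a = b \<or> b \<in> elts a)"
          have "x \<in> elts b" if "x \<in> elts a" for x
            using step[OF that] o n that Ord_elt Ord_trans by metis
          moreover have "x \<in> elts a" if "x \<in> elts b" for x
            using stepb[OF that] o n that Ord_elt Ord_trans by metis
          ultimately show False using n elts_eqI by blast
        qed
      qed
    qed
    then show ?case by blast
  qed
  with assms show ?thesis by blast
qed

lemma Ord_subset_iff: "Ord a \<Longrightarrow> Ord b \<Longrightarrow> elts a \<subseteq> elts b \<longleftrightarrow> a \<in> elts b \<or> a = b"
  by (metis Ord_linear Ord_trans not_mem_self subset_iff)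

lemma Ord_least: assumes "D (\<lambda>e. P (e 0))" "Ord a" "P a"
  obtains b where "Ord b" "P b" "\<And>c. c \<in> elts b \<Longrightarrow> \<not> P c"
proof -
  have "Ord a \<longrightarrow> P a \<longrightarrow> (\<exists>b. Ord b \<and> P b \<and> (\<forall>c\<in>elts b. \<not> P c))" for a
  proof (induction a rule: eps_induct)
    show "D (\<lambda>e. Ord (e 0) \<longrightarrow> P (e 0) \<longrightarrow> (\<exists>b. Ord b \<and> P b \<and> (\<forall>c\<in>elts b. \<not> P c)))"
      by (intro dfn D_compose1[OF assms(1)])
  qed (metis Ord_elt)
  with assms that show thesis by blast
qed

lemma Ord_om: "Ord om"
proof (rule OrdI)
  show "Trans om" unfolding Trans_def using om_elt by blast
  have "n \<in> elts om \<Longrightarrow> Ord n" for n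
  proof (induction n rule: om_induct)
    case D show ?case by (intro dfn)
  qed auto
  then show "y \<in> elts om \<Longrightarrow> Ord y" for y .
qed

definition Limit :: "'v \<Rightarrow> bool" where
  "Limit x \<longleftrightarrow> Ord x \<and> elts x \<noteq> {} \<and> (\<forall>y\<in>elts x. succ y \<in> elts x)"

lemma D_Limit [THEN D_compose1, dfn]: "D (\<lambda>e. Limit (e 0))"
  unfolding Limit_def elts_eq_empty by (intro dfn)

lemma sat_limit [simp]: "sat (limit_f x) \<longleftrightarrow> Limit x"
proof -
  have "sat (limit_f x) \<longleftrightarrow> Ord x \<and> elts x \<noteq> {} \<and> (\<forall>y\<in>elts x. \<exists>z\<in>elts x. y \<in> elts z)"
    by (auto simp: limit_f_def Ord_def elts_def)
  moreover have "succ y \<in> elts x" if "Ord x" "y \<in> elts x" "z \<in> elts x" "y \<in> elts z" for y z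
  proof -
    have o: "Ord y" "Ord z" using that Ord_elt by blast+
    have "elts (succ y) \<subseteq> elts z" using that(4) Ord_trans[OF o(2) that(4)] by auto
    then have "succ y \<in> elts z \<or> succ y = z" using Ord_subset_iff[OF Ord_succ[OF o(1)] o(2)] by blast
    then show ?thesis using Ord_trans[OF that(1,3)] that(3) by blast
  qed
  ultimately show ?thesis unfolding Limit_def by (metis elts_succ insertI1)
qed

lemma Limit_om: "Limit om"
  unfolding Limit_def using Ord_om om_0 by (metis om_succ empty_iff)

lemma not_Limit_om: "n \<in> elts om \<Longrightarrow> \<not> Limit n"
  by (erule om_cases) (auto simp: Limit_def)

lemma sat_omega [simp]: "sat (omega_f w) \<longleftrightarrow> w = om"
proof
  assume "sat (omega_f w)"
  then have w: "Limit w" "\<forall>n\<in>elts w. \<not> Limit n" by (auto simp: omega_f_def elts_def)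
  then show "w = om" using Ord_linear[of w om] Ord_om not_Limit_om Limit_om by (auto simp: Limit_def)
qed (use Limit_om not_Limit_om in \<open>auto simp: omega_f_def elts_def\<close>)

lemma omega_om: "omega = om" by (simp add: omega_def)

subsection \<open>Comparing cardinalities\<close>

lemma sat_upair [simp]: "sat (upair_f w x y) \<longleftrightarrow> w = vset {x, y}"
proof -
  have "sat (upair_f w x y) \<longleftrightarrow> (\<forall>z. z \<in> elts w \<longleftrightarrow> z = x \<or> z = y)"
    by (auto simp: upair_f_def elts_def)
  then show ?thesis by (auto simp: elts_inject[symmetric])
qed

lemma sat_opair [simp]: "sat (opair_f w x y) \<longleftrightarrow> w = opair x y"
  by (auto simp: opair_f_def opair_def)

lemma sat_rel [simp]: "sat (rel_f r x y) \<longleftrightarrow> opair x y \<in> elts r"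
  by (auto simp: rel_f_def elts_def)

lemma sat_fun [simp]: "sat (fun_f f a b) \<longleftrightarrow> func f a \<and> (\<forall>x\<in>elts a. ap f x \<in> elts b)"
proof -
  have "sat (fun_f f a b) \<longleftrightarrow>
    (\<forall>w\<in>elts f. \<exists>x\<in>elts a. \<exists>y\<in>elts b. w = opair x y) \<and> (\<forall>x\<in>elts a. \<exists>y. opair x y \<in> elts f) \<and>
    (\<forall>x y y'. opair x y \<in> elts f \<and> opair x y' \<in> elts f \<longrightarrow> y = y')"
    by (auto simp: fun_f_def elts_def)
  also have "\<dots> \<longleftrightarrow> func f a \<and> (\<forall>x\<in>elts a. ap f x \<in> elts b)"
  proof safe
    assume *: "\<forall>w\<in>elts f. \<exists>x\<in>elts a. \<exists>y\<in>elts b. w = opair x y"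
      "\<forall>x\<in>elts a. \<exists>y. opair x y \<in> elts f"
      "\<forall>x y y'. opair x y \<in> elts f \<and> opair x y' \<in> elts f \<longrightarrow> y = y'"
    then show f: "func f a" unfolding func_def by blast
    fix x assume "x \<in> elts a"
    then have "opair x (ap f x) \<in> elts f" using func_opair[OF f] by simp
    then show "ap f x \<in> elts b" using *(1) by fastforce
  next
    assume f: "func f a" and b: "\<forall>x\<in>elts a. ap f x \<in> elts b"
    show "\<exists>x\<in>elts a. \<exists>y\<in>elts b. w = opair x y" if "w \<in> elts f" for w
      using f b that func_opair[OF f] unfolding func_def by metis
    show "x \<in> elts a \<Longrightarrow> \<exists>y. opair x y \<in> elts f" for x using func_opair[OF f] by blast
    show "opair x y \<in> elts f \<Longrightarrow> opair x y' \<in> elts f \<Longrightarrow> y = y'" for x y y'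
      using func_opair[OF f] by simp
  qed
  finally show ?thesis .
qed

lemma sat_inj [simp]: "sat (inj_f f a b) \<longleftrightarrow>
  func f a \<and> (\<forall>x\<in>elts a. ap f x \<in> elts b) \<and> inj_on (ap f) (elts a)"
proof -
  have "sat (inj_f f a b) \<longleftrightarrow> sat (fun_f f a b) \<and>
    (\<forall>x x' y. opair x y \<in> elts f \<and> opair x' y \<in> elts f \<longrightarrow> x = x')"
    by (auto simp: inj_f_def simp del: sat_fun)
  moreover have "(\<forall>x x' y. opair x y \<in> elts f \<and> opair x' y \<in> elts f \<longrightarrow> x = x') \<longleftrightarrow> inj_on (ap f) (elts a)"
    if f: "func f a"
    unfolding func_opair[OF f] inj_on_def by metis
  ultimately show ?thesis by auto
qed

lemma sat_countable [simp]: "sat (countable_f x) \<longleftrightarrow> card_le x om"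
  by (simp add: countable_f_def card_le_def)

lemma card_le_iff: "card_le x y \<longleftrightarrow>
    (\<exists>f. func f x \<and> (\<forall>a\<in>elts x. ap f a \<in> elts y) \<and> (\<forall>a\<in>elts x. \<forall>b\<in>elts x. ap f a = ap f b \<longrightarrow> a = b))"
  unfolding card_le_def sat_inj inj_on_def by blast

lemma D_card_le [THEN D_compose2, dfn]: "D (\<lambda>e. card_le (e 0) (e 1))"
  unfolding card_le_iff by (intro dfn)

lemma D_card_less [THEN D_compose2, dfn]: "D (\<lambda>e. card_less (e 0) (e 1))"
  unfolding card_less_def by (intro dfn)

lemma card_leI: assumes "Dt (\<lambda>e. F (e 0))" "\<And>a. a \<in> elts x \<Longrightarrow> F a \<in> elts y"
    "\<And>a b. a \<in> elts x \<Longrightarrow> b \<in> elts x \<Longrightarrow> F a = F b \<Longrightarrow> a = b"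
  shows "card_le x y"
  unfolding card_le_iff using assms(2,3)
  by (intro exI[of _ "Lam x F"]) (auto simp: func_Lam[OF assms(1)] ap_Lam[OF assms(1)])

lemma card_leE: assumes "card_le x y" obtains F where "Dt (\<lambda>e. F (e 0))"
    "\<And>a. a \<in> elts x \<Longrightarrow> F a \<in> elts y"
    "\<And>a b. a \<in> elts x \<Longrightarrow> b \<in> elts x \<Longrightarrow> F a = F b \<Longrightarrow> a = b"
proof -
  obtain f where "(\<forall>a\<in>elts x. ap f a \<in> elts y)" "(\<forall>a\<in>elts x. \<forall>b\<in>elts x. ap f a = ap f b \<longrightarrow> a = b)"
    using assms card_le_iff by blast
  moreover have "Dt (\<lambda>e. ap f (e 0))" by (intro dfn)
  ultimately show thesis using that by blast
qed

lemma card_le_subset: "elts x \<subseteq> elts y \<Longrightarrow> card_le x y"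
  by (rule card_leI[where F = "\<lambda>x. x"]) (intro dfn, auto)

lemma card_le_refl [simp]: "card_le x x" by (simp add: card_le_subset)

lemma card_le_trans: assumes "card_le x y" "card_le y z" shows "card_le x z"
proof -
  obtain F where F: "Dt (\<lambda>e. F (e 0))" "\<And>a. a \<in> elts x \<Longrightarrow> F a \<in> elts y"
    "\<And>a b. a \<in> elts x \<Longrightarrow> b \<in> elts x \<Longrightarrow> F a = F b \<Longrightarrow> a = b" using assms(1) by (rule card_leE) blast
  obtain G where G: "Dt (\<lambda>e. G (e 0))" "\<And>a. a \<in> elts y \<Longrightarrow> G a \<in> elts z"
    "\<And>a b. a \<in> elts y \<Longrightarrow> b \<in> elts y \<Longrightarrow> G a = G b \<Longrightarrow> a = b" using assms(2) by (rule card_leE) blast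
  show ?thesis
    by (rule card_leI[where F = "\<lambda>a. G (F a)"]) (use Dt_compose1[OF G(1) F(1)] F G in auto)
qed

lemma card_le_surj: assumes "Dt (\<lambda>e. F (e 0))" "elts y \<subseteq> F ` elts x" shows "card_le y x"
proof -
  have R: "D (\<lambda>e. F (e 1) = e 0)" by (intro dfn Dt_compose1[OF assms(1)])
  have "\<exists>u\<in>elts x. F u = v" if "v \<in> elts y" for v using assms(2) that by blast
  then obtain f where f: "\<And>v. v \<in> elts y \<Longrightarrow> ap f v \<in> elts x \<and> F (ap f v) = v"
    using AC[OF R, of y x] by blast
  have d: "Dt (\<lambda>e. ap f (e 0))" by (intro dfn)
  show ?thesis by (rule card_leI[OF d]) (use f in metis)+
qed

lemma card_le_surjE: assumes "card_le x y" "elts x \<noteq> {}"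
  obtains F where "Dt (\<lambda>e. F (e 0))" "F ` elts y = elts x"
proof -
  obtain u0 where u0: "u0 \<in> elts x" using assms(2) by blast
  obtain F where F: "Dt (\<lambda>e. F (e 0))" "\<And>a. a \<in> elts x \<Longrightarrow> F a \<in> elts y"
    "\<And>a b. a \<in> elts x \<Longrightarrow> b \<in> elts x \<Longrightarrow> F a = F b \<Longrightarrow> a = b" using assms(1) by (rule card_leE) blast
  have R: "D (\<lambda>e. (\<exists>u\<in>elts x. F u = e 0) \<longrightarrow> F (e 1) = e 0)" by (intro dfn Dt_compose1[OF F(1)])
  have "\<exists>u\<in>elts x. (\<exists>u\<in>elts x. F u = v) \<longrightarrow> F u = v" for v using u0 by blast
  then obtain g where g: "\<And>v. v \<in> elts y \<Longrightarrow> ap g v \<in> elts x \<and> ((\<exists>u\<in>elts x. F u = v) \<longrightarrow> F (ap g v) = v)"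
    using AC[OF R, of y x] by metis
  have d: "Dt (\<lambda>e. ap g (e 0))" by (intro dfn)
  have "u \<in> ap g ` elts y" if "u \<in> elts x" for u
    using g[of "F u"] F that by (metis imageI)
  then have "ap g ` elts y = elts x" using g by blast
  with d that show thesis by blast
qed

lemma card_le_image: "Dt (\<lambda>e. F (e 0)) \<Longrightarrow> card_le (img x F) x"
  by (rule card_le_surj) (auto simp: elts_img)

lemma card_le_Pow: assumes "card_le x y" shows "card_le (Pow x) (Pow y)"
proof -
  obtain F where F: "Dt (\<lambda>e. F (e 0))" "\<And>a. a \<in> elts x \<Longrightarrow> F a \<in> elts y"
    "\<And>a b. a \<in> elts x \<Longrightarrow> b \<in> elts x \<Longrightarrow> F a = F b \<Longrightarrow> a = b" using assms by (rule card_leE) blast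
  have e: "elts (img s F) = F ` elts s" for s by (rule elts_img[OF F(1)])
  have i: "inj_on F (elts x)" using F(3) by (auto intro: inj_onI)
  show ?thesis
  proof (rule card_leI[where F = "\<lambda>s. img s F"])
    show "Dt (\<lambda>e. img (e 0) F)" by (intro dfn Dt_compose1[OF F(1)])
  next
    fix a b assume ab: "a \<in> elts (Pow x)" "b \<in> elts (Pow x)" "img a F = img b F"
    then have "F ` elts a = F ` elts b" using e by metis
    then have "elts a = elts b" using inj_on_image_eq_iff[OF i] ab by simp
    then show "a = b" by (rule elts_eqI)
  qed (use F(2) e in auto)
qed

lemma card_le_cart: assumes "card_le a b" "card_le c d" shows "card_le (cart a c) (cart b d)"
proof -
  obtain F where F: "Dt (\<lambda>e. F (e 0))" "\<And>u. u \<in> elts a \<Longrightarrow> F u \<in> elts b"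
    "\<And>u v. u \<in> elts a \<Longrightarrow> v \<in> elts a \<Longrightarrow> F u = F v \<Longrightarrow> u = v" using assms(1) by (rule card_leE) blast
  obtain G where G: "Dt (\<lambda>e. G (e 0))" "\<And>u. u \<in> elts c \<Longrightarrow> G u \<in> elts d"
    "\<And>u v. u \<in> elts c \<Longrightarrow> v \<in> elts c \<Longrightarrow> G u = G v \<Longrightarrow> u = v" using assms(2) by (rule card_leE) blast
  show ?thesis
    by (rule card_leI[where F = "\<lambda>p. opair (F (pfst p)) (G (psnd p))"])
      (intro dfn Dt_compose1[OF F(1)] Dt_compose1[OF G(1)], use F G in auto)
qed

lemma Cantor: "\<not> card_le (Pow x) x"
proof
  assume "card_le (Pow x) x"
  moreover have "elts (Pow x) \<noteq> {}" by auto
  ultimately obtain F where F: "Dt (\<lambda>e. F (e 0))" "F ` elts x = elts (Pow x)" by (rule card_le_surjE) blast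
  have s: "elts (sep x (\<lambda>u. u \<notin> elts (F u))) = {u \<in> elts x. u \<notin> elts (F u)}"
    by (rule elts_sep) (intro dfn Dt_compose1[OF F(1)])
  then have "sep x (\<lambda>u. u \<notin> elts (F u)) \<in> F ` elts x" unfolding F(2) by auto
  then show False using s by auto
qed

definition dif :: "'v \<Rightarrow> 'v \<Rightarrow> 'v" where "dif x y = sep x (\<lambda>z. z \<notin> elts y)"
lemma Dt_dif [THEN Dt_compose2, dfn]: "Dt (\<lambda>e. dif (e 0) (e 1))" unfolding dif_def by (intro dfn)
lemma elts_dif [simp]: "elts (dif x y) = elts x - elts y"
  unfolding dif_def by (subst elts_sep) (intro dfn, auto)

section \<open>Well-ordering and cardinal comparison\<close>

lemma not_small_Ord: "\<not> small {a. Ord a}"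
proof
  assume s: "small {a. Ord a}"
  have "Ord (vset {a. Ord a})" by (rule OrdI) (use s Ord_elt in \<open>auto simp: Trans_def\<close>)
  then have "vset {a. Ord a} \<in> elts (vset {a. Ord a})" using s by simp
  then show False by simp
qed

text \<open>
  The enumeration of a set, at each step choosing among the remaining elements \<open>W\<close> one
  related to \<open>W\<close> by \<open>R\<close>.
\<close>

lemma Zermelo:
  assumes R: "D (\<lambda>e. R (e 0) (e 1))"
    and ex: "\<And>W. elts W \<subseteq> elts P \<Longrightarrow> elts W \<noteq> {} \<Longrightarrow> \<exists>u\<in>elts W. R W u"
  obtains t e where "Ord t" "Dt (\<lambda>x. e (x 0))" "e ` elts t = elts P" "inj_on e (elts t)"
    "\<And>i. i \<in> elts t \<Longrightarrow> R (dif P (img i e)) (e i)"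
proof -
  have dR: "D (\<lambda>e. e 1 \<in> elts (e 0) \<and> R (e 0) (e 1))" by (intro dfn D_compose2[OF R])
  have "\<exists>u\<in>elts P. u \<in> elts W \<and> R W u" if "W \<in> elts (dif (Pow P) (sing emp))" for W
  proof -
    have "elts W \<subseteq> elts P" "elts W \<noteq> {}" using that by auto
    then show ?thesis using ex[of W] by blast
  qed
  then obtain c where c: "\<And>W. W \<in> elts (dif (Pow P) (sing emp)) \<Longrightarrow> ap c W \<in> elts W \<and> R W (ap c W)"
    using AC[OF dR, of "dif (Pow P) (sing emp)" P] by metis
  \<comment> \<open>The value \<open>P\<close> signals that nothing remains. It cannot be confused
    with a chosen element because no set is a member of itself.\<close>
  define e where "e = rec (\<lambda>i f. if dif P (img i (\<lambda>j. ap f j)) = emp then P else ap c (dif P (img i (\<lambda>j. ap f j))))"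
  have dG: "Dt (\<lambda>e. if dif P (img (e 0) (\<lambda>j. ap (e 1) j)) = emp then P else ap c (dif P (img (e 0) (\<lambda>j. ap (e 1) j))))"
    by (intro dfn)
  have de: "Dt (\<lambda>x. e (x 0))" unfolding e_def by (intro dfn)
  have e: "e i = (if dif P (img i e) = emp then P else ap c (dif P (img i e)))" for i
  proof -
    have "img i (\<lambda>j. ap (Lam i e) j) = img i e"
    proof -
      have "Dt (\<lambda>x. ap (Lam i e) (x 0))" by (intro dfn Dt_compose1[OF de])
      then show ?thesis by (intro elts_eqI) (auto simp: elts_img elts_img[OF de] ap_Lam[OF de])
    qed
    then show ?thesis using rec_unfold[OF dG, of i] unfolding e_def[symmetric] by simp
  qed
  have ie: "elts (img i e) = e ` elts i" for i by (rule elts_img[OF de])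
  have mem: "e i \<in> elts P - e ` elts i \<and> R (dif P (img i e)) (e i)" if "e i \<noteq> P" for i
    using e[of i] c[of "dif P (img i e)"] that ie[of i] by (auto split: if_splits)
  have emp: "e i = P \<Longrightarrow> elts P \<subseteq> e ` elts i" for i
  proof (rule ccontr)
    assume *: "e i = P" "\<not> elts P \<subseteq> e ` elts i"
    then have "dif P (img i e) \<noteq> emp" using ie by (metis Diff_eq_empty_iff elts_dif elts_emp)
    then have "e i \<in> elts P" using e[of i] c[of "dif P (img i e)"] by auto
    with * show False by simp
  qed
  have "\<exists>t. Ord t \<and> e t = P"
  proof (rule ccontr)
    assume "\<not> ?thesis"
    then have nP: "\<And>i. Ord i \<Longrightarrow> e i \<noteq> P" by blast
    have inj: "i = j" if "Ord i" "Ord j" "e i = e j" for i j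
    proof -
      have "i \<notin> elts j" using mem[OF nP[OF that(2)]] that by (metis DiffD2 imageI)
      moreover have "j \<notin> elts i" using mem[OF nP[OF that(1)]] that by (metis DiffD2 imageI)
      ultimately show ?thesis using Ord_linear that by blast
    qed
    \<comment> \<open>If the enumeration never stopped, its inverse would map \<open>P\<close> onto
      a class containing all ordinals, and replacement would make the ordinals a set.\<close>
    define g where "g p = (if \<exists>i. Ord i \<and> e i = p then THE i. Ord i \<and> e i = p else emp)" for p
    have g: "g (e i) = i" if "Ord i" for i
      unfolding g_def using that inj by (auto intro!: the_equality)
    have dg: "Dt (\<lambda>x. g (x 0))"
    proof (rule DtI)
      show "y = g (x 0) \<longleftrightarrow> (if \<exists>i. Ord i \<and> e i = x 0 then Ord y \<and> e y = x 0 else y = emp)"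
        for y and x :: "nat \<Rightarrow> 'v"
      proof (cases "\<exists>i. Ord i \<and> e i = x 0")
        case True
        then obtain i where i: "Ord i" "x 0 = e i" by metis
        then have "y = i \<longleftrightarrow> Ord y \<and> e y = x 0" using inj by auto
        with i True g[of i] show ?thesis by simp
      qed (auto simp: g_def)
    qed (intro dfn Dt_compose1[OF de])
    have "{a. Ord a} \<subseteq> elts (img P g)"
    proof
      fix a assume "a \<in> {a. Ord a}"
      then have "e a \<in> elts P" "g (e a) = a" using mem nP g by auto
      then show "a \<in> elts (img P g)" unfolding elts_img[OF dg] by (metis imageI)
    qed
    then have "small {a. Ord a}" by (rule small_subset) (simp, intro dfn)
    then show False using not_small_Ord by blast
  qed
  moreover have "D (\<lambda>x. e (x 0) = P)" by (intro dfn Dt_compose1[OF de])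
  ultimately obtain t where t: "Ord t" "e t = P" "\<And>i. i \<in> elts t \<Longrightarrow> e i \<noteq> P"
    using Ord_least[of "\<lambda>i. e i = P"] by blast
  show thesis
  proof (rule that[OF t(1) de])
    show "e ` elts t = elts P" using emp[OF t(2)] mem t(3) by blast
    show "inj_on e (elts t)"
    proof (rule inj_onI)
      fix i j assume ij: "i \<in> elts t" "j \<in> elts t" "e i = e j"
      have "i \<notin> elts j" using mem[OF t(3)[OF ij(2)]] ij by (metis DiffD2 imageI)
      moreover have "j \<notin> elts i" using mem[OF t(3)[OF ij(1)]] ij by (metis DiffD2 imageI)
      ultimately show "i = j" using Ord_linear Ord_elt[OF t(1)] ij by blast
    qed
    show "R (dif P (img i e)) (e i)" if "i \<in> elts t" for i using mem[OF t(3)[OF that]] by blast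
  qed
qed

lemma card_le_Ord: obtains t where "Ord t" "card_le x t" "card_le t x"
proof -
  have d: "D (\<lambda>e. e 1 \<in> elts (e 0))" by (intro dfn)
  obtain t e where t: "Ord t" "Dt (\<lambda>x. e (x 0))" "e ` elts t = elts x" "inj_on e (elts t)"
    by (rule Zermelo[where R = "\<lambda>W u. u \<in> elts W" and P = x, OF d]) blast+
  have "card_le t x" by (rule card_leI[OF t(2)]) (use t in \<open>auto simp: inj_on_def\<close>)
  moreover have "card_le x t" by (rule card_le_surj[OF t(2)]) (use t in auto)
  ultimately show thesis using that t by blast
qed

lemma Ord_card_le: "Ord a \<Longrightarrow> Ord b \<Longrightarrow> \<not> card_le b a \<Longrightarrow> a \<in> elts b"
  using Ord_linear[of a b] card_le_subset[of b a] Ord_iff Trans_def by auto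

lemma Ord_mem_card_le: "Ord b \<Longrightarrow> a \<in> elts b \<Longrightarrow> card_le a b"
  by (rule card_le_subset) (auto simp: Ord_iff Trans_def)

lemma card_le_total: "card_le x y \<or> card_le y x"
proof -
  obtain s where s: "Ord s" "card_le x s" "card_le s x" by (rule card_le_Ord)
  obtain t where t: "Ord t" "card_le y t" "card_le t y" by (rule card_le_Ord)
  have "card_le s t \<or> card_le t s" using Ord_card_le[of s t] Ord_mem_card_le s t by blast
  then show ?thesis using s t card_le_trans by meson
qed

text \<open>By Cantor's theorem, an ordinal equinumerous with the power set of \<open>x\<close> lies
  above all ordinals that inject into \<open>x\<close>. So these ordinals form a set, which is
  itself the required ordinal.\<close>

lemma hartogs: "elts (hartogs x) = {a. Ord a \<and> card_le a x}" "Ord (hartogs x)" "\<not> card_le (hartogs x) x"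
proof -
  obtain t where t: "Ord t" "card_le (Pow x) t" "card_le t (Pow x)" by (rule card_le_Ord)
  have "\<not> card_le t x" using Cantor card_le_trans t by blast
  then have "a \<in> elts t" if "Ord a" "card_le a x" for a
    using that Ord_card_le[OF that(1) t(1)] card_le_trans by blast
  then have "small {a. Ord a \<and> card_le a x}" by (intro small_Collect[of _ t]) (intro dfn, auto)
  then obtain h where h: "elts h = {a. Ord a \<and> card_le a x}" by (auto simp: small_def)
  have oh: "Ord h"
  proof (rule OrdI)
    show "Trans h" unfolding Trans_def h
      using Ord_elt Ord_mem_card_le card_le_trans by blast
  qed (use h in auto)
  moreover have nh: "\<not> card_le h x" using oh h not_mem_self[of h] by blast
  ultimately have "hartogs x = h" unfolding hartogs_def
  proof (intro the_equality)
    fix a assume a: "Ord a \<and> \<not> card_le a x \<and> (\<forall>b\<in>elts a. card_le b x)"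
    show "a = h"
    proof (rule elts_eqI, unfold h, rule set_eqI)
      fix b
      have "b \<in> elts a" if "Ord b" "card_le b x"
        using that a Ord_card_le[of b a] card_le_trans by blast
      then show "b \<in> elts a \<longleftrightarrow> b \<in> {a. Ord a \<and> card_le a x}" using a Ord_elt by blast
    qed
  qed (use h in auto)
  then show "elts (hartogs x) = {a. Ord a \<and> card_le a x}" "Ord (hartogs x)" "\<not> card_le (hartogs x) x"
    using h oh nh by auto
qed

subsection \<open>Finite and infinite sets\<close>

lemma om_not_card_le: "n \<in> elts om \<Longrightarrow> \<not> card_le om n"
proof (induction n rule: om_induct)
  case D show ?case by (intro dfn)
next
  case zero
  show ?case using om_0 by (metis card_leE elts_emp empty_iff)
next
  case (succ n)
  show ?case
  proof
    assume "card_le om (succ n)"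
    then obtain F where F: "Dt (\<lambda>e. F (e 0))" "\<And>a. a \<in> elts om \<Longrightarrow> F a \<in> elts (succ n)"
      "\<And>a b. a \<in> elts om \<Longrightarrow> b \<in> elts om \<Longrightarrow> F a = F b \<Longrightarrow> a = b" by (rule card_leE) blast
    \<comment> \<open>The forbidden value \<open>n\<close> is replaced by the value of
      \<open>F\<close> at \<open>emp\<close>, which the shift by \<open>succ\<close> has set
      free.\<close>
    define G where "G k = (if F (succ k) = n then F emp else F (succ k))" for k
    have "card_le om n"
    proof (rule card_leI)
      show "Dt (\<lambda>e. G (e 0))" unfolding G_def by (intro dfn Dt_compose1[OF F(1)])
      show "G k \<in> elts n" if "k \<in> elts om" for k
        using F(2)[of "succ k"] F(2)[of emp] F(3)[of "succ k" emp] that by (auto simp: G_def)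
      show "a = b" if "a \<in> elts om" "b \<in> elts om" "G a = G b" for a b
        using F(3)[of "succ a" "succ b"] F(3)[of "succ a" emp] F(3)[of emp "succ b"] that
        by (auto simp: G_def split: if_splits)
    qed
    with succ show False by blast
  qed
qed

lemma card_le_insert: assumes "card_le x y" shows "card_le (un x (sing a)) (succ y)"
proof -
  obtain F where F: "Dt (\<lambda>e. F (e 0))" "\<And>a. a \<in> elts x \<Longrightarrow> F a \<in> elts y"
    "\<And>a b. a \<in> elts x \<Longrightarrow> b \<in> elts x \<Longrightarrow> F a = F b \<Longrightarrow> a = b" using assms by (rule card_leE) blast
  have ne: "F b \<noteq> y" if "b \<in> elts x" for b using F(2)[OF that] by auto
  have "Dt (\<lambda>e. if e 0 \<in> elts x then F (e 0) else y)" by (intro dfn F(1))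
  then show ?thesis
    by (rule card_leI) (use F(2,3) ne in \<open>auto split: if_splits\<close>)
qed

lemma finite_un: assumes "k \<in> elts om" "card_le A k"
  shows "n \<in> elts om \<Longrightarrow> \<forall>B. card_le B n \<longrightarrow> (\<exists>l\<in>elts om. card_le (un A B) l)"
proof (induction n rule: om_induct)
  case D show ?case by (intro dfn)
next
  case zero
  have "un A B = A" if "card_le B emp" for B
    using that by (intro elts_eqI) (metis card_leE elts_emp elts_un empty_iff ex_in_conv sup_bot.right_neutral)
  then show ?case using assms by metis
next
  case (succ n)
  show ?case
  proof (intro allI impI)
    fix B assume "card_le B (succ n)"
    then obtain F where F: "Dt (\<lambda>e. F (e 0))" "\<And>a. a \<in> elts B \<Longrightarrow> F a \<in> elts (succ n)"
      "\<And>a b. a \<in> elts B \<Longrightarrow> b \<in> elts B \<Longrightarrow> F a = F b \<Longrightarrow> a = b" by (rule card_leE) blast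
    have e: "elts (sep B (\<lambda>b. F b \<in> elts n)) = {b \<in> elts B. F b \<in> elts n}"
      by (rule elts_sep) (intro dfn F(1))
    have "card_le (sep B (\<lambda>b. F b \<in> elts n)) n"
      by (rule card_leI[OF F(1)]) (use F(2,3) in \<open>auto simp: e\<close>)
    then obtain l where l: "l \<in> elts om" "card_le (un A (sep B (\<lambda>b. F b \<in> elts n))) l" using succ by blast
    have "\<exists>b0. elts B \<subseteq> insert b0 {b \<in> elts B. F b \<in> elts n}"
    proof (cases "\<exists>b0\<in>elts B. F b0 = n")
      case True
      then obtain b0 where "b0 \<in> elts B" "F b0 = n" by blast
      then show ?thesis using F(2,3) by (intro exI[of _ b0]) auto
    next
      case False
      then show ?thesis using F(2) by (intro exI[of _ B]) auto
    qed
    then obtain b0 where b0: "elts B \<subseteq> insert b0 {b \<in> elts B. F b \<in> elts n}" by blast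
    have "card_le (un A B) (un (un A (sep B (\<lambda>b. F b \<in> elts n))) (sing b0))"
      by (rule card_le_subset) (use b0 e in auto)
    also note card_le_insert[OF l(2)]
    finally (card_le_trans) show "\<exists>l\<in>elts om. card_le (un A B) l" using l om_succ by blast
  qed
qed

text \<open>Covers the finite initial segments in \<open>Hessenberg\<close>, where a square is
  larger than its side but still finite.\<close>

lemma finite_cart: assumes "n \<in> elts om"
  shows "m \<in> elts om \<Longrightarrow> \<exists>l\<in>elts om. card_le (cart n m) l"
proof (induction m rule: om_induct)
  case D show ?case by (intro dfn)
next
  case zero
  have "cart n emp = emp" by (rule elts_eqI) auto
  then show ?case by (intro bexI[of _ emp]) auto
next
  case (succ m)
  then obtain l where l: "l \<in> elts om" "card_le (cart n m) l" by blast
  have "card_le (cart n (sing m)) n"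
    by (rule card_leI[where F = pfst]) (intro dfn, auto)
  then obtain l' where "l' \<in> elts om" "card_le (un (cart n m) (cart n (sing m))) l'"
    using finite_un[OF l assms] by blast
  moreover have "un (cart n m) (cart n (sing m)) = cart n (succ m)" by (rule elts_eqI) auto
  ultimately show ?case by auto
qed

lemma om_subset: assumes "Ord a" "card_le om a" shows "elts om \<subseteq> elts a"
proof -
  have "a \<notin> elts om" using om_not_card_le assms by blast
  then have "om \<in> elts a \<or> om = a" using Ord_linear Ord_om assms by blast
  then show ?thesis using assms(1) by (auto simp: Ord_iff Trans_def)
qed

lemma card_le_succ: assumes "Ord a" "card_le om a" shows "card_le (succ a) a"
proof -
  have s: "elts om \<subseteq> elts a" by (rule om_subset[OF assms])
  have na: "a \<notin> elts om" using s not_mem_self by blast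
  show ?thesis
  proof (rule card_leI[where F = "\<lambda>x. if x = a then emp else if x \<in> elts om then succ x else x"])
    show "Dt (\<lambda>e. if e 0 = a then emp else if e 0 \<in> elts om then succ (e 0) else e 0)" by (intro dfn)
    show "(if x = a then emp else if x \<in> elts om then succ x else x) \<in> elts a" if "x \<in> elts (succ a)" for x
      using that s om_succ om_0 by auto
    show "x = y" if "(if x = a then emp else if x \<in> elts om then succ x else x) =
        (if y = a then emp else if y \<in> elts om then succ y else y)" for x y
      using that om_succ om_0 by (metis succ_inject succ_neq(1))
  qed
qed

text \<open>Let \<open>a\<close> be an initial ordinal and enumerate the pairs, always taking one
  with the least maximum. If the enumeration were longer than \<open>a\<close>, its first
  \<open>a\<close> entries would lie in the square of \<open>succ g\<close> for some
  \<open>g\<close> below \<open>a\<close>, which is too small by induction.\<close>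

lemma Hessenberg: assumes "Ord a" "card_le om a" shows "card_le (cart a a) a"
proof -
  have "Ord a \<longrightarrow> card_le om a \<longrightarrow> card_le (cart a a) a" for a
  proof (induction a rule: eps_induct)
    show "D (\<lambda>e. Ord (e 0) \<longrightarrow> card_le om (e 0) \<longrightarrow> card_le (cart (e 0) (e 0)) (e 0))" by (intro dfn)
  next
    case (step a)
    show ?case
    proof (intro impI)
      assume a: "Ord a" "card_le om a"
      show "card_le (cart a a) a"
      proof (cases "\<exists>b\<in>elts a. card_le a b")
        \<comment> \<open>An ordinal that is not initial inherits the claim from a smaller one of
          the same size.\<close>
        case True
        then obtain b where b: "b \<in> elts a" "card_le a b" by blast
        then have "card_le (cart b b) b" using step[OF b(1)] a Ord_elt card_le_trans by blast
        then show ?thesis using card_le_cart[OF b(2) b(2)] b Ord_mem_card_le[OF a(1)] card_le_trans by blast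
      next
        case init: False
        define mx where "mx u = un (pfst u) (psnd u)" for u
        have mx_D [THEN Dt_compose1, dfn]: "Dt (\<lambda>e. mx (e 0))" unfolding mx_def by (intro dfn)
        have mx: "mx (opair x y) \<in> elts a \<and> x \<in> elts (succ (mx (opair x y))) \<and> y \<in> elts (succ (mx (opair x y)))"
          if "x \<in> elts a" "y \<in> elts a" for x y
        proof -
          have o: "Ord x" "Ord y" using that a Ord_elt by blast+
          have "elts x \<subseteq> elts y \<or> elts y \<subseteq> elts x" using Ord_linear[OF o] o by (auto simp: Ord_iff Trans_def)
          then have "(mx (opair x y) = y \<and> elts x \<subseteq> elts y) \<or> (mx (opair x y) = x \<and> elts y \<subseteq> elts x)"
            by (auto simp: mx_def elts_inject[symmetric])
          then show ?thesis using that Ord_subset_iff o by auto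
        qed
        define R where "R W u \<longleftrightarrow> u \<in> elts W \<and> (\<forall>w\<in>elts W. elts (mx u) \<subseteq> elts (mx w))" for W u
        have dR: "D (\<lambda>e. R (e 0) (e 1))" unfolding R_def by (intro dfn)
        have "\<exists>u\<in>elts W. R W u" if W: "elts W \<subseteq> elts (cart a a)" "elts W \<noteq> {}" for W
        proof -
          have om: "Ord (mx w)" if "w \<in> elts W" for w
          proof -
            have "w \<in> elts (cart a a)" using W(1) that by blast
            then obtain x y where "w = opair x y" "x \<in> elts a" "y \<in> elts a" by auto
            then show ?thesis using mx[of x y] a Ord_elt by blast
          qed
          obtain w where "w \<in> elts W" using W by blast
          moreover have "D (\<lambda>e. \<exists>u\<in>elts W. mx u = e 0)" by (intro dfn)
          ultimately obtain m where m: "Ord m" "\<exists>u\<in>elts W. mx u = m" "\<And>c. c \<in> elts m \<Longrightarrow> \<not> (\<exists>u\<in>elts W. mx u = c)"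
            using Ord_least[of "\<lambda>m. \<exists>u\<in>elts W. mx u = m" "mx w"] om by blast
          then obtain u where u: "u \<in> elts W" "mx u = m" by blast
          have "elts m \<subseteq> elts (mx w)" if "w \<in> elts W" for w
            using m(3) that Ord_linear[OF m(1) om[OF that]] om[OF that] by (auto simp: Ord_iff Trans_def)
          then show ?thesis using u by (auto simp: R_def)
        qed
        then obtain t e where t: "Ord t" "Dt (\<lambda>x. e (x 0))" "e ` elts t = elts (cart a a)" "inj_on e (elts t)"
            "\<And>i. i \<in> elts t \<Longrightarrow> R (dif (cart a a) (img i e)) (e i)"
          by (rule Zermelo[where R = R and P = "cart a a", OF dR]) blast+
        have "a \<notin> elts t"
        proof
          assume at: "a \<in> elts t"
          define g where "g = mx (e a)"
          have ea: "e a \<in> elts (cart a a)" using at t(3) by blast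
          then have g: "g \<in> elts a" using mx by (auto simp: g_def)
          have "e i \<in> elts (cart (succ g) (succ g))" if i: "i \<in> elts a" for i
          proof -
            have it: "i \<in> elts t" using i at t(1) Ord_trans by blast
            have "e a \<noteq> e j" if "j \<in> elts i" for j
            proof
              assume "e a = e j"
              moreover have ja: "j \<in> elts a" using Ord_trans[OF a(1) i that] .
              moreover have "j \<in> elts t" using Ord_trans[OF t(1) at ja] .
              ultimately show False using t(4) at by (auto simp: inj_on_def)
            qed
            then have "e a \<in> elts (dif (cart a a) (img i e))"
              using ea by (auto simp: elts_img[OF t(2)])
            then have s: "elts (mx (e i)) \<subseteq> elts g" using t(5)[OF it] by (auto simp: R_def g_def)
            obtain x y where xy: "e i = opair x y" "x \<in> elts a" "y \<in> elts a" using it t(3) by fastforce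
            have og: "Ord g" "Ord (mx (e i))" using g mx[OF xy(2,3)] xy(1) a Ord_elt by auto
            then have "mx (e i) \<in> elts (succ g)" using s Ord_subset_iff by auto
            then have "elts (succ (mx (e i))) \<subseteq> elts (succ g)"
              using Ord_succ[OF og(1)] by (auto simp: Ord_iff Trans_def)
            then show ?thesis using mx[OF xy(2,3)] xy by auto
          qed
          then have ac: "card_le a (cart (succ g) (succ g))"
            using t(4) at t(1) Ord_trans by (intro card_leI[OF t(2)]) (auto simp: inj_on_def)
          have og: "Ord g" using g a Ord_elt by blast
          show False
          proof (cases "g \<in> elts om")
            case True
            then obtain l where "l \<in> elts om" "card_le (cart (succ g) (succ g)) l" using finite_cart om_succ by blast
            then show False using om_not_card_le ac a card_le_trans by meson
          next
            case False
            then have "card_le om g" using Ord_linear[OF og Ord_om] Ord_mem_card_le[OF og] by auto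
            then have "card_le (succ g) g" "card_le (cart g g) g" using card_le_succ og step g by auto
            then have "card_le a g" using ac card_le_cart card_le_trans by meson
            with init g show False by blast
          qed
        qed
        then have "card_le t a" using Ord_card_le[OF a(1) t(1)] by blast
        moreover have "card_le (cart a a) t" by (rule card_le_surj[OF t(2)]) (use t in auto)
        ultimately show ?thesis using card_le_trans by blast
      qed
    qed
  qed
  with assms show ?thesis by blast
qed

subsection \<open>Regular cardinals\<close>

text \<open>These two properties of an infinite cardinal carry all later size computations.\<close>

definition infsq :: "'v \<Rightarrow> bool" where
  "infsq r \<longleftrightarrow> card_le om r \<and> card_le (cart r r) r"

lemma infsq_Ord: "Ord a \<Longrightarrow> card_le om a \<Longrightarrow> infsq a"
  by (simp add: infsq_def Hessenberg)

text \<open>Choose an injection for each \<open>F i\<close> and an index for each element of the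
  union; an element is coded by its index and its value under the corresponding injection. The
  injections are drawn from the power set of \<open>cart U r\<close>, so that choice
  applies.\<close>

lemma card_le_UN:
  assumes r: "infsq r" and I: "card_le I r" and F: "Dt (\<lambda>e. F (e 0))"
    and Fr: "\<And>i. i \<in> elts I \<Longrightarrow> card_le (F i) r"
  shows "card_le (Union (img I F)) r"
proof -
  define U where "U = Union (img I F)"
  have U: "elts U = (\<Union>i\<in>elts I. elts (F i))" unfolding U_def by (simp add: elts_img[OF F])
  define R where "R i f \<longleftrightarrow> (\<forall>a\<in>elts (F i). ap f a \<in> elts r) \<and>
    (\<forall>a\<in>elts (F i). \<forall>b\<in>elts (F i). ap f a = ap f b \<longrightarrow> a = b)" for i f
  have R: "D (\<lambda>e. R (e 0) (e 1))" unfolding R_def by (intro dfn Dt_compose1[OF F])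
  have "\<exists>f\<in>elts (Pow (cart U r)). R i f" if i: "i \<in> elts I" for i
  proof -
    obtain f where f: "func f (F i)" "R i f" using Fr[OF i] unfolding card_le_iff R_def by blast
    have "elts f \<subseteq> elts (cart U r)"
    proof
      fix w assume "w \<in> elts f"
      then obtain x where x: "x \<in> elts (F i)" "w = opair x (ap f x)"
        using f(1) func_opair[OF f(1)] unfolding func_def by metis
      then show "w \<in> elts (cart U r)" using f(2) U i by (auto simp: R_def)
    qed
    with f show ?thesis by auto
  qed
  then obtain fs where fs: "\<And>i. i \<in> elts I \<Longrightarrow> R i (ap fs i)" using AC[OF R, of I] by metis
  have R2: "D (\<lambda>e. e 0 \<in> elts (F (e 1)))" by (intro dfn Dt_compose1[OF F])
  have "\<exists>i\<in>elts I. u \<in> elts (F i)" if "u \<in> elts U" for u using U that by blast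
  then obtain g where g: "\<And>u. u \<in> elts U \<Longrightarrow> ap g u \<in> elts I \<and> u \<in> elts (F (ap g u))"
    using AC[OF R2, of U I] by metis
  obtain h where h: "Dt (\<lambda>e. h (e 0))" "\<And>i. i \<in> elts I \<Longrightarrow> h i \<in> elts r"
    "\<And>i j. i \<in> elts I \<Longrightarrow> j \<in> elts I \<Longrightarrow> h i = h j \<Longrightarrow> i = j" using I by (rule card_leE) blast
  have "card_le U (cart r r)"
  proof (rule card_leI[where F = "\<lambda>u. opair (h (ap g u)) (ap (ap fs (ap g u)) u)"])
    show "Dt (\<lambda>e. opair (h (ap g (e 0))) (ap (ap fs (ap g (e 0))) (e 0)))" by (intro dfn Dt_compose1[OF h(1)])
    show "opair (h (ap g u)) (ap (ap fs (ap g u)) u) \<in> elts (cart r r)" if "u \<in> elts U" for u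
      using g[OF that] h(2) fs by (auto simp: R_def)
    show "u = v" if "u \<in> elts U" "v \<in> elts U"
      "opair (h (ap g u)) (ap (ap fs (ap g u)) u) = opair (h (ap g v)) (ap (ap fs (ap g v)) v)" for u v
    proof -
      have "ap g u = ap g v" using that h(3) g by simp
      then show ?thesis using that fs[of "ap g u"] g by (metis R_def opair_inject)
    qed
  qed
  then show ?thesis using r card_le_trans unfolding infsq_def U_def by blast
qed

lemma card_le_un: assumes r: "infsq r" and "card_le A r" "card_le B r" shows "card_le (un A B) r"
proof -
  have "card_le (vset {A, B}) om"
  proof (rule card_leI[where F = "\<lambda>x. if x = A then emp else succ emp"])
    show "Dt (\<lambda>e. if e 0 = A then emp else succ emp)" by (intro dfn)
  qed (auto split: if_splits)
  then have "card_le (vset {A, B}) r" using r card_le_trans unfolding infsq_def by blast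
  moreover have d: "Dt (\<lambda>e. e 0)" by (intro dfn)
  ultimately have "card_le (Union (img (vset {A, B}) (\<lambda>x. x))) r"
    by (intro card_le_UN[OF r]) (use assms in auto)
  moreover have "Union (img (vset {A, B}) (\<lambda>x. x)) = un A B"
    by (rule elts_eqI) (auto simp: elts_img[OF d])
  ultimately show ?thesis by simp
qed

lemma card_le_sing: assumes "infsq r" shows "card_le (sing x) r"
proof -
  have "card_le (sing x) om" by (rule card_leI[where F = "\<lambda>x. emp"]) (intro dfn, auto)
  then show ?thesis using assms card_le_trans unfolding infsq_def by blast
qed

lemma E_elts: "E x y \<longleftrightarrow> x \<in> elts y" by (simp add: elts_def)

lemma regular_iff: "regular k \<longleftrightarrow> Limit k \<and>
  (\<forall>a\<in>elts k. \<forall>f. func f a \<and> (\<forall>x\<in>elts a. ap f x \<in> elts k) \<longrightarrow> (\<exists>b\<in>elts k. \<forall>x\<in>elts a. ap f x \<in> elts b))"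
proof -
  have "regular k \<longleftrightarrow> Limit k \<and> (\<forall>a f. a \<in> elts k \<and> (func f a \<and> (\<forall>x\<in>elts a. ap f x \<in> elts k)) \<longrightarrow>
      (\<exists>b. b \<in> elts k \<and> (\<forall>x y. opair x y \<in> elts f \<longrightarrow> y \<in> elts b)))"
    unfolding regular_def regular_f_def by (simp add: E_elts) blast
  moreover have "(\<exists>b. b \<in> elts k \<and> (\<forall>x y. opair x y \<in> elts f \<longrightarrow> y \<in> elts b)) \<longleftrightarrow>
      (\<exists>b\<in>elts k. \<forall>x\<in>elts a. ap f x \<in> elts b)" if "func f a" for f a
    unfolding func_opair[OF that] by blast
  ultimately show ?thesis by (simp only: Ball_def) blast
qed

lemma D_regular [THEN D_compose1, dfn]: "D (\<lambda>e. regular (e 0))"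
  unfolding regular_iff by (intro dfn)

lemma regular_Ord: "regular k \<Longrightarrow> Ord k" by (simp add: regular_iff Limit_def)

text \<open>Regularity speaks of functions on ordinals; a surjection from the ordinal transfers it
  to every index set of smaller size.\<close>

lemma regular_bound:
  assumes k: "regular k" and X: "card_le X a" "a \<in> elts k" and F: "Dt (\<lambda>e. F (e 0))"
    "\<And>x. x \<in> elts X \<Longrightarrow> F x \<in> elts k"
  shows "\<exists>b\<in>elts k. \<forall>x\<in>elts X. F x \<in> elts b"
proof (cases "elts X = {}")
  case True then show ?thesis using X by auto
next
  case False
  obtain g where g: "Dt (\<lambda>e. g (e 0))" "g ` elts a = elts X" using X(1) False by (rule card_le_surjE) blast
  have d: "Dt (\<lambda>e. F (g (e 0)))" by (rule Dt_compose1[OF F(1) g(1)])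
  have "\<exists>b\<in>elts k. \<forall>x\<in>elts a. ap (Lam a (\<lambda>x. F (g x))) x \<in> elts b"
  proof -
    have "\<forall>f. func f a \<and> (\<forall>x\<in>elts a. ap f x \<in> elts k) \<longrightarrow> (\<exists>b\<in>elts k. \<forall>x\<in>elts a. ap f x \<in> elts b)"
      using k X(2) by (simp add: regular_iff)
    moreover have "\<forall>x\<in>elts a. ap (Lam a (\<lambda>x. F (g x))) x \<in> elts k"
      using F(2) g(2) by (auto simp: ap_Lam[OF d])
    ultimately show ?thesis using func_Lam[OF d] by blast
  qed
  then show ?thesis using g(2) by (auto simp: ap_Lam[OF d] image_iff) (metis imageE)
qed

lemma regular_not_le: assumes "regular k" "a \<in> elts k" shows "\<not> card_le k a"
proof
  assume "card_le k a"
  moreover have "Dt (\<lambda>e. e 0)" by (intro dfn)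
  ultimately obtain b where "b \<in> elts k" "\<forall>x\<in>elts k. x \<in> elts b"
    using regular_bound[OF assms(1) _ assms(2), of k "\<lambda>x. x"] by blast
  then show False using not_mem_self by blast
qed

text \<open>This is the regularity of successor cardinals in the form of suprema: a union of at most
  \<open>r\<close> sets of size at most \<open>r\<close> has size at most \<open>r\<close>.\<close>

lemma hartogs_Union: assumes r: "Ord r" "card_le om r" and X: "card_le X r" "elts X \<subseteq> elts (hartogs r)"
  shows "Union X \<in> elts (hartogs r)"
proof -
  have d: "Dt (\<lambda>e. e 0)" by (intro dfn)
  have "card_le (Union (img X (\<lambda>x. x))) r"
    by (rule card_le_UN[OF infsq_Ord[OF r] X(1) d]) (use X(2) hartogs in auto)
  moreover have "img X (\<lambda>x. x) = X" by (rule elts_eqI) (simp add: elts_img[OF d])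
  moreover have "Ord (Union X)" using X(2) hartogs(1) by (intro Ord_Union) auto
  ultimately show ?thesis by (simp add: hartogs(1))
qed

lemma hartogs_Limit: assumes r: "Ord r" "card_le om r" shows "Limit (hartogs r)"
proof -
  have "card_le emp r" by (rule card_le_subset) simp
  moreover have "card_le (succ a) r" if "card_le a r" for a
  proof -
    have "succ a = un a (sing a)" by (rule elts_eqI) auto
    then show ?thesis using card_le_insert[OF that, of a] card_le_succ[OF r] card_le_trans by simp
  qed
  moreover have "emp \<in> elts (hartogs r)" by (simp add: hartogs(1) \<open>card_le emp r\<close>)
  then have "elts (hartogs r) \<noteq> {}" by blast
  ultimately show ?thesis unfolding Limit_def using hartogs(1,2) by auto
qed

lemma hartogs_regular: assumes r: "Ord r" "card_le om r" shows "regular (hartogs r)"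
  unfolding regular_iff
proof (intro conjI ballI allI impI)
  show L: "Limit (hartogs r)" by (rule hartogs_Limit[OF r])
  fix a f assume a: "a \<in> elts (hartogs r)" and f: "func f a \<and> (\<forall>x\<in>elts a. ap f x \<in> elts (hartogs r))"
  have d: "Dt (\<lambda>e. ap f (e 0))" by (intro dfn)
  define b where "b = Union (img a (ap f))"
  have "card_le (img a (ap f)) r" using card_le_image[OF d] a hartogs(1) card_le_trans by blast
  then have b: "b \<in> elts (hartogs r)"
    unfolding b_def by (rule hartogs_Union[OF r]) (use f in \<open>auto simp: elts_img[OF d]\<close>)
  have "ap f x \<in> elts (succ b)" if "x \<in> elts a" for x
  proof -
    have "elts (ap f x) \<subseteq> elts b" using that by (auto simp: b_def elts_img[OF d])
    then show ?thesis using Ord_subset_iff[of "ap f x" b] b f that hartogs(1) by auto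
  qed
  then show "\<exists>b\<in>elts (hartogs r). \<forall>x\<in>elts a. ap f x \<in> elts b"
    using b L unfolding Limit_def by blast
qed

lemma hartogs_self: "Ord r \<Longrightarrow> r \<in> elts (hartogs r)" by (simp add: hartogs(1))

lemma omega1_eq: "omega1 = hartogs om" by (simp add: omega1_def omega_om)

lemma Ord_omega1 [simp]: "Ord omega1" and Ord_omega2 [simp]: "Ord omega2"
  by (simp_all add: omega1_eq omega2_def hartogs)

lemma om_omega1: "om \<in> elts omega1" by (simp add: omega1_eq hartogs_self Ord_om)
lemma omega1_omega2: "omega1 \<in> elts omega2" by (simp add: omega2_def hartogs_self)

lemma om_le_omega1: "card_le om omega1"
  using om_omega1 Ord_mem_card_le Ord_omega1 by blast

lemma infsq_omega1: "infsq omega1" by (simp add: infsq_Ord om_le_omega1)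

lemma om_sub_omega1: "elts om \<subseteq> elts omega1" by (rule om_subset) (simp_all add: om_le_omega1)

lemma regular_omega2: "regular omega2" by (simp add: omega2_def hartogs_regular om_le_omega1)

lemma elts_omega2: "elts omega2 = {a. Ord a \<and> card_le a omega1}" by (simp add: omega2_def hartogs)

lemma omega2_not_le: "\<not> card_le omega2 omega1" by (simp add: omega2_def hartogs)

text \<open>Well-ordering \<open>M\<close> reduces the claim to the fact that \<open>omega2\<close>
  consists of the ordinals that inject into \<open>omega1\<close>.\<close>

lemma card_less_omega2: "card_less M omega2 \<longleftrightarrow> card_le M omega1"
proof
  assume M: "card_less M omega2"
  obtain t where t: "Ord t" "card_le M t" "card_le t M" by (rule card_le_Ord)
  have "t \<in> elts omega2"
    using Ord_card_le[OF t(1) Ord_omega2] M t(3) card_le_trans unfolding card_less_def by blast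
  then have "card_le t omega1" by (simp add: elts_omega2)
  then show "card_le M omega1" using t card_le_trans by blast
next
  assume M: "card_le M omega1"
  then have "card_le M omega2" using omega1_omega2 Ord_mem_card_le[OF Ord_omega2] card_le_trans by blast
  then show "card_less M omega2" using M omega2_not_le card_le_trans unfolding card_less_def by blast
qed

lemma cardinal_omega2: "cardinal omega2"
  unfolding cardinal_def card_less_def
  using Ord_omega2 Ord_mem_card_le regular_not_le[OF regular_omega2] by blast

lemma elts_Union_mono: "x \<in> elts X \<Longrightarrow> elts x \<subseteq> elts (Union X)" by auto

subsection \<open>The cumulative hierarchy\<close>

definition Vr :: "'v \<Rightarrow> 'v" where
  "Vr a = rec (\<lambda>x f. Union (img x (\<lambda>c. Pow (ap f c)))) a"

lemma Dt_Vr [THEN Dt_compose1, dfn]: "Dt (\<lambda>e. Vr (e 0))" unfolding Vr_def by (intro dfn)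

lemma elts_Vr: "elts (Vr a) = {y. \<exists>c\<in>elts a. elts y \<subseteq> elts (Vr c)}"
proof -
  have G: "Dt (\<lambda>e. Union (img (e 0) (\<lambda>c. Pow (ap (e 1) c))))" by (intro dfn)
  have d: "Dt (\<lambda>e. Vr (e 0))" by (intro dfn)
  have d2: "Dt (\<lambda>e. Pow (ap (Lam a Vr) (e 0)))" by (intro dfn)
  have "Vr a = Union (img a (\<lambda>c. Pow (ap (Lam a Vr) c)))"
    using rec_unfold[OF G, of a] unfolding Vr_def[symmetric] Vr_def[abs_def, symmetric] by simp
  then show ?thesis by (auto simp: elts_img[OF d2] ap_Lam[OF d])
qed

lemma Trans_Vr: "Trans (Vr a)"
proof (induction a rule: eps_induct)
  show "D (\<lambda>e. Trans (Vr (e 0)))" by (intro dfn)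
next
  case (step a)
  then show ?case unfolding Trans_def elts_Vr[of a] by blast
qed

lemma Vr_mem: "c \<in> elts a \<Longrightarrow> elts y \<subseteq> elts (Vr c) \<Longrightarrow> y \<in> elts (Vr a)"
  unfolding elts_Vr[of a] by blast

lemma Ord_sub_Vr: "Ord a \<Longrightarrow> elts a \<subseteq> elts (Vr a)"
proof -
  have "Ord a \<longrightarrow> elts a \<subseteq> elts (Vr a)"
  proof (induction a rule: eps_induct)
    show "D (\<lambda>e. Ord (e 0) \<longrightarrow> elts (e 0) \<subseteq> elts (Vr (e 0)))" by (intro dfn)
  next
    case (step a)
    show ?case using step Ord_elt Vr_mem by blast
  qed
  then show "Ord a \<Longrightarrow> elts a \<subseteq> elts (Vr a)" by blast
qed

text \<open>By induction, the function \<open>h\<close> that \<open>Vlevel\<close> postulates must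
  agree with the recursively defined class function \<open>Vr\<close> up to
  \<open>a\<close>.\<close>

lemma Vlevel_Vr: assumes "Ord a" shows "Vlevel a = Vr a"
  unfolding Vlevel_def
proof (rule the_equality)
  have s: "vset (insert a (elts a)) = succ a" by (simp add: succ_def)
  have d: "Dt (\<lambda>e. Vr (e 0))" by (intro dfn)
  have L: "ap (Lam (succ a) Vr) b = Vr b" if "b \<in> elts (succ a)" for b by (rule ap_Lam[OF d that])
  have app: "app (Lam (succ a) Vr) b = Vr b" if "b \<in> insert a (elts a)" for b
    using func_app[OF func_Lam[OF d]] L that by simp
  have sub: "c \<in> insert a (elts a)" if "b \<in> insert a (elts a)" "c \<in> elts b" for b c
    using that Ord_trans[OF assms] by blast
  show "\<exists>h. func h (vset (insert a (elts a))) \<and> (\<forall>b\<in>insert a (elts a).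
      elts (app h b) = {y. \<exists>c\<in>elts b. elts y \<subseteq> elts (app h c)}) \<and> Vr a = app h a"
  proof (intro exI[of _ "Lam (succ a) Vr"] conjI ballI)
    show "func (Lam (succ a) Vr) (vset (insert a (elts a)))" unfolding s by (rule func_Lam[OF d])
    show "elts (app (Lam (succ a) Vr) b) = {y. \<exists>c\<in>elts b. elts y \<subseteq> elts (app (Lam (succ a) Vr) c)}"
      if b: "b \<in> insert a (elts a)" for b
      unfolding app[OF b] elts_Vr[of b] using app sub[OF b] by auto
  qed (simp add: app)
  fix x assume "\<exists>h. func h (vset (insert a (elts a))) \<and> (\<forall>b\<in>insert a (elts a).
      elts (app h b) = {y. \<exists>c\<in>elts b. elts y \<subseteq> elts (app h c)}) \<and> x = app h a"
  then obtain h where h: "func h (succ a)"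
    "\<forall>b\<in>insert a (elts a). elts (app h b) = {y. \<exists>c\<in>elts b. elts y \<subseteq> elts (app h c)}" "x = app h a"
    unfolding s by blast
  have h': "elts (ap h b) = {y. \<exists>c\<in>elts b. elts y \<subseteq> elts (ap h c)}" if "b \<in> insert a (elts a)" for b
  proof -
    have "elts (ap h b) = {y. \<exists>c\<in>elts b. elts y \<subseteq> elts (app h c)}"
      using h(2)[rule_format, OF that] func_app[OF h(1), of b] that by simp
    moreover have "app h c = ap h c" if "c \<in> elts b" for c
      using func_app[OF h(1), of c] sub[OF \<open>b \<in> insert a (elts a)\<close> that] by simp
    ultimately show ?thesis by auto
  qed
  have "b \<in> elts (succ a) \<longrightarrow> ap h b = Vr b" for b
  proof (induction b rule: eps_induct)
    show "D (\<lambda>e. e 0 \<in> elts (succ a) \<longrightarrow> ap h (e 0) = Vr (e 0))" by (intro dfn)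
  next
    case (step b)
    show ?case
    proof
      assume b: "b \<in> elts (succ a)"
      have "elts (ap h b) = elts (Vr b)"
        unfolding elts_Vr[of b] using h'[of b] b sub[of b] step by auto
      then show "ap h b = Vr b" by (rule elts_eqI)
    qed
  qed
  then show "x = Vr a" using h(3) func_app[OF h(1), of a] by simp
qed

section \<open>Ranks, and the position of H_\<lambda> in the cumulative hierarchy\<close>

definition rk :: "'v \<Rightarrow> 'v" where
  "rk a = rec (\<lambda>x f. Union (img x (\<lambda>y. succ (ap f y)))) a"

lemma Dt_rk [THEN Dt_compose1, dfn]: "Dt (\<lambda>e. rk (e 0))" unfolding rk_def by (intro dfn)

lemma elts_rk: "elts (rk a) = (\<Union>y\<in>elts a. insert (rk y) (elts (rk y)))"
proof -
  have G: "Dt (\<lambda>e. Union (img (e 0) (\<lambda>c. succ (ap (e 1) c))))" by (intro dfn)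
  have d: "Dt (\<lambda>e. rk (e 0))" by (intro dfn)
  have d2: "Dt (\<lambda>e. succ (ap (Lam a rk) (e 0)))" by (intro dfn)
  have "rk a = Union (img a (\<lambda>c. succ (ap (Lam a rk) c)))"
    using rec_unfold[OF G, of a] unfolding rk_def[symmetric] rk_def[abs_def, symmetric] by simp
  then show ?thesis by (auto simp: elts_img[OF d2] ap_Lam[OF d])
qed

lemma Ord_rk: "Ord (rk a)"
proof (induction a rule: eps_induct)
  show "D (\<lambda>e. Ord (rk (e 0)))" by (intro dfn)
next
  case (step a)
  show ?case
  proof (rule OrdI)
    show "Trans (rk a)" using step unfolding Trans_def elts_rk[of a] by (auto simp: Ord_iff Trans_def)
    show "Ord y" if "y \<in> elts (rk a)" for y using that step Ord_elt unfolding elts_rk[of a] by blast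
  qed
qed

lemma sub_Vr_rk: "elts x \<subseteq> elts (Vr (rk x))"
proof (induction x rule: eps_induct)
  show "D (\<lambda>e. elts (e 0) \<subseteq> elts (Vr (rk (e 0))))" by (intro dfn)
next
  case (step x)
  show ?case
  proof
    fix y assume y: "y \<in> elts x"
    then have "rk y \<in> elts (rk x)" unfolding elts_rk[of x] by blast
    then show "y \<in> elts (Vr (rk x))" using step[OF y] by (rule Vr_mem)
  qed
qed

text \<open>The ranks of the elements of a transitive set leave no gaps, so they exhaust its rank.
  This bounds the ranks of members of \<open>H l\<close>.\<close>

lemma rk_Trans: assumes t: "Trans t" shows "card_le (rk t) t"
proof -
  have d: "Dt (\<lambda>e. rk (e 0))" by (intro dfn)
  have "x \<in> elts t \<longrightarrow> elts (rk x) \<subseteq> elts (img t rk)" for x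
  proof (induction x rule: eps_induct)
    show "D (\<lambda>e. e 0 \<in> elts t \<longrightarrow> elts (rk (e 0)) \<subseteq> elts (img t rk))" by (intro dfn)
  next
    case (step x)
    show ?case using step t unfolding Trans_def elts_rk[of x] elts_img[OF d] by blast
  qed
  then have "elts (rk t) \<subseteq> rk ` elts t" unfolding elts_rk[of t] elts_img[OF d] by blast
  then show ?thesis by (rule card_le_surj[OF d])
qed

lemma small_H: "small {x. \<exists>t. Trans t \<and> elts x \<subseteq> elts t \<and> card_less t l}"
proof (rule small_Collect[of _ "Vr (hartogs l)"])
  show "D (\<lambda>e. \<exists>t. Trans t \<and> elts (e 0) \<subseteq> elts t \<and> card_less t l)" by (intro dfn)
  fix x assume "\<exists>t. Trans t \<and> elts x \<subseteq> elts t \<and> card_less t l"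
  then obtain t where t: "Trans t" "elts x \<subseteq> elts t" "card_le t l" by (auto simp: card_less_def)
  then have "rk t \<in> elts (hartogs l)"
    using rk_Trans[OF t(1)] Ord_rk card_le_trans by (auto simp: hartogs(1))
  then show "x \<in> elts (Vr (hartogs l))" using t(2) sub_Vr_rk[of t] by (intro Vr_mem) auto
qed

lemma elts_H: "elts (H l) = {x. \<exists>t. Trans t \<and> elts x \<subseteq> elts t \<and> card_less t l}"
  unfolding H_def sat_trans by (simp add: small_H)

lemma Dt_H [THEN Dt_compose1, dfn]: "Dt (\<lambda>e. H (e 0))"
  unfolding H_def sat_trans by (rule Dt_vset) (intro dfn, rule small_H)

lemma elts_Z: "elts (Z l) = {M. elts M \<subseteq> elts (H l) \<and> card_le M omega1}"
proof -
  have "small {M. elts M \<subseteq> elts (H l) \<and> card_less M omega2}"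
    by (rule small_Collect[of _ "Pow (H l)"]) (intro dfn, auto)
  then show ?thesis unfolding Z_def by (simp add: card_less_omega2)
qed

lemma Dt_Z [THEN Dt_compose1, dfn]: "Dt (\<lambda>e. Z (e 0))"
  unfolding Z_def
proof (rule Dt_vset)
  show "small {M. elts M \<subseteq> elts (H (e 0)) \<and> card_less M omega2}" for e :: "nat \<Rightarrow> 'v"
    by (rule small_Collect[of _ "Pow (H (e 0))"]) (intro dfn, auto)
qed (intro dfn)

lemma H_sub_Vr: "Ord l \<Longrightarrow> elts (H l) \<subseteq> elts (Vr l)"
proof
  fix x assume l: "Ord l" and "x \<in> elts (H l)"
  then obtain t where t: "Trans t" "elts x \<subseteq> elts t" "card_less t l" by (auto simp: elts_H)
  have "rk t \<in> elts l"
    using Ord_card_le[OF Ord_rk l] rk_Trans[OF t(1)] t(3) card_le_trans unfolding card_less_def by blast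
  then show "x \<in> elts (Vr l)" using t(2) sub_Vr_rk[of t] by (intro Vr_mem) auto
qed

lemma regular_sub_H: assumes "regular l" shows "elts l \<subseteq> elts (H l)"
proof
  fix c assume c: "c \<in> elts l"
  have "Ord l" using assms by (rule regular_Ord)
  then have "Trans c" "card_less c l"
    using c Ord_elt[OF _ c] Ord_mem_card_le regular_not_le[OF assms c] by (auto simp: card_less_def Ord_iff)
  then show "c \<in> elts (H l)" unfolding elts_H by blast
qed

lemma H_mono: assumes "Ord l" "Ord l'" "elts l \<subseteq> elts l'" "regular l'" shows "elts (H l) \<subseteq> elts (H l')"
proof
  fix x assume "x \<in> elts (H l)"
  then obtain t where t: "Trans t" "elts x \<subseteq> elts t" "card_less t l" by (auto simp: elts_H)
  have "card_le l l'" by (rule card_le_subset[OF assms(3)])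
  then have "card_less t l'" using t(3) card_le_trans unfolding card_less_def by blast
  then show "x \<in> elts (H l')" using t unfolding elts_H by blast
qed

section \<open>Dependent choice and closures of length omega\<close>

lemma DC: assumes R: "D (\<lambda>e. R (e 0) (e 1))" and x0: "x0 \<in> elts A"
    and ex: "\<And>x. x \<in> elts A \<Longrightarrow> \<exists>y\<in>elts A. R x y"
  obtains F where "Dt (\<lambda>e. F (e 0))" "F emp = x0"
    "\<And>n. n \<in> elts om \<Longrightarrow> F n \<in> elts A" "\<And>n. n \<in> elts om \<Longrightarrow> R (F n) (F (succ n))"
proof -
  obtain f where f: "\<And>x. x \<in> elts A \<Longrightarrow> ap f x \<in> elts A \<and> R x (ap f x)"
    using AC[OF R, of A A] ex by blast
  have d: "Dt (\<lambda>e. ap f (e 0))" by (intro dfn)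
  define F where "F = iter x0 (ap f)"
  have dF: "Dt (\<lambda>e. F (e 0))" unfolding F_def by (rule Dt_iter[OF d])
  have F0: "F emp = x0" unfolding F_def by (rule iter_0[OF d])
  have FS: "F (succ n) = ap f (F n)" if "n \<in> elts om" for n unfolding F_def by (rule iter_succ[OF d that])
  have FA: "F n \<in> elts A" if "n \<in> elts om" for n
    using that
  proof (induction n rule: om_induct)
    case D show ?case by (intro dfn Dt_compose1[OF dF])
  qed (use F0 x0 FS f in auto)
  show thesis by (rule that[OF dF F0 FA]) (use FA FS f in auto)
qed

text \<open>Carrying the stage along as the first component of a pair reduces the claim to
  \<open>DC\<close>.\<close>

lemma DC_nat: assumes R: "D (\<lambda>e. R (e 0) (e 1) (e 2))" and x0: "x0 \<in> elts A"
    and ex: "\<And>n x. n \<in> elts om \<Longrightarrow> x \<in> elts A \<Longrightarrow> \<exists>y\<in>elts A. R n x y"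
  obtains F where "Dt (\<lambda>e. F (e 0))" "F emp = x0"
    "\<And>n. n \<in> elts om \<Longrightarrow> F n \<in> elts A" "\<And>n. n \<in> elts om \<Longrightarrow> R n (F n) (F (succ n))"
proof -
  define Q where "Q p q \<longleftrightarrow> pfst q = succ (pfst p) \<and> R (pfst p) (psnd p) (psnd q)" for p q
  have Q: "D (\<lambda>e. Q (e 0) (e 1))" unfolding Q_def by (intro dfn D_compose3[OF R])
  have q: "\<exists>q\<in>elts (cart om A). Q p q" if p: "p \<in> elts (cart om A)" for p
  proof -
    obtain n x where p: "p = opair n x" "n \<in> elts om" "x \<in> elts A" using p by auto
    obtain y where "y \<in> elts A" "R n x y" using ex p by blast
    then show ?thesis using p by (intro bexI[of _ "opair (succ n) y"]) (auto simp: Q_def)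
  qed
  have p0: "opair emp x0 \<in> elts (cart om A)" using x0 by auto
  obtain F where F: "Dt (\<lambda>e. F (e 0))" "F emp = opair emp x0"
    "\<And>n. n \<in> elts om \<Longrightarrow> F n \<in> elts (cart om A)" "\<And>n. n \<in> elts om \<Longrightarrow> Q (F n) (F (succ n))"
    by (rule DC[of Q "opair emp x0" "cart om A", OF Q p0 q]) blast+
  have n: "pfst (F n) = n" if "n \<in> elts om" for n
    using that
  proof (induction n rule: om_induct)
    case D show ?case by (intro dfn Dt_compose1[OF F(1)])
  qed (use F(2,4) in \<open>auto simp: Q_def\<close>)
  show thesis
  proof (rule that[of "\<lambda>n. psnd (F n)"])
    show "Dt (\<lambda>e. psnd (F (e 0)))" by (intro dfn F(1))
    show "psnd (F n) \<in> elts A" if "n \<in> elts om" for n using F(3)[OF that] by auto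
    show "R n (psnd (F n)) (psnd (F (succ n)))" if "n \<in> elts om" for n
      using F(4)[OF that] n[OF that] by (simp add: Q_def)
  qed (simp add: F(2))
qed

lemma om_chain: assumes F: "Dt (\<lambda>e. F (e 0))" "\<And>n. n \<in> elts om \<Longrightarrow> elts (F n) \<subseteq> elts (F (succ n))"
    and n: "n \<in> elts om" "m \<in> elts om"
  shows "elts (F n) \<subseteq> elts (F m) \<or> elts (F m) \<subseteq> elts (F n)"
proof -
  have a: "\<forall>n\<in>elts m. elts (F n) \<subseteq> elts (F m)" if "m \<in> elts om" for m
    using that
  proof (induction m rule: om_induct)
    case D show ?case by (intro dfn Dt_compose1[OF F(1)])
  qed (use F(2) in auto)
  show ?thesis using a n Ord_linear[of n m] Ord_elt[OF Ord_om] by blast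
qed

text \<open>As \<open>G\<close> is binary, omega many rounds suffice, and a round adds at most
  \<open>r\<close> many sets of size at most \<open>r\<close>. The operation is set-valued so that a
  single \<open>G\<close> can encode up to \<open>r\<close> many operations.\<close>

lemma closure_ex:
  assumes r: "infsq r" and G: "Dt (\<lambda>e. G (e 0) (e 1))"
    and GU: "\<And>x y. x \<in> elts U \<Longrightarrow> y \<in> elts U \<Longrightarrow> elts (G x y) \<subseteq> elts U \<and> card_le (G x y) r"
    and X: "elts X \<subseteq> elts U" "card_le X r"
  obtains Y where "elts X \<subseteq> elts Y" "elts Y \<subseteq> elts U" "card_le Y r"
    "\<And>x y. x \<in> elts Y \<Longrightarrow> y \<in> elts Y \<Longrightarrow> elts (G x y) \<subseteq> elts Y"
proof -
  define st where "st Y = un Y (Union (img (cart Y Y) (\<lambda>p. G (pfst p) (psnd p))))" for Y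
  have dG: "Dt (\<lambda>e. G (pfst (e 0)) (psnd (e 0)))" by (intro dfn Dt_compose2[OF G])
  have dst: "Dt (\<lambda>e. st (e 0))" unfolding st_def by (intro dfn Dt_compose2[OF G])
  have st: "elts (st Y) = elts Y \<union> (\<Union>x\<in>elts Y. \<Union>y\<in>elts Y. elts (G x y))" for Y
    unfolding st_def by (auto simp: elts_img[OF dG]) (metis pfst_opair psnd_opair)
  define F where "F = iter X st"
  have dF: "Dt (\<lambda>e. F (e 0))" unfolding F_def by (rule Dt_iter[OF dst])
  have F0: "F emp = X" unfolding F_def by (rule iter_0[OF dst])
  have FS: "F (succ n) = st (F n)" if "n \<in> elts om" for n unfolding F_def by (rule iter_succ[OF dst that])
  have FU: "elts (F n) \<subseteq> elts U \<and> card_le (F n) r" if "n \<in> elts om" for n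
    using that
  proof (induction n rule: om_induct)
    case D show ?case by (intro dfn Dt_compose1[OF dF])
  next
    case (succ n)
    have "card_le (Union (img (cart (F n) (F n)) (\<lambda>p. G (pfst p) (psnd p)))) r"
    proof (rule card_le_UN[OF r _ dG])
      show "card_le (cart (F n) (F n)) r"
        using card_le_cart succ r card_le_trans unfolding infsq_def by blast
    next
      fix i assume "i \<in> elts (cart (F n) (F n))"
      then obtain x y where "i = opair x y" "x \<in> elts U" "y \<in> elts U" using succ by auto
      then show "card_le (G (pfst i) (psnd i)) r" using GU[of x y] by simp
    qed
    then have "card_le (st (F n)) r" unfolding st_def using card_le_un[OF r] succ by blast
    moreover have "elts (st (F n)) \<subseteq> elts U" unfolding st using succ GU by blast
    ultimately show ?case using FS succ by simp
  qed (use F0 X in auto)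
  have mono: "elts (F n) \<subseteq> elts (F (succ n))" if "n \<in> elts om" for n
    using FS[OF that] st by auto
  define Y where "Y = Union (img om F)"
  have Y: "elts Y = (\<Union>n\<in>elts om. elts (F n))" unfolding Y_def by (simp add: elts_img[OF dF])
  show thesis
  proof (rule that)
    show "elts X \<subseteq> elts Y" using Y F0 om_0 by blast
    show "elts Y \<subseteq> elts U" using Y FU by auto
    show "card_le Y r" unfolding Y_def
      by (rule card_le_UN[OF r _ dF]) (use r FU in \<open>auto simp: infsq_def\<close>)
    fix x y assume "x \<in> elts Y" "y \<in> elts Y"
    then obtain n m where nm: "n \<in> elts om" "x \<in> elts (F n)" "m \<in> elts om" "y \<in> elts (F m)" using Y by auto
    then obtain k where k: "k \<in> elts om" "x \<in> elts (F k)" "y \<in> elts (F k)"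
      using om_chain[OF dF mono nm(1,3)] by blast
    then have "elts (G x y) \<subseteq> elts (F (succ k))" using FS st by auto
    then show "elts (G x y) \<subseteq> elts Y" using Y om_succ[OF k(1)] by blast
  qed
qed

subsection \<open>Collapsing sets of ordinals\<close>

text \<open>The Mostowski collapse relative to \<open>M\<close>. At an ordinal \<open>z\<close> it
  is the order type of \<open>M \<inter> z\<close>, also when \<open>z\<close> is not in
  \<open>M\<close>.\<close>

definition col :: "'v \<Rightarrow> 'v \<Rightarrow> 'v" where
  "col M z = rec (\<lambda>z f. img (int z M) (\<lambda>w. ap f w)) z"

lemma Dt_col [THEN Dt_compose2, dfn]: "Dt (\<lambda>e. col (e 0) (e 1))" unfolding col_def by (intro dfn)

lemma elts_col: "elts (col M z) = col M ` (elts z \<inter> elts M)"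
proof -
  have G: "Dt (\<lambda>e. img (int (e 0) M) (\<lambda>w. ap (e 1) w))" by (intro dfn)
  have d: "Dt (\<lambda>e. col M (e 0))" by (intro dfn)
  have d2: "Dt (\<lambda>e. ap (Lam z (col M)) (e 0))" by (intro dfn d)
  have "col M z = img (int z M) (\<lambda>w. ap (Lam z (col M)) w)"
    using rec_unfold[OF G, of z] unfolding col_def[symmetric] col_def[abs_def, symmetric] by simp
  then show ?thesis by (auto simp: elts_img[OF d2] ap_Lam[OF d])
qed

lemma col_iff: "u \<in> elts (col M z) \<longleftrightarrow> (\<exists>w. w \<in> elts z \<and> w \<in> elts M \<and> u = col M w)"
  by (auto simp: elts_col)

lemma Ord_col: "Ord z \<Longrightarrow> Ord (col M z)"
proof -
  have "Ord z \<longrightarrow> Ord (col M z)"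
  proof (induction z rule: eps_induct)
    show "D (\<lambda>e. Ord (e 0) \<longrightarrow> Ord (col M (e 0)))" by (intro dfn)
  next
    case (step z)
    show ?case
    proof (rule impI, rule OrdI)
      assume z: "Ord z"
      show "Trans (col M z)" unfolding Trans_def
      proof (intro ballI subsetI)
        fix y u assume "y \<in> elts (col M z)" "u \<in> elts y"
        then obtain w where w: "w \<in> elts z" "w \<in> elts M" "u \<in> elts (col M w)"
          by (metis col_iff)
        then obtain x where "x \<in> elts w" "x \<in> elts M" "u = col M x" by (metis col_iff)
        then show "u \<in> elts (col M z)" using Ord_trans[OF z w(1)] by (metis col_iff)
      qed
      fix y assume "y \<in> elts (col M z)"
      then obtain w where "w \<in> elts z" "y = col M w" by (metis col_iff)
      then show "Ord y" using step[of w] Ord_elt[OF z] by blast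
    qed
  qed
  then show "Ord z \<Longrightarrow> Ord (col M z)" by blast
qed

lemma col_mem: "w \<in> elts z \<Longrightarrow> w \<in> elts M \<Longrightarrow> col M w \<in> elts (col M z)"
  by (metis col_iff)

lemma col_inj: "Ord w \<Longrightarrow> Ord z \<Longrightarrow> w \<in> elts M \<Longrightarrow> z \<in> elts M \<Longrightarrow> col M w = col M z \<Longrightarrow> w = z"
  using Ord_linear[of w z] col_mem not_mem_self by metis

lemma card_le_col: "card_le (col M z) M"
proof (rule card_le_surj[where F = "col M"])
  show "Dt (\<lambda>e. col M (e 0))" by (intro dfn)
qed (auto simp: elts_col)

lemma col_omega2: "card_le M omega1 \<Longrightarrow> Ord z \<Longrightarrow> col M z \<in> elts omega2"
  using card_le_col card_le_trans Ord_col by (simp add: elts_omega2) blast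

text \<open>The collapse does not move countable ordinals that form an initial part of
  \<open>M\<close>. At the end of the proof this makes \<open>omega1\<close> the value of any
  function that represents the ordinal \<open>omega1\<close>.\<close>

lemma col_omega1: assumes "elts omega1 \<subseteq> elts M" shows "col M omega1 = omega1"
proof -
  have "z \<in> elts (succ omega1) \<longrightarrow> col M z = z" for z
  proof (induction z rule: eps_induct)
    show "D (\<lambda>e. e 0 \<in> elts (succ omega1) \<longrightarrow> col M (e 0) = e 0)" by (intro dfn)
  next
    case (step z)
    show ?case
    proof
      assume z: "z \<in> elts (succ omega1)"
      then have s: "elts z \<subseteq> elts omega1" using Ord_omega1 by (auto simp: Ord_iff Trans_def)
      then have "elts (col M z) = elts z" unfolding elts_col using step assms by force
      then show "col M z = z" by (rule elts_eqI)
    qed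
  qed
  then show ?thesis by simp
qed

text \<open>Induction along \<open>z\<close>. Through this minimality of the collapse, the maps
  carried along in the game bound order types.\<close>

lemma col_least: assumes v: "\<And>x y. x \<in> elts M \<Longrightarrow> y \<in> elts M \<Longrightarrow> Ord y \<Longrightarrow> x \<in> elts y \<Longrightarrow> v x \<in> elts (v y)"
    and o: "\<And>x. x \<in> elts M \<Longrightarrow> Ord x \<Longrightarrow> Ord (v x)" and d: "Dt (\<lambda>e. v (e 0))"
  shows "z \<in> elts M \<Longrightarrow> Ord z \<Longrightarrow> elts (col M z) \<subseteq> elts (v z)"
proof -
  have "z \<in> elts M \<longrightarrow> Ord z \<longrightarrow> elts (col M z) \<subseteq> elts (v z)"
  proof (induction z rule: eps_induct)
    show "D (\<lambda>e. e 0 \<in> elts M \<longrightarrow> Ord (e 0) \<longrightarrow> elts (col M (e 0)) \<subseteq> elts (v (e 0)))" by (intro dfn Dt_compose1[OF d])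
  next
    case (step z)
    show ?case
    proof (intro impI subsetI)
      fix x assume z: "z \<in> elts M" "Ord z" "x \<in> elts (col M z)"
      then obtain w where w: "w \<in> elts z" "w \<in> elts M" "x = col M w" by (metis col_iff)
      have ow: "Ord w" using w z Ord_elt by blast
      have "elts (col M w) \<subseteq> elts (v w)" using step w ow by blast
      moreover have "v w \<in> elts (v z)" using v w z by blast
      ultimately have "col M w \<in> elts (v w) \<or> col M w = v w"
        using Ord_subset_iff[OF Ord_col[OF ow] o[OF w(2) ow]] by blast
      then show "x \<in> elts (v z)"
        using Ord_trans[OF o[OF z(1,2)] \<open>v w \<in> elts (v z)\<close>] \<open>v w \<in> elts (v z)\<close> w by auto
    qed
  qed
  then show "z \<in> elts M \<Longrightarrow> Ord z \<Longrightarrow> elts (col M z) \<subseteq> elts (v z)" by blast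
qed

subsection \<open>Collection and ranked games\<close>

text \<open>Scott's trick: for each \<open>x\<close>, the least level of the hierarchy with a
  witness is a single value, to which replacement applies.\<close>

lemma Collection: assumes R: "D (\<lambda>e. R (e 0) (e 1))" and ex: "\<And>x. x \<in> elts a \<Longrightarrow> \<exists>y. R x y"
  obtains b where "\<And>x. x \<in> elts a \<Longrightarrow> \<exists>y\<in>elts b. R x y"
proof -
  define Q where "Q x r \<longleftrightarrow> Ord r \<and> (\<exists>y\<in>elts (Vr r). R x y) \<and> (\<forall>s\<in>elts r. \<not> (\<exists>y\<in>elts (Vr s). R x y))" for x r
  have Q: "D (\<lambda>e. Q (e 0) (e 1))" unfolding Q_def by (intro dfn D_compose2[OF R])
  have uniq: "r = s" if "Q x r" "Q x s" for x r s
    using that Ord_linear[of r s] unfolding Q_def by blast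
  define F where "F x = (if \<exists>r. Q x r then THE r. Q x r else emp)" for x
  have F: "F x = r" if "Q x r" for x r
    unfolding F_def using that uniq by (auto intro!: the_equality)
  have dF: "Dt (\<lambda>e. F (e 0))"
  proof (rule DtI)
    show "y = F (e 0) \<longleftrightarrow> (if \<exists>r. Q (e 0) r then Q (e 0) y else y = emp)" for y and e :: "nat \<Rightarrow> 'v"
    proof (cases "\<exists>r. Q (e 0) r")
      case True
      then obtain r where r: "Q (e 0) r" by blast
      then have "y = r \<longleftrightarrow> Q (e 0) y" using uniq by blast
      then show ?thesis using F[OF r] True by simp
    qed (simp add: F_def)
  qed (intro dfn D_compose2[OF Q])
  have d: "Dt (\<lambda>e. Vr (F (e 0)))" by (intro dfn dF)
  show thesis
  proof (rule that[of "Union (img a (\<lambda>x. Vr (F x)))"])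
    fix x assume x: "x \<in> elts a"
    then obtain y where y: "R x y" using ex by blast
    have "y \<in> elts (Vr (succ (rk y)))" by (rule Vr_mem[OF _ sub_Vr_rk]) simp
    then have "\<exists>y\<in>elts (Vr (succ (rk y))). R x y" using y by blast
    moreover have "D (\<lambda>e. \<exists>y\<in>elts (Vr (e 0)). R x y)" by (intro dfn D_compose2[OF R])
    ultimately obtain r where "Ord r" "\<exists>y\<in>elts (Vr r). R x y" "\<And>s. s \<in> elts r \<Longrightarrow> \<not> (\<exists>y\<in>elts (Vr s). R x y)"
      using Ord_least[of "\<lambda>r. \<exists>y\<in>elts (Vr r). R x y" "succ (rk y)"] Ord_succ[OF Ord_rk] by blast
    then have "Q x r" by (simp add: Q_def)
    then have "\<exists>y\<in>elts (Vr (F x)). R x y" using F by (simp add: Q_def)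
    then show "\<exists>y\<in>elts (Union (img a (\<lambda>x. Vr (F x)))). R x y" using x by (auto simp: elts_img[OF d])
  qed
qed

lemma AC_class: assumes R: "D (\<lambda>e. R (e 0) (e 1))" and ex: "\<And>x. x \<in> elts a \<Longrightarrow> \<exists>y. R x y"
  obtains f where "func f a" "\<And>x. x \<in> elts a \<Longrightarrow> R x (ap f x)"
proof -
  obtain b where b: "\<And>x. x \<in> elts a \<Longrightarrow> \<exists>y\<in>elts b. R x y" using Collection[OF R ex] by blast
  obtain f where "func f a" "\<And>x. x \<in> elts a \<Longrightarrow> ap f x \<in> elts b \<and> R x (ap f x)" by (rule AC[OF R b]) blast+
  then show thesis using that by blast
qed

text \<open>
  If no nonempty part of \<open>P\<close> allows the second player to move forever, then \<open>P\<close> is ranked,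
  so that the moves prescribed by \<open>s\<close> force the rank to decrease.
\<close>

lemma ranking: assumes N: "D (\<lambda>e. N (e 0) (e 1) (e 2))"
    and no: "\<And>W. elts W \<subseteq> elts P \<Longrightarrow> elts W \<noteq> {} \<Longrightarrow> \<exists>p\<in>elts W. \<exists>b\<in>elts K. \<forall>q\<in>elts W. \<not> N b p q"
  obtains s r where "\<And>p. p \<in> elts P \<Longrightarrow> ap s p \<in> elts K"
    "\<And>p q. p \<in> elts P \<Longrightarrow> q \<in> elts P \<Longrightarrow> N (ap s p) p q \<Longrightarrow> ap r q \<in> elts (ap r p)"
proof -
  \<comment> \<open>\<open>R W p\<close> says that some move at \<open>p\<close> has no answer
    within \<open>W\<close>. Such positions are peeled off one at a time, and the place in this
    enumeration is the rank.\<close>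
  define R where "R W p \<longleftrightarrow> (\<exists>b\<in>elts K. \<forall>q\<in>elts W. \<not> N b p q)" for W p
  have R: "D (\<lambda>e. R (e 0) (e 1))" unfolding R_def by (intro dfn D_compose3[OF N])
  have exR: "\<And>W. elts W \<subseteq> elts P \<Longrightarrow> elts W \<noteq> {} \<Longrightarrow> \<exists>u\<in>elts W. R W u" using no unfolding R_def .
  obtain t e where t: "Ord t" "Dt (\<lambda>x. e (x 0))" "e ` elts t = elts P" "inj_on e (elts t)"
      "\<And>i. i \<in> elts t \<Longrightarrow> R (dif P (img i e)) (e i)"
    by (rule Zermelo[where R = R and P = P, OF R exR]) blast+
  have d1: "D (\<lambda>x. e (x 1) = x 0)" by (intro dfn Dt_compose1[OF t(2)])
  have ex1: "\<exists>i\<in>elts t. e i = p" if "p \<in> elts P" for p using t(3) that by (metis imageE)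
  obtain r where r: "\<And>p. p \<in> elts P \<Longrightarrow> ap r p \<in> elts t \<and> e (ap r p) = p" by (rule AC[OF d1 ex1]) blast+
  have d2: "D (\<lambda>x. \<forall>q\<in>elts (dif P (img (ap r (x 0)) e)). \<not> N (x 1) (x 0) q)"
    by (intro dfn D_compose3[OF N] Dt_compose1[OF t(2)])
  have ex2: "\<exists>b\<in>elts K. \<forall>q\<in>elts (dif P (img (ap r p) e)). \<not> N b p q" if "p \<in> elts P" for p
    using t(5)[of "ap r p"] r[OF that] unfolding R_def by simp
  obtain s where s: "\<And>p. p \<in> elts P \<Longrightarrow> ap s p \<in> elts K \<and> (\<forall>q\<in>elts (dif P (img (ap r p) e)). \<not> N (ap s p) p q)"
    by (rule AC[OF d2 ex2]) blast+
  show thesis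
  proof (rule that)
    show "ap s p \<in> elts K" if "p \<in> elts P" for p using s[OF that] by blast
    fix p q assume pq: "p \<in> elts P" "q \<in> elts P" "N (ap s p) p q"
    \<comment> \<open>An answer to the prescribed move is not among the positions that remained when
      \<open>p\<close> was taken, so it was removed earlier and has smaller rank.\<close>
    then have "q \<in> e ` elts (ap r p)" using s[OF pq(1)] by (auto simp: elts_img[OF t(2)])
    then obtain j where j: "j \<in> elts (ap r p)" "q = e j" by blast
    have "j \<in> elts t" using j r[OF pq(1)] Ord_trans[OF t(1)] by blast
    then have "ap r q = j" using t(4) r[OF pq(2)] j by (auto simp: inj_on_def)
    then show "ap r q \<in> elts (ap r p)" using j by simp
  qed
qed

end

section \<open>An inaccessible cardinal\<close>

locale zfc_inaccessible = zfc E for E :: "'v \<Rightarrow> 'v \<Rightarrow> bool" +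
  fixes \<delta> :: 'v
  assumes inaccessible_\<delta>: "inaccessible \<delta>"
begin

lemma regular_\<delta>: "regular \<delta>" and om_\<delta>: "om \<in> elts \<delta>"
    and strong_\<delta>: "a \<in> elts \<delta> \<Longrightarrow> card_less (Pow a) \<delta>"
  using inaccessible_\<delta> by (auto simp: inaccessible_def omega_om)

lemma Ord_\<delta>: "Ord \<delta>" by (rule regular_Ord[OF regular_\<delta>])

section \<open>Sets of size below \<delta>, and the level V_\<delta>\<close>

definition lt :: "'v \<Rightarrow> bool" where "lt x \<longleftrightarrow> (\<exists>b\<in>elts \<delta>. card_le x b)"

lemma ltI: "b \<in> elts \<delta> \<Longrightarrow> card_le x b \<Longrightarrow> lt x" unfolding lt_def by blast

lemma lt_le: "lt y \<Longrightarrow> card_le x y \<Longrightarrow> lt x" unfolding lt_def using card_le_trans by blast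

lemma lt_subset: "lt y \<Longrightarrow> elts x \<subseteq> elts y \<Longrightarrow> lt x" using lt_le card_le_subset by blast

lemma D_lt [THEN D_compose1, dfn]: "D (\<lambda>e. lt (e 0))" unfolding lt_def by (intro dfn)

lemma lt_elt: "b \<in> elts \<delta> \<Longrightarrow> lt b" by (rule ltI) auto

lemma lt_Pow: assumes "lt x" shows "lt (Pow x)"
proof -
  obtain b where b: "b \<in> elts \<delta>" "card_le x b" using assms unfolding lt_def by blast
  obtain t where t: "Ord t" "card_le (Pow b) t" "card_le t (Pow b)" by (rule card_le_Ord)
  have "t \<in> elts \<delta>"
    using Ord_card_le[OF t(1) Ord_\<delta>] strong_\<delta>[OF b(1)] t(3) card_le_trans unfolding card_less_def by blast
  then show ?thesis using t(2) card_le_Pow[OF b(2)] card_le_trans ltI by blast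
qed

lemma \<delta>_infinite_above: assumes "b \<in> elts \<delta>" "c \<in> elts \<delta>"
  obtains d where "d \<in> elts \<delta>" "card_le b d" "card_le c d" "infsq d" "Ord d"
proof -
  have o: "Ord b" "Ord c" using assms Ord_elt[OF Ord_\<delta>] by auto
  have two: "\<exists>d\<in>elts \<delta>. card_le b d \<and> card_le c d" if "b \<in> elts \<delta>" "c \<in> elts \<delta>" for b c
    using that Ord_linear[of b c] Ord_elt[OF Ord_\<delta>] Ord_mem_card_le card_le_refl by metis
  obtain d1 where d1: "d1 \<in> elts \<delta>" "card_le b d1" "card_le c d1" using two assms by blast
  obtain d where d: "d \<in> elts \<delta>" "card_le d1 d" "card_le om d" using two d1 om_\<delta> by blast
  moreover have "Ord d" using d Ord_elt[OF Ord_\<delta>] by auto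
  ultimately show thesis using that infsq_Ord d1 card_le_trans by blast
qed

text \<open>Regularity bounds the sizes of all members of the family by one ordinal below
  \<delta>.\<close>

lemma lt_UN: assumes I: "lt I" and F: "Dt (\<lambda>e. F (e 0))" and lF: "\<And>i. i \<in> elts I \<Longrightarrow> lt (F i)"
  shows "lt (Union (img I F))"
proof -
  obtain c where c: "c \<in> elts \<delta>" "card_le I c" using I unfolding lt_def by blast
  have R: "D (\<lambda>e. card_le (F (e 0)) (e 1))" by (intro dfn Dt_compose1[OF F])
  obtain f where f: "\<And>i. i \<in> elts I \<Longrightarrow> ap f i \<in> elts \<delta> \<and> card_le (F i) (ap f i)"
    using AC[OF R, of I \<delta>] lF unfolding lt_def by blast
  have d: "Dt (\<lambda>e. ap f (e 0))" by (intro dfn)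
  obtain b where b: "b \<in> elts \<delta>" "\<forall>i\<in>elts I. ap f i \<in> elts b"
    using regular_bound[OF regular_\<delta> c(2,1) d] f by blast
  obtain m where m: "m \<in> elts \<delta>" "card_le b m" "card_le c m" "infsq m" by (rule \<delta>_infinite_above[OF b(1) c(1)])
  have "card_le (Union (img I F)) m"
  proof (rule card_le_UN[OF m(4) _ F])
    show "card_le I m" using c m card_le_trans by blast
    fix i assume i: "i \<in> elts I"
    have "card_le (ap f i) b" using b i Ord_mem_card_le Ord_elt[OF Ord_\<delta>] by blast
    then show "card_le (F i) m" using f[OF i] m card_le_trans by meson
  qed
  then show ?thesis using m ltI by blast
qed

lemma lt_cart: assumes "lt x" "lt y" shows "lt (cart x y)"
proof -
  obtain b c where bc: "b \<in> elts \<delta>" "card_le x b" "c \<in> elts \<delta>" "card_le y c" using assms unfolding lt_def by blast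
  obtain m where m: "m \<in> elts \<delta>" "card_le b m" "card_le c m" "infsq m" by (rule \<delta>_infinite_above[OF bc(1,3)])
  have "card_le x m" "card_le y m" using bc m card_le_trans by blast+
  then show ?thesis using card_le_cart[of x m y m] m card_le_trans ltI unfolding infsq_def by blast
qed

lemma \<delta>_not_lt: "\<not> lt \<delta>" unfolding lt_def using regular_not_le[OF regular_\<delta>] by blast

lemma Ord_lt: "Ord a \<Longrightarrow> lt a \<Longrightarrow> a \<in> elts \<delta>"
  using Ord_card_le[OF _ Ord_\<delta>] \<delta>_not_lt lt_le by blast

lemma hartogs_\<delta>: assumes "r \<in> elts \<delta>" shows "hartogs r \<in> elts \<delta>"
proof -
  obtain b where b: "b \<in> elts \<delta>" "card_le (Pow r) b" using lt_Pow[OF lt_elt[OF assms]] lt_def by auto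
  have ob: "Ord b" using b Ord_elt[OF Ord_\<delta>] by blast
  have "a \<in> elts b" if "Ord a" "card_le a r" for a
    using that Ord_card_le[OF that(1) ob] b Cantor card_le_trans by blast
  then have "elts (hartogs r) \<subseteq> elts b" by (auto simp: hartogs(1))
  then show ?thesis using Ord_lt[OF hartogs(2)] lt_subset[OF lt_elt[OF b(1)]] by blast
qed

lemma omega1_\<delta>: "omega1 \<in> elts \<delta>" by (simp add: omega1_eq hartogs_\<delta> om_\<delta>)
lemma omega2_\<delta>: "omega2 \<in> elts \<delta>" by (simp add: omega2_def hartogs_\<delta> omega1_\<delta>)

lemma lt_om [simp]: "lt om" and lt_omega1 [simp]: "lt omega1" and lt_omega2 [simp]: "lt omega2"
  by (simp_all add: lt_elt om_\<delta> omega1_\<delta> omega2_\<delta>)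

definition Vd :: 'v where "Vd = Vr \<delta>"

lemma Vlevel_\<delta>: "Vlevel \<delta> = Vd" by (simp add: Vd_def Vlevel_Vr Ord_\<delta>)

lemma Vd_iff: "x \<in> elts Vd \<longleftrightarrow> (\<exists>c\<in>elts \<delta>. elts x \<subseteq> elts (Vr c))"
  unfolding Vd_def elts_Vr[of \<delta>] by blast

lemma Trans_Vd: "Trans Vd" unfolding Vd_def by (rule Trans_Vr)

lemma Vd_trans: "x \<in> elts Vd \<Longrightarrow> y \<in> elts x \<Longrightarrow> y \<in> elts Vd"
  using Trans_Vd unfolding Trans_def by blast

lemma Vd_subset: "x \<in> elts Vd \<Longrightarrow> elts y \<subseteq> elts x \<Longrightarrow> y \<in> elts Vd"
  unfolding Vd_iff by blast

lemma \<delta>_sub_Vd: "elts \<delta> \<subseteq> elts Vd" unfolding Vd_def by (rule Ord_sub_Vr[OF Ord_\<delta>])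

lemma lt_Vr: "c \<in> elts \<delta> \<Longrightarrow> lt (Vr c)"
proof -
  have "c \<in> elts \<delta> \<longrightarrow> lt (Vr c)"
  proof (induction c rule: eps_induct)
    show "D (\<lambda>e. e 0 \<in> elts \<delta> \<longrightarrow> lt (Vr (e 0)))" by (intro dfn)
  next
    case (step c)
    show ?case
    proof
      assume c: "c \<in> elts \<delta>"
      have d: "Dt (\<lambda>e. Pow (Vr (e 0)))" by (intro dfn)
      have "lt (Union (img c (\<lambda>b. Pow (Vr b))))"
        by (rule lt_UN[OF lt_elt[OF c] d]) (use step Ord_trans[OF Ord_\<delta> c] lt_Pow in blast)
      moreover have "Union (img c (\<lambda>b. Pow (Vr b))) = Vr c"
        by (rule elts_eqI) (auto simp: elts_img[OF d] elts_Vr[of c])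
      ultimately show "lt (Vr c)" by simp
    qed
  qed
  then show "c \<in> elts \<delta> \<Longrightarrow> lt (Vr c)" by blast
qed

lemma Vd_lt: "x \<in> elts Vd \<Longrightarrow> lt x"
  unfolding Vd_iff using lt_Vr lt_subset by blast

text \<open>Regularity bounds the levels at which fewer than \<delta> many elements appear. In this
  way sets of size omega_1 and functions serving as parameters are seen to lie in
  V_\<delta>.\<close>

lemma VdI: assumes "elts X \<subseteq> elts Vd" "lt X" shows "X \<in> elts Vd"
proof -
  obtain c where c: "c \<in> elts \<delta>" "card_le X c" using assms(2) unfolding lt_def by blast
  have R: "D (\<lambda>e. elts (e 0) \<subseteq> elts (Vr (e 1)))" by (intro dfn)
  have ex: "\<exists>c\<in>elts \<delta>. elts x \<subseteq> elts (Vr c)" if "x \<in> elts X" for x using assms(1) that Vd_iff by blast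
  obtain f where f: "\<And>i. i \<in> elts X \<Longrightarrow> ap f i \<in> elts \<delta> \<and> elts i \<subseteq> elts (Vr (ap f i))"
    by (rule AC[OF R ex]) blast+
  have d: "Dt (\<lambda>e. ap f (e 0))" by (intro dfn)
  obtain b where b: "b \<in> elts \<delta>" "\<forall>i\<in>elts X. ap f i \<in> elts b"
    using regular_bound[OF regular_\<delta> c(2,1) d] f by blast
  have "elts X \<subseteq> elts (Vr b)" using b(2) f Vr_mem by blast
  then show ?thesis using b Vd_iff by blast
qed

lemma Vd_pair: assumes "x \<in> elts Vd" "y \<in> elts Vd" shows "vset {x, y} \<in> elts Vd"
proof (rule VdI)
  have "card_le (vset {x, y}) om"
  proof (rule card_leI[where F = "\<lambda>z. if z = x then emp else succ emp"])
    show "Dt (\<lambda>e. if e 0 = x then emp else succ emp)" by (intro dfn)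
  qed (auto split: if_splits)
  then show "lt (vset {x, y})" by (rule lt_le[OF lt_om])
qed (use assms in auto)

lemma Vd_opair: assumes "x \<in> elts Vd" "y \<in> elts Vd" shows "opair x y \<in> elts Vd"
proof -
  have "vset {x} = vset {x, x}" by simp
  then show ?thesis unfolding opair_def using Vd_pair assms by metis
qed

lemma Vd_emp: "emp \<in> elts Vd" using Vd_subset[of omega1 emp] \<delta>_sub_Vd omega1_\<delta> by auto

lemma Vd_Pow: assumes "x \<in> elts Vd" shows "Pow x \<in> elts Vd"
  by (rule VdI) (use assms Vd_subset Vd_lt lt_Pow in auto)

text \<open>Turns a family indexed by a set in V_\<delta> into a single element of V_\<delta>; each
  diagonal argument about good sets takes such a function as its parameter.\<close>

lemma Vd_Lam: assumes F: "Dt (\<lambda>e. F (e 0))" and x: "x \<in> elts Vd" "\<And>z. z \<in> elts x \<Longrightarrow> F z \<in> elts Vd"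
  shows "Lam x F \<in> elts Vd"
proof (rule VdI)
  show "elts (Lam x F) \<subseteq> elts Vd" using x Vd_trans Vd_opair by (auto simp: elts_Lam[OF F])
  have d: "Dt (\<lambda>e. opair (e 0) (F (e 0)))" by (intro dfn F)
  show "lt (Lam x F)" unfolding Lam_def by (rule lt_le[OF Vd_lt[OF x(1)] card_le_image[OF d]])
qed

lemma Vd_ap: assumes "f \<in> elts Vd" shows "ap f x \<in> elts Vd"
proof (cases "\<exists>!y. opair x y \<in> elts f")
  case True
  have "opair x (ap f x) \<in> elts f" unfolding ap_def using theI'[OF True] True by simp
  then have "opair x (ap f x) \<in> elts Vd" using Vd_trans[OF assms] by blast
  moreover have "vset {x, ap f x} \<in> elts (opair x (ap f x))" by (simp add: opair_def)
  ultimately have "vset {x, ap f x} \<in> elts Vd" using Vd_trans by blast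
  then show ?thesis using Vd_trans[of "vset {x, ap f x}" "ap f x"] by simp
qed (use Vd_emp in \<open>simp add: ap_def\<close>)

section \<open>The indices of the tower\<close>

lemma D_tower_index [THEN D_compose1, dfn]: "D (\<lambda>e. e 0 \<in> tower_index \<delta>)"
  unfolding tower_index_def mem_Collect_eq by (intro dfn)

lemma tower_indexD: assumes "l \<in> tower_index \<delta>"
  shows "l \<in> elts \<delta>" "regular l" "Ord l" "elts omega2 \<subseteq> elts l" "omega1 \<in> elts l"
    "H l \<in> elts Vd" "elts (H l) \<subseteq> elts Vd" "elts l \<subseteq> elts (H l)"
proof -
  show a: "l \<in> elts \<delta>" "regular l" "elts omega2 \<subseteq> elts l" using assms by (auto simp: tower_index_def)
  then show "Ord l" "omega1 \<in> elts l" using regular_Ord omega1_omega2 by auto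
  then show "H l \<in> elts Vd" using H_sub_Vr[of l] a Vd_iff by blast
  then show "elts (H l) \<subseteq> elts Vd" using Vd_trans by blast
  show "elts l \<subseteq> elts (H l)" by (rule regular_sub_H[OF a(2)])
qed

lemma tower_index_above: assumes "c \<in> elts \<delta>" obtains l where "l \<in> tower_index \<delta>" "c \<in> elts l"
proof -
  obtain d where d: "d \<in> elts \<delta>" "card_le c d" "card_le omega2 d" "infsq d" "Ord d"
    by (rule \<delta>_infinite_above[OF assms omega2_\<delta>])
  have r: "regular (hartogs d)" using hartogs_regular d by (auto simp: infsq_def)
  have "omega2 \<in> elts (hartogs d)" "c \<in> elts (hartogs d)"
    using d assms Ord_elt[OF Ord_\<delta>] by (auto simp: hartogs(1))
  then have "hartogs d \<in> tower_index \<delta>" "c \<in> elts (hartogs d)"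
    using r hartogs_\<delta>[OF d(1)] Ord_trans[OF hartogs(2)] by (auto simp: tower_index_def)
  then show thesis using that by blast
qed

lemma small_tower_index: "small (tower_index \<delta>)"
  by (rule small_subset[of _ \<delta>]) (auto simp: tower_index_def, intro dfn)

subsection \<open>A partition into stationary sets\<close>

lemma rho_ex: "\<exists>r. r \<in> elts \<delta> \<and> Ord r \<and> infsq r \<and> card_le (Pow (cart omega1 omega2)) r"
proof -
  obtain b where b: "b \<in> elts \<delta>" "card_le (Pow (cart omega1 omega2)) b"
    using lt_Pow[OF lt_cart[OF lt_omega1 lt_omega2]] lt_def by blast
  obtain d where "d \<in> elts \<delta>" "card_le b d" "card_le om d" "infsq d" "Ord d"
    by (rule \<delta>_infinite_above[OF b(1) om_\<delta>])
  then show ?thesis using b card_le_trans by blast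
qed

text \<open>For \<open>M\<close> of size at most omega_1, the maps from
  \<open>M \<inter> \<delta>\<close> to omega_2 correspond to subsets of a product no larger than
  \<open>cart omega1 omega2\<close>. \<open>rho\<close> bounds their number, and
  \<open>kappa\<close> is its successor cardinal.\<close>

definition rho :: 'v where
  "rho = (SOME r. r \<in> elts \<delta> \<and> Ord r \<and> infsq r \<and> card_le (Pow (cart omega1 omega2)) r)"

definition kappa :: 'v where "kappa = hartogs rho"

lemma rho: "rho \<in> elts \<delta>" "Ord rho" "infsq rho" "card_le om rho" "card_le (Pow (cart omega1 omega2)) rho"
proof -
  have "rho \<in> elts \<delta> \<and> Ord rho \<and> infsq rho \<and> card_le (Pow (cart omega1 omega2)) rho"
    unfolding rho_def by (rule someI_ex[OF rho_ex])
  then show "rho \<in> elts \<delta>" "Ord rho" "infsq rho" "card_le om rho" "card_le (Pow (cart omega1 omega2)) rho"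
    by (auto simp: infsq_def)
qed

lemma omega2_rho: "card_le omega2 rho"
proof -
  have "card_le omega2 (Pow (cart omega1 omega2))"
  proof (rule card_leI[where F = "\<lambda>x. sing (opair emp x)"])
    show "sing (opair emp a) \<in> elts (Pow (cart omega1 omega2))" if "a \<in> elts omega2" for a
      using that om_sub_omega1 om_0 by auto
    show "a = b" if "sing (opair emp a) = sing (opair emp b)" for a b
      using that by (metis elts_sing opair_inject singleton_inject)
  qed (intro dfn)
  then show ?thesis using rho(5) card_le_trans by blast
qed

lemma omega1_rho: "card_le omega1 rho"
  using omega2_rho Ord_mem_card_le[OF Ord_omega2 omega1_omega2] card_le_trans by blast

lemma kappa: "kappa \<in> elts \<delta>" "Ord kappa" "Limit kappa" "elts kappa = {a. Ord a \<and> card_le a rho}"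
    "\<not> card_le kappa rho" "elts kappa \<subseteq> elts \<delta>"
proof -
  show "kappa \<in> elts \<delta>" unfolding kappa_def by (rule hartogs_\<delta>[OF rho(1)])
  then show "elts kappa \<subseteq> elts \<delta>" using Ord_trans[OF Ord_\<delta>] by blast
qed (use rho hartogs hartogs_Limit in \<open>auto simp: kappa_def\<close>)

lemma kappa_Union: "card_le X rho \<Longrightarrow> elts X \<subseteq> elts kappa \<Longrightarrow> Union X \<in> elts kappa"
  unfolding kappa_def by (rule hartogs_Union[OF rho(2,4)])

text \<open>An algebra on \<open>U\<close> with a set-valued binary operation; its closed subsets
  play the role of a club. The universe may extend \<open>kappa\<close>, so that game positions and
  ordinals can be closed off together.\<close>

definition stat_data :: "'v \<Rightarrow> 'v \<Rightarrow> 'v \<Rightarrow> bool" where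
  "stat_data U G X \<longleftrightarrow> elts kappa \<subseteq> elts U \<and> elts X \<subseteq> elts U \<and> card_le X rho \<and>
    (\<forall>x\<in>elts U. \<forall>y\<in>elts U. elts (ap G (opair x y)) \<subseteq> elts U \<and> card_le (ap G (opair x y)) rho)"

text \<open>The sequence \<open>b\<close> witnesses that \<open>g\<close> has countable cofinality.
  In \<open>Good_ex\<close> its terms are the demands made in the game.\<close>

definition stat_hit :: "'v \<Rightarrow> 'v \<Rightarrow> 'v \<Rightarrow> 'v \<Rightarrow> bool" where
  "stat_hit U G X g \<longleftrightarrow> g \<in> elts kappa \<and> (\<exists>Y b. elts X \<subseteq> elts Y \<and> elts Y \<subseteq> elts U \<and>
    (\<forall>x\<in>elts Y. \<forall>y\<in>elts Y. elts (ap G (opair x y)) \<subseteq> elts Y) \<and> int Y kappa = g \<and>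
    (\<forall>n\<in>elts om. ap b n \<in> elts g) \<and> (\<forall>z\<in>elts g. \<exists>n\<in>elts om. z \<in> elts (ap b n)))"

text \<open>A version of stationarity in \<open>kappa\<close>, concentrating on points of countable cofinality.\<close>

definition stat :: "'v \<Rightarrow> bool" where
  "stat T \<longleftrightarrow> (\<forall>U G X. stat_data U G X \<longrightarrow> (\<exists>g\<in>elts T. stat_hit U G X g))"

lemma D_stat_data [THEN D_compose3, dfn]: "D (\<lambda>e. stat_data (e 0) (e 1) (e 2))"
  unfolding stat_data_def by (intro dfn)

text \<open>The analogue of the fact that \<open>rho\<close> many clubs in \<open>kappa\<close> have
  unbounded intersection. The algebras are merged on the union of their universes, and a chain of
  length omega of closed sets of size at most \<open>rho\<close> yields one point for all of
  them.\<close>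

lemma stat_hit_common:
  assumes w: "\<And>i. i \<in> elts rho \<Longrightarrow> stat_data (pfst (ap w i)) (pfst (psnd (ap w i))) (psnd (psnd (ap w i)))"
    and al: "al \<in> elts kappa"
  shows "\<exists>g. al \<in> elts g \<and> g \<in> elts kappa \<and>
    (\<forall>i\<in>elts rho. stat_hit (pfst (ap w i)) (pfst (psnd (ap w i))) (psnd (psnd (ap w i))) g)"
proof -
  define Us where "Us i = pfst (ap w i)" for i
  define Gs where "Gs i = pfst (psnd (ap w i))" for i
  define Xs where "Xs i = psnd (psnd (ap w i))" for i
  have dUs [THEN Dt_compose1, dfn]: "Dt (\<lambda>e. Us (e 0))" unfolding Us_def by (intro dfn)
  have dGs [THEN Dt_compose1, dfn]: "Dt (\<lambda>e. Gs (e 0))" unfolding Gs_def by (intro dfn)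
  have dXs [THEN Dt_compose1, dfn]: "Dt (\<lambda>e. Xs (e 0))" unfolding Xs_def by (intro dfn)
  have dUs1: "Dt (\<lambda>e. Us (e 0))" "Dt (\<lambda>e. Xs (e 0))" by (intro dfn)+
  have stat_data: "stat_data (Us i) (Gs i) (Xs i)" if "i \<in> elts rho" for i
    using w[OF that] by (simp add: Us_def Gs_def Xs_def)
  define U where "U = Union (img rho Us)"
  define X where "X = un (Union (img rho Xs)) (sing al)"
  \<comment> \<open>The summand \<open>x\<close> for \<open>x\<close> in \<open>kappa\<close> makes
    the part of a closed set inside \<open>kappa\<close> transitive, hence an ordinal.\<close>
  define G where "G x y = un (Union (img rho (\<lambda>i. if x \<in> elts (Us i) \<and> y \<in> elts (Us i) then ap (Gs i) (opair x y) else emp)))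
    (if x \<in> elts kappa then x else emp)" for x y
  have dG: "Dt (\<lambda>e. G (e 0) (e 1))" unfolding G_def by (intro dfn)
  have U: "elts U = (\<Union>i\<in>elts rho. elts (Us i))" unfolding U_def by (simp add: elts_img[OF dUs1(1)])
  have di: "Dt (\<lambda>e. if x \<in> elts (Us (e 0)) \<and> y \<in> elts (Us (e 0)) then ap (Gs (e 0)) (opair x y) else emp)" for x y
    by (intro dfn)
  have G: "elts (G x y) = (\<Union>i\<in>{i\<in>elts rho. x \<in> elts (Us i) \<and> y \<in> elts (Us i)}. elts (ap (Gs i) (opair x y))) \<union>
    (if x \<in> elts kappa then elts x else {})" for x y
    unfolding G_def by (auto simp: elts_img[OF di])
  have emr: "emp \<in> elts rho" using om_subset[OF rho(2,4)] om_0 by blast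
  have kU: "elts kappa \<subseteq> elts U" using U emr stat_data[OF emr] unfolding stat_data_def by blast
  have ktr: "elts x \<subseteq> elts kappa" "card_le x rho" if "x \<in> elts kappa" for x
    using that kappa(2,4) Ord_trans by blast+
  have GU: "elts (G x y) \<subseteq> elts U \<and> card_le (G x y) rho" if xy: "x \<in> elts U" "y \<in> elts U" for x y
  proof
    show "elts (G x y) \<subseteq> elts U"
    proof
      fix z assume "z \<in> elts (G x y)"
      then consider i where "i \<in> elts rho" "x \<in> elts (Us i)" "y \<in> elts (Us i)" "z \<in> elts (ap (Gs i) (opair x y))"
        | "x \<in> elts kappa" "z \<in> elts x" unfolding G by (auto split: if_splits)
      then show "z \<in> elts U"
      proof cases
        case 1 then show ?thesis using stat_data[OF 1(1)] U unfolding stat_data_def by blast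
      next
        case 2 then show ?thesis using ktr kU by blast
      qed
    qed
    have e: "card_le emp rho" by (rule card_le_subset) simp
    have "card_le (Union (img rho (\<lambda>i. if x \<in> elts (Us i) \<and> y \<in> elts (Us i) then ap (Gs i) (opair x y) else emp))) rho"
    proof (rule card_le_UN[OF rho(3) card_le_refl di])
      fix i assume "i \<in> elts rho"
      then show "card_le (if x \<in> elts (Us i) \<and> y \<in> elts (Us i) then ap (Gs i) (opair x y) else emp) rho"
        using stat_data[of i] e unfolding stat_data_def by auto
    qed
    then show "card_le (G x y) rho" unfolding G_def by (rule card_le_un[OF rho(3)]) (use e ktr in auto)
  qed
  have X: "elts X \<subseteq> elts U" "card_le X rho"
  proof -
    show "elts X \<subseteq> elts U"
    proof
      fix z assume "z \<in> elts X"
      then consider i where "i \<in> elts rho" "z \<in> elts (Xs i)" | "z = al"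
        unfolding X_def by (auto simp: elts_img[OF dUs1(2)])
      then show "z \<in> elts U"
      proof cases
        case 1 then show ?thesis using stat_data[OF 1(1)] U unfolding stat_data_def by blast
      next
        case 2 then show ?thesis using al kU by blast
      qed
    qed
    have "card_le (Union (img rho Xs)) rho"
      by (rule card_le_UN[OF rho(3) card_le_refl dUs1(2)]) (use stat_data in \<open>auto simp: stat_data_def\<close>)
    then show "card_le X rho" unfolding X_def by (rule card_le_un[OF rho(3) _ card_le_sing[OF rho(3)]])
  qed
  define A where "A = sep (Pow U) (\<lambda>Y. card_le Y rho \<and> elts X \<subseteq> elts Y \<and>
    (\<forall>x\<in>elts Y. \<forall>y\<in>elts Y. elts (G x y) \<subseteq> elts Y))"
  have A: "Y \<in> elts A \<longleftrightarrow> elts Y \<subseteq> elts U \<and> card_le Y rho \<and> elts X \<subseteq> elts Y \<and>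
    (\<forall>x\<in>elts Y. \<forall>y\<in>elts Y. elts (G x y) \<subseteq> elts Y)" for Y
    unfolding A_def by (subst elts_sep) (intro dfn Dt_compose2[OF dG], auto)
  have seg: "int Y kappa \<in> elts kappa"
    if Y: "card_le Y rho" "\<And>x. x \<in> elts Y \<Longrightarrow> elts (G x x) \<subseteq> elts Y" for Y
  proof -
    have "Ord (int Y kappa)"
    proof (rule OrdI)
      show "Trans (int Y kappa)" unfolding Trans_def
      proof (intro ballI)
        fix x assume x: "x \<in> elts (int Y kappa)"
        then have "elts x \<subseteq> elts (G x x)" by (auto simp: G)
        then show "elts x \<subseteq> elts (int Y kappa)" using x Y(2)[of x] ktr(1)[of x] by auto
      qed
      show "Ord x" if "x \<in> elts (int Y kappa)" for x using that kappa(4) by auto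
    qed
    moreover have "card_le (int Y kappa) rho" using card_le_subset[of "int Y kappa" Y] Y card_le_trans by auto
    ultimately show ?thesis by (simp add: kappa(4))
  qed
  \<comment> \<open>Each set contains the ordinal cut out by its predecessor, so these ordinals
    increase strictly and supply the sequence \<open>b\<close> of a hit.\<close>
  define R where "R Y Y' \<longleftrightarrow> elts Y \<subseteq> elts Y' \<and> int Y kappa \<in> elts Y'" for Y Y'
  have dR: "D (\<lambda>e. R (e 0) (e 1))" unfolding R_def by (intro dfn)
  have exR: "\<exists>Y'\<in>elts A. R Y Y'" if Y: "Y \<in> elts A" for Y
  proof -
    have k: "int Y kappa \<in> elts kappa" by (rule seg) (use Y A in blast)+
    have s: "elts (un Y (sing (int Y kappa))) \<subseteq> elts U" using k kU Y A by auto
    have c: "card_le (un Y (sing (int Y kappa))) rho"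
      by (rule card_le_un[OF rho(3) _ card_le_sing[OF rho(3)]]) (use Y A in blast)
    obtain Y' where Y': "elts (un Y (sing (int Y kappa))) \<subseteq> elts Y'" "elts Y' \<subseteq> elts U" "card_le Y' rho"
      "\<And>x y. x \<in> elts Y' \<Longrightarrow> y \<in> elts Y' \<Longrightarrow> elts (G x y) \<subseteq> elts Y'"
      by (rule closure_ex[OF rho(3) dG GU s c]) blast+
    then have "Y' \<in> elts A" using Y unfolding A by auto
    then show ?thesis using Y'(1) by (auto simp: R_def)
  qed
  obtain Y0 where Y0: "elts X \<subseteq> elts Y0" "elts Y0 \<subseteq> elts U" "card_le Y0 rho"
      "\<And>x y. x \<in> elts Y0 \<Longrightarrow> y \<in> elts Y0 \<Longrightarrow> elts (G x y) \<subseteq> elts Y0"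
    by (rule closure_ex[OF rho(3) dG GU X]) blast+
  then have Y0A: "Y0 \<in> elts A" by (simp add: A)
  obtain F where F: "Dt (\<lambda>e. F (e 0))" "F emp = Y0"
    "\<And>n. n \<in> elts om \<Longrightarrow> F n \<in> elts A" "\<And>n. n \<in> elts om \<Longrightarrow> R (F n) (F (succ n))"
    by (rule DC[OF dR Y0A exR]) blast+
  define Y where "Y = Union (img om F)"
  have Y: "elts Y = (\<Union>n\<in>elts om. elts (F n))" unfolding Y_def by (simp add: elts_img[OF F(1)])
  have mono: "elts (F n) \<subseteq> elts (F (succ n))" if "n \<in> elts om" for n using F(4)[OF that] by (simp add: R_def)
  have XY: "elts X \<subseteq> elts Y" using Y F(2) om_0 Y0(1) by blast
  have YU: "elts Y \<subseteq> elts U" using Y F(3) A by blast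
  have Yr: "card_le Y rho" unfolding Y_def by (rule card_le_UN[OF rho(3,4) F(1)]) (use F(3) A in blast)
  have cl: "elts (G x y) \<subseteq> elts Y" if "x \<in> elts Y" "y \<in> elts Y" for x y
  proof -
    obtain n m where nm: "n \<in> elts om" "x \<in> elts (F n)" "m \<in> elts om" "y \<in> elts (F m)"
      using \<open>x \<in> elts Y\<close> \<open>y \<in> elts Y\<close> Y by auto
    then obtain k where k: "k \<in> elts om" "x \<in> elts (F k)" "y \<in> elts (F k)"
      using om_chain[OF F(1) mono nm(1,3)] by blast
    then have "elts (G x y) \<subseteq> elts (F k)" using F(3)[OF k(1)] A by blast
    then show ?thesis using Y k(1) by blast
  qed
  define g where "g = int Y kappa"
  have g: "g \<in> elts kappa" unfolding g_def by (rule seg[OF Yr cl])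
  define b where "b = Lam om (\<lambda>n. int (F n) kappa)"
  have db: "Dt (\<lambda>e. int (F (e 0)) kappa)" by (intro dfn F(1))
  have b: "ap b n = int (F n) kappa" if "n \<in> elts om" for n unfolding b_def by (rule ap_Lam[OF db that])
  have "stat_hit (Us i) (Gs i) (Xs i) g" if i: "i \<in> elts rho" for i
    unfolding stat_hit_def
  proof (rule conjI[OF g], rule exI[of _ "int Y (Us i)"], rule exI[of _ b], intro conjI ballI)
    have di: "stat_data (Us i) (Gs i) (Xs i)" by (rule stat_data[OF i])
    show "elts (Xs i) \<subseteq> elts (int Y (Us i))"
      using XY di i unfolding stat_data_def X_def by (auto simp: elts_img[OF dUs1(2)])
    show "elts (ap (Gs i) (opair x y)) \<subseteq> elts (int Y (Us i))"
      if "x \<in> elts (int Y (Us i))" "y \<in> elts (int Y (Us i))" for x y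
    proof -
      have "elts (ap (Gs i) (opair x y)) \<subseteq> elts (G x y)" using that i by (auto simp: G)
      then show ?thesis using cl[of x y] that di unfolding stat_data_def by auto
    qed
    show "int (int Y (Us i)) kappa = g"
      unfolding g_def by (rule elts_eqI) (use di in \<open>auto simp: stat_data_def\<close>)
    show "ap b n \<in> elts g" if "n \<in> elts om" for n
    proof -
      have "ap b n \<in> elts kappa" unfolding b[OF that] by (rule seg) (use F(3)[OF that] A in blast)+
      moreover have "ap b n \<in> elts (F (succ n))" using F(4)[OF that] b[OF that] by (simp add: R_def)
      ultimately show ?thesis unfolding g_def using Y om_succ[OF that] by auto
    qed
    show "\<exists>n\<in>elts om. z \<in> elts (ap b n)" if "z \<in> elts g" for z
    proof -
      obtain n where "n \<in> elts om" "z \<in> elts (F n)" "z \<in> elts kappa" using \<open>z \<in> elts g\<close> Y by (auto simp: g_def)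
      then show ?thesis using b by (intro bexI[of _ n]) auto
    qed
  qed auto
  moreover have "al \<in> elts g" unfolding g_def using al XY by (auto simp: X_def)
  ultimately show ?thesis using g unfolding Us_def Gs_def Xs_def by blast
qed

lemma Ulam: "\<exists>f. func f kappa \<and> (\<forall>g\<in>elts kappa. ap f g \<in> elts omega2) \<and>
  (\<forall>z\<in>elts omega2. stat (sep kappa (\<lambda>g. ap f g = z)))"
proof -
  have d: "D (\<lambda>e. (\<forall>a\<in>elts (e 0). ap (e 1) a \<in> elts rho) \<and>
      (\<forall>a\<in>elts (e 0). \<forall>b\<in>elts (e 0). ap (e 1) a = ap (e 1) b \<longrightarrow> a = b))" by (intro dfn)
  have ex: "\<exists>f. (\<forall>a\<in>elts g. ap f a \<in> elts rho) \<and> (\<forall>a\<in>elts g. \<forall>b\<in>elts g. ap f a = ap f b \<longrightarrow> a = b)"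
    if "g \<in> elts kappa" for g
    using that kappa(4) card_le_iff[of g rho] by blast
  obtain Fm where Fm: "\<And>g. g \<in> elts kappa \<Longrightarrow> (\<forall>a\<in>elts g. ap (ap Fm g) a \<in> elts rho) \<and>
      (\<forall>a\<in>elts g. \<forall>b\<in>elts g. ap (ap Fm g) a = ap (ap Fm g) b \<longrightarrow> a = b)"
    by (rule AC_class[OF d ex]) blast+
  \<comment> \<open>The Ulam matrix. For fixed \<open>i\<close> the sets \<open>T a i\<close> are
    disjoint because the map chosen for \<open>g\<close> is injective; for fixed \<open>a\<close>
    they cover all \<open>g\<close> above \<open>a\<close>.\<close>
  define T where "T a i = sep kappa (\<lambda>g. a \<in> elts g \<and> ap (ap Fm g) a = i)" for a i
  have T: "g \<in> elts (T a i) \<longleftrightarrow> g \<in> elts kappa \<and> a \<in> elts g \<and> ap (ap Fm g) a = i" for g a i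
    unfolding T_def by (subst elts_sep) (intro dfn, auto)
  have dT: "Dt (\<lambda>e. T (e 0) (e 1))" unfolding T_def by (intro dfn)
  have dstat [THEN D_compose1, dfn]: "D (\<lambda>e. stat (e 0))"
    unfolding stat_def stat_hit_def by (intro dfn)
  have one: "\<exists>i\<in>elts rho. stat (T a i)" if a: "a \<in> elts kappa" for a
  proof (rule ccontr)
    assume n: "\<not> (\<exists>i\<in>elts rho. stat (T a i))"
    have d: "D (\<lambda>e. stat_data (pfst (e 1)) (pfst (psnd (e 1))) (psnd (psnd (e 1))) \<and>
        \<not> (\<exists>g\<in>elts (T a (e 0)). stat_hit (pfst (e 1)) (pfst (psnd (e 1))) (psnd (psnd (e 1))) g))"
      unfolding stat_hit_def by (intro dfn Dt_compose2[OF dT])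
    have ex: "\<exists>w. stat_data (pfst w) (pfst (psnd w)) (psnd (psnd w)) \<and>
        \<not> (\<exists>g\<in>elts (T a i). stat_hit (pfst w) (pfst (psnd w)) (psnd (psnd w)) g)" if i: "i \<in> elts rho" for i
    proof -
      obtain U G X where "stat_data U G X" "\<not> (\<exists>g\<in>elts (T a i). stat_hit U G X g)" using n i unfolding stat_def by blast
      then show ?thesis by (intro exI[of _ "opair U (opair G X)"]) simp
    qed
    obtain w where w: "\<And>i. i \<in> elts rho \<Longrightarrow> stat_data (pfst (ap w i)) (pfst (psnd (ap w i))) (psnd (psnd (ap w i))) \<and>
        \<not> (\<exists>g\<in>elts (T a i). stat_hit (pfst (ap w i)) (pfst (psnd (ap w i))) (psnd (psnd (ap w i))) g)"
      by (rule AC_class[OF d ex]) blast+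
    \<comment> \<open>A point above \<open>a\<close> that hits all \<open>rho\<close> many
      counterexamples at once lies in some \<open>T a i\<close>, whose own counterexample it
      refutes.\<close>
    obtain g where g: "a \<in> elts g" "g \<in> elts kappa"
      "\<And>i. i \<in> elts rho \<Longrightarrow> stat_hit (pfst (ap w i)) (pfst (psnd (ap w i))) (psnd (psnd (ap w i))) g"
      using stat_hit_common[of w a] w a by blast
    have i: "ap (ap Fm g) a \<in> elts rho" using Fm g by blast
    have "g \<in> elts (T a (ap (ap Fm g) a))" using g by (simp add: T)
    then show False using w[OF i] g(3)[OF i] by blast
  qed
  define A where "A i = sep kappa (\<lambda>a. stat (T a i))" for i
  have A: "elts (A i) = {a \<in> elts kappa. stat (T a i)}" for i
    unfolding A_def by (rule elts_sep) (intro dfn Dt_compose2[OF dT])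
  have dA: "Dt (\<lambda>e. A (e 0))" unfolding A_def by (intro dfn Dt_compose2[OF dT])
  \<comment> \<open>Since \<open>kappa\<close> is not a union of \<open>rho\<close> many sets of
    size at most \<open>rho\<close>, one index \<open>i\<close> serves more than \<open>rho\<close>
    many \<open>a\<close>. Of these, omega_2 many are kept.\<close>
  obtain i where i: "i \<in> elts rho" "\<not> card_le (A i) rho"
  proof -
    have "\<exists>i\<in>elts rho. \<not> card_le (A i) rho"
    proof (rule ccontr)
      assume "\<not> ?thesis"
      then have "card_le (Union (img rho A)) rho" by (intro card_le_UN[OF rho(3) card_le_refl dA]) auto
      moreover have "elts kappa \<subseteq> elts (Union (img rho A))" using one by (auto simp: elts_img[OF dA] A)
      ultimately show False using kappa(5) card_le_subset card_le_trans by blast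
    qed
    then show thesis using that by blast
  qed
  have "card_le omega2 (A i)" using card_le_total[of omega2 "A i"] omega2_rho i(2) card_le_trans by blast
  then obtain j where j: "Dt (\<lambda>e. j (e 0))" "\<And>z. z \<in> elts omega2 \<Longrightarrow> j z \<in> elts (A i)"
    "\<And>y z. y \<in> elts omega2 \<Longrightarrow> z \<in> elts omega2 \<Longrightarrow> j y = j z \<Longrightarrow> y = z" by (rule card_leE) blast
  have dE: "D (\<lambda>e. \<forall>z\<in>elts omega2. j z \<in> elts (e 0) \<and> ap (ap Fm (e 0)) (j z) = i \<longrightarrow> e 1 = z)"
    by (intro dfn Dt_compose1[OF j(1)])
  have exE: "\<exists>y\<in>elts omega2. \<forall>z\<in>elts omega2. j z \<in> elts g \<and> ap (ap Fm g) (j z) = i \<longrightarrow> y = z"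
    if g: "g \<in> elts kappa" for g
  proof (cases "\<exists>y\<in>elts omega2. j y \<in> elts g \<and> ap (ap Fm g) (j y) = i")
    case True
    then obtain y where y: "y \<in> elts omega2" "j y \<in> elts g" "ap (ap Fm g) (j y) = i" by blast
    then show ?thesis using Fm[OF g] j(3) by (intro bexI[of _ y]) auto
  next
    \<comment> \<open>Points outside all the chosen sets receive an arbitrary value, which only
      enlarges one of the stationary sets.\<close>
    case False
    then show ?thesis using omega1_omega2 by blast
  qed
  obtain f where f: "func f kappa" "\<And>g. g \<in> elts kappa \<Longrightarrow> ap f g \<in> elts omega2 \<and>
      (\<forall>z\<in>elts omega2. j z \<in> elts g \<and> ap (ap Fm g) (j z) = i \<longrightarrow> ap f g = z)"
    by (rule AC[OF dE exE]) blast+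
  have "stat (sep kappa (\<lambda>g. ap f g = z))" if z: "z \<in> elts omega2" for z
  proof -
    have s: "elts (sep kappa (\<lambda>g. ap f g = z)) = {g \<in> elts kappa. ap f g = z}" by (rule elts_sep) (intro dfn)
    have "stat (T (j z) i)" using j(2)[OF z] A by blast
    moreover have "elts (T (j z) i) \<subseteq> elts (sep kappa (\<lambda>g. ap f g = z))"
      unfolding s using f(2) z by (auto simp: T)
    ultimately show ?thesis unfolding stat_def by blast
  qed
  with f show ?thesis by blast
qed

definition EE :: 'v where
  "EE = (SOME f. func f kappa \<and> (\<forall>g\<in>elts kappa. ap f g \<in> elts omega2) \<and>
    (\<forall>z\<in>elts omega2. stat (sep kappa (\<lambda>g. ap f g = z))))"

lemma EE: "g \<in> elts kappa \<Longrightarrow> ap EE g \<in> elts omega2"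
    "z \<in> elts omega2 \<Longrightarrow> stat (sep kappa (\<lambda>g. ap EE g = z))"
  using someI_ex[OF Ulam] unfolding EE_def[symmetric] by blast+

subsection \<open>Admissible and good sets\<close>

text \<open>Closure under application stands in for elementarity: functions in \<open>M\<close> take
  values in \<open>M\<close> at elements of \<open>M\<close>.\<close>

definition Adm :: "'v \<Rightarrow> bool" where
  "Adm M \<longleftrightarrow> elts M \<subseteq> elts Vd \<and> card_le M omega1 \<and> elts omega1 \<subseteq> elts M \<and>
    (\<forall>f\<in>elts M. \<forall>x\<in>elts M. ap f x \<in> elts M)"

lemma D_Adm [THEN D_compose1, dfn]: "D (\<lambda>e. Adm (e 0))" unfolding Adm_def by (intro dfn)

lemma Adm_Vd: "Adm M \<Longrightarrow> M \<in> elts Vd"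
  unfolding Adm_def by (intro VdI) (auto intro: lt_le[OF lt_omega1])

lemma Adm_ex: assumes X: "elts X \<subseteq> elts Vd" "card_le X omega1"
  obtains M where "Adm M" "elts X \<subseteq> elts M"
proof -
  have oV: "elts omega1 \<subseteq> elts Vd"
    using \<delta>_sub_Vd omega1_\<delta> Ord_trans[OF Ord_\<delta>] by blast
  have d: "Dt (\<lambda>e. sing (ap (e 0) (e 1)))" by (intro dfn)
  have G: "elts (sing (ap f x)) \<subseteq> elts Vd \<and> card_le (sing (ap f x)) omega1" if "f \<in> elts Vd" "x \<in> elts Vd" for f x
    using Vd_ap[OF that(1)] card_le_sing[OF infsq_omega1] by simp
  have s: "elts (un X omega1) \<subseteq> elts Vd" using X(1) oV by simp
  have c: "card_le (un X omega1) omega1" by (rule card_le_un[OF infsq_omega1 X(2) card_le_refl])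
  obtain Y where Y: "elts (un X omega1) \<subseteq> elts Y" "elts Y \<subseteq> elts Vd" "card_le Y omega1"
    "\<And>x y. x \<in> elts Y \<Longrightarrow> y \<in> elts Y \<Longrightarrow> elts (sing (ap x y)) \<subseteq> elts Y"
    by (rule closure_ex[where G = "\<lambda>f x. sing (ap f x)", OF infsq_omega1 d G s c]) blast+
  have "Adm Y" unfolding Adm_def using Y by auto
  then show thesis using that Y(1) by auto
qed

lemma Adm_Union: assumes F: "Dt (\<lambda>e. F (e 0))" "\<And>n. n \<in> elts om \<Longrightarrow> Adm (F n)"
    "\<And>n. n \<in> elts om \<Longrightarrow> elts (F n) \<subseteq> elts (F (succ n))"
  shows "Adm (Union (img om F))"
proof -
  have Y: "elts (Union (img om F)) = (\<Union>n\<in>elts om. elts (F n))" by (simp add: elts_img[OF F(1)])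
  have "card_le (Union (img om F)) omega1"
    by (rule card_le_UN[OF infsq_omega1 om_le_omega1 F(1)]) (use F(2) in \<open>auto simp: Adm_def\<close>)
  moreover have "ap f x \<in> elts (Union (img om F))"
    if f: "f \<in> elts (Union (img om F))" and x: "x \<in> elts (Union (img om F))" for f x
  proof -
    obtain n m where nm: "n \<in> elts om" "f \<in> elts (F n)" "m \<in> elts om" "x \<in> elts (F m)"
      using f x unfolding Y by auto
    then obtain k where k: "k \<in> elts om" "f \<in> elts (F k)" "x \<in> elts (F k)"
      using om_chain[OF F(1,3) nm(1,3)] by blast
    then have "ap f x \<in> elts (F k)" using F(2)[OF k(1)] unfolding Adm_def by blast
    then show ?thesis unfolding Y using k by blast
  qed
  moreover have "elts (Union (img om F)) \<subseteq> elts Vd" unfolding Y using F(2) unfolding Adm_def by blast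
  moreover have "elts omega1 \<subseteq> elts (Union (img om F))"
    unfolding Y using F(2)[OF om_0] om_0 unfolding Adm_def by blast
  ultimately show ?thesis unfolding Adm_def by blast
qed

lemma Ord_Vd: assumes "Ord x" "x \<in> elts Vd" shows "x \<in> elts \<delta>"
  by (rule Ord_lt[OF assms(1) Vd_lt[OF assms(2)]])

text \<open>The fibres of \<open>EE\<close> are the sets \<open>T \<zeta>\<close> of the overview,
  and the union is \<open>sup (M \<inter> kappa)\<close>; so the last clause compares order types
  with \<open>\<epsilon> M\<close>.\<close>

definition Good :: "'v \<Rightarrow> bool" where
  "Good M \<longleftrightarrow> Adm M \<and> Union (int M kappa) \<in> elts kappa \<and>
    (\<forall>z\<in>elts M. z \<in> elts \<delta> \<longrightarrow> col M z \<in> elts (ap EE (Union (int M kappa))))"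

lemma D_Good [THEN D_compose1, dfn]: "D (\<lambda>e. Good (e 0))" unfolding Good_def by (intro dfn)

section \<open>The game that produces good sets\<close>

definition position :: "'v \<Rightarrow> 'v \<Rightarrow> 'v \<Rightarrow> bool" where
  "position a z p \<longleftrightarrow> Adm (pfst p) \<and> a \<in> elts (pfst p) \<and> func (psnd p) (int (pfst p) \<delta>) \<and>
    (\<forall>x\<in>elts (int (pfst p) \<delta>). ap (psnd p) x \<in> elts z) \<and>
    (\<forall>x\<in>elts (int (pfst p) \<delta>). \<forall>y\<in>elts (int (pfst p) \<delta>). x \<in> elts y \<longrightarrow> ap (psnd p) x \<in> elts (ap (psnd p) y))"

definition positions :: "'v \<Rightarrow> 'v \<Rightarrow> 'v" where
  "positions a z = sep (cart (Pow Vd) (Pow (cart \<delta> omega2))) (position a z)"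

text \<open>The first player demands \<open>b\<close>; the reply must reach above it inside
  \<open>kappa\<close> while extending both components of the position.\<close>

definition next_position :: "'v \<Rightarrow> 'v \<Rightarrow> 'v \<Rightarrow> bool" where
  "next_position b p q \<longleftrightarrow> elts (pfst p) \<subseteq> elts (pfst q) \<and> elts (psnd p) \<subseteq> elts (psnd q) \<and>
    (\<exists>x\<in>elts (pfst q). x \<in> elts kappa \<and> b \<in> elts x)"

lemma D_position [THEN D_compose3, dfn]: "D (\<lambda>e. position (e 0) (e 1) (e 2))" unfolding position_def by (intro dfn)
lemma Dt_positions [THEN Dt_compose2, dfn]: "Dt (\<lambda>e. positions (e 0) (e 1))" unfolding positions_def by (intro dfn)
lemma D_next_position: "D (\<lambda>e. next_position (e 0) (e 1) (e 2))" unfolding next_position_def by (intro dfn)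

lemma elts_positions: assumes "z \<in> elts omega2"
  shows "p \<in> elts (positions a z) \<longleftrightarrow> (\<exists>M v. p = opair M v) \<and> position a z p"
proof -
  have e: "elts (positions a z) = {p \<in> elts (cart (Pow Vd) (Pow (cart \<delta> omega2))). position a z p}"
    unfolding positions_def by (rule elts_sep) (intro dfn)
  have "opair M v \<in> elts (cart (Pow Vd) (Pow (cart \<delta> omega2)))" if p: "position a z (opair M v)" for M v
  proof -
    have f: "func v (int M \<delta>)" using p by (simp add: position_def)
    have "elts v \<subseteq> elts (cart \<delta> omega2)"
    proof
      fix w assume "w \<in> elts v"
      then obtain x where x: "x \<in> elts (int M \<delta>)" "w = opair x (ap v x)"
        using f func_opair[OF f] unfolding func_def by metis
      then have "ap v x \<in> elts z" using p by (simp add: position_def)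
      then show "w \<in> elts (cart \<delta> omega2)" using x Ord_trans[OF Ord_omega2 assms] by auto
    qed
    then show ?thesis using p by (auto simp: position_def Adm_def)
  qed
  then show ?thesis unfolding e by auto
qed

text \<open>A set of positions in which every demand has an answer takes the place of a winning
  strategy; dependent choice turns it into plays of length omega.\<close>

definition second_wins :: "'v \<Rightarrow> 'v \<Rightarrow> bool" where
  "second_wins a z \<longleftrightarrow> (\<exists>W. elts W \<subseteq> elts (positions a z) \<and> elts W \<noteq> {} \<and>
    (\<forall>p\<in>elts W. \<forall>b\<in>elts kappa. \<exists>q\<in>elts W. next_position b p q))"

lemma no_descent: assumes f: "Dt (\<lambda>e. f (e 0))" and d: "\<And>n. n \<in> elts om \<Longrightarrow> f (succ n) \<in> elts (f n)"
  shows False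
proof -
  have "f emp \<in> elts (img om f)" unfolding elts_img[OF f] using om_0 by (rule imageI)
  then have "elts (img om f) \<noteq> {}" by blast
  then obtain m where m: "m \<in> elts (img om f)" "elts m \<inter> elts (img om f) = {}" by (rule foundation')
  then obtain n where n: "n \<in> elts om" "m = f n" by (auto simp: elts_img[OF f])
  then have "f (succ n) \<in> elts m \<inter> elts (img om f)" using d om_succ[OF n(1)] by (auto simp: elts_img[OF f])
  with m show False by simp
qed

lemma second_wins_ex: assumes a: "a \<in> elts Vd" shows "\<exists>z\<in>elts omega2. second_wins a z"
proof (rule ccontr)
  assume n: "\<not> ?thesis"
  \<comment> \<open>\<open>w\<close> codes a strategy of the first player together with its rank
    from \<open>ranking\<close>, so that a play of length omega against the strategy would be an
    infinite descent.\<close>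
  define Q where "Q z w \<longleftrightarrow> (\<forall>p\<in>elts (positions a z). ap (pfst w) p \<in> elts kappa) \<and>
    (\<forall>p\<in>elts (positions a z). \<forall>q\<in>elts (positions a z). next_position (ap (pfst w) p) p q \<longrightarrow> ap (psnd w) q \<in> elts (ap (psnd w) p))" for z w
  have dQ: "D (\<lambda>e. Q (e 0) (e 1))" unfolding Q_def by (intro dfn D_compose3[OF D_next_position])
  have exQ: "\<exists>w. Q z w" if z: "z \<in> elts omega2" for z
  proof -
    have no: "\<exists>p\<in>elts W. \<exists>b\<in>elts kappa. \<forall>q\<in>elts W. \<not> next_position b p q"
      if "elts W \<subseteq> elts (positions a z)" "elts W \<noteq> {}" for W
      using n z that unfolding second_wins_def by blast
    obtain s r where "\<And>p. p \<in> elts (positions a z) \<Longrightarrow> ap s p \<in> elts kappa"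
      "\<And>p q. p \<in> elts (positions a z) \<Longrightarrow> q \<in> elts (positions a z) \<Longrightarrow> next_position (ap s p) p q \<Longrightarrow> ap r q \<in> elts (ap r p)"
      by (rule ranking[OF D_next_position no]) blast+
    then show ?thesis by (intro exI[of _ "opair s r"]) (simp add: Q_def)
  qed
  obtain w where w: "\<And>z. z \<in> elts omega2 \<Longrightarrow> Q z (ap w z)" by (rule AC_class[OF dQ exQ]) blast+
  define S where "S z p = ap (pfst (ap w z)) p" for z p
  define Rk where "Rk z p = ap (psnd (ap w z)) p" for z p
  have dS: "Dt (\<lambda>e. S (e 0) (e 1))" unfolding S_def by (intro dfn)
  have dRk: "Dt (\<lambda>e. Rk (e 0) (e 1))" unfolding Rk_def by (intro dfn)
  have S: "S z p \<in> elts kappa" if "z \<in> elts omega2" "p \<in> elts (positions a z)" for z p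
    using w[OF that(1)] that(2) by (simp add: Q_def S_def)
  have Rk: "Rk z q \<in> elts (Rk z p)"
    if "z \<in> elts omega2" "p \<in> elts (positions a z)" "q \<in> elts (positions a z)" "next_position (S z p) p q" for z p q
    using w[OF that(1)] that(2-) by (simp add: Q_def S_def Rk_def)
  define A where "A = sep (Pow Vd) (\<lambda>M. Adm M \<and> a \<in> elts M)"
  have A: "M \<in> elts A \<longleftrightarrow> Adm M \<and> a \<in> elts M" for M
    unfolding A_def by (subst elts_sep) (intro dfn, auto simp: Adm_def)
  define R where "R M M' \<longleftrightarrow> elts M \<subseteq> elts M' \<and> (\<exists>x\<in>elts M'. x \<in> elts kappa \<and>
    (\<forall>z\<in>elts omega2. \<forall>v. opair M v \<in> elts (positions a z) \<longrightarrow> S z (opair M v) \<in> elts x))" for M M'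
  have dR: "D (\<lambda>e. R (e 0) (e 1))" unfolding R_def by (intro dfn Dt_compose2[OF dS])
  have exR: "\<exists>M'\<in>elts A. R M M'" if M: "M \<in> elts A" for M
  proof -
    have aM: "Adm M" using M A by blast
    \<comment> \<open>All pairs of a \<open>z\<close> and a map on the current ordinals. The choice
      of \<open>rho\<close> allows at most \<open>rho\<close> of them, so the demands of all
      strategies have a common bound in \<open>kappa\<close>.\<close>
    define I where "I = cart omega2 (Pow (cart (int M \<delta>) omega2))"
    define f where "f u = (if opair M (psnd u) \<in> elts (positions a (pfst u)) then S (pfst u) (opair M (psnd u)) else emp)" for u
    have df: "Dt (\<lambda>e. f (e 0))" unfolding f_def by (intro dfn Dt_compose2[OF dS])
    have "card_le (int M \<delta>) omega1" using aM card_le_subset[of "int M \<delta>" M] card_le_trans by (auto simp: Adm_def)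
    then have "card_le (Pow (cart (int M \<delta>) omega2)) rho"
      using card_le_Pow[OF card_le_cart[OF _ card_le_refl]] rho(5) card_le_trans by blast
    then have "card_le I rho"
      unfolding I_def using card_le_cart[OF omega2_rho] rho(3) card_le_trans unfolding infsq_def by blast
    then have X1: "card_le (img I f) rho" using card_le_image[OF df] card_le_trans by blast
    have e: "emp \<in> elts kappa" using kappa(4) card_le_subset[of emp rho] by simp
    have X2: "elts (img I f) \<subseteq> elts kappa" unfolding elts_img[OF df] I_def f_def using S e by auto
    define x where "x = succ (Union (img I f))"
    have xk: "x \<in> elts kappa" using kappa_Union[OF X1 X2] kappa(3) unfolding x_def Limit_def by blast
    have c: "card_le (un M (sing x)) omega1"
      by (rule card_le_un[OF infsq_omega1]) (use aM card_le_sing[OF infsq_omega1] in \<open>auto simp: Adm_def\<close>)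
    have s: "elts (un M (sing x)) \<subseteq> elts Vd" using aM xk kappa(6) \<delta>_sub_Vd by (auto simp: Adm_def)
    obtain M' where M': "Adm M'" "elts (un M (sing x)) \<subseteq> elts M'" by (rule Adm_ex[OF s c])
    have "S z (opair M v) \<in> elts x" if z: "z \<in> elts omega2" and p: "opair M v \<in> elts (positions a z)" for z v
    proof -
      have "position a z (opair M v)" using p elts_positions[OF z] by blast
      then have fv: "func v (int M \<delta>)" "\<forall>x\<in>elts (int M \<delta>). ap v x \<in> elts z" by (auto simp: position_def)
      have "elts v \<subseteq> elts (cart (int M \<delta>) omega2)"
      proof
        fix w assume "w \<in> elts v"
        then obtain x where x: "x \<in> elts (int M \<delta>)" "w = opair x (ap v x)"
          using fv func_opair[OF fv(1)] unfolding func_def by metis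
        then have "ap v x \<in> elts omega2" using fv(2) Ord_trans[OF Ord_omega2 z] by blast
        then show "w \<in> elts (cart (int M \<delta>) omega2)" using x by auto
      qed
      then have "opair z v \<in> elts I" using z by (simp add: I_def)
      moreover have "f (opair z v) = S z (opair M v)" using p by (simp add: f_def)
      ultimately have i: "S z (opair M v) \<in> elts (img I f)" unfolding elts_img[OF df] by (metis imageI)
      then have "elts (S z (opair M v)) \<subseteq> elts (Union (img I f))" by (rule elts_Union_mono)
      moreover have "Ord (S z (opair M v))" "Ord (Union (img I f))"
        using i X2 kappa(4) kappa_Union[OF X1 X2] by blast+
      ultimately have "S z (opair M v) \<in> elts (Union (img I f)) \<or> S z (opair M v) = Union (img I f)"
        using Ord_subset_iff by blast
      then show ?thesis unfolding x_def elts_succ by blast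
    qed
    then have "R M M'" unfolding R_def using M'(2) xk by auto
    moreover have "M' \<in> elts A" using M' M A by auto
    ultimately show ?thesis by blast
  qed
  obtain M0 where M0: "Adm M0" "elts (sing a) \<subseteq> elts M0"
    by (rule Adm_ex[of "sing a"]) (use a card_le_sing[OF infsq_omega1] in auto)
  then have "M0 \<in> elts A" by (simp add: A)
  then obtain F where F: "Dt (\<lambda>e. F (e 0))" "F emp = M0"
    "\<And>n. n \<in> elts om \<Longrightarrow> F n \<in> elts A" "\<And>n. n \<in> elts om \<Longrightarrow> R (F n) (F (succ n))"
    by (rule DC[OF dR _ exR]) blast+
  define M where "M = Union (img om F)"
  have mono: "elts (F n) \<subseteq> elts (F (succ n))" if "n \<in> elts om" for n using F(4)[OF that] by (simp add: R_def)
  have aM: "Adm M" unfolding M_def by (rule Adm_Union[OF F(1) _ mono]) (use F(3) A in blast)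
  have FM: "elts (F n) \<subseteq> elts M" if "n \<in> elts om" for n
    unfolding M_def using that by (auto simp: elts_img[OF F(1)])
  have dc: "Dt (\<lambda>e. col M (e 0))" by (intro dfn)
  have "card_le (int M \<delta>) omega1" using aM card_le_subset[of "int M \<delta>" M] card_le_trans by (auto simp: Adm_def)
  moreover have "col M x \<in> elts omega2" if "x \<in> elts (int M \<delta>)" for x
    using col_omega2[of M x] aM that Ord_elt[OF Ord_\<delta>] by (simp add: Adm_def)
  \<comment> \<open>At most omega_1 many order types occur, so the regularity of omega_2 gives a
    \<open>z\<close> above all of them. For this \<open>z\<close> the collapse is a legal
    map.\<close>
  ultimately obtain z where z: "z \<in> elts omega2" "\<forall>x\<in>elts (int M \<delta>). col M x \<in> elts z"
    using regular_bound[OF regular_omega2 _ omega1_omega2 dc] by blast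
  \<comment> \<open>Every stage uses a restriction of the collapse of the final \<open>M\<close>,
    not of the current set; thus the maps extend one another.\<close>
  define p where "p n = opair (F n) (Lam (int (F n) \<delta>) (col M))" for n
  have dp: "Dt (\<lambda>e. p (e 0))" unfolding p_def by (intro dfn F(1) Dt_compose1[OF F(1)])
  have pP: "p n \<in> elts (positions a z)" if nn: "n \<in> elts om" for n
    unfolding elts_positions[OF z(1)] position_def p_def
    using F(3)[OF nn] A FM[OF nn] z(2) func_Lam[OF dc] col_mem[of _ _ M] by (auto simp: ap_Lam[OF dc])
  have "next_position (S z (p n)) (p n) (p (succ n))" if nn: "n \<in> elts om" for n
  proof -
    have "elts (Lam (int (F n) \<delta>) (col M)) \<subseteq> elts (Lam (int (F (succ n)) \<delta>) (col M))"
      unfolding elts_Lam[OF dc] using mono[OF nn] by auto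
    moreover obtain x where "x \<in> elts (F (succ n))" "x \<in> elts kappa" "S z (p n) \<in> elts x"
      using F(4)[OF nn] pP[OF nn] z(1) unfolding R_def p_def by blast
    ultimately show ?thesis unfolding next_position_def using mono[OF nn] by (auto simp: p_def)
  qed
  then have "Rk z (p (succ n)) \<in> elts (Rk z (p n))" if "n \<in> elts om" for n
    using Rk[OF z(1) pP pP] that om_succ by blast
  moreover have "Dt (\<lambda>e. Rk z (p (e 0)))" by (intro dfn Dt_compose2[OF dRk] dp)
  ultimately show False using no_descent[of "\<lambda>n. Rk z (p n)"] by blast
qed

lemma ap_unique: assumes "opair x y \<in> elts f" "\<And>y'. opair x y' \<in> elts f \<Longrightarrow> y' = y" shows "ap f x = y"
proof -
  have ex: "\<exists>!y. opair x y \<in> elts f" using assms by blast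
  have "opair x (ap f x) \<in> elts f" unfolding ap_def using theI'[OF ex] ex by simp
  then show ?thesis by (rule assms(2))
qed

text \<open>Stationarity provides a closed set \<open>Y\<close> whose ordinal \<open>c\<close> lies
  in the fibre of \<open>z\<close>. Playing inside \<open>Y\<close> against a sequence cofinal in
  \<open>c\<close> yields \<open>M\<close> with supremum exactly \<open>c\<close>, while the maps
  keep the order types below \<open>z\<close>.\<close>

lemma Good_ex: assumes a: "a \<in> elts Vd" obtains M where "Good M" "a \<in> elts M"
proof -
  obtain z W where z: "z \<in> elts omega2" and W: "elts W \<subseteq> elts (positions a z)" "elts W \<noteq> {}"
      "\<And>p b. p \<in> elts W \<Longrightarrow> b \<in> elts kappa \<Longrightarrow> \<exists>q\<in>elts W. next_position b p q"
    using second_wins_ex[OF a] unfolding second_wins_def by blast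
  have pW: "position a z p" if "p \<in> elts W" for p using W(1) that elts_positions[OF z] by blast
  have dR: "D (\<lambda>e. next_position (pfst (e 0)) (psnd (e 0)) (e 1))" by (intro dfn D_compose3[OF D_next_position])
  have exR: "\<exists>q\<in>elts W. next_position (pfst u) (psnd u) q" if "u \<in> elts (cart kappa W)" for u
    using W(3) that by auto
  obtain N where N: "\<And>u. u \<in> elts (cart kappa W) \<Longrightarrow> ap N u \<in> elts W \<and> next_position (pfst u) (psnd u) (ap N u)"
    by (rule AC[OF dR exR]) blast+
  define U where "U = un W kappa"
  \<comment> \<open>Two closure requirements: answers to demands in \<open>Y\<close> stay in
    \<open>Y\<close>, and the ordinals in \<open>kappa\<close> of each position in \<open>Y\<close>
    belong to \<open>Y\<close>, hence lie below \<open>c\<close>.\<close>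
  define g where "g u = un (if pfst u \<in> elts W \<and> psnd u \<in> elts kappa then sing (ap N (opair (psnd u) (pfst u))) else emp)
      (if pfst u \<in> elts W then int (pfst (pfst u)) kappa else emp)" for u
  have dg: "Dt (\<lambda>e. g (e 0))" unfolding g_def by (intro dfn)
  define G where "G = Lam (cart U U) g"
  have G: "ap G (opair x y) = g (opair x y)" if "x \<in> elts U" "y \<in> elts U" for x y
    unfolding G_def using that by (intro ap_Lam[OF dg]) auto
  obtain p0 where p0: "p0 \<in> elts W" using W(2) by blast
  have e: "card_le emp rho" by (rule card_le_subset) simp
  have "stat_data U G (sing p0)" unfolding stat_data_def
  proof (intro conjI ballI)
    show "elts kappa \<subseteq> elts U" "elts (sing p0) \<subseteq> elts U" using p0 by (auto simp: U_def)
    show "card_le (sing p0) rho" by (rule card_le_sing[OF rho(3)])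
    fix x y assume xy: "x \<in> elts U" "y \<in> elts U"
    show "elts (ap G (opair x y)) \<subseteq> elts U"
      unfolding G[OF xy] using N[of "opair y x"] by (auto simp: g_def U_def split: if_splits)
    have "card_le (int (pfst x) kappa) rho" if "x \<in> elts W"
    proof -
      have "card_le (pfst x) omega1" using pW[OF that] by (simp add: position_def Adm_def)
      moreover have "card_le (int (pfst x) kappa) (pfst x)" by (rule card_le_subset) simp
      ultimately show ?thesis using omega1_rho card_le_trans by blast
    qed
    then show "card_le (ap G (opair x y)) rho"
      unfolding G[OF xy] g_def by (intro card_le_un[OF rho(3)]) (auto simp: e card_le_sing[OF rho(3)])
  qed
  then obtain c where c: "c \<in> elts (sep kappa (\<lambda>g. ap EE g = z))" "stat_hit U G (sing p0) c"
    using EE(2)[OF z] unfolding stat_def by blast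
  have "elts (sep kappa (\<lambda>g. ap EE g = z)) = {g \<in> elts kappa. ap EE g = z}" by (rule elts_sep) (intro dfn)
  then have c1: "c \<in> elts kappa" "ap EE c = z" using c(1) by auto
  obtain Y b where "elts (sing p0) \<subseteq> elts Y" and Y1: "elts Y \<subseteq> elts U"
    "\<forall>x\<in>elts Y. \<forall>y\<in>elts Y. elts (ap G (opair x y)) \<subseteq> elts Y" "int Y kappa = c"
    "\<forall>n\<in>elts om. ap b n \<in> elts c" "\<forall>x\<in>elts c. \<exists>n\<in>elts om. x \<in> elts (ap b n)"
    using c(2) unfolding stat_hit_def by blast
  then have "p0 \<in> elts Y" by simp
  note Y = this Y1(1) Y1(2)[rule_format] Y1(3) Y1(4)[rule_format] Y1(5)[rule_format]
  have cY: "x \<in> elts Y" "x \<in> elts kappa" if "x \<in> elts c" for x using that Y(4) by auto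
  have Gs: "elts (g (opair x y)) \<subseteq> elts Y" if "x \<in> elts Y" "y \<in> elts Y" for x y
  proof -
    have "x \<in> elts U" "y \<in> elts U" using Y(2) that by blast+
    then show ?thesis using Y(3)[OF that] G by simp
  qed
  have dS: "D (\<lambda>e. next_position (ap b (e 0)) (e 1) (e 2))" by (intro dfn D_compose3[OF D_next_position])
  have exS: "\<exists>q\<in>elts (int Y W). next_position (ap b n) p q" if n: "n \<in> elts om" and p: "p \<in> elts (int Y W)" for n p
  proof -
    have bn: "ap b n \<in> elts Y" "ap b n \<in> elts kappa" using cY Y(5)[OF n] by auto
    have "ap N (opair (ap b n) p) \<in> elts (g (opair p (ap b n)))" using p bn by (auto simp: g_def)
    then have "ap N (opair (ap b n) p) \<in> elts Y" using Gs[of p "ap b n"] p bn by auto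
    then show ?thesis using N[of "opair (ap b n) p"] p bn by auto
  qed
  have "p0 \<in> elts (int Y W)" using p0 Y(1) by simp
  then obtain F where F: "Dt (\<lambda>e. F (e 0))" "F emp = p0"
    "\<And>n. n \<in> elts om \<Longrightarrow> F n \<in> elts (int Y W)" "\<And>n. n \<in> elts om \<Longrightarrow> next_position (ap b n) (F n) (F (succ n))"
    by (rule DC_nat[OF dS _ exS]) blast+
  have FW: "F n \<in> elts W" "F n \<in> elts Y" "position a z (F n)" if "n \<in> elts om" for n using F(3)[OF that] pW by auto
  define M where "M = Union (img om (\<lambda>n. pfst (F n)))"
  have dM: "Dt (\<lambda>e. pfst (F (e 0)))" by (intro dfn F(1))
  have M: "elts M = (\<Union>n\<in>elts om. elts (pfst (F n)))" unfolding M_def by (simp add: elts_img[OF dM])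
  have mono: "elts (pfst (F n)) \<subseteq> elts (pfst (F (succ n)))" if "n \<in> elts om" for n
    using F(4)[OF that] by (simp add: next_position_def)
  have aM: "Adm M" unfolding M_def by (rule Adm_Union[OF dM _ mono]) (use FW(3) in \<open>auto simp: position_def\<close>)
  have "a \<in> elts M" using FW(3)[OF om_0] om_0 unfolding M position_def by blast
  \<comment> \<open>Closure of \<open>Y\<close> keeps the supremum from exceeding \<open>c\<close>;
    it reaches \<open>c\<close> because stage n+1 contains an ordinal above \<open>ap b n\<close>
    and these are cofinal.\<close>
  have Mc: "Union (int M kappa) = c"
  proof (rule elts_eqI, rule set_eqI, rule iffI)
    fix x assume "x \<in> elts (Union (int M kappa))"
    then obtain y n where y: "x \<in> elts y" "y \<in> elts kappa" "n \<in> elts om" "y \<in> elts (pfst (F n))"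
      using M by auto
    then have "y \<in> elts (g (opair (F n) (F n)))" using FW[OF y(3)] by (auto simp: g_def)
    then have "y \<in> elts Y" using Gs FW[OF y(3)] by blast
    then have "y \<in> elts c" using y Y(4) by auto
    then show "x \<in> elts c" using y(1) Ord_trans[OF Ord_elt[OF kappa(2) c1(1)]] by blast
  next
    fix x assume "x \<in> elts c"
    then obtain n where n: "n \<in> elts om" "x \<in> elts (ap b n)" using Y(6) by blast
    then obtain y where y: "y \<in> elts (pfst (F (succ n)))" "y \<in> elts kappa" "ap b n \<in> elts y"
      using F(4)[OF n(1)] by (auto simp: next_position_def)
    then have "x \<in> elts y" using n(2) Ord_trans[OF Ord_elt[OF kappa(2) y(2)]] by blast
    moreover have "y \<in> elts (int M kappa)" using y om_succ[OF n(1)] unfolding elts_int M by blast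
    ultimately show "x \<in> elts (Union (int M kappa))" by auto
  qed
  define v where "v = Union (img om (\<lambda>n. psnd (F n)))"
  have dv: "Dt (\<lambda>e. psnd (F (e 0)))" by (intro dfn F(1))
  have v: "elts v = (\<Union>n\<in>elts om. elts (psnd (F n)))" unfolding v_def by (simp add: elts_img[OF dv])
  have vmono: "elts (psnd (F n)) \<subseteq> elts (psnd (F (succ n)))" if "n \<in> elts om" for n
    using F(4)[OF that] by (simp add: next_position_def)
  have vF: "ap v x = ap (psnd (F n)) x" if n: "n \<in> elts om" and x: "x \<in> elts (int (pfst (F n)) \<delta>)" for n x
  proof -
    have fn: "func (psnd (F n)) (int (pfst (F n)) \<delta>)" if "n \<in> elts om" for n using FW(3)[OF that] by (simp add: position_def)
    have in1: "opair x (ap (psnd (F n)) x) \<in> elts v" unfolding v using n x func_opair[OF fn[OF n]] by blast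
    have "y = ap (psnd (F n)) x" if xy: "opair x y \<in> elts v" for y
    proof -
      obtain m where m: "m \<in> elts om" "opair x y \<in> elts (psnd (F m))" using xy unfolding v by blast
      have n': "opair x (ap (psnd (F n)) x) \<in> elts (psnd (F n))" using x func_opair[OF fn[OF n]] by blast
      obtain k where "k \<in> elts om" "opair x y \<in> elts (psnd (F k))" "opair x (ap (psnd (F n)) x) \<in> elts (psnd (F k))"
        using om_chain[OF dv vmono m(1) n] m n n' by blast
      then show ?thesis using func_opair[OF fn] by metis
    qed
    then show ?thesis by (rule ap_unique[OF in1])
  qed
  have vz: "ap v x \<in> elts z" if x: "x \<in> elts M" "Ord x" for x
  proof -
    obtain n where n: "n \<in> elts om" "x \<in> elts (pfst (F n))" using x(1) unfolding M by blast
    have "x \<in> elts \<delta>" using Ord_Vd x aM by (auto simp: Adm_def)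
    then show ?thesis using vF[OF n(1), of x] n FW(3)[OF n(1)] by (auto simp: position_def)
  qed
  have vinc: "ap v x \<in> elts (ap v y)" if xy: "x \<in> elts M" "y \<in> elts M" "Ord y" "x \<in> elts y" for x y
  proof -
    obtain n m where nm: "n \<in> elts om" "x \<in> elts (pfst (F n))" "m \<in> elts om" "y \<in> elts (pfst (F m))"
      using xy(1,2) unfolding M by blast
    obtain k where k: "k \<in> elts om" "x \<in> elts (pfst (F k))" "y \<in> elts (pfst (F k))"
      using om_chain[OF dM mono nm(1,3)] nm by blast
    have "y \<in> elts \<delta>" using Ord_Vd xy aM by (auto simp: Adm_def)
    then have "x \<in> elts \<delta>" using xy(4) Ord_trans[OF Ord_\<delta>] by blast
    then show ?thesis
      using vF[OF k(1), of x] vF[OF k(1), of y] \<open>y \<in> elts \<delta>\<close> k FW(3)[OF k(1)] xy(4) by (auto simp: position_def)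
  qed
  have oz: "Ord z" using z Ord_elt[OF Ord_omega2] by blast
  have vo: "Ord (ap v x)" if "x \<in> elts M" "Ord x" for x using vz[OF that] Ord_elt[OF oz] by blast
  have dva: "Dt (\<lambda>e. ap v (e 0))" by (intro dfn)
  \<comment> \<open>The union \<open>v\<close> of the maps is increasing into \<open>z\<close>, and
    the collapse lies pointwise below it.\<close>
  have "col M x \<in> elts z" if x: "x \<in> elts M" "x \<in> elts \<delta>" for x
  proof -
    have ox: "Ord x" using x Ord_elt[OF Ord_\<delta>] by blast
    have "elts (col M x) \<subseteq> elts (ap v x)" by (rule col_least[OF vinc vo dva x(1) ox]) auto
    then have "col M x \<in> elts (ap v x) \<or> col M x = ap v x"
      using Ord_subset_iff[OF Ord_col[OF ox] vo[OF x(1) ox]] by blast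
    then show ?thesis using vz[OF x(1) ox] Ord_trans[OF oz vz[OF x(1) ox]] by auto
  qed
  then have "Good M" unfolding Good_def Mc using aM c1 by auto
  then show thesis using that \<open>a \<in> elts M\<close> by blast
qed

section \<open>The tower of ideals\<close>

text \<open>The parameter ranges over all of V_\<delta> and not just over \<open>H l\<close>; this
  is what makes the projections between levels exact.\<close>

definition I\<^sub>T :: "'v \<Rightarrow> 'v" where
  "I\<^sub>T l = sep (Pow (Z l)) (\<lambda>A. \<exists>a\<in>elts Vd. \<forall>M. Good M \<and> a \<in> elts M \<longrightarrow> int M (H l) \<notin> elts A)"

definition TI :: 'v where "TI = Lam (vset (tower_index \<delta>)) I\<^sub>T"

lemma Dt_IT [THEN Dt_compose1, dfn]: "Dt (\<lambda>e. I\<^sub>T (e 0))" unfolding I\<^sub>T_def by (intro dfn)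

lemma elts_IT: "A \<in> elts (I\<^sub>T l) \<longleftrightarrow> elts A \<subseteq> elts (Z l) \<and>
  (\<exists>a\<in>elts Vd. \<forall>M. Good M \<and> a \<in> elts M \<longrightarrow> int M (H l) \<notin> elts A)"
  unfolding I\<^sub>T_def by (subst elts_sep) (intro dfn, auto)

lemma func_TI: "func TI (vset (tower_index \<delta>))"
proof -
  have d: "Dt (\<lambda>e. I\<^sub>T (e 0))" by (intro dfn)
  show ?thesis unfolding TI_def by (rule func_Lam[OF d])
qed

lemma app_TI: assumes "l \<in> tower_index \<delta>" shows "app TI l = I\<^sub>T l"
proof -
  have d: "Dt (\<lambda>e. I\<^sub>T (e 0))" by (intro dfn)
  have l: "l \<in> elts (vset (tower_index \<delta>))" using assms small_tower_index by simp
  show ?thesis unfolding func_app[OF func_TI l] unfolding TI_def by (rule ap_Lam[OF d l])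
qed

lemma GoodD: assumes "Good M" shows "Adm M" "elts M \<subseteq> elts Vd" "card_le M omega1" "elts omega1 \<subseteq> elts M"
    "\<And>f x. f \<in> elts M \<Longrightarrow> x \<in> elts M \<Longrightarrow> ap f x \<in> elts M" "M \<in> elts Vd" "elts om \<subseteq> elts M"
  using assms Adm_Vd om_sub_omega1 unfolding Good_def Adm_def by auto

text \<open>One parameter represents a whole family, accessible at those indices that belong to
  \<open>M\<close>.\<close>

lemma Good_param: assumes F: "Dt (\<lambda>e. F (e 0))" "Good M" "Lam x F \<in> elts M" "z \<in> elts x" "z \<in> elts M"
  shows "F z \<in> elts M"
  using GoodD(5)[OF F(2,3,5)] ap_Lam[OF F(1,4)] by simp

text \<open>The two parameters are coded as values of one function on \<open>om\<close>, which every
  good set includes. Consequently \<open>Fr\<close> respects conjunction.\<close>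

lemma Good_two: assumes "a \<in> elts Vd" "b \<in> elts Vd"
  obtains c where "c \<in> elts Vd" "\<And>M. Good M \<Longrightarrow> c \<in> elts M \<Longrightarrow> a \<in> elts M \<and> b \<in> elts M"
proof -
  define F where "F i = (if i = emp then a else b)" for i
  have dF: "Dt (\<lambda>e. F (e 0))" unfolding F_def by (intro dfn)
  have "om \<in> elts Vd" using \<delta>_sub_Vd om_\<delta> by blast
  then have "Lam om F \<in> elts Vd" by (rule Vd_Lam[OF dF]) (use assms in \<open>auto simp: F_def\<close>)
  moreover have "a \<in> elts M \<and> b \<in> elts M" if M: "Good M" "Lam om F \<in> elts M" for M
  proof -
    have "F emp \<in> elts M" "F (succ emp) \<in> elts M"
      using Good_param[OF dF M om_0] Good_param[OF dF M om_succ[OF om_0]] GoodD(7)[OF M(1)] om_0 om_succ by blast+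
    then show ?thesis by (simp add: F_def)
  qed
  ultimately show thesis using that by blast
qed

lemma trace_Z: "Good M \<Longrightarrow> int M (H l) \<in> elts (Z l)"
  using card_le_subset[of "int M (H l)" M] GoodD(3) card_le_trans by (auto simp: elts_Z)

lemma int_H: assumes "l \<in> tower_index \<delta>" "l' \<in> tower_index \<delta>" "elts l \<subseteq> elts l'"
  shows "int (int M (H l')) (H l) = int M (H l)"
  using H_mono[OF tower_indexD(3)[OF assms(1)] tower_indexD(3)[OF assms(2)] assms(3) tower_indexD(2)[OF assms(2)]]
  by (intro elts_eqI) auto

lemma elts_Union_Z: "elts (Union (Z l)) = elts (H l)"
proof -
  have "b \<in> elts (Union (Z l))" if b: "b \<in> elts (H l)" for b
  proof -
    have "sing b \<in> elts (Z l)" using b card_le_sing[OF infsq_omega1] by (auto simp: elts_Z)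
    then show ?thesis by (auto intro!: bexI[of _ "sing b"])
  qed
  then show ?thesis by (auto simp: elts_Z)
qed

text \<open>Parameters for omega_1 many sets are coded by a function on \<open>omega1\<close>; a
  good set contains all countable ordinals, hence all its values.\<close>

lemma IT_complete: assumes F: "elts F \<subseteq> elts (I\<^sub>T l)" "card_le F omega1" shows "Union F \<in> elts (I\<^sub>T l)"
proof (cases "elts F = {}")
  case True
  then have "Union F = emp" by (intro elts_eqI) auto
  then show ?thesis using Vd_emp by (auto simp: elts_IT)
next
  case False
  obtain g where g: "Dt (\<lambda>e. g (e 0))" "g ` elts omega1 = elts F" by (rule card_le_surjE[OF F(2) False]) blast
  have R: "D (\<lambda>e. \<forall>M. Good M \<and> e 1 \<in> elts M \<longrightarrow> int M (H l) \<notin> elts (e 0))" by (intro dfn)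
  have ex: "\<exists>a\<in>elts Vd. \<forall>M. Good M \<and> a \<in> elts M \<longrightarrow> int M (H l) \<notin> elts A" if "A \<in> elts F" for A
    using F(1) that elts_IT by blast
  obtain f where f: "\<And>A. A \<in> elts F \<Longrightarrow> ap f A \<in> elts Vd \<and>
      (\<forall>M. Good M \<and> ap f A \<in> elts M \<longrightarrow> int M (H l) \<notin> elts A)"
    by (rule AC[OF R ex]) blast+
  define h where "h i = ap f (g i)" for i
  have dh: "Dt (\<lambda>e. h (e 0))" unfolding h_def by (intro dfn g(1))
  have a: "Lam omega1 h \<in> elts Vd"
    by (rule Vd_Lam[OF dh]) (use \<delta>_sub_Vd omega1_\<delta> f g(2) in \<open>auto simp: h_def\<close>)
  have "int M (H l) \<notin> elts (Union F)" if M: "Good M" "Lam omega1 h \<in> elts M" for M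
  proof
    assume "int M (H l) \<in> elts (Union F)"
    then obtain A where A: "A \<in> elts F" "int M (H l) \<in> elts A" by auto
    then obtain i where i: "i \<in> elts omega1" "A = g i" using g(2) by blast
    have "h i \<in> elts M" using Good_param[OF dh M i(1)] GoodD(4)[OF M(1)] i by blast
    then show False using f[OF A(1)] A M i by (auto simp: h_def)
  qed
  moreover have "elts A \<subseteq> elts (Z l)" if "A \<in> elts F" for A using F(1) that elts_IT by blast
  then have "elts (Union F) \<subseteq> elts (Z l)" by auto
  ultimately show ?thesis using a unfolding elts_IT by blast
qed

lemma IT_Z: "Z l \<notin> elts (I\<^sub>T l)"
proof
  assume "Z l \<in> elts (I\<^sub>T l)"
  then obtain a where "a \<in> elts Vd" "\<forall>M. Good M \<and> a \<in> elts M \<longrightarrow> int M (H l) \<notin> elts (Z l)"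
    unfolding elts_IT by blast
  then show False using Good_ex trace_Z by metis
qed

lemma IT_fine: assumes "l \<in> tower_index \<delta>" "b \<in> elts (H l)" shows "vset {M \<in> elts (Z l). b \<notin> elts M} \<in> elts (I\<^sub>T l)"
proof -
  have "small {M \<in> elts (Z l). b \<notin> elts M}" by (rule small_sep) (intro dfn)
  moreover have "b \<in> elts Vd" using assms tower_indexD(7) by blast
  ultimately show ?thesis unfolding elts_IT using assms(2) by auto
qed

text \<open>If all fibres of \<open>g\<close> were in the ideal, a single function could collect
  parameters \<open>ap f c\<close> excluding them. For a good \<open>M\<close> containing it, the
  value \<open>c\<close> at the trace is in \<open>M\<close>, hence so is \<open>ap f c\<close>,
  which excludes that value.\<close>

lemma IT_normal: assumes l: "l \<in> tower_index \<delta>" and S: "elts S \<subseteq> elts (Z l)" "S \<notin> elts (I\<^sub>T l)"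
    and g: "func g S" "\<And>M. M \<in> elts S \<Longrightarrow> ap g M \<in> elts M"
  shows "\<exists>S' c. elts S' \<subseteq> elts S \<and> S' \<notin> elts (I\<^sub>T l) \<and> (\<forall>M\<in>elts S'. ap g M = c)"
proof (rule ccontr)
  assume n: "\<not> ?thesis"
  have e: "elts (sep S (\<lambda>M. ap g M = c)) = {M \<in> elts S. ap g M = c}" for c
    by (rule elts_sep) (intro dfn)
  have R: "D (\<lambda>e. \<forall>M. Good M \<and> e 1 \<in> elts M \<longrightarrow> \<not> (int M (H l) \<in> elts S \<and> ap g (int M (H l)) = e 0))"
    by (intro dfn)
  have ex: "\<exists>a\<in>elts Vd. \<forall>M. Good M \<and> a \<in> elts M \<longrightarrow> \<not> (int M (H l) \<in> elts S \<and> ap g (int M (H l)) = c)" for c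
  proof -
    have "sep S (\<lambda>M. ap g M = c) \<in> elts (I\<^sub>T l)" using n e[of c] by blast
    then show ?thesis unfolding elts_IT e by blast
  qed
  obtain f where f: "\<And>c. c \<in> elts (H l) \<Longrightarrow> ap f c \<in> elts Vd \<and>
      (\<forall>M. Good M \<and> ap f c \<in> elts M \<longrightarrow> \<not> (int M (H l) \<in> elts S \<and> ap g (int M (H l)) = c))"
    by (rule AC[OF R ex, of "H l"]) blast+
  have df: "Dt (\<lambda>e. ap f (e 0))" by (intro dfn)
  have a: "Lam (H l) (ap f) \<in> elts Vd" by (rule Vd_Lam[OF df]) (use tower_indexD(6)[OF l] f in auto)
  obtain M where M: "Good M" "Lam (H l) (ap f) \<in> elts M" "int M (H l) \<in> elts S"
    using S a unfolding elts_IT by blast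
  define c where "c = ap g (int M (H l))"
  have c: "c \<in> elts M" "c \<in> elts (H l)" using g(2)[OF M(3)] by (auto simp: c_def)
  have "ap f c \<in> elts M" by (rule Good_param[OF df M(1,2) c(2,1)])
  then show False using f[OF c(2)] M c_def by blast
qed

text \<open>A trace of a trace is the trace on the smaller set, so the same parameter works on both
  levels.\<close>

lemma IT_projection: assumes "l \<in> tower_index \<delta>" "l' \<in> tower_index \<delta>" "elts l \<subseteq> elts l'"
  shows "canonical_projection (I\<^sub>T l) (Z l) (I\<^sub>T l') (Z l')"
proof -
  have "elts (vset {M' \<in> elts (Z l'). int M' (H l) \<in> elts A}) = {M' \<in> elts (Z l'). int M' (H l) \<in> elts A}" for A
    by (rule elts_vset, rule small_sep) (intro dfn)
  then have eq: "vset {M' \<in> elts (Z l'). int M' (H l) \<in> elts A} \<in> elts (I\<^sub>T l') \<longleftrightarrow>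
      (\<exists>a\<in>elts Vd. \<forall>M. Good M \<and> a \<in> elts M \<longrightarrow> int M (H l) \<notin> elts A)" for A
    unfolding elts_IT using trace_Z[of _ l'] int_H[OF assms] by auto
  then show ?thesis
    unfolding canonical_projection_def elts_Union_Z vset_int
    by (intro set_eqI) (unfold mem_Collect_eq eq, rule elts_IT)
qed

text \<open>For the failure at omega_2, take for each ordinal below omega_2 the set of
  \<open>M\<close> omitting it. These sets are in the ideal by fineness and cover
  \<open>Z l\<close>, because \<open>M\<close> has size at most omega_1.\<close>

lemma IT_completeness: assumes l: "l \<in> tower_index \<delta>" shows "completeness (I\<^sub>T l) omega2"
  unfolding completeness_def
proof (intro conjI allI impI)
  show "cardinal omega2" by (rule cardinal_omega2)
  show "Union F \<in> elts (I\<^sub>T l)" if "elts F \<subseteq> elts (I\<^sub>T l) \<and> card_less F omega2" for F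
    using that IT_complete by (simp add: card_less_omega2)
  define A where "A b = sep (Z l) (\<lambda>M. b \<notin> elts M)" for b
  have dA: "Dt (\<lambda>e. A (e 0))" unfolding A_def by (intro dfn)
  have A: "elts (A b) = {M \<in> elts (Z l). b \<notin> elts M}" for b unfolding A_def by (rule elts_sep) (intro dfn)
  have sub: "elts omega2 \<subseteq> elts (H l)" using tower_indexD(4,8)[OF l] by blast
  have AI: "A b \<in> elts (I\<^sub>T l)" if "b \<in> elts omega2" for b
    using IT_fine[OF l, of b] sub that A[of b] by (metis (no_types, lifting) elts_eqI elts_vset subsetD small_elts)
  have inj: "b = c" if bc: "b \<in> elts omega2" "A b = A c" for b c
  proof -
    have "sing b \<in> elts (Z l)" using sub bc(1) card_le_sing[OF infsq_omega1] by (auto simp: elts_Z)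
    moreover have "sing b \<notin> elts (A b)" by (simp add: A)
    ultimately have "c \<in> elts (sing b)" unfolding bc(2) using A by auto
    then show ?thesis by simp
  qed
  have "Union (img omega2 A) = Z l"
  proof (rule elts_eqI, rule set_eqI, rule iffI)
    fix M assume "M \<in> elts (Union (img omega2 A))"
    then show "M \<in> elts (Z l)" by (auto simp: elts_img[OF dA] A)
  next
    fix M assume M: "M \<in> elts (Z l)"
    have "\<not> elts omega2 \<subseteq> elts M"
    proof
      assume "elts omega2 \<subseteq> elts M"
      then have "card_le omega2 M" by (rule card_le_subset)
      moreover have "card_le M omega1" using M by (simp add: elts_Z)
      ultimately show False using omega2_not_le card_le_trans by blast
    qed
    then show "M \<in> elts (Union (img omega2 A))" using M by (auto simp: elts_img[OF dA] A)
  qed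
  moreover have "card_eq (img omega2 A) omega2"
    unfolding card_eq_def
  proof
    show "card_le (img omega2 A) omega2" by (rule card_le_image[OF dA])
    show "card_le omega2 (img omega2 A)"
      by (rule card_leI[OF dA]) (use inj in \<open>auto simp: elts_img[OF dA]\<close>)
  qed
  ultimately show "\<exists>F. elts F \<subseteq> elts (I\<^sub>T l) \<and> card_eq F omega2 \<and> Union F \<notin> elts (I\<^sub>T l)"
    using IT_Z AI by (intro exI[of _ "img omega2 A"]) (auto simp: elts_img[OF dA])
qed

lemma IT_ideal: assumes l: "l \<in> tower_index \<delta>" shows "ideal (I\<^sub>T l) (Z l)"
  unfolding ideal_def
proof (intro conjI ballI allI impI)
  show "\<And>A. A \<in> elts (I\<^sub>T l) \<Longrightarrow> elts A \<subseteq> elts (Z l)" by (simp add: elts_IT)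
  show "B \<in> elts (I\<^sub>T l)" if "A \<in> elts (I\<^sub>T l)" "elts B \<subseteq> elts A" for A B
    using that unfolding elts_IT by blast
  show "Z l \<notin> elts (I\<^sub>T l)" by (rule IT_Z)
  show "Union F \<in> elts (I\<^sub>T l)" if "elts F \<subseteq> elts (I\<^sub>T l) \<and> sat (countable_f F)" for F
    using that IT_complete om_le_omega1 card_le_trans by auto
  show "vset {M \<in> elts (Z l). b \<notin> elts M} \<in> elts (I\<^sub>T l)" if "b \<in> elts (Union (Z l))" for b
    using IT_fine[OF l] that unfolding elts_Union_Z by blast
  show "\<exists>S' c. elts S' \<subseteq> elts S \<and> S' \<notin> elts (I\<^sub>T l) \<and> (\<forall>M\<in>elts S'. app g M = c)"
    if h: "elts S \<subseteq> elts (Z l) \<and> S \<notin> elts (I\<^sub>T l) \<and> func g S \<and> (\<forall>M\<in>elts S. app g M \<in> elts M)" for S g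
  proof -
    have a: "app g M = ap g M" if "M \<in> elts S" for M using func_app[OF _ that] h by blast
    obtain S' c where S: "elts S' \<subseteq> elts S" "S' \<notin> elts (I\<^sub>T l)" "\<forall>M\<in>elts S'. ap g M = c"
      using IT_normal[OF l, of S g] h a by auto
    then have "\<forall>M\<in>elts S'. app g M = c" using a by auto
    then show ?thesis using S by blast
  qed
qed

lemma tower_TI: "tower \<delta> TI"
  unfolding tower_def using func_TI IT_ideal IT_projection by (auto simp: app_TI)

lemma critical_point_TI: "critical_point \<delta> TI omega2"
  unfolding critical_point_def using IT_completeness by (auto simp: app_TI)

subsection \<open>Conditions\<close>

definition PP :: 'v where "PP = tower_poset \<delta> TI"
definition LL :: 'v where "LL = tower_order \<delta> TI"

text \<open>Conditions are studied through the good sets whose traces they contain. In this way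
  conditions of different levels speak about the same objects.\<close>

definition meets :: "'v \<Rightarrow> 'v \<Rightarrow> bool" where
  "meets M p \<longleftrightarrow> Good M \<and> int M (H (pfst p)) \<in> elts (psnd p)"

lemma D_meets [THEN D_compose2, dfn]: "D (\<lambda>e. meets (e 0) (e 1))" unfolding meets_def by (intro dfn)

lemma tower_conditions_TI: "tower_conditions \<delta> TI =
  {opair l S | l S. l \<in> tower_index \<delta> \<and> elts S \<subseteq> elts (Z l) \<and> S \<notin> elts (I\<^sub>T l)}"
  unfolding tower_conditions_def by (auto simp: app_TI)

lemma D_tower_conditions [THEN D_compose1, dfn]: "D (\<lambda>e. e 0 \<in> tower_conditions \<delta> TI)"
  unfolding tower_conditions_TI mem_Collect_eq by (intro dfn)

lemma Z_Vd: assumes "l \<in> tower_index \<delta>" shows "Z l \<in> elts Vd"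
proof -
  have "elts (Z l) \<subseteq> elts (Pow (H l))" by (auto simp: elts_Z)
  then show ?thesis using Vd_Pow[OF tower_indexD(6)[OF assms]] Vd_subset by blast
qed

lemma elts_PP: "elts PP = tower_conditions \<delta> TI"
proof -
  have "tower_conditions \<delta> TI \<subseteq> elts Vd"
    unfolding tower_conditions_TI using Vd_opair Z_Vd Vd_subset \<delta>_sub_Vd tower_indexD(1) by blast
  then have "small (tower_conditions \<delta> TI)" by (rule small_subset) (intro dfn)
  then show ?thesis unfolding PP_def tower_poset_def by simp
qed

lemma PP_iff: "p \<in> elts PP \<longleftrightarrow> (\<exists>l S. p = opair l S \<and> l \<in> tower_index \<delta> \<and> elts S \<subseteq> elts (Z l)) \<and>
  (\<forall>a\<in>elts Vd. \<exists>M. a \<in> elts M \<and> meets M p)"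
  unfolding elts_PP tower_conditions_TI elts_IT meets_def by (auto, blast+)

lemma PP_meets: "p \<in> elts PP \<Longrightarrow> a \<in> elts Vd \<Longrightarrow> \<exists>M. a \<in> elts M \<and> meets M p"
  unfolding PP_iff by blast

lemma LL_iff: "opair q p \<in> elts LL \<longleftrightarrow> q \<in> elts PP \<and> p \<in> elts PP \<and> elts (pfst p) \<subseteq> elts (pfst q) \<and>
  (\<forall>M\<in>elts (psnd q). int M (H (pfst p)) \<in> elts (psnd p))"
proof -
  define Q where "Q w \<longleftrightarrow> (\<exists>q\<in>elts PP. \<exists>p\<in>elts PP. w = opair q p \<and> elts (pfst p) \<subseteq> elts (pfst q) \<and>
    (\<forall>M\<in>elts (psnd q). int M (H (pfst p)) \<in> elts (psnd p)))" for w
  have QP: "l \<in> tower_index \<delta>" "elts S \<subseteq> elts (Z l)" if "opair l S \<in> elts PP" for l S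
    using that unfolding PP_iff by auto
  have "{opair (opair l' S') (opair l S) | l' S' l S.
     opair l' S' \<in> tower_conditions \<delta> TI \<and> opair l S \<in> tower_conditions \<delta> TI \<and>
     elts l \<subseteq> elts l' \<and> elts S' \<subseteq> {M' \<in> elts (Z l'). int M' (H l) \<in> elts S}} = {w. Q w}" (is "?A = _")
  proof (rule set_eqI, rule iffI)
    fix w assume "w \<in> ?A"
    then obtain l' S' l S where w: "w = opair (opair l' S') (opair l S)" "opair l' S' \<in> elts PP" "opair l S \<in> elts PP"
      "elts l \<subseteq> elts l'" "elts S' \<subseteq> {M' \<in> elts (Z l'). int M' (H l) \<in> elts S}" unfolding elts_PP by blast
    then have "Q w" unfolding Q_def
      by (intro bexI[of _ "opair l' S'"] bexI[of _ "opair l S"]) auto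
    then show "w \<in> {w. Q w}" by simp
  next
    fix w assume "w \<in> {w. Q w}"
    then obtain q p where w: "q \<in> elts PP" "p \<in> elts PP" "w = opair q p" "elts (pfst p) \<subseteq> elts (pfst q)"
      "\<forall>M\<in>elts (psnd q). int M (H (pfst p)) \<in> elts (psnd p)" unfolding Q_def by blast
    obtain l' S' where q: "q = opair l' S'" "elts S' \<subseteq> elts (Z l')" using w(1) unfolding PP_iff by blast
    obtain l S where p: "p = opair l S" using w(2) unfolding PP_iff by blast
    have "elts l \<subseteq> elts l'" "elts S' \<subseteq> {M' \<in> elts (Z l'). int M' (H l) \<in> elts S}" using w(4,5) q p by auto
    then show "w \<in> ?A" using w(1-3) p q(1) unfolding elts_PP by blast
  qed
  moreover have "small {w. Q w}"
  proof (rule small_Collect[of _ "cart PP PP"])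
    show "D (\<lambda>e. Q (e 0))" unfolding Q_def by (intro dfn)
  qed (auto simp: Q_def)
  ultimately have "elts LL = {w. Q w}" unfolding LL_def tower_order_def vset_int by simp
  then show ?thesis by (auto simp: Q_def)
qed

abbreviation le :: "'v \<Rightarrow> 'v \<Rightarrow> bool" where "le q p \<equiv> opair q p \<in> elts LL"

lemma le_PP: "le q p \<Longrightarrow> q \<in> elts PP" "le q p \<Longrightarrow> p \<in> elts PP" by (auto simp: LL_iff)

lemma PP_trace: assumes "p \<in> elts PP" "M \<in> elts (psnd p)" shows "elts M \<subseteq> elts (H (pfst p))"
proof -
  obtain l S where "p = opair l S" "elts S \<subseteq> elts (Z l)" using assms(1) unfolding PP_iff by blast
  then have "M \<in> elts (Z (pfst p))" using assms(2) by auto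
  then show ?thesis by (simp add: elts_Z)
qed

lemma PP_index: "p \<in> elts PP \<Longrightarrow> pfst p \<in> tower_index \<delta>"
  unfolding PP_iff by auto

lemma le_refl: assumes "p \<in> elts PP" shows "le p p"
proof -
  have "int M (H (pfst p)) = M" if "M \<in> elts (psnd p)" for M
    using PP_trace[OF assms that] by (intro elts_eqI) auto
  then show ?thesis using assms by (simp add: LL_iff)
qed

lemma le_trans: assumes "le r q" "le q p" shows "le r p"
proof -
  have "int (int M (H (pfst q))) (H (pfst p)) = int M (H (pfst p))" for M
    by (rule int_H) (use assms PP_index in \<open>auto simp: LL_iff\<close>)
  then show ?thesis using assms unfolding LL_iff by (metis (no_types, lifting) subset_trans)
qed

lemma le_meets: assumes "le q p" "meets M q" shows "meets M p"
proof -
  have "int (int M (H (pfst q))) (H (pfst p)) = int M (H (pfst p))"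
    by (rule int_H) (use assms(1) PP_index in \<open>auto simp: LL_iff\<close>)
  then show ?thesis using assms unfolding LL_iff meets_def by metis
qed

text \<open>\<open>Fr p \<psi>\<close> says that \<open>\<psi>\<close> holds almost everywhere on the condition \<open>p\<close>.\<close>

definition Fr :: "'v \<Rightarrow> ('v \<Rightarrow> bool) \<Rightarrow> bool" where
  "Fr p \<psi> \<longleftrightarrow> (\<exists>a\<in>elts Vd. \<forall>M. meets M p \<and> a \<in> elts M \<longrightarrow> \<psi> M)"

text \<open>Conditions live on a level below \<delta>, so a predicate can be built into a condition
  if traces on some level decide it.\<close>

definition bounded_pred :: "('v \<Rightarrow> bool) \<Rightarrow> bool" where
  "bounded_pred \<psi> \<longleftrightarrow> (\<exists>k\<in>tower_index \<delta>. \<forall>l\<in>tower_index \<delta>. elts k \<subseteq> elts l \<longrightarrow>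
    (\<forall>M. Good M \<longrightarrow> \<psi> (int M (H l)) = \<psi> M))"

lemma FrI: "(\<And>M. meets M p \<Longrightarrow> \<psi> M) \<Longrightarrow> Fr p \<psi>" unfolding Fr_def using Vd_emp by blast

lemma Fr_le: "Fr p \<psi> \<Longrightarrow> le q p \<Longrightarrow> Fr q \<psi>" unfolding Fr_def using le_meets by blast

lemma Fr_weaken: "Fr p \<psi> \<Longrightarrow> (\<And>M. meets M p \<Longrightarrow> \<psi> M \<Longrightarrow> \<chi> M) \<Longrightarrow> Fr p \<chi>" unfolding Fr_def by blast

lemma Fr_conj: assumes "Fr p \<psi>" "Fr p \<chi>" shows "Fr p (\<lambda>M. \<psi> M \<and> \<chi> M)"
proof -
  obtain a b where a: "a \<in> elts Vd" "\<forall>M. meets M p \<and> a \<in> elts M \<longrightarrow> \<psi> M"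
    and b: "b \<in> elts Vd" "\<forall>M. meets M p \<and> b \<in> elts M \<longrightarrow> \<chi> M" using assms unfolding Fr_def by blast
  obtain c where "c \<in> elts Vd" "\<And>M. Good M \<Longrightarrow> c \<in> elts M \<Longrightarrow> a \<in> elts M \<and> b \<in> elts M"
    by (rule Good_two[OF a(1) b(1)]) blast
  then show ?thesis using a b unfolding Fr_def meets_def by blast
qed

lemma Fr_mem: "a \<in> elts Vd \<Longrightarrow> Fr p (\<lambda>M. a \<in> elts M)" unfolding Fr_def by blast

lemma Fr_ex: assumes "p \<in> elts PP" "Fr p \<psi>" shows "\<exists>M. meets M p \<and> \<psi> M"
  using assms PP_meets unfolding Fr_def by blast

lemma Fr_not: "p \<in> elts PP \<Longrightarrow> Fr p \<psi> \<Longrightarrow> Fr p (\<lambda>M. \<not> \<psi> M) \<Longrightarrow> False"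
  using Fr_ex[OF _ Fr_conj] by blast

lemma index_max: assumes "k \<in> tower_index \<delta>" "l \<in> tower_index \<delta>"
  obtains m where "m \<in> tower_index \<delta>" "elts k \<subseteq> elts m" "elts l \<subseteq> elts m"
proof -
  have o: "Ord k" "Ord l" using assms tower_indexD(3) by auto
  have "elts k \<subseteq> elts l \<or> elts l \<subseteq> elts k" using Ord_linear[OF o] o by (auto simp: Ord_iff Trans_def)
  then show thesis using that assms by blast
qed

text \<open>Lift the condition to a level that decides \<psi> and intersect it with \<psi>; the
  assumption on \<open>Fr\<close> is the positivity of the result.\<close>

lemma strengthen: assumes p: "p \<in> elts PP" and b: "bounded_pred \<psi>" and d: "D (\<lambda>e. \<psi> (e 0))"
    and n: "\<not> Fr p (\<lambda>M. \<not> \<psi> M)"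
  obtains q where "le q p" "\<And>M. meets M q \<Longrightarrow> \<psi> M"
proof -
  obtain k where k: "k \<in> tower_index \<delta>" "\<And>l M. l \<in> tower_index \<delta> \<Longrightarrow> elts k \<subseteq> elts l \<Longrightarrow> Good M \<Longrightarrow>
      \<psi> (int M (H l)) = \<psi> M" using b unfolding bounded_pred_def by blast
  obtain m where m: "m \<in> tower_index \<delta>" "elts k \<subseteq> elts m" "elts (pfst p) \<subseteq> elts m"
    by (rule index_max[OF k(1) PP_index[OF p]])
  define S where "S = sep (Z m) (\<lambda>N. int N (H (pfst p)) \<in> elts (psnd p) \<and> \<psi> N)"
  have S: "elts S = {N \<in> elts (Z m). int N (H (pfst p)) \<in> elts (psnd p) \<and> \<psi> N}"
    unfolding S_def by (rule elts_sep) (intro dfn d)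
  have me: "meets M (opair m S) \<longleftrightarrow> meets M p \<and> \<psi> M" for M
  proof (cases "Good M")
    case True
    then show ?thesis
      using int_H[OF PP_index[OF p] m(1,3)] k(2)[OF m(1,2) True] trace_Z[OF True, of m]
      by (auto simp: meets_def S)
  qed (simp add: meets_def)
  have q: "opair m S \<in> elts PP"
    unfolding PP_iff me using n m(1) S unfolding Fr_def by blast
  then have "le (opair m S) p" unfolding LL_iff using p m(3) S by auto
  then show thesis using that me by blast
qed

lemma not_Fr: assumes p: "p \<in> elts PP" and b: "bounded_pred \<psi>" and d: "D (\<lambda>e. \<psi> (e 0))" and n: "\<not> Fr p \<psi>"
  obtains q where "le q p" "\<And>M. meets M q \<Longrightarrow> \<not> \<psi> M"
proof -
  have "bounded_pred (\<lambda>M. \<not> \<psi> M)" using b unfolding bounded_pred_def by simp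
  moreover have "D (\<lambda>e. \<not> \<psi> (e 0))" by (intro dfn d)
  ultimately show thesis using strengthen[OF p, of "\<lambda>M. \<not> \<psi> M"] n that by auto
qed

text \<open>A failure would give a condition below \<open>p\<close> at which \<psi> fails for every
  set meeting it, and no extension could repair this.\<close>

lemma Fr_dense: assumes p: "p \<in> elts PP" and b: "bounded_pred \<psi>" and d: "D (\<lambda>e. \<psi> (e 0))"
    and dn: "\<And>q. le q p \<Longrightarrow> \<exists>r. le r q \<and> Fr r \<psi>"
  shows "Fr p \<psi>"
proof (rule ccontr)
  assume "\<not> Fr p \<psi>"
  then obtain q where q: "le q p" "\<And>M. meets M q \<Longrightarrow> \<not> \<psi> M" by (rule not_Fr[OF p b d]) blast
  obtain r where r: "le r q" "Fr r \<psi>" using dn[OF q(1)] by blast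
  have "Fr r (\<lambda>M. \<not> \<psi> M)" by (rule FrI) (use q(2) le_meets[OF r(1)] in blast)
  then show False using Fr_not le_PP(1)[OF r(1)] r(2) by blast
qed

text \<open>Normality in terms of \<open>Fr\<close>: if every \<chi> \<open>c\<close> failed almost
  everywhere on \<open>p\<close>, the witnessing parameters could be collected in one function. The
  requirement that \<open>c\<close> be in \<open>M\<close> lets \<open>M\<close> recover the
  parameter for \<open>c\<close>.\<close>

lemma press_down: assumes p: "p \<in> elts PP" and x: "x \<in> elts Vd"
    and b: "\<And>c. c \<in> elts x \<Longrightarrow> bounded_pred (\<chi> c)" and d: "D (\<lambda>e. \<chi> (e 0) (e 1))"
    and F: "Fr p (\<lambda>M. \<exists>c\<in>elts x. c \<in> elts M \<and> \<chi> c M)"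
  obtains c q where "c \<in> elts x" "le q p" "\<And>M. meets M q \<Longrightarrow> \<chi> c M"
proof (rule ccontr)
  assume n: "\<not> thesis"
  note thesisI = that
  have dc: "D (\<lambda>e. \<chi> c (e 0))" for c by (intro dfn D_compose2[OF d])
  have R: "D (\<lambda>e. \<forall>M. meets M p \<and> e 1 \<in> elts M \<longrightarrow> \<not> \<chi> (e 0) M)" by (intro dfn D_compose2[OF d])
  have ex: "\<exists>a\<in>elts Vd. \<forall>M. meets M p \<and> a \<in> elts M \<longrightarrow> \<not> \<chi> c M" if c: "c \<in> elts x" for c
  proof (rule ccontr)
    assume "\<not> ?thesis"
    then have "\<not> Fr p (\<lambda>M. \<not> \<chi> c M)" unfolding Fr_def by blast
    then obtain q where "le q p" "\<And>M. meets M q \<Longrightarrow> \<chi> c M" by (rule strengthen[OF p b[OF c] dc]) blast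
    then show False using n thesisI c by blast
  qed
  obtain f where f: "\<And>c. c \<in> elts x \<Longrightarrow> ap f c \<in> elts Vd \<and> (\<forall>M. meets M p \<and> ap f c \<in> elts M \<longrightarrow> \<not> \<chi> c M)"
    by (rule AC[OF R ex]) blast+
  have df: "Dt (\<lambda>e. ap f (e 0))" by (intro dfn)
  have a: "Lam x (ap f) \<in> elts Vd" by (rule Vd_Lam[OF df x]) (use f in blast)
  obtain M where M: "meets M p" "\<exists>c\<in>elts x. c \<in> elts M \<and> \<chi> c M" "Lam x (ap f) \<in> elts M"
    using Fr_ex[OF p Fr_conj[OF F Fr_mem[OF a]]] by blast
  then obtain c where c: "c \<in> elts x" "c \<in> elts M" "\<chi> c M" by blast
  have "ap f c \<in> elts M" by (rule Good_param[OF df _ M(3) c(1,2)]) (use M(1) in \<open>simp add: meets_def\<close>)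
  then show False using f[OF c(1)] M(1) c(3) by blast
qed

lemma PP_nonempty: obtains p where "p \<in> elts PP"
proof -
  obtain l where l: "l \<in> tower_index \<delta>" by (rule tower_index_above[OF om_\<delta>])
  have "opair l (Z l) \<in> elts PP" unfolding elts_PP tower_conditions_TI using l IT_Z by blast
  then show thesis by (rule that)
qed

end

section \<open>The forcing relation\<close>

text \<open>The forcing theorems are proved for an arbitrary preorder and are later transferred to
  the tower poset by a sublocale.\<close>

locale zfc_forcing = zfc E for E :: "'v \<Rightarrow> 'v \<Rightarrow> bool" +
  fixes P L :: 'v
  assumes L_field: "opair q p \<in> elts L \<Longrightarrow> q \<in> elts P \<and> p \<in> elts P"
    and L_refl: "p \<in> elts P \<Longrightarrow> opair p p \<in> elts L"
    and L_trans: "opair r q \<in> elts L \<Longrightarrow> opair q p \<in> elts L \<Longrightarrow> opair r p \<in> elts L"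
begin

abbreviation bl :: "'v \<Rightarrow> 'v set" where "bl p \<equiv> below P L p"

lemma bl_iff: "q \<in> bl p \<longleftrightarrow> opair q p \<in> elts L"
  using L_field by (auto simp: below_def)

lemma bl_P: "q \<in> bl p \<Longrightarrow> q \<in> elts P" "q \<in> bl p \<Longrightarrow> p \<in> elts P" using L_field by (auto simp: bl_iff)
lemma bl_refl: "p \<in> elts P \<Longrightarrow> p \<in> bl p" by (simp add: bl_iff L_refl)
lemma bl_trans: "r \<in> bl q \<Longrightarrow> q \<in> bl p \<Longrightarrow> r \<in> bl p" using L_trans by (simp add: bl_iff)

lemma D_bl [THEN D_compose2, dfn]: "D (\<lambda>e. e 0 \<in> bl (e 1))" unfolding bl_iff by (intro dfn)

lemma Ball_bl: "(\<forall>q\<in>bl p. \<phi> q) \<longleftrightarrow> (\<forall>q. q \<in> bl p \<longrightarrow> \<phi> q)" by blast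
lemma Bex_bl: "(\<exists>q\<in>bl p. \<phi> q) \<longleftrightarrow> (\<exists>q. q \<in> bl p \<and> \<phi> q)" by blast

lemma D_Ball_bl [dfn]: "Dt t \<Longrightarrow> D (\<lambda>e. \<phi> (e 0) (\<lambda>n. e (Suc n))) \<Longrightarrow> D (\<lambda>e. \<forall>q\<in>bl (t e). \<phi> q e)"
  unfolding Ball_bl by (rule D_All, rule D_imp, rule D_bl, rule Dt_var, erule Dt_shift)
lemma D_Bex_bl [dfn]: "Dt t \<Longrightarrow> D (\<lambda>e. \<phi> (e 0) (\<lambda>n. e (Suc n))) \<Longrightarrow> D (\<lambda>e. \<exists>q\<in>bl (t e). \<phi> q e)"
  unfolding Bex_bl by (rule D_Ex, rule D_conj, rule D_bl, rule Dt_var, erule Dt_shift)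

lemma D_name_closed [THEN D_compose1, dfn]: "D (\<lambda>e. name_closed P (e 0))"
  unfolding name_closed_def by (intro dfn)

lemma D_name [THEN D_compose1, dfn]: "D (\<lambda>e. name P (e 0))"
  unfolding name_def by (intro dfn)

lemma name_dom_iff: "c \<in> name_dom a \<longleftrightarrow> (\<exists>s. opair c s \<in> elts a)"
  by (simp add: name_dom_def)

lemma forcing_table_iff: "forcing_table P L N Q M \<longleftrightarrow>
    name_closed P N \<and>
    (\<forall>p \<in> elts P. \<forall>a \<in> elts N. \<forall>b \<in> elts N.
      (opair p (opair a b) \<in> elts Q \<longleftrightarrow>
        (\<forall>c. (\<exists>s. opair c s \<in> elts a) \<or> (\<exists>s. opair c s \<in> elts b) \<longrightarrow> (\<forall>q \<in> bl p.
          opair q (opair c a) \<in> elts M \<longleftrightarrow> opair q (opair c b) \<in> elts M))) \<and>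
      (opair p (opair a b) \<in> elts M \<longleftrightarrow>
        (\<forall>q \<in> bl p. \<exists>r \<in> bl q. \<exists>c s.
          opair c s \<in> elts b \<and> r \<in> bl s \<and> opair r (opair a c) \<in> elts Q)))"
  unfolding forcing_table_def by (simp add: Ball_def Un_iff name_dom_iff)

lemma tableD: assumes "forcing_table P L N Q M"
  shows "name_closed P N"
    and "p \<in> elts P \<Longrightarrow> a \<in> elts N \<Longrightarrow> b \<in> elts N \<Longrightarrow> opair p (opair a b) \<in> elts Q \<longleftrightarrow>
        (\<forall>c. (\<exists>s. opair c s \<in> elts a) \<or> (\<exists>s. opair c s \<in> elts b) \<longrightarrow> (\<forall>q \<in> bl p.
          opair q (opair c a) \<in> elts M \<longleftrightarrow> opair q (opair c b) \<in> elts M))"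
    and "p \<in> elts P \<Longrightarrow> a \<in> elts N \<Longrightarrow> b \<in> elts N \<Longrightarrow> opair p (opair a b) \<in> elts M \<longleftrightarrow>
        (\<forall>q \<in> bl p. \<exists>r \<in> bl q. \<exists>c s. opair c s \<in> elts b \<and> r \<in> bl s \<and> opair r (opair a c) \<in> elts Q)"
proof -
  note t = assms[unfolded forcing_table_iff]
  show "name_closed P N" by (rule t[THEN conjunct1])
  show "p \<in> elts P \<Longrightarrow> a \<in> elts N \<Longrightarrow> b \<in> elts N \<Longrightarrow> opair p (opair a b) \<in> elts Q \<longleftrightarrow>
        (\<forall>c. (\<exists>s. opair c s \<in> elts a) \<or> (\<exists>s. opair c s \<in> elts b) \<longrightarrow> (\<forall>q \<in> bl p.
          opair q (opair c a) \<in> elts M \<longleftrightarrow> opair q (opair c b) \<in> elts M))"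
    by (rule t[THEN conjunct2, THEN bspec, THEN bspec, THEN bspec, THEN conjunct1])
  show "p \<in> elts P \<Longrightarrow> a \<in> elts N \<Longrightarrow> b \<in> elts N \<Longrightarrow> opair p (opair a b) \<in> elts M \<longleftrightarrow>
        (\<forall>q \<in> bl p. \<exists>r \<in> bl q. \<exists>c s. opair c s \<in> elts b \<and> r \<in> bl s \<and> opair r (opair a c) \<in> elts Q)"
    by (rule t[THEN conjunct2, THEN bspec, THEN bspec, THEN bspec, THEN conjunct2])
qed

lemma D_force_eq: "D (\<lambda>e. force_eq P L (e 0) (e 1) (e 2))"
  unfolding force_eq_def forcing_table_iff by (intro dfn)
lemma D_force_mem: "D (\<lambda>e. force_mem P L (e 0) (e 1) (e 2))"
  unfolding force_mem_def forcing_table_iff by (intro dfn)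

lemmas [dfn] = D_compose3[OF D_force_eq] D_compose3[OF D_force_mem]

lemma name_closedD: "name_closed P N \<Longrightarrow> a \<in> elts N \<Longrightarrow> opair c s \<in> elts a \<Longrightarrow> c \<in> elts N \<and> s \<in> elts P"
  unfolding name_closed_def by fastforce

lemma rk_mem: "y \<in> elts x \<Longrightarrow> rk y \<in> elts (rk x)"
  unfolding elts_rk[of x] by blast

lemma rk_dom: assumes "opair c s \<in> elts a" shows "rk c \<in> elts (rk a)"
proof -
  have "c \<in> elts (vset {c, s})" "vset {c, s} \<in> elts (opair c s)" by (simp_all add: opair_def)
  then have "rk c \<in> elts (rk (vset {c, s}))" "rk (vset {c, s}) \<in> elts (rk (opair c s))" "rk (opair c s) \<in> elts (rk a)"
    using assms rk_mem by blast+
  then show ?thesis using Ord_trans[OF Ord_rk] by blast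
qed

text \<open>The maximum of the ranks. Equality of \<open>a\<close> and \<open>b\<close> refers to
  membership of their elements \<open>c\<close> in them, and that refers to equality of
  \<open>c\<close> with elements \<open>d\<close>. Two steps bring both ranks below the maximum, so
  recursion on it handles equality with membership eliminated.\<close>

definition sg :: "'v \<Rightarrow> 'v \<Rightarrow> 'v" where "sg a b = un (rk a) (rk b)"

lemma Dt_sg [THEN Dt_compose2, dfn]: "Dt (\<lambda>e. sg (e 0) (e 1))" unfolding sg_def by (intro dfn)

lemma un_Ord: assumes "Ord a" "Ord b" shows "un a b = a \<or> un a b = b"
proof -
  have "elts a \<subseteq> elts b \<or> elts b \<subseteq> elts a" using Ord_linear[OF assms] assms by (auto simp: Ord_iff Trans_def)
  then show ?thesis by (auto simp: elts_inject[symmetric])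
qed

lemma sg_less: assumes "rk c \<in> elts (sg a b)" "rk d \<in> elts (sg a b)" shows "sg c d \<in> elts (sg a b)"
  using un_Ord[OF Ord_rk Ord_rk, of c d] assms unfolding sg_def[of c d] by metis

lemma sg_dom: "opair c s \<in> elts a \<or> opair c s \<in> elts b \<Longrightarrow> rk c \<in> elts (sg a b)"
  using rk_dom unfolding sg_def by auto

section \<open>Uniqueness and existence of the forcing recursion\<close>

lemma table_unique:
  assumes t: "forcing_table P L N Q M" "forcing_table P L N' Q' M'"
  shows "a \<in> elts N \<Longrightarrow> a \<in> elts N' \<Longrightarrow> b \<in> elts N \<Longrightarrow> b \<in> elts N' \<Longrightarrow> p \<in> elts P \<Longrightarrow>
    (opair p (opair a b) \<in> elts Q \<longleftrightarrow> opair p (opair a b) \<in> elts Q') \<and>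
    (opair p (opair a b) \<in> elts M \<longleftrightarrow> opair p (opair a b) \<in> elts M')"
proof -
  define X where "X a \<longleftrightarrow> a \<in> elts N \<and> a \<in> elts N'" for a
  have X: "X c \<and> s \<in> elts P" if "X a" "opair c s \<in> elts a" for a c s
    using that name_closedD[OF tableD(1)[OF t(1)]] name_closedD[OF tableD(1)[OF t(2)]] unfolding X_def by blast
  have Q: "opair p (opair a b) \<in> elts Q \<longleftrightarrow> (\<forall>c. (\<exists>s. opair c s \<in> elts a) \<or> (\<exists>s. opair c s \<in> elts b) \<longrightarrow> (\<forall>q \<in> bl p.
          opair q (opair c a) \<in> elts M \<longleftrightarrow> opair q (opair c b) \<in> elts M))"
    "opair p (opair a b) \<in> elts Q' \<longleftrightarrow> (\<forall>c. (\<exists>s. opair c s \<in> elts a) \<or> (\<exists>s. opair c s \<in> elts b) \<longrightarrow> (\<forall>q \<in> bl p.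
          opair q (opair c a) \<in> elts M' \<longleftrightarrow> opair q (opair c b) \<in> elts M'))"
    if "X a" "X b" "p \<in> elts P" for a b p
    using that unfolding X_def by (intro tableD(2)[OF t(1)] tableD(2)[OF t(2)]; blast)+
  have M: "opair p (opair a b) \<in> elts M \<longleftrightarrow> (\<forall>q \<in> bl p. \<exists>r \<in> bl q. \<exists>c s.
          opair c s \<in> elts b \<and> r \<in> bl s \<and> opair r (opair a c) \<in> elts Q)"
    "opair p (opair a b) \<in> elts M' \<longleftrightarrow> (\<forall>q \<in> bl p. \<exists>r \<in> bl q. \<exists>c s.
          opair c s \<in> elts b \<and> r \<in> bl s \<and> opair r (opair a c) \<in> elts Q')"
    if "X a" "X b" "p \<in> elts P" for a b p
    using that unfolding X_def by (intro tableD(3)[OF t(1)] tableD(3)[OF t(2)]; blast)+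
  \<comment> \<open>The induction concerns equality alone; agreement on membership follows by one
    use of its clause.\<close>
  have Qeq: "\<forall>a b. a \<in> elts N \<and> a \<in> elts N' \<longrightarrow> b \<in> elts N \<and> b \<in> elts N' \<longrightarrow> sg a b = z \<longrightarrow>
      (\<forall>p\<in>elts P. opair p (opair a b) \<in> elts Q \<longleftrightarrow> opair p (opair a b) \<in> elts Q')" for z
  proof (induction z rule: eps_induct)
    show "D (\<lambda>e. \<forall>a b. a \<in> elts N \<and> a \<in> elts N' \<longrightarrow> b \<in> elts N \<and> b \<in> elts N' \<longrightarrow> sg a b = e 0 \<longrightarrow>
      (\<forall>p\<in>elts P. opair p (opair a b) \<in> elts Q \<longleftrightarrow> opair p (opair a b) \<in> elts Q'))" by (intro dfn)
  next
    case (step z)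
    show ?case
    proof (intro allI impI ballI)
      fix a b p assume ab: "a \<in> elts N \<and> a \<in> elts N'" "b \<in> elts N \<and> b \<in> elts N'" "sg a b = z" and p: "p \<in> elts P"
      have Xab: "X a" "X b" using ab by (auto simp: X_def)
      have IH: "opair r (opair c d) \<in> elts Q \<longleftrightarrow> opair r (opair c d) \<in> elts Q'"
        if "X c" "X d" "rk c \<in> elts z" "rk d \<in> elts z" "r \<in> elts P" for c d r
        using step[of "sg c d"] sg_less[of c a b d] that ab(3) by (auto simp: X_def)
      have "opair q (opair c x) \<in> elts M \<longleftrightarrow> opair q (opair c x) \<in> elts M'"
        if c: "(\<exists>s. opair c s \<in> elts a) \<or> (\<exists>s. opair c s \<in> elts b)" and x: "x = a \<or> x = b" and q: "q \<in> bl p" for c x q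
      proof -
        have Xc: "X c" "X x" using c x X Xab by blast+
        have rc: "rk c \<in> elts z" using c sg_dom ab(3) by blast
        have "opair r (opair c d) \<in> elts Q \<longleftrightarrow> opair r (opair c d) \<in> elts Q'"
          if d: "opair d s \<in> elts x" and r: "r \<in> bl s" for d s r
          by (rule IH) (use Xc X[OF Xc(2) d] rc d x sg_dom ab(3) bl_P(1)[OF r] in auto)
        then show ?thesis unfolding M[OF Xc bl_P(1)[OF q]] by blast
      qed
      then show "opair p (opair a b) \<in> elts Q \<longleftrightarrow> opair p (opair a b) \<in> elts Q'"
        unfolding Q[OF Xab p] by blast
    qed
  qed
  assume a: "a \<in> elts N" "a \<in> elts N'" "b \<in> elts N" "b \<in> elts N'" "p \<in> elts P"
  have Xab: "X a" "X b" using a by (auto simp: X_def)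
  have "opair r (opair a c) \<in> elts Q \<longleftrightarrow> opair r (opair a c) \<in> elts Q'" if "opair c s \<in> elts b" "r \<in> bl s" for r c s
    using Qeq X[OF Xab(2) that(1)] a bl_P(1)[OF that(2)] by (auto simp: X_def)
  then show ?thesis using Qeq a unfolding M[OF Xab a(5)] by blast
qed

lemma table_ex: assumes N: "name_closed P N" shows "\<exists>Q M. forcing_table P L N Q M"
proof -
  define mm where "mm R q c a \<longleftrightarrow> (\<forall>q'\<in>bl q. \<exists>r\<in>bl q'. \<exists>d s. opair d s \<in> elts a \<and> r \<in> bl s \<and> opair r (opair c d) \<in> elts R)"
    for R q c a
  have dmm0: "D (\<lambda>e. mm (e 0) (e 1) (e 2) (e 3))" unfolding mm_def by (intro dfn)
  define qq where "qq R p a b \<longleftrightarrow> (\<forall>c. (\<exists>s. opair c s \<in> elts a) \<or> (\<exists>s. opair c s \<in> elts b) \<longrightarrow>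
      (\<forall>q\<in>bl p. mm R q c a \<longleftrightarrow> mm R q c b))" for R p a b
  \<comment> \<open>Layer \<open>T z\<close> records the equalities between pairs of maximal rank
    \<open>z\<close>; the union over \<open>z\<close> collects the earlier layers, from which
    \<open>mm\<close> computes membership.\<close>
  define T where "T = rec (\<lambda>z f. sep (cart P (cart N N)) (\<lambda>u. sg (pfst (psnd u)) (psnd (psnd u)) = z \<and>
      qq (Union (img z (\<lambda>y. ap f y))) (pfst u) (pfst (psnd u)) (psnd (psnd u))))"
  have dG: "Dt (\<lambda>e. sep (cart P (cart N N)) (\<lambda>u. sg (pfst (psnd u)) (psnd (psnd u)) = e 0 \<and>
      qq (Union (img (e 0) (\<lambda>y. ap (e 1) y))) (pfst u) (pfst (psnd u)) (psnd (psnd u))))"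
    unfolding qq_def mm_def by (intro dfn)
  have dT: "Dt (\<lambda>e. T (e 0))" unfolding T_def qq_def mm_def by (intro dfn)
  have dqq: "D (\<lambda>e. sg (pfst (psnd (e 0))) (psnd (psnd (e 0))) = z \<and>
      qq R (pfst (e 0)) (pfst (psnd (e 0))) (psnd (psnd (e 0))))" for z R
    unfolding qq_def mm_def by (intro dfn)
  have T: "opair p (opair a b) \<in> elts (T z) \<longleftrightarrow> p \<in> elts P \<and> a \<in> elts N \<and> b \<in> elts N \<and> sg a b = z \<and>
      qq (Union (img z T)) p a b" for p a b z
  proof -
    have dd: "Dt (\<lambda>e. ap (Lam z T) (e 0))" by (intro dfn Dt_compose1[OF dT])
    have "img z (\<lambda>y. ap (Lam z T) y) = img z T"
      by (intro elts_eqI) (auto simp: elts_img[OF dd] elts_img[OF dT] ap_Lam[OF dT])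
    then have "T z = sep (cart P (cart N N)) (\<lambda>u. sg (pfst (psnd u)) (psnd (psnd u)) = z \<and>
      qq (Union (img z T)) (pfst u) (pfst (psnd u)) (psnd (psnd u)))"
      using rec_unfold[OF dG, of z] unfolding T_def[symmetric] by simp
    then show ?thesis by (auto simp: elts_sep[OF dqq])
  qed
  define Q where "Q = sep (cart P (cart N N)) (\<lambda>u. u \<in> elts (T (sg (pfst (psnd u)) (psnd (psnd u)))))"
  have Q: "opair p (opair a b) \<in> elts Q \<longleftrightarrow> opair p (opair a b) \<in> elts (T (sg a b))" for p a b
    unfolding Q_def by (subst elts_sep) (intro dfn Dt_compose1[OF dT], auto simp: T)
  have QU: "opair r (opair c d) \<in> elts (Union (img z T)) \<longleftrightarrow> opair r (opair c d) \<in> elts Q"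
    if "sg c d \<in> elts z" for r c d z
    using that unfolding Q elts_Union elts_img[OF dT] by (auto simp: T)
  define M where "M = sep (cart P (cart N N)) (\<lambda>u. mm Q (pfst u) (pfst (psnd u)) (psnd (psnd u)))"
  have M: "opair p (opair a b) \<in> elts M \<longleftrightarrow> p \<in> elts P \<and> a \<in> elts N \<and> b \<in> elts N \<and> mm Q p a b" for p a b
    unfolding M_def by (subst elts_sep) (unfold mm_def, intro dfn, auto)
  have mmQ: "mm (Union (img (sg a b) T)) q c x = mm Q q c x"
    if c: "(\<exists>s. opair c s \<in> elts a) \<or> (\<exists>s. opair c s \<in> elts b)" and x: "x = a \<or> x = b" for a b c x q
  proof -
    have "sg c d \<in> elts (sg a b)" if "opair d s \<in> elts x" for d s
      by (rule sg_less) (use that c x sg_dom in blast)+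
    then show ?thesis unfolding mm_def using QU by blast
  qed
  have "forcing_table P L N Q M"
    unfolding forcing_table_iff
  proof (intro conjI ballI N)
    fix p a b assume h: "p \<in> elts P" "a \<in> elts N" "b \<in> elts N"
    have "opair p (opair a b) \<in> elts Q \<longleftrightarrow> qq (Union (img (sg a b) T)) p a b" unfolding Q T using h by blast
    also have "\<dots> \<longleftrightarrow> (\<forall>c. (\<exists>s. opair c s \<in> elts a) \<or> (\<exists>s. opair c s \<in> elts b) \<longrightarrow>
        (\<forall>q \<in> bl p. mm Q q c a \<longleftrightarrow> mm Q q c b))" unfolding qq_def using mmQ by blast
    also have "\<dots> \<longleftrightarrow> (\<forall>c. (\<exists>s. opair c s \<in> elts a) \<or> (\<exists>s. opair c s \<in> elts b) \<longrightarrow>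
        (\<forall>q \<in> bl p. opair q (opair c a) \<in> elts M \<longleftrightarrow> opair q (opair c b) \<in> elts M))"
      unfolding M using bl_P(1) name_closedD[OF N h(2)] name_closedD[OF N h(3)] h by blast
    finally show "opair p (opair a b) \<in> elts Q \<longleftrightarrow> (\<forall>c. (\<exists>s. opair c s \<in> elts a) \<or> (\<exists>s. opair c s \<in> elts b) \<longrightarrow>
        (\<forall>q \<in> bl p. opair q (opair c a) \<in> elts M \<longleftrightarrow> opair q (opair c b) \<in> elts M))" .
    show "opair p (opair a b) \<in> elts M \<longleftrightarrow> (\<forall>q \<in> bl p. \<exists>r \<in> bl q. \<exists>c s.
          opair c s \<in> elts b \<and> r \<in> bl s \<and> opair r (opair a c) \<in> elts Q)"
      unfolding M using h by (simp add: mm_def)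
  qed
  then show ?thesis by blast
qed

abbreviation nm :: "'v \<Rightarrow> bool" where "nm \<equiv> name P"
abbreviation FE :: "'v \<Rightarrow> 'v \<Rightarrow> 'v \<Rightarrow> bool" where "FE p a b \<equiv> force_eq P L a b p"
abbreviation FM :: "'v \<Rightarrow> 'v \<Rightarrow> 'v \<Rightarrow> bool" where "FM p a b \<equiv> force_mem P L a b p"

lemma common_table: assumes "nm a" "nm b"
  obtains N Q M where "forcing_table P L N Q M" "a \<in> elts N" "b \<in> elts N"
proof -
  obtain N1 N2 where N: "name_closed P N1" "a \<in> elts N1" "name_closed P N2" "b \<in> elts N2"
    using assms unfolding name_def by blast
  have "name_closed P (un N1 N2)" using N unfolding name_closed_def elts_un by blast
  then obtain Q M where "forcing_table P L (un N1 N2) Q M" using table_ex by blast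
  then show thesis using that N by auto
qed

lemma table_FE: assumes "forcing_table P L N Q M" "a \<in> elts N" "b \<in> elts N" "p \<in> elts P"
  shows "FE p a b \<longleftrightarrow> opair p (opair a b) \<in> elts Q" "FM p a b \<longleftrightarrow> opair p (opair a b) \<in> elts M"
  unfolding force_eq_def force_mem_def using table_unique[OF assms(1) _ assms(2) _ assms(3) _ assms(4)] assms by blast+

lemma nm_dom: assumes "nm a" "opair c s \<in> elts a" shows "nm c" "s \<in> elts P"
  using assms name_closedD unfolding name_def by blast+

lemma FE_iff: assumes "nm a" "nm b" "p \<in> elts P"
  shows "FE p a b \<longleftrightarrow> (\<forall>c. (\<exists>s. opair c s \<in> elts a) \<or> (\<exists>s. opair c s \<in> elts b) \<longrightarrow> (\<forall>q\<in>bl p. FM q c a \<longleftrightarrow> FM q c b))"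
proof -
  obtain N Q M where t: "forcing_table P L N Q M" "a \<in> elts N" "b \<in> elts N" by (rule common_table[OF assms(1,2)])
  have N: "name_closed P N" using t by (simp add: forcing_table_iff)
  have "FM q c a = (opair q (opair c a) \<in> elts M)" "FM q c b = (opair q (opair c b) \<in> elts M)"
    if "(\<exists>s. opair c s \<in> elts a) \<or> (\<exists>s. opair c s \<in> elts b)" "q \<in> bl p" for c q
    using table_FE(2)[OF t(1) _ t(2) bl_P(1)[OF that(2)]] table_FE(2)[OF t(1) _ t(3) bl_P(1)[OF that(2)]]
      that(1) name_closedD[OF N] t(2,3) by blast+
  then show ?thesis unfolding table_FE(1)[OF t assms(3)] tableD(2)[OF t(1) assms(3) t(2,3)] by blast
qed

lemma FM_iff: assumes "nm a" "nm b" "p \<in> elts P"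
  shows "FM p a b \<longleftrightarrow> (\<forall>q\<in>bl p. \<exists>r\<in>bl q. \<exists>c s. opair c s \<in> elts b \<and> r \<in> bl s \<and> FE r a c)"
proof -
  obtain N Q M where t: "forcing_table P L N Q M" "a \<in> elts N" "b \<in> elts N" by (rule common_table[OF assms(1,2)])
  have N: "name_closed P N" using t by (simp add: forcing_table_iff)
  have "FE r a c = (opair r (opair a c) \<in> elts Q)" if "opair c s \<in> elts b" "r \<in> bl s" for c s r
    using table_FE(1)[OF t(1,2) _ bl_P(1)[OF that(2)]] name_closedD[OF N t(3) that(1)] by blast
  then show ?thesis unfolding table_FE(2)[OF t assms(3)] tableD(3)[OF t(1) assms(3) t(2,3)] by blast
qed

lemma FM_below: "nm a \<Longrightarrow> nm b \<Longrightarrow> FM p a b \<Longrightarrow> q \<in> bl p \<Longrightarrow> FM q a b"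
  using FM_iff bl_P bl_trans by (smt (verit, best))

lemma FE_below: "nm a \<Longrightarrow> nm b \<Longrightarrow> FE p a b \<Longrightarrow> q \<in> bl p \<Longrightarrow> FE q a b"
  using FE_iff bl_P bl_trans by (smt (verit, best))

lemma FM_dense: assumes "nm a" "nm b" "p \<in> elts P" "\<And>q. q \<in> bl p \<Longrightarrow> \<exists>r\<in>bl q. FM r a b" shows "FM p a b"
  unfolding FM_iff[OF assms(1-3)]
proof
  fix q assume "q \<in> bl p"
  then obtain r where r: "r \<in> bl q" "FM r a b" using assms(4) by blast
  then obtain r' c s where "r' \<in> bl r" "opair c s \<in> elts b" "r' \<in> bl s" "FE r' a c"
    using FM_iff[OF assms(1,2) bl_P(1)[OF r(1)]] bl_refl[OF bl_P(1)[OF r(1)]] by blast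
  then show "\<exists>r\<in>bl q. \<exists>c s. opair c s \<in> elts b \<and> r \<in> bl s \<and> FE r a c" using r(1) bl_trans by blast
qed

section \<open>Forced equality as a congruence\<close>

lemma FE_refl: "nm a \<Longrightarrow> p \<in> elts P \<Longrightarrow> FE p a a" by (simp add: FE_iff)

lemma FE_sym: "nm a \<Longrightarrow> nm b \<Longrightarrow> p \<in> elts P \<Longrightarrow> FE p a b \<Longrightarrow> FE p b a"
  by (auto simp: FE_iff)

lemma FM_dom: assumes "nm b" "opair c s \<in> elts b" "r \<in> bl s" shows "FM r c b"
proof -
  have c: "nm c" using nm_dom assms by blast
  have "\<exists>r\<in>bl q. \<exists>c' s. opair c' s \<in> elts b \<and> r \<in> bl s \<and> FE r c c'" if "q \<in> bl r" for q
    using assms FE_refl[OF c bl_P(1)[OF that]] bl_trans[OF that assms(3)] bl_refl[OF bl_P(1)[OF that]] by blast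
  then show ?thesis using FM_iff[OF c assms(1) bl_P(1)[OF assms(3)]] by blast
qed

lemma FE_dense: assumes "nm a" "nm b" "p \<in> elts P" "\<And>q. q \<in> bl p \<Longrightarrow> \<exists>r\<in>bl q. FE r a b" shows "FE p a b"
proof -
  have "FM q c a = FM q c b" if c: "(\<exists>s. opair c s \<in> elts a) \<or> (\<exists>s. opair c s \<in> elts b)" and q: "q \<in> bl p" for c q
  proof -
    have nc: "nm c" using c nm_dom assms by blast
    have "\<exists>r\<in>bl q1. FM r c a = FM r c b" if q1: "q1 \<in> bl q" for q1
    proof -
      obtain r where r: "r \<in> bl q1" "FE r a b" using assms(4)[OF bl_trans[OF q1 q]] by blast
      then show ?thesis using FE_iff[OF assms(1,2) bl_P(1)[OF r(1)]] c bl_refl[OF bl_P(1)[OF r(1)]] by blast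
    qed
    then show ?thesis
      using FM_dense[OF nc assms(1) bl_P(1)[OF q]] FM_dense[OF nc assms(2) bl_P(1)[OF q]]
        FM_below[OF nc assms(1)] FM_below[OF nc assms(2)] bl_trans by meson
  qed
  then show ?thesis unfolding FE_iff[OF assms(1-3)] by blast
qed

lemma FM_E: assumes "nm a" "nm b" "FM p a b" "q \<in> bl p"
  obtains r c s where "r \<in> bl q" "opair c s \<in> elts b" "nm c" "r \<in> bl s" "FE r a c" "FM r c b"
proof -
  obtain r c s where r: "r \<in> bl q" "opair c s \<in> elts b" "r \<in> bl s" "FE r a c"
    using FM_iff[OF assms(1,2) bl_P(2)[OF assms(4)]] assms by blast
  then show thesis using that nm_dom[OF assms(2)] FM_dom[OF assms(2)] by blast
qed

text \<open>Induction on a bound for all three ranks. Below suitable conditions an element of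
  \<open>a\<close> equals one of \<open>b\<close>, which equals one of \<open>c\<close>; these
  equalities concern names of smaller rank, for which transitivity is already available.\<close>

lemma FE_trans: assumes "nm a" "nm b" "nm c" "p \<in> elts P" "FE p a b" "FE p b c" shows "FE p a c"
proof -
  have "\<forall>a b c. rk a \<in> elts z \<longrightarrow> rk b \<in> elts z \<longrightarrow> rk c \<in> elts z \<longrightarrow> nm a \<longrightarrow> nm b \<longrightarrow> nm c \<longrightarrow>
      (\<forall>p\<in>elts P. FE p a b \<longrightarrow> FE p b c \<longrightarrow> FE p a c)" for z
  proof (induction z rule: eps_induct)
    show "D (\<lambda>e. \<forall>a b c. rk a \<in> elts (e 0) \<longrightarrow> rk b \<in> elts (e 0) \<longrightarrow> rk c \<in> elts (e 0) \<longrightarrow> nm a \<longrightarrow> nm b \<longrightarrow> nm c \<longrightarrow>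
      (\<forall>p\<in>elts P. FE p a b \<longrightarrow> FE p b c \<longrightarrow> FE p a c))" by (intro dfn)
  next
    case (step z)
    have half: "FM q x c" if
      abc: "rk a \<in> elts z" "rk b \<in> elts z" "rk c \<in> elts z" "nm a" "nm b" "nm c" and
      F: "FE p a b" "FE p b c" "p \<in> elts P" "q \<in> bl p" and
      x: "nm x" "(\<exists>s. opair x s \<in> elts a) \<or> (\<exists>s. opair x s \<in> elts c)" "FM q x a" for a b c p q x
    proof (rule FM_dense[OF x(1) abc(6) bl_P(1)[OF F(4)]])
      fix q1 assume q1: "q1 \<in> bl q"
      obtain r d s where r: "r \<in> bl q1" "opair d s \<in> elts a" "nm d" "FE r x d" "FM r d a"
        by (rule FM_E[OF x(1) abc(4) x(3) q1])
      have rp: "r \<in> bl p" using r q1 F bl_trans by blast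
      have "FM r d b" using FE_iff[OF abc(4,5) F(3)] F(1) r(2,5) rp by blast
      then obtain r1 e1 s1 where r1: "r1 \<in> bl r" "opair e1 s1 \<in> elts b" "nm e1" "FE r1 d e1" "FM r1 e1 b"
        by (rule FM_E[OF r(3) abc(5) _ bl_refl[OF bl_P(1)[OF r(1)]]])
      have r1p: "r1 \<in> bl p" using r1 rp bl_trans by blast
      have "FM r1 e1 c" using FE_iff[OF abc(5,6) F(3)] F(2) r1(2,5) r1p by blast
      then obtain r2 g s2 where r2: "r2 \<in> bl r1" "opair g s2 \<in> elts c" "nm g" "r2 \<in> bl s2" "FE r2 e1 g"
        by (rule FM_E[OF r1(3) abc(6) _ bl_refl[OF bl_P(1)[OF r1(1)]]])
      \<comment> \<open>The maximum of the three ranks is below \<open>z\<close> and above the ranks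
        of the four names just found, so the induction hypothesis applies at
        \<open>y\<close>.\<close>
      define y where "y = un (un (rk a) (rk b)) (rk c)"
      have yz: "y \<in> elts z"
        using un_Ord[OF Ord_rk Ord_rk, of a b] un_Ord[of "un (rk a) (rk b)" "rk c"] Ord_rk abc(1-3) unfolding y_def by metis
      have ry: "rk x \<in> elts y" "rk d \<in> elts y" "rk e1 \<in> elts y" "rk g \<in> elts y"
        using x(2) r(2) r1(2) r2(2) rk_dom unfolding y_def by auto
      have P2: "r2 \<in> elts P" using r2 bl_P by blast
      have f: "FE r2 x d" "FE r2 d e1"
        using FE_below[OF x(1) r(3) r(4)] FE_below[OF r(3) r1(3) r1(4)] r1(1) r2(1) bl_trans by blast+
      have "FE r2 x e1" using step[OF yz] ry x(1) r(3) r1(3) P2 f by blast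
      then have "FE r2 x g" using step[OF yz] ry x(1) r2(3,5) r1(3) P2 by blast
      then have "FM r2 x c"
        using FM_dom[OF abc(6) r2(2)] r2 FM_iff[OF x(1) abc(6) P2] FE_below[OF x(1) r2(3)] bl_trans bl_refl bl_P by meson
      then show "\<exists>r\<in>bl q1. FM r x c" using r2(1) r1(1) r(1) bl_trans by blast
    qed
    show ?case
    proof (intro allI impI ballI)
      fix a b c p assume abc: "rk a \<in> elts z" "rk b \<in> elts z" "rk c \<in> elts z" "nm a" "nm b" "nm c"
        and p: "p \<in> elts P" and F: "FE p a b" "FE p b c"
      have F': "FE p c b" "FE p b a" using F FE_sym abc p by blast+
      have "FM q x a = FM q x c" if x: "(\<exists>s. opair x s \<in> elts a) \<or> (\<exists>s. opair x s \<in> elts c)" and q: "q \<in> bl p" for x q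
      proof -
        have nx: "nm x" using x abc nm_dom by blast
        show ?thesis
          using half[OF abc F p q nx x] half[OF abc(3,2,1,6,5,4) F' p q nx] x by blast
      qed
      then show "FE p a c" unfolding FE_iff[OF abc(4,6) p] by blast
    qed
  qed
  note this[rule_format, of a "succ (un (un (rk a) (rk b)) (rk c))" b c p]
  moreover have "rk x \<in> elts (succ (un (un (rk a) (rk b)) (rk c)))" if "x = a \<or> x = b \<or> x = c" for x
  proof -
    have o: "Ord (un (un (rk a) (rk b)) (rk c))" "Ord (rk x)"
      using un_Ord[OF Ord_rk Ord_rk, of a b] un_Ord[of "un (rk a) (rk b)" "rk c"] Ord_rk by metis+
    have "elts (rk x) \<subseteq> elts (un (un (rk a) (rk b)) (rk c))" using that by auto
    then show ?thesis using Ord_subset_iff[OF o(2,1)] unfolding elts_succ by blast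
  qed
  ultimately show ?thesis using assms by blast
qed

lemma FM_left: assumes n: "nm a" "nm b" "nm c" and p: "p \<in> elts P" and F: "FE p a b" "FM p b c" shows "FM p a c"
  unfolding FM_iff[OF n(1,3) p]
proof
  fix q assume q: "q \<in> bl p"
  obtain r d s where r: "r \<in> bl q" "opair d s \<in> elts c" "nm d" "r \<in> bl s" "FE r b d"
    by (rule FM_E[OF n(2,3) F(2) q])
  have "FE r a b" using FE_below[OF n(1,2) F(1)] r(1) q bl_trans by blast
  then have "FE r a d" using FE_trans[OF n(1,2) r(3) bl_P(1)[OF r(1)]] r(5) by blast
  then show "\<exists>r\<in>bl q. \<exists>d s. opair d s \<in> elts c \<and> r \<in> bl s \<and> FE r a d" using r by blast
qed

lemma FM_right: assumes n: "nm a" "nm b" "nm c" and p: "p \<in> elts P" and F: "FE p b c" "FM p a b" shows "FM p a c"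
proof (rule FM_dense[OF n(1,3) p])
  fix q assume q: "q \<in> bl p"
  obtain r d s where r: "r \<in> bl q" "opair d s \<in> elts b" "nm d" "r \<in> bl s" "FE r a d" "FM r d b"
    by (rule FM_E[OF n(1,2) F(2) q])
  have "r \<in> bl p" using r q bl_trans by blast
  then have "FM r d c" using FE_iff[OF n(2,3) p] F(1) r(2,6) by blast
  then have "FM r a c" using FM_left[OF n(1) r(3) n(3) bl_P(1)[OF r(1)]] r(5) by blast
  then show "\<exists>r\<in>bl q. FM r a c" using r(1) by blast
qed

lemma FE_ext: assumes n: "nm a" "nm b" and p: "p \<in> elts P"
  shows "FE p a b \<longleftrightarrow> (\<forall>c. nm c \<longrightarrow> (\<forall>q\<in>bl p. FM q c a \<longleftrightarrow> FM q c b))"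
proof
  assume F: "FE p a b"
  have "FM q c a \<longleftrightarrow> FM q c b" if "nm c" "q \<in> bl p" for c q
    using FM_right[OF that(1) n bl_P(1)[OF that(2)]] FM_right[OF that(1) n(2,1) bl_P(1)[OF that(2)]]
      FE_below[OF n F that(2)] FE_sym[OF n bl_P(1)[OF that(2)]] by blast
  then show "\<forall>c. nm c \<longrightarrow> (\<forall>q\<in>bl p. FM q c a \<longleftrightarrow> FM q c b)" by blast
next
  assume "\<forall>c. nm c \<longrightarrow> (\<forall>q\<in>bl p. FM q c a \<longleftrightarrow> FM q c b)"
  then show "FE p a b" unfolding FE_iff[OF n p] using nm_dom n by blast
qed

subsection \<open>Canonical names\<close>

text \<open>A class recursion makes canonical names definable terms; \<open>check_chk\<close>
  identifies the result with \<open>check\<close>.\<close>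

definition chk :: "'v \<Rightarrow> 'v" where "chk x = rec (\<lambda>x f. cart (img x (\<lambda>z. ap f z)) P) x"

lemma Dt_chk [THEN Dt_compose1, dfn]: "Dt (\<lambda>e. chk (e 0))" unfolding chk_def by (intro dfn)

lemma elts_chk: "elts (chk x) = {opair (chk z) p | z p. z \<in> elts x \<and> p \<in> elts P}"
proof -
  have G: "Dt (\<lambda>e. cart (img (e 0) (\<lambda>z. ap (e 1) z)) P)" by (intro dfn)
  have d: "Dt (\<lambda>e. chk (e 0))" by (intro dfn)
  have d2: "Dt (\<lambda>e. ap (Lam x chk) (e 0))" by (intro dfn)
  have "chk x = cart (img x (\<lambda>z. ap (Lam x chk) z)) P"
    using rec_unfold[OF G, of x] unfolding chk_def[symmetric] chk_def[abs_def, symmetric] by simp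
  moreover have "elts (img x (\<lambda>z. ap (Lam x chk) z)) = chk ` elts x"
    by (auto simp: elts_img[OF d2] ap_Lam[OF d])
  ultimately show ?thesis by auto
qed

lemma check_chk: "check P x = chk x"
  unfolding check_def
proof (rule the_equality)
  have d: "Dt (\<lambda>e. chk (e 0))" by (intro dfn)
  obtain t where t: "Trans t" "elts (sing x) \<subseteq> elts t" using Trans_ex by blast
  have app: "app (Lam t chk) y = chk y" if "y \<in> elts t" for y
    using func_app[OF func_Lam[OF d] that] ap_Lam[OF d that] by simp
  have "elts (app (Lam t chk) y) = {opair (app (Lam t chk) z) p | z p. z \<in> elts y \<and> p \<in> elts P}" if y: "y \<in> elts t" for y
  proof -
    have "app (Lam t chk) z = chk z" if "z \<in> elts y" for z using app[of z] that y t(1) unfolding Trans_def by blast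
    then show ?thesis unfolding app[OF y] elts_chk[of y] by (auto; metis)
  qed
  then show "\<exists>h t. sat (trans_f t) \<and> x \<in> elts t \<and> func h t \<and>
     (\<forall>y\<in>elts t. elts (app h y) = {opair (app h z) p | z p. z \<in> elts y \<and> p \<in> elts P}) \<and> chk x = app h x"
    using t app func_Lam[OF d, of t] by (intro exI[of _ "Lam t chk"] exI[of _ t]) auto
  fix c assume "\<exists>h t. sat (trans_f t) \<and> x \<in> elts t \<and> func h t \<and>
     (\<forall>y\<in>elts t. elts (app h y) = {opair (app h z) p | z p. z \<in> elts y \<and> p \<in> elts P}) \<and> c = app h x"
  then obtain h t where h: "Trans t" "x \<in> elts t" "func h t"
     "\<forall>y\<in>elts t. elts (app h y) = {opair (app h z) p | z p. z \<in> elts y \<and> p \<in> elts P}" "c = app h x"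
    unfolding sat_trans by blast
  have "y \<in> elts t \<longrightarrow> ap h y = chk y" for y
  proof (induction y rule: eps_induct)
    show "D (\<lambda>e. e 0 \<in> elts t \<longrightarrow> ap h (e 0) = chk (e 0))" by (intro dfn)
  next
    case (step y)
    show ?case
    proof
      assume y: "y \<in> elts t"
      have z: "app h z = chk z" if "z \<in> elts y" for z
        using step[OF that] func_app[OF h(3), of z] h(1) y that unfolding Trans_def by auto
      have "elts (ap h y) = {opair (app h z) p | z p. z \<in> elts y \<and> p \<in> elts P}"
        by (rule h(4)[rule_format, OF y, unfolded func_app[OF h(3) y]])
      also have "\<dots> = elts (chk y)" unfolding elts_chk[of y] using z by (auto; metis)
      finally show "ap h y = chk y" by (rule elts_eqI)
    qed
  qed
  then show "c = chk x" using h func_app[OF h(3,2)] by simp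
qed

lemma nm_chk [simp]: "nm (chk x)"
proof -
  have d: "Dt (\<lambda>e. chk (e 0))" by (intro dfn)
  obtain t where t: "Trans t" "elts (sing x) \<subseteq> elts t" using Trans_ex by blast
  have "name_closed P (img t chk)"
    unfolding name_closed_def elts_img[OF d]
  proof (intro ballI)
    fix y w assume "y \<in> chk ` elts t" "w \<in> elts y"
    then obtain u z p where u: "u \<in> elts t" "z \<in> elts u" "p \<in> elts P" "w = opair (chk z) p" using elts_chk by blast
    then have "z \<in> elts t" using t(1) unfolding Trans_def by blast
    then show "\<exists>y\<in>chk ` elts t. \<exists>p\<in>elts P. w = opair y p" using u by blast
  qed
  moreover have "chk x \<in> elts (img t chk)" unfolding elts_img[OF d] using t(2) by simp
  ultimately show ?thesis unfolding name_def by blast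
qed

lemma FM_chk_in: "p \<in> elts P \<Longrightarrow> z \<in> elts x \<Longrightarrow> FM p (chk z) (chk x)"
  by (rule FM_dom[OF nm_chk, of _ p]) (auto simp: elts_chk[of x] bl_refl)

lemma FM_chk_E: assumes "nm a" "FM p a (chk x)" "q \<in> bl p"
  obtains r z where "r \<in> bl q" "z \<in> elts x" "FE r a (chk z)"
  using FM_E[OF assms(1) nm_chk assms(2,3)] unfolding elts_chk[of x] by (auto; metis)

text \<open>Each element of one set is forced equal to an element of the other, and by induction
  these are the same; extensionality does the rest.\<close>

lemma FE_chk_aux: "\<forall>y. \<forall>p\<in>elts P. FE p (chk x) (chk y) \<longrightarrow> x = y"
proof (induction x rule: eps_induct)
  show "D (\<lambda>e. \<forall>y. \<forall>p\<in>elts P. FE p (chk (e 0)) (chk y) \<longrightarrow> e 0 = y)" by (intro dfn)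
next
  case (step x)
  show ?case
  proof (intro allI ballI impI)
    fix y p assume p: "p \<in> elts P" and F: "FE p (chk x) (chk y)"
    have "z \<in> elts y" if z: "z \<in> elts x" for z
    proof -
      have "FM p (chk z) (chk y)" by (rule FM_right[OF nm_chk nm_chk nm_chk p F FM_chk_in[OF p z]])
      then obtain r w where "r \<in> bl p" "w \<in> elts y" "FE r (chk z) (chk w)"
        by (rule FM_chk_E[OF nm_chk _ bl_refl[OF p]])
      then show ?thesis using step[OF z] bl_P(1) by blast
    qed
    moreover have "w \<in> elts x" if w: "w \<in> elts y" for w
    proof -
      have F': "FE p (chk y) (chk x)" using FE_sym F p by simp
      have "FM p (chk w) (chk x)" by (rule FM_right[OF nm_chk nm_chk nm_chk p F' FM_chk_in[OF p w]])
      then obtain r z where "r \<in> bl p" "z \<in> elts x" "FE r (chk w) (chk z)"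
        by (rule FM_chk_E[OF nm_chk _ bl_refl[OF p]])
      then show ?thesis using step[of z] bl_P(1) FE_sym[OF nm_chk nm_chk] by blast
    qed
    ultimately show "x = y" by (intro elts_eqI) blast
  qed
qed

lemma FE_chk: "p \<in> elts P \<Longrightarrow> FE p (chk x) (chk y) \<longleftrightarrow> x = y"
  using FE_chk_aux FE_refl by auto

lemma FM_chk: assumes p: "p \<in> elts P" shows "FM p (chk x) (chk y) \<longleftrightarrow> x \<in> elts y"
proof
  assume "FM p (chk x) (chk y)"
  then obtain r z where r: "r \<in> bl p" "z \<in> elts y" "FE r (chk x) (chk z)"
    by (rule FM_chk_E[OF nm_chk _ bl_refl[OF p]])
  then show "x \<in> elts y" using FE_chk[OF bl_P(1)[OF r(1)]] by simp
qed (rule FM_chk_in[OF p])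

lemma elts_generic_name: "elts (generic_name P) = {opair (chk p) p | p. p \<in> elts P}"
proof -
  have d: "Dt (\<lambda>e. opair (chk (e 0)) (e 0))" by (intro dfn)
  have "small ((\<lambda>p. opair (chk p) p) ` elts P)" by (rule small_image[OF d])
  moreover have "(\<lambda>p. opair (chk p) p) ` elts P = {opair (chk p) p | p. p \<in> elts P}" by auto
  ultimately show ?thesis unfolding generic_name_def check_chk by simp
qed

lemma nm_generic_name: "nm (generic_name P)"
proof -
  have d: "Dt (\<lambda>e. chk (e 0))" by (intro dfn)
  have ex: "\<exists>N. name_closed P N \<and> chk x \<in> elts N" for x using nm_chk unfolding name_def .
  have dR: "D (\<lambda>e. name_closed P (e 1) \<and> chk (e 0) \<in> elts (e 1))" by (intro dfn)
  obtain f where f: "\<And>p. p \<in> elts P \<Longrightarrow> name_closed P (ap f p) \<and> chk p \<in> elts (ap f p)"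
    by (rule AC_class[OF dR ex, of P]) blast+
  have df: "Dt (\<lambda>e. ap f (e 0))" by (intro dfn)
  define N where "N = un (sing (generic_name P)) (Union (img P (ap f)))"
  have N: "elts N = insert (generic_name P) (\<Union>p\<in>elts P. elts (ap f p))" unfolding N_def by (simp add: elts_img[OF df])
  have "name_closed P N"
    unfolding name_closed_def
  proof (intro ballI)
    fix x w assume x: "x \<in> elts N" "w \<in> elts x"
    show "\<exists>y\<in>elts N. \<exists>p\<in>elts P. w = opair y p"
    proof (cases "x = generic_name P")
      case True
      then obtain p where "p \<in> elts P" "w = opair (chk p) p" using x(2) elts_generic_name by blast
      then show ?thesis using f[of p] N by blast
    next
      case False
      then obtain p where p: "p \<in> elts P" "x \<in> elts (ap f p)" using x N by blast
      then obtain y q where "y \<in> elts (ap f p)" "q \<in> elts P" "w = opair y q"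
        using f[of p] x(2) unfolding name_closed_def by blast
      then show ?thesis using N p by blast
    qed
  qed
  then show ?thesis unfolding name_def using N by blast
qed

text \<open>The poset may fail to be separative, hence the density condition instead of
  \<open>p\<close> being below \<open>s\<close>.\<close>

lemma FM_generic: assumes p: "p \<in> elts P"
  shows "FM p (chk s) (generic_name P) \<longleftrightarrow> (\<forall>q\<in>bl p. \<exists>r\<in>bl q. r \<in> bl s)"
proof -
  have "(\<exists>c t. opair c t \<in> elts (generic_name P) \<and> r \<in> bl t \<and> FE r (chk s) c) \<longleftrightarrow> r \<in> bl s" if "r \<in> bl q" for r q
    unfolding elts_generic_name using FE_chk[OF bl_P(1)[OF that]] bl_P(2) by auto
  then show ?thesis unfolding FM_iff[OF nm_chk nm_generic_name p] by blast
qed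

subsection \<open>Forcing first-order formulas\<close>

text \<open>Truth values of the forcing language: downward closed and determined by density. For
  them the clauses built from negation take their familiar form. Parameters must be names and
  binders carry arbitrary functions of the meta-logic, so stability is verified formula by formula
  with \<open>stb_intros\<close>.\<close>

definition stb :: "('v \<Rightarrow> bool) \<Rightarrow> bool" where
  "stb \<psi> \<longleftrightarrow> (\<forall>p q. \<psi> p \<longrightarrow> q \<in> bl p \<longrightarrow> \<psi> q) \<and>
    (\<forall>p\<in>elts P. (\<forall>q\<in>bl p. \<exists>r\<in>bl q. \<psi> r) \<longrightarrow> \<psi> p)"

abbreviation fr :: "'v form \<Rightarrow> 'v \<Rightarrow> bool" where "fr \<phi> \<equiv> forces P L \<phi>"

lemma stb_below: "stb \<psi> \<Longrightarrow> \<psi> p \<Longrightarrow> q \<in> bl p \<Longrightarrow> \<psi> q" unfolding stb_def by blast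
lemma stb_dense: "stb \<psi> \<Longrightarrow> p \<in> elts P \<Longrightarrow> (\<And>q. q \<in> bl p \<Longrightarrow> \<exists>r\<in>bl q. \<psi> r) \<Longrightarrow> \<psi> p" unfolding stb_def by blast

lemma fr_mem: "fr (x \<^bold>\<in> y) p \<longleftrightarrow> FM p x y" and fr_eq: "fr (x \<^bold>= y) p \<longleftrightarrow> FE p x y"
  and fr_neg: "fr (\<^bold>\<not> \<phi>) p \<longleftrightarrow> (\<forall>q\<in>bl p. \<not> fr \<phi> q)"
  and fr_conj: "fr (\<phi> \<^bold>\<and> \<psi>) p \<longleftrightarrow> fr \<phi> p \<and> fr \<psi> p"
  and fr_all: "fr (All \<chi>) p \<longleftrightarrow> (\<forall>x. \<forall>q\<in>bl p. \<not> (nm x \<and> (\<forall>r\<in>bl q. \<not> fr (\<chi> x) r)))"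
  by (simp_all add: forces_def fneg_def fconj_def fall_def fimp_def)

lemma stb_mem: "nm x \<Longrightarrow> nm y \<Longrightarrow> stb (fr (x \<^bold>\<in> y))"
  unfolding stb_def fr_mem using FM_below FM_dense by blast

lemma stb_eq: "nm x \<Longrightarrow> nm y \<Longrightarrow> stb (fr (x \<^bold>= y))"
  unfolding stb_def fr_eq using FE_below FE_dense by blast

lemma stb_neg: assumes "stb (fr \<phi>)" shows "stb (fr (\<^bold>\<not> \<phi>))"
  unfolding stb_def fr_neg using assms stb_below bl_trans bl_refl bl_P by meson

lemma stb_conj: "stb (fr \<phi>) \<Longrightarrow> stb (fr \<psi>) \<Longrightarrow> stb (fr (\<phi> \<^bold>\<and> \<psi>))"
  unfolding stb_def fr_conj by meson

lemma fr_all': assumes s: "\<And>x. nm x \<Longrightarrow> stb (fr (\<chi> x))" and p: "p \<in> elts P"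
  shows "fr (All \<chi>) p \<longleftrightarrow> (\<forall>x. nm x \<longrightarrow> fr (\<chi> x) p)"
proof
  assume a: "fr (All \<chi>) p"
  show "\<forall>x. nm x \<longrightarrow> fr (\<chi> x) p"
  proof (intro allI impI)
    fix x assume x: "nm x"
    show "fr (\<chi> x) p" by (rule stb_dense[OF s[OF x] p]) (use a x in \<open>auto simp: fr_all\<close>)
  qed
next
  assume "\<forall>x. nm x \<longrightarrow> fr (\<chi> x) p"
  then show "fr (All \<chi>) p" unfolding fr_all using s stb_below bl_refl bl_P(1) by meson
qed

lemma stb_all: assumes s: "\<And>x. nm x \<Longrightarrow> stb (fr (\<chi> x))" shows "stb (fr (All \<chi>))"
  unfolding stb_def
proof (intro conjI allI impI ballI)
  show "fr (All \<chi>) q" if "fr (All \<chi>) p" "q \<in> bl p" for p q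
    using that unfolding fr_all using bl_trans by blast
  fix p assume p: "p \<in> elts P" and d: "\<forall>q\<in>bl p. \<exists>r\<in>bl q. fr (All \<chi>) r"
  show "fr (All \<chi>) p"
  proof (rule fr_all'[THEN iffD2], rule s, assumption, rule p, intro allI impI)
    fix x assume x: "nm x"
    show "fr (\<chi> x) p"
    proof (rule stb_dense[OF s[OF x] p])
      fix q assume "q \<in> bl p"
      then obtain r where r: "r \<in> bl q" "fr (All \<chi>) r" using d by blast
      have "\<forall>x. nm x \<longrightarrow> fr (\<chi> x) r"
        by (rule fr_all'[THEN iffD1, OF _ _ r(2)], rule s, assumption, rule bl_P(1)[OF r(1)])
      then show "\<exists>r\<in>bl q. fr (\<chi> x) r" using r(1) x by blast
    qed
  qed
qed

lemmas stb_intros = stb_mem stb_eq stb_neg stb_conj stb_all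

lemma fr_imp: assumes "stb (fr \<phi>)" "stb (fr \<psi>)" "p \<in> elts P"
  shows "fr (\<phi> \<^bold>\<longrightarrow> \<psi>) p \<longleftrightarrow> (\<forall>q\<in>bl p. fr \<phi> q \<longrightarrow> fr \<psi> q)"
  unfolding fr_neg fr_conj
proof
  assume a: "\<forall>q\<in>bl p. \<not> (fr \<phi> q \<and> (\<forall>q\<in>bl q. \<not> fr \<psi> q))"
  show "\<forall>q\<in>bl p. fr \<phi> q \<longrightarrow> fr \<psi> q"
  proof (intro ballI impI)
    fix q assume q: "q \<in> bl p" "fr \<phi> q"
    show "fr \<psi> q"
      by (rule stb_dense[OF assms(2) bl_P(1)[OF q(1)]])
        (use a q stb_below[OF assms(1)] bl_trans in blast)
  qed
qed (use bl_refl bl_P in blast)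

lemma fr_ex: assumes s: "\<And>x. nm x \<Longrightarrow> stb (fr (\<chi> x))" and p: "p \<in> elts P"
  shows "fr (Exi \<chi>) p \<longleftrightarrow> (\<forall>q\<in>bl p. \<exists>r\<in>bl q. \<exists>x. nm x \<and> fr (\<chi> x) r)"
proof -
  have "fr (\<^bold>\<forall>x. \<^bold>\<not> \<chi> x) q \<longleftrightarrow> (\<forall>x. nm x \<longrightarrow> fr (\<^bold>\<not> \<chi> x) q)" if "q \<in> bl p" for q
    by (rule fr_all'[OF stb_neg[OF s] bl_P(1)[OF that]])
  then show ?thesis unfolding fr_neg[of "\<^bold>\<forall>x. \<^bold>\<not> \<chi> x"] by (simp add: fr_neg) blast
qed

lemma fr_disj: assumes s: "stb (fr \<phi>)" "stb (fr \<psi>)" and p: "p \<in> elts P"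
  shows "fr (\<phi> \<^bold>\<or> \<psi>) p \<longleftrightarrow> (\<forall>q\<in>bl p. \<exists>r\<in>bl q. fr \<phi> r \<or> fr \<psi> r)"
  unfolding fr_neg fr_conj using s stb_below bl_refl bl_trans bl_P by (smt (verit, best))

lemma fr_iff: assumes "stb (fr \<phi>)" "stb (fr \<psi>)" "p \<in> elts P"
  shows "fr (\<phi> \<^bold>\<longleftrightarrow> \<psi>) p \<longleftrightarrow> (\<forall>q\<in>bl p. fr \<phi> q \<longleftrightarrow> fr \<psi> q)"
  using fr_imp[OF assms] fr_imp[OF assms(2,1,3)] unfolding fr_conj by blast

section \<open>Names of pairs\<close>

definition up :: "'v \<Rightarrow> 'v \<Rightarrow> 'v" where "up x y = cart (vset {x, y}) P"
definition op :: "'v \<Rightarrow> 'v \<Rightarrow> 'v" where "op x y = up (up x x) (up x y)"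

lemma Dt_up [THEN Dt_compose2, dfn]: "Dt (\<lambda>e. up (e 0) (e 1))" unfolding up_def by (intro dfn)
lemma Dt_op [THEN Dt_compose2, dfn]: "Dt (\<lambda>e. op (e 0) (e 1))" unfolding op_def by (intro dfn)

lemma elts_up: "elts (up x y) = {opair z p | z p. (z = x \<or> z = y) \<and> p \<in> elts P}"
  unfolding up_def by auto

lemma nm_up [simp]: assumes "nm x" "nm y" shows "nm (up x y)"
proof -
  obtain N1 N2 where N: "name_closed P N1" "x \<in> elts N1" "name_closed P N2" "y \<in> elts N2"
    using assms unfolding name_def by blast
  have "name_closed P (un (sing (up x y)) (un N1 N2))"
    unfolding name_closed_def
  proof (intro ballI)
    fix u w assume u: "u \<in> elts (un (sing (up x y)) (un N1 N2))" "w \<in> elts u"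
    then consider "u = up x y" | "u \<in> elts N1" | "u \<in> elts N2" by auto
    then show "\<exists>z\<in>elts (un (sing (up x y)) (un N1 N2)). \<exists>p\<in>elts P. w = opair z p"
    proof cases
      case 1 then show ?thesis using u(2) N elts_up by auto
    next
      case 2 then show ?thesis using N(1) u(2) unfolding name_closed_def elts_un by blast
    next
      case 3 then show ?thesis using N(3) u(2) unfolding name_closed_def elts_un by blast
    qed
  qed
  then show ?thesis unfolding name_def by (intro exI[of _ "un (sing (up x y)) (un N1 N2)"]) simp
qed

lemma nm_op [simp]: "nm x \<Longrightarrow> nm y \<Longrightarrow> nm (op x y)" by (simp add: op_def)

lemma FM_up: assumes n: "nm z" "nm x" "nm y" and p: "p \<in> elts P"
  shows "FM p z (up x y) \<longleftrightarrow> (\<forall>q\<in>bl p. \<exists>r\<in>bl q. FE r z x \<or> FE r z y)"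
proof -
  have "(\<exists>c s. opair c s \<in> elts (up x y) \<and> r \<in> bl s \<and> FE r z c) \<longleftrightarrow> FE r z x \<or> FE r z y" if "r \<in> bl q" for r q
    unfolding elts_up using bl_refl[OF bl_P(1)[OF that]] bl_P(1)[OF that] by auto
  then show ?thesis unfolding FM_iff[OF n(1) nm_up[OF n(2,3)] p] by blast
qed

lemma FM_up_in: "nm x \<Longrightarrow> nm y \<Longrightarrow> p \<in> elts P \<Longrightarrow> FM p x (up x y)"
  "nm x \<Longrightarrow> nm y \<Longrightarrow> p \<in> elts P \<Longrightarrow> FM p y (up x y)"
  using FM_up FE_refl bl_refl bl_P(1) by meson+

lemma FE_up: assumes n: "nm x" "nm y" "nm x'" "nm y'" and p: "p \<in> elts P" and F: "FE p x x'" "FE p y y'"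
  shows "FE p (up x y) (up x' y')"
proof -
  have half: "FM q z (up x' y')" if n: "nm x" "nm y" "nm x'" "nm y'" "nm z" and q: "q \<in> elts P"
    and F: "FE q x x'" "FE q y y'" "FM q z (up x y)" for x y x' y' z q
    unfolding FM_up[OF n(5,3,4) q]
  proof
    fix q1 assume q1: "q1 \<in> bl q"
    obtain r where r: "r \<in> bl q1" "FE r z x \<or> FE r z y" using F(3) FM_up[OF n(5,1,2) q] q1 by blast
    have "FE r x x'" "FE r y y'"
      using FE_below[OF n(1,3) F(1)] FE_below[OF n(2,4) F(2)] bl_trans[OF r(1) q1] by blast+
    then show "\<exists>r\<in>bl q1. FE r z x' \<or> FE r z y'"
      using r FE_trans[OF n(5,1,3) bl_P(1)[OF r(1)]] FE_trans[OF n(5,2,4) bl_P(1)[OF r(1)]] by blast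
  qed
  have "FM q z (up x y) \<longleftrightarrow> FM q z (up x' y')" if "nm z" "q \<in> bl p" for z q
  proof -
    have f: "FE q x x'" "FE q y y'" using FE_below[OF n(1,3) F(1)] FE_below[OF n(2,4) F(2)] that by blast+
    then have "FE q x' x" "FE q y' y" using FE_sym n bl_P(1)[OF that(2)] by blast+
    then show ?thesis using half[OF n that(1) bl_P(1)[OF that(2)]] half[OF n(3,4,1,2) that(1) bl_P(1)[OF that(2)]] f by blast
  qed
  then show ?thesis using FE_ext[OF nm_up[OF n(1,2)] nm_up[OF n(3,4)] p] by blast
qed

lemma FE_op: assumes n: "nm x" "nm y" "nm x'" "nm y'" and p: "p \<in> elts P" and F: "FE p x x'" "FE p y y'"
  shows "FE p (op x y) (op x' y')"
  unfolding op_def by (intro FE_up nm_up n p F)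

lemma FE_up_sing: assumes n: "nm x" "nm u" "nm v" and p: "p \<in> elts P" and F: "FE p (up x x) (up u v)"
  shows "FE p x u" "FE p x v"
proof -
  have F': "FE p (up u v) (up x x)" by (rule FE_sym[OF _ _ p F]) (use n in auto)
  have "FM p u (up x x)" by (rule FM_right[OF n(2) nm_up[OF n(2,3)] nm_up[OF n(1,1)] p F' FM_up_in(1)[OF n(2,3) p]])
  then have "FE p u x" using FM_up[OF n(2,1,1) p] by (intro FE_dense[OF n(2,1) p]) blast
  then show "FE p x u" by (rule FE_sym[OF n(2,1) p])
  have "FM p v (up x x)" by (rule FM_right[OF n(3) nm_up[OF n(2,3)] nm_up[OF n(1,1)] p F' FM_up_in(2)[OF n(2,3) p]])
  then have "FE p v x" using FM_up[OF n(3,1,1) p] by (intro FE_dense[OF n(3,1) p]) blast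
  then show "FE p x v" by (rule FE_sym[OF n(3,1) p])
qed

text \<open>The usual argument for Kuratowski pairs, localised to dense sets of conditions.
  Comparing with the singleton gives the first coordinates; for the second ones the critical case is
  that \<open>y\<close> equals \<open>x'\<close>, where \<open>y'\<close> is also forced to coincide
  with \<open>x\<close> or with \<open>y\<close>.\<close>

lemma FE_op_D: assumes n: "nm x" "nm y" "nm x'" "nm y'" and p: "p \<in> elts P" and F: "FE p (op x y) (op x' y')"
  shows "FE p x x'" "FE p y y'"
proof -
  have nn: "nm (up x x)" "nm (up x y)" "nm (up x' x')" "nm (up x' y')" using n by auto
  have X: "FE r u u'" if F: "FE r (op u v) (op u' v')" and n: "nm u" "nm v" "nm u'" "nm v'" and r: "r \<in> elts P" for r u v u' v'
  proof -
    have m: "nm (up u u)" "nm (up u v)" "nm (up u' u')" "nm (up u' v')" using n by auto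
    have F': "FE r (up (up u u) (up u v)) (up (up u' u') (up u' v'))" using F by (simp add: op_def)
    have "FM r (up u u) (up (up u' u') (up u' v'))"
      by (rule FM_right[OF m(1) nm_up[OF m(1,2)] nm_up[OF m(3,4)] r F' FM_up_in(1)[OF m(1,2) r]])
    then have d: "\<And>q. q \<in> bl r \<Longrightarrow> \<exists>s\<in>bl q. FE s (up u u) (up u' u') \<or> FE s (up u u) (up u' v')"
      using FM_up[OF m(1,3,4) r] by blast
    show ?thesis
    proof (rule FE_dense[OF n(1,3) r])
      fix q assume "q \<in> bl r"
      then obtain s where "s \<in> bl q" "FE s (up u u) (up u' u') \<or> FE s (up u u) (up u' v')" using d by blast
      then show "\<exists>s\<in>bl q. FE s u u'"
        using FE_up_sing(1)[OF n(1,3,3)] FE_up_sing(1)[OF n(1,3,4)] bl_P(1) by blast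
    qed
  qed
  show x: "FE p x x'" by (rule X[OF F n p])
  have F1: "FE p (up (up x x) (up x y)) (up (up x' x') (up x' y'))" using F by (simp add: op_def)
  have F2: "FE p (up (up x' x') (up x' y')) (up (up x x) (up x y))"
    by (rule FE_sym[OF nm_up[OF nn(1,2)] nm_up[OF nn(3,4)] p F1])
  have M1: "FM p (up x y) (up (up x' x') (up x' y'))"
    by (rule FM_right[OF nn(2) nm_up[OF nn(1,2)] nm_up[OF nn(3,4)] p F1 FM_up_in(2)[OF nn(1,2) p]])
  have M2: "FM p (up x' y') (up (up x x) (up x y))"
    by (rule FM_right[OF nn(4) nm_up[OF nn(3,4)] nm_up[OF nn(1,2)] p F2 FM_up_in(2)[OF nn(3,4) p]])
  show "FE p y y'"
  proof (rule FE_dense[OF n(2,4) p])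
    fix q assume q: "q \<in> bl p"
    obtain r where r: "r \<in> bl q" "FE r (up x y) (up x' x') \<or> FE r (up x y) (up x' y')"
      using M1 FM_up[OF nn(2,3,4) p] q by blast
    obtain s where s: "s \<in> bl r" "FE s (up x' y') (up x x) \<or> FE s (up x' y') (up x y)"
      using M2 FM_up[OF nn(4,1,2) p] bl_trans[OF r(1) q] by blast
    have sP: "s \<in> elts P" using bl_P(1)[OF s(1)] .
    have sp: "s \<in> bl p" using s(1) r(1) q bl_trans by blast
    have xs: "FE s x x'" using FE_below[OF n(1,3) x sp] .
    have xs': "FE s x' x" using FE_sym[OF n(1,3) sP xs] .
    have r': "FE s (up x y) (up x' x') \<or> FE s (up x y) (up x' y')"
      using r(2) FE_below[OF nn(2,3) _ s(1)] FE_below[OF nn(2,4) _ s(1)] by blast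
    note tr = FE_trans[OF _ _ _ sP] and sy = FE_sym[OF _ _ sP]
    have yM: "FM s y (up x y)" "FM s y' (up x' y')" using FM_up_in(2) n sP by blast+
    have y1: "\<exists>t\<in>bl s. FE t y x' \<or> FE t y y'"
    proof -
      have "FM s y (up x' x') \<or> FM s y (up x' y')"
        using r' FM_right[OF n(2) nn(2) nn(3) sP _ yM(1)] FM_right[OF n(2) nn(2) nn(4) sP _ yM(1)] by blast
      then show ?thesis using FM_up[OF n(2,3,3) sP] FM_up[OF n(2,3,4) sP] bl_refl[OF sP] by blast
    qed
    then obtain t where t: "t \<in> bl s" "FE t y x' \<or> FE t y y'" by blast
    have tP: "t \<in> elts P" using bl_P(1)[OF t(1)] .
    show "\<exists>r\<in>bl q. FE r y y'"
    proof (cases "FE t y y'")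
      case True
      then show ?thesis using t(1) s(1) r(1) bl_trans by blast
    next
      case False
      then have yx': "FE t y x'" using t by blast
      have xt: "FE t x' x" using FE_below[OF n(3,1) xs' t(1)] .
      have yx: "FE t y x" using FE_trans[OF n(2,3,1) tP yx' xt] .
      have s': "FE t (up x' y') (up x x) \<or> FE t (up x' y') (up x y)"
        using s(2) FE_below[OF nn(4,1) _ t(1)] FE_below[OF nn(4,2) _ t(1)] by blast
      have y'M: "FM t y' (up x' y')" using FM_up_in(2) n tP by blast
      have "FM t y' (up x x) \<or> FM t y' (up x y)"
        using s' FM_right[OF n(4) nn(4) nn(1) tP _ y'M] FM_right[OF n(4) nn(4) nn(2) tP _ y'M] by blast
      then obtain u where u: "u \<in> bl t" "FE u y' x \<or> FE u y' y"
        using FM_up[OF n(4,1,1) tP] FM_up[OF n(4,1,2) tP] bl_refl[OF tP] by blast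
      have uP: "u \<in> elts P" using bl_P(1)[OF u(1)] .
      have yxu: "FE u y x" using FE_below[OF n(2,1) yx u(1)] .
      have "FE u y y'"
        using u(2) FE_trans[OF n(2,1,4) uP yxu FE_sym[OF n(4,1) uP]] FE_sym[OF n(4,2) uP] by blast
      then show ?thesis using u(1) t(1) s(1) r(1) bl_trans by blast
    qed
  qed
qed

lemma stb_upair: "nm w \<Longrightarrow> nm x \<Longrightarrow> nm y \<Longrightarrow> stb (fr (upair_f w x y))"
  unfolding upair_f_def by (intro stb_intros)

text \<open>Both sides describe the same elements, so \<open>FE_ext\<close> applies. With this and
  \<open>fr_opair\<close>, formulas about pairs become statements about concrete names.\<close>

lemma fr_upair: assumes n: "nm w" "nm x" "nm y" and p: "p \<in> elts P"
  shows "fr (upair_f w x y) p \<longleftrightarrow> FE p w (up x y)"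
proof -
  have s: "stb (fr (z \<^bold>\<in> w))" "stb (fr (z \<^bold>= x \<^bold>\<or> z \<^bold>= y))" if "nm z" for z by (intro stb_intros n that)+
  have d: "fr (z \<^bold>= x \<^bold>\<or> z \<^bold>= y) q \<longleftrightarrow> FM q z (up x y)" if "nm z" "q \<in> bl p" for z q
    unfolding FM_up[OF that(1) n(2,3) bl_P(1)[OF that(2)]]
    using fr_disj[OF stb_eq[OF that(1) n(2)] stb_eq[OF that(1) n(3)] bl_P(1)[OF that(2)]] by (simp add: fr_eq)
  have "fr (upair_f w x y) p \<longleftrightarrow> (\<forall>z. nm z \<longrightarrow> fr (z \<^bold>\<in> w \<^bold>\<longleftrightarrow> (z \<^bold>= x \<^bold>\<or> z \<^bold>= y)) p)"
    unfolding upair_f_def by (rule fr_all'[OF _ p]) (intro stb_intros n)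
  also have "\<dots> \<longleftrightarrow> (\<forall>z. nm z \<longrightarrow> (\<forall>q\<in>bl p. FM q z w \<longleftrightarrow> FM q z (up x y)))"
    using fr_iff[OF s p] d by (simp add: fr_mem)
  also have "\<dots> \<longleftrightarrow> FE p w (up x y)" using FE_ext[OF n(1) nm_up[OF n(2,3)] p] by simp
  finally show ?thesis .
qed

lemma stb_opair: "nm w \<Longrightarrow> nm x \<Longrightarrow> nm y \<Longrightarrow> stb (fr (opair_f w x y))"
  unfolding opair_f_def by (intro stb_intros stb_upair)

lemma fr_opair: assumes n: "nm w" "nm x" "nm y" and p: "p \<in> elts P"
  shows "fr (opair_f w x y) p \<longleftrightarrow> FE p w (op x y)"
proof -
  have e1: "fr (opair_f w x y) p \<longleftrightarrow> (\<forall>q\<in>bl p. \<exists>r\<in>bl q. \<exists>a. nm a \<and>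
      fr (\<^bold>\<exists>b. upair_f a x x \<^bold>\<and> upair_f b x y \<^bold>\<and> upair_f w a b) r)"
    unfolding opair_f_def by (rule fr_ex[OF _ p]) (intro stb_intros stb_upair n)
  have e2: "fr (\<^bold>\<exists>b. upair_f a x x \<^bold>\<and> upair_f b x y \<^bold>\<and> upair_f w a b) r \<longleftrightarrow>
      (\<forall>q\<in>bl r. \<exists>r\<in>bl q. \<exists>b. nm b \<and> fr (upair_f a x x \<^bold>\<and> upair_f b x y \<^bold>\<and> upair_f w a b) r)"
    if "nm a" "r \<in> elts P" for a r
    by (rule fr_ex[OF _ that(2)]) (intro stb_intros stb_upair n that(1))
  have e3: "fr (upair_f a x x \<^bold>\<and> upair_f b x y \<^bold>\<and> upair_f w a b) r \<longleftrightarrow>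
      FE r a (up x x) \<and> FE r b (up x y) \<and> FE r w (up a b)" if "nm a" "nm b" "r \<in> elts P" for a b r
    unfolding fr_conj using fr_upair n that by simp
  have key: "FE r w (op x y)" if "nm a" "nm b" "r \<in> elts P" "FE r a (up x x)" "FE r b (up x y)" "FE r w (up a b)" for a b r
  proof -
    have m: "nm (up x x)" "nm (up x y)" "nm (up a b)" using n that by auto
    have "FE r (up a b) (op x y)" unfolding op_def by (rule FE_up[OF that(1,2) m(1,2) that(3-5)])
    then show ?thesis using FE_trans[OF n(1) m(3) nm_op[OF n(2,3)] that(3,6)] by blast
  qed
  show ?thesis
  proof
    assume F: "fr (opair_f w x y) p"
    show "FE p w (op x y)"
    proof (rule FE_dense[OF n(1) nm_op[OF n(2,3)] p])
      fix q assume "q \<in> bl p"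
      then obtain r a where r: "r \<in> bl q" "nm a" "fr (\<^bold>\<exists>b. upair_f a x x \<^bold>\<and> upair_f b x y \<^bold>\<and> upair_f w a b) r"
        using F unfolding e1 by blast
      then obtain s b where s: "s \<in> bl r" "nm b" "fr (upair_f a x x \<^bold>\<and> upair_f b x y \<^bold>\<and> upair_f w a b) s"
        unfolding e2[OF r(2) bl_P(1)[OF r(1)]] using bl_refl[OF bl_P(1)[OF r(1)]] by blast
      then have "FE s w (op x y)" using key[OF r(2) s(2) bl_P(1)[OF s(1)]] unfolding e3[OF r(2) s(2) bl_P(1)[OF s(1)]] by blast
      then show "\<exists>r\<in>bl q. FE r w (op x y)" using r s bl_trans by blast
    qed
  next
    assume F: "FE p w (op x y)"
    have m: "nm (up x x)" "nm (up x y)" using n by auto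
    have "fr (upair_f (up x x) x x \<^bold>\<and> upair_f (up x y) x y \<^bold>\<and> upair_f w (up x x) (up x y)) r" if "r \<in> bl p" for r
      unfolding e3[OF m bl_P(1)[OF that]]
      using FE_refl m bl_P(1)[OF that] FE_below[OF n(1) nm_op[OF n(2,3)] F that] by (simp add: op_def)
    then show "fr (opair_f w x y) p"
      unfolding e1 using e2[OF m(1)] m bl_trans bl_refl bl_P(1) by meson
  qed
qed

lemma stb_rel: "nm w \<Longrightarrow> nm x \<Longrightarrow> nm y \<Longrightarrow> stb (fr (rel_f w x y))"
  unfolding rel_f_def by (intro stb_intros stb_opair)

lemma fr_rel: assumes n: "nm f" "nm x" "nm y" and p: "p \<in> elts P"
  shows "fr (rel_f f x y) p \<longleftrightarrow> FM p (op x y) f"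
proof -
  have o: "nm (op x y)" using n by simp
  have e1: "fr (rel_f f x y) p \<longleftrightarrow> (\<forall>q\<in>bl p. \<exists>r\<in>bl q. \<exists>w. nm w \<and> fr (opair_f w x y \<^bold>\<and> w \<^bold>\<in> f) r)"
    unfolding rel_f_def by (rule fr_ex[OF _ p]) (intro stb_intros stb_opair n)
  have e2: "fr (opair_f w x y \<^bold>\<and> w \<^bold>\<in> f) r \<longleftrightarrow> FE r w (op x y) \<and> FM r w f" if "nm w" "r \<in> elts P" for w r
    unfolding fr_conj fr_mem using fr_opair n that by simp
  show ?thesis
  proof
    assume F: "fr (rel_f f x y) p"
    show "FM p (op x y) f"
    proof (rule FM_dense[OF o n(1) p])
      fix q assume "q \<in> bl p"
      then obtain r w where r: "r \<in> bl q" "nm w" "FE r w (op x y)" "FM r w f" using F e2 bl_P(1) unfolding e1 by meson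
      then have "FM r (op x y) f" using FM_left[OF o r(2) n(1)] FE_sym[OF r(2) o] bl_P(1) by blast
      then show "\<exists>r\<in>bl q. FM r (op x y) f" using r by blast
    qed
  next
    assume F: "FM p (op x y) f"
    show "fr (rel_f f x y) p"
      unfolding e1 using e2[OF o] o FM_below[OF o n(1) F] FE_refl[OF o] bl_trans bl_refl bl_P(1) by meson
  qed
qed

lemma D_Fun: assumes Th: "D (\<lambda>e. Th (e 0) (e 1) (e 2))"
  shows "\<exists>F. elts F = {opair (op (chk x) (chk z)) s | x z s. x \<in> elts A \<and> z \<in> elts K \<and> s \<in> elts P \<and> Th s x z}"
proof -
  define X where "X = img (cart A K) (\<lambda>u. op (chk (pfst u)) (chk (psnd u)))"
  have d: "Dt (\<lambda>e. op (chk (pfst (e 0))) (chk (psnd (e 0))))" by (intro dfn)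
  have X: "elts X = {op (chk x) (chk z) | x z. x \<in> elts A \<and> z \<in> elts K}"
    unfolding X_def elts_img[OF d] by (auto; force)
  have e: "elts (sep (cart X P) (\<lambda>w. \<exists>x\<in>elts A. \<exists>z\<in>elts K. pfst w = op (chk x) (chk z) \<and> Th (psnd w) x z)) =
      {w \<in> elts (cart X P). \<exists>x\<in>elts A. \<exists>z\<in>elts K. pfst w = op (chk x) (chk z) \<and> Th (psnd w) x z}"
    by (rule elts_sep) (intro dfn D_compose3[OF Th])
  show ?thesis
    by (rule exI[of _ "sep (cart X P) (\<lambda>w. \<exists>x\<in>elts A. \<exists>z\<in>elts K. pfst w = op (chk x) (chk z) \<and> Th (psnd w) x z)"],
      unfold e) (auto simp: X; blast)
qed

lemma nm_of_subset: assumes "\<And>w. w \<in> elts F \<Longrightarrow> \<exists>y p. w = opair y p \<and> nm y \<and> p \<in> elts P" shows "nm F"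
proof -
  have dR: "D (\<lambda>e. name_closed P (e 1) \<and> pfst (e 0) \<in> elts (e 1))" by (intro dfn)
  have ex: "\<exists>N. name_closed P N \<and> pfst w \<in> elts N" if "w \<in> elts F" for w
    using assms[OF that] unfolding name_def by auto
  obtain f where f: "\<And>w. w \<in> elts F \<Longrightarrow> name_closed P (ap f w) \<and> pfst w \<in> elts (ap f w)"
    by (rule AC_class[OF dR ex]) blast+
  have df: "Dt (\<lambda>e. ap f (e 0))" by (intro dfn)
  define N where "N = un (sing F) (Union (img F (ap f)))"
  have N: "elts N = insert F (\<Union>p\<in>elts F. elts (ap f p))" unfolding N_def by (simp add: elts_img[OF df])
  have "name_closed P N"
    unfolding name_closed_def
  proof (intro ballI)
    fix x w assume x: "x \<in> elts N" "w \<in> elts x"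
    show "\<exists>y\<in>elts N. \<exists>p\<in>elts P. w = opair y p"
    proof (cases "x = F")
      case True
      then obtain y p where y: "w = opair y p" "p \<in> elts P" using x(2) assms by blast
      then have "y \<in> elts (ap f w)" using f[of w] x(2) True by simp
      then show ?thesis using y N x(2) True by blast
    next
      case False
      then obtain p where p: "p \<in> elts F" "x \<in> elts (ap f p)" using x N by blast
      then obtain y q where "y \<in> elts (ap f p)" "q \<in> elts P" "w = opair y q"
        using f[of p] x(2) unfolding name_closed_def by blast
      then show ?thesis using N p by blast
    qed
  qed
  then show ?thesis unfolding name_def using N by blast
qed

lemma fr_all2: assumes s: "\<And>x y. nm x \<Longrightarrow> nm y \<Longrightarrow> stb (fr (\<chi> x y))" and p: "p \<in> elts P"
  shows "fr (\<^bold>\<forall>x. \<^bold>\<forall>y. \<chi> x y) p \<longleftrightarrow> (\<forall>x y. nm x \<longrightarrow> nm y \<longrightarrow> fr (\<chi> x y) p)"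
proof -
  have a: "fr (\<^bold>\<forall>y. \<chi> x y) p \<longleftrightarrow> (\<forall>y. nm y \<longrightarrow> fr (\<chi> x y) p)" if "nm x" for x
    by (rule fr_all'[OF s[OF that] p])
  have "fr (\<^bold>\<forall>x. \<^bold>\<forall>y. \<chi> x y) p \<longleftrightarrow> (\<forall>x. nm x \<longrightarrow> fr (\<^bold>\<forall>y. \<chi> x y) p)"
    by (rule fr_all'[OF _ p]) (intro stb_intros s)
  then show ?thesis using a by blast
qed

text \<open>
  A relation between conditions, elements of \<open>A\<close> and elements of \<open>K\<close>, read as ``\<open>p\<close> decides that
  \<open>x\<close> is mapped to \<open>z\<close>'', gives a name of a function from \<open>A\<close> to \<open>K\<close>.
\<close>

lemma not_forced_regular:
  assumes A: "A \<in> elts K" and Th: "D (\<lambda>e. Th (e 0) (e 1) (e 2))"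
    and mono: "\<And>p q x z. Th p x z \<Longrightarrow> q \<in> bl p \<Longrightarrow> Th q x z"
    and total: "\<And>p x. p \<in> elts P \<Longrightarrow> x \<in> elts A \<Longrightarrow> \<exists>q\<in>bl p. \<exists>z\<in>elts K. Th q x z"
    and uniq: "\<And>p x z z'. p \<in> elts P \<Longrightarrow> Th p x z \<Longrightarrow> Th p x z' \<Longrightarrow> z = z'"
    and cofinal: "\<And>p b. p \<in> elts P \<Longrightarrow> b \<in> elts K \<Longrightarrow> \<exists>q\<in>bl p. \<exists>x\<in>elts A. \<exists>z\<in>elts K. z \<notin> elts b \<and> Th q x z"
    and p: "p \<in> elts P"
  shows "\<not> fr (regular_f (chk K)) p"
proof
  assume reg: "fr (regular_f (chk K)) p"
  \<comment> \<open>The name puts a pair into the function under exactly those conditions that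
    decide its second component as the value at the first.\<close>
  obtain F where F: "elts F = {opair (op (chk x) (chk z)) s | x z s. x \<in> elts A \<and> z \<in> elts K \<and> s \<in> elts P \<and> Th s x z}"
    using D_Fun[OF Th] by blast
  have nF: "nm F" by (rule nm_of_subset) (auto simp: F)
  have FI: "FM q (op (chk x) (chk z)) F" if "x \<in> elts A" "z \<in> elts K" "Th q x z" "q \<in> elts P" for q x z
    by (rule FM_dom[OF nF _ bl_refl[OF that(4)]]) (use that F in blast)
  have FEl: "\<exists>r\<in>bl q. \<exists>x z. x \<in> elts A \<and> z \<in> elts K \<and> Th r x z \<and> FE r w (op (chk x) (chk z))"
    if w: "FM q w F" "nm w" and q: "q \<in> elts P" for q w
  proof -
    obtain r c s where r: "r \<in> bl q" "opair c s \<in> elts F" "nm c" "r \<in> bl s" "FE r w c"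
      by (rule FM_E[OF w(2) nF w(1) bl_refl[OF q]])
    then obtain x z where "x \<in> elts A" "z \<in> elts K" "Th s x z" "c = op (chk x) (chk z)" unfolding F by auto
    then show ?thesis using r mono[OF _ r(4)] by blast
  qed
  have fun1: "fr (\<^bold>\<forall>w. w \<^bold>\<in> F \<^bold>\<longrightarrow> (\<^bold>\<exists>x. \<^bold>\<exists>y. x \<^bold>\<in> chk A \<^bold>\<and> y \<^bold>\<in> chk K \<^bold>\<and> opair_f w x y)) p"
  proof (rule fr_all'[THEN iffD2, OF _ p], (intro stb_intros stb_opair nF nm_chk; assumption), intro allI impI)
    fix w assume w: "nm w"
    have s2: "stb (fr (\<^bold>\<exists>x. \<^bold>\<exists>y. x \<^bold>\<in> chk A \<^bold>\<and> y \<^bold>\<in> chk K \<^bold>\<and> opair_f w x y))"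
      by (intro stb_intros stb_opair nF nm_chk w)
    show "fr (w \<^bold>\<in> F \<^bold>\<longrightarrow> (\<^bold>\<exists>x. \<^bold>\<exists>y. x \<^bold>\<in> chk A \<^bold>\<and> y \<^bold>\<in> chk K \<^bold>\<and> opair_f w x y)) p"
      unfolding fr_imp[OF stb_mem[OF w nF] s2 p]
    proof (intro ballI impI)
      fix q assume q: "q \<in> bl p" "fr (w \<^bold>\<in> F) q"
      show "fr (\<^bold>\<exists>x. \<^bold>\<exists>y. x \<^bold>\<in> chk A \<^bold>\<and> y \<^bold>\<in> chk K \<^bold>\<and> opair_f w x y) q"
      proof (rule stb_dense[OF s2 bl_P(1)[OF q(1)]])
        fix q1 assume q1: "q1 \<in> bl q"
        have "FM q1 w F" using FM_below[OF w nF _ q1] q(2) by (simp add: fr_mem)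
        then obtain r x z where r: "r \<in> bl q1" "x \<in> elts A" "z \<in> elts K" "FE r w (op (chk x) (chk z))"
          using FEl[OF _ w bl_P(1)[OF q1]] by blast
        have b: "fr (chk x \<^bold>\<in> chk A \<^bold>\<and> chk z \<^bold>\<in> chk K \<^bold>\<and> opair_f w (chk x) (chk z)) s" if "s \<in> bl r" for s
          unfolding fr_conj fr_mem fr_opair[OF w nm_chk nm_chk bl_P(1)[OF that]]
          using FM_chk_in[OF bl_P(1)[OF that]] r FE_below[OF w nm_op[OF nm_chk nm_chk] r(4) that] by blast
        have "fr (\<^bold>\<exists>y. chk x \<^bold>\<in> chk A \<^bold>\<and> y \<^bold>\<in> chk K \<^bold>\<and> opair_f w (chk x) y) s" if "s \<in> bl r" for s
        proof (rule fr_ex[THEN iffD2, OF _ bl_P(1)[OF that]], (intro stb_intros stb_opair nF nm_chk w; assumption), intro ballI)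
          fix s1 assume s1: "s1 \<in> bl s"
          show "\<exists>r\<in>bl s1. \<exists>y. nm y \<and> fr (chk x \<^bold>\<in> chk A \<^bold>\<and> y \<^bold>\<in> chk K \<^bold>\<and> opair_f w (chk x) y) r"
            using b[OF bl_trans[OF s1 that]] bl_refl[OF bl_P(1)[OF s1]] nm_chk by blast
        qed
        note b2 = this
        have "fr (\<^bold>\<exists>x. \<^bold>\<exists>y. x \<^bold>\<in> chk A \<^bold>\<and> y \<^bold>\<in> chk K \<^bold>\<and> opair_f w x y) r"
        proof (rule fr_ex[THEN iffD2, OF _ bl_P(1)[OF r(1)]], (intro stb_intros stb_opair nF nm_chk w; assumption), intro ballI)
          fix s1 assume s1: "s1 \<in> bl r"
          show "\<exists>r\<in>bl s1. \<exists>x. nm x \<and> fr (\<^bold>\<exists>y. x \<^bold>\<in> chk A \<^bold>\<and> y \<^bold>\<in> chk K \<^bold>\<and> opair_f w x y) r"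
            using b2[OF s1] bl_refl[OF bl_P(1)[OF s1]] nm_chk by blast
        qed
        then show "\<exists>r\<in>bl q1. fr (\<^bold>\<exists>x. \<^bold>\<exists>y. x \<^bold>\<in> chk A \<^bold>\<and> y \<^bold>\<in> chk K \<^bold>\<and> opair_f w x y) r" using r(1) by blast
      qed
    qed
  qed
  have fun2: "fr (\<^bold>\<forall>x. x \<^bold>\<in> chk A \<^bold>\<longrightarrow> (\<^bold>\<exists>y. rel_f F x y)) p"
  proof (rule fr_all'[THEN iffD2, OF _ p], (intro stb_intros stb_rel nF nm_chk; assumption), intro allI impI)
    fix x assume x: "nm x"
    have s2: "stb (fr (\<^bold>\<exists>y. rel_f F x y))" by (intro stb_intros stb_rel nF x)
    show "fr (x \<^bold>\<in> chk A \<^bold>\<longrightarrow> (\<^bold>\<exists>y. rel_f F x y)) p"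
      unfolding fr_imp[OF stb_mem[OF x nm_chk] s2 p]
    proof (intro ballI impI)
      fix q assume q: "q \<in> bl p" "fr (x \<^bold>\<in> chk A) q"
      show "fr (\<^bold>\<exists>y. rel_f F x y) q"
      proof (rule fr_ex[THEN iffD2, OF _ bl_P(1)[OF q(1)]], (intro stb_rel nF x; assumption), intro ballI)
        fix q1 assume q1: "q1 \<in> bl q"
        obtain r a where r: "r \<in> bl q1" "a \<in> elts A" "FE r x (chk a)"
          by (rule FM_chk_E[OF x _ q1]) (use q(2) in \<open>auto simp: fr_mem\<close>)
        obtain s z where s: "s \<in> bl r" "z \<in> elts K" "Th s a z" using total[OF bl_P(1)[OF r(1)] r(2)] by blast
        have sP: "s \<in> elts P" using bl_P(1)[OF s(1)] .
        have "FE s x (chk a)" using FE_below[OF x nm_chk r(3) s(1)] .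
        then have "FE s (op x (chk z)) (op (chk a) (chk z))"
          using FE_op[OF x nm_chk nm_chk nm_chk sP] FE_refl[OF nm_chk sP] by blast
        then have "FM s (op x (chk z)) F"
          using FM_left[OF nm_op[OF x nm_chk] nm_op[OF nm_chk nm_chk] nF sP] FI[OF r(2) s(2,3) sP] by blast
        then have "fr (rel_f F x (chk z)) s" using fr_rel[OF nF x nm_chk sP] by blast
        then show "\<exists>r\<in>bl q1. \<exists>y. nm y \<and> fr (rel_f F x y) r" using bl_trans[OF s(1) r(1)] nm_chk by blast
      qed
    qed
  qed
  have fun3: "fr (\<^bold>\<forall>x. \<^bold>\<forall>y. \<^bold>\<forall>y'. (rel_f F x y \<^bold>\<and> rel_f F x y') \<^bold>\<longrightarrow> y \<^bold>= y') p"
  proof (rule fr_all2[THEN iffD2, OF _ p], (intro stb_intros stb_rel nF; assumption), intro allI impI)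
    fix x y assume x: "nm x" and y: "nm y"
    show "fr (\<^bold>\<forall>y'. (rel_f F x y \<^bold>\<and> rel_f F x y') \<^bold>\<longrightarrow> y \<^bold>= y') p"
    proof (rule fr_all'[THEN iffD2, OF _ p], (intro stb_intros stb_rel nF x y; assumption), intro allI impI)
      fix y' assume y': "nm y'"
      show "fr ((rel_f F x y \<^bold>\<and> rel_f F x y') \<^bold>\<longrightarrow> y \<^bold>= y') p"
        unfolding fr_imp[OF stb_conj[OF stb_rel[OF nF x y] stb_rel[OF nF x y']] stb_eq[OF y y'] p] fr_conj fr_eq
      proof (intro ballI impI)
        fix q assume q: "q \<in> bl p" "fr (rel_f F x y) q \<and> fr (rel_f F x y') q"
        have qP: "q \<in> elts P" using bl_P(1)[OF q(1)] .
        have M: "FM q (op x y) F" "FM q (op x y') F" using q(2) fr_rel[OF nF x y qP] fr_rel[OF nF x y' qP] by auto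
        show "FE q y y'"
        proof (rule FE_dense[OF y y' qP])
          fix q1 assume q1: "q1 \<in> bl q"
          have q1P: "q1 \<in> elts P" using bl_P(1)[OF q1] .
          obtain r a z where r: "r \<in> bl q1" "a \<in> elts A" "z \<in> elts K" "Th r a z" "FE r (op x y) (op (chk a) (chk z))"
            using FEl[OF FM_below[OF nm_op[OF x y] nF M(1) q1] nm_op[OF x y] q1P] by blast
          have rP: "r \<in> elts P" "r \<in> bl q" using bl_P(1)[OF r(1)] bl_trans[OF r(1) q1] by auto
          obtain s a' z' where s: "s \<in> bl r" "a' \<in> elts A" "z' \<in> elts K" "Th s a' z'" "FE s (op x y') (op (chk a') (chk z'))"
            using FEl[OF FM_below[OF nm_op[OF x y'] nF M(2) rP(2)] nm_op[OF x y'] rP(1)] by blast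
          have sP: "s \<in> elts P" using bl_P(1)[OF s(1)] .
          have e1: "FE s x (chk a)" "FE s y (chk z)"
            using FE_op_D[OF x y nm_chk nm_chk rP(1) r(5)] FE_below[OF _ nm_chk _ s(1)] x y by blast+
          have e2: "FE s x (chk a')" "FE s y' (chk z')" using FE_op_D[OF x y' nm_chk nm_chk sP s(5)] by blast+
          have "FE s (chk a) (chk a')" using FE_trans[OF nm_chk x nm_chk sP FE_sym[OF x nm_chk sP e1(1)] e2(1)] .
          then have "a = a'" using FE_chk[OF sP] by blast
          then have "z = z'" using uniq[OF sP mono[OF r(4) s(1)]] s(4) by blast
          then have "FE s y y'" using FE_trans[OF y nm_chk y' sP e1(2)] FE_sym[OF y' nm_chk sP e2(2)] by blast
          then show "\<exists>r\<in>bl q1. FE r y y'" using bl_trans[OF s(1) r(1)] by blast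
        qed
      qed
    qed
  qed
  have "fr (fun_f F (chk A) (chk K)) p" unfolding fun_f_def fr_conj using fun1 fun2 fun3 by blast
  then have ante: "fr (chk A \<^bold>\<in> chk K \<^bold>\<and> fun_f F (chk A) (chk K)) p"
    unfolding fr_conj fr_mem using FM_chk_in[OF p A] by blast
  have sfun: "stb (fr (fun_f f a b))" if "nm f" "nm a" "nm b" for f a b
    unfolding fun_f_def by (intro stb_intros stb_rel stb_opair that)
  \<comment> \<open>The boundedness clause at the end of \<open>regular_f\<close>.\<close>
  define cn where "cn f = (\<^bold>\<exists>b. b \<^bold>\<in> chk K \<^bold>\<and> (\<^bold>\<forall>x. \<^bold>\<forall>y. rel_f f x y \<^bold>\<longrightarrow> y \<^bold>\<in> b))" for f
  have scn: "stb (fr (cn f))" if "nm f" for f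
    unfolding cn_def by (intro stb_intros stb_rel that nm_chk)
  have "fr (\<^bold>\<forall>a. \<^bold>\<forall>f. (a \<^bold>\<in> chk K \<^bold>\<and> fun_f f a (chk K)) \<^bold>\<longrightarrow> cn f) p"
    using reg unfolding regular_f_def fr_conj cn_def by blast
  then have "fr ((chk A \<^bold>\<in> chk K \<^bold>\<and> fun_f F (chk A) (chk K)) \<^bold>\<longrightarrow> cn F) p"
    by (rule fr_all2[THEN iffD1, OF _ p, rule_format, rotated]) (use nF sfun scn in \<open>auto intro!: stb_intros\<close>)
  then have "fr (cn F) p"
    using fr_imp[OF stb_conj[OF stb_mem[OF nm_chk nm_chk] sfun[OF nF nm_chk nm_chk]] scn[OF nF] p] ante bl_refl[OF p] by blast
  then obtain r b where r: "r \<in> bl p" "nm b" "fr (b \<^bold>\<in> chk K \<^bold>\<and> (\<^bold>\<forall>x. \<^bold>\<forall>y. rel_f F x y \<^bold>\<longrightarrow> y \<^bold>\<in> b)) r"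
  proof -
    have "\<forall>q\<in>bl p. \<exists>r\<in>bl q. \<exists>b. nm b \<and> fr (b \<^bold>\<in> chk K \<^bold>\<and> (\<^bold>\<forall>x. \<^bold>\<forall>y. rel_f F x y \<^bold>\<longrightarrow> y \<^bold>\<in> b)) r"
      by (rule fr_ex[THEN iffD1, OF _ p]) (use \<open>fr (cn F) p\<close> in \<open>auto simp: cn_def intro!: stb_intros stb_rel nF\<close>)
    then show thesis using that bl_refl[OF p] by blast
  qed
  have "FM r b (chk K)" using r(3) by (simp add: fr_conj fr_mem)
  then obtain r1 bb where r1: "r1 \<in> bl r" "bb \<in> elts K" "FE r1 b (chk bb)"
    by (rule FM_chk_E[OF r(2) _ bl_refl[OF bl_P(1)[OF r(1)]]])
  \<comment> \<open>Below \<open>r1\<close> the alleged bound is the ground-model element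
    \<open>bb\<close>; cofinality provides a decided value outside it.\<close>
  obtain q x z where q: "q \<in> bl r1" "x \<in> elts A" "z \<in> elts K" "z \<notin> elts bb" "Th q x z"
    using cofinal[OF bl_P(1)[OF r1(1)] r1(2)] by blast
  have qP: "q \<in> elts P" and qr: "q \<in> bl r" using bl_P(1)[OF q(1)] bl_trans[OF q(1) r1(1)] by auto
  have s: "stb (fr (rel_f F x y \<^bold>\<longrightarrow> y \<^bold>\<in> b))" if "nm x" "nm y" for x y
    by (intro stb_intros stb_rel nF that r(2))
  have "fr (rel_f F (chk x) (chk z) \<^bold>\<longrightarrow> chk z \<^bold>\<in> b) r"
    using fr_all2[where \<chi> = "\<lambda>x y. rel_f F x y \<^bold>\<longrightarrow> y \<^bold>\<in> b", THEN iffD1, OF s bl_P(1)[OF r(1)]] r(3) nm_chk unfolding fr_conj by blast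
  moreover have "fr (rel_f F (chk x) (chk z)) q"
    using fr_rel[OF nF nm_chk nm_chk qP] FI[OF q(2,3,5) qP] by blast
  ultimately have "FM q (chk z) b"
    using fr_imp[OF stb_rel[OF nF nm_chk nm_chk] stb_mem[OF nm_chk r(2)] bl_P(1)[OF r(1)]] qr by (auto simp: fr_mem)
  then have "FM q (chk z) (chk bb)"
    using FM_right[OF nm_chk r(2) nm_chk qP] FE_below[OF r(2) nm_chk r1(3) q(1)] by blast
  then show False using FM_chk[OF qP] q(4) by blast
qed

end

sublocale zfc_inaccessible \<subseteq> zfc_forcing E PP LL
  by unfold_locales (use le_PP le_refl le_trans in blast)+

context zfc_inaccessible
begin

section \<open>The tower is not presaturated\<close>

lemma PP_unfold: "tower_poset \<delta> TI = PP" "tower_order \<delta> TI = LL"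
  by (simp_all add: PP_def LL_def)

lemma col_int: assumes "Ord z" "elts z \<subseteq> elts X" shows "col (int M X) z = col M z"
proof -
  have "Ord z \<longrightarrow> elts z \<subseteq> elts X \<longrightarrow> col (int M X) z = col M z" for z
  proof (induction z rule: eps_induct)
    show "D (\<lambda>e. Ord (e 0) \<longrightarrow> elts (e 0) \<subseteq> elts X \<longrightarrow> col (int M X) (e 0) = col M (e 0))" by (intro dfn)
  next
    case (step z)
    show ?case
    proof (intro impI)
      assume z: "Ord z" "elts z \<subseteq> elts X"
      have "col (int M X) w = col M w" if "w \<in> elts z" for w
        using step[OF that] that z Ord_elt[OF z(1) that] Ord_trans[OF z(1) that] by blast
      then have "elts (col (int M X) z) = elts (col M z)"
        unfolding elts_col elts_int using z(2) by (auto intro!: image_cong)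
      then show "col (int M X) z = col M z" by (rule elts_eqI)
    qed
  qed
  with assms show ?thesis by blast
qed

definition eps :: "'v \<Rightarrow> 'v" where "eps M = ap EE (Union (int M kappa))"

lemma Dt_eps [THEN Dt_compose1, dfn]: "Dt (\<lambda>e. eps (e 0))" unfolding eps_def by (intro dfn)

lemma Good_eps: "Good M \<Longrightarrow> eps M \<in> elts omega2"
    "Good M \<Longrightarrow> z \<in> elts M \<Longrightarrow> z \<in> elts \<delta> \<Longrightarrow> col M z \<in> elts (eps M)"
  using EE(1) unfolding Good_def eps_def by auto

text \<open>From such a level on, traces determine both \<open>eps M\<close> and
  \<open>col M z\<close>.\<close>

lemma index_for: assumes "z \<in> elts \<delta>"
  obtains k where "k \<in> tower_index \<delta>"
    "\<And>l. l \<in> tower_index \<delta> \<Longrightarrow> elts k \<subseteq> elts l \<Longrightarrow> elts z \<subseteq> elts (H l) \<and> elts kappa \<subseteq> elts (H l)"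
proof -
  obtain k1 where k1: "k1 \<in> tower_index \<delta>" "z \<in> elts k1" by (rule tower_index_above[OF assms])
  obtain k2 where k2: "k2 \<in> tower_index \<delta>" "kappa \<in> elts k2" by (rule tower_index_above[OF kappa(1)])
  obtain k where k: "k \<in> tower_index \<delta>" "elts k1 \<subseteq> elts k" "elts k2 \<subseteq> elts k" by (rule index_max[OF k1(1) k2(1)])
  have "elts z \<subseteq> elts (H l) \<and> elts kappa \<subseteq> elts (H l)" if l: "l \<in> tower_index \<delta>" "elts k \<subseteq> elts l" for l
    using k k1 k2 l tower_indexD(8)[OF l(1)] Ord_trans[OF tower_indexD(3)[OF l(1)]] by blast
  then show thesis using that k(1) by blast
qed

lemma eps_int: "elts kappa \<subseteq> elts X \<Longrightarrow> eps (int M X) = eps M"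
proof -
  assume "elts kappa \<subseteq> elts X"
  then have "int (int M X) kappa = int M kappa" by (intro elts_eqI) auto
  then show ?thesis by (simp add: eps_def)
qed

lemma bounded_pred_eps_col: assumes "z \<in> elts \<delta>" shows "bounded_pred (\<lambda>M. \<phi> (eps M) (col M z))"
proof -
  obtain k where k: "k \<in> tower_index \<delta>"
    "\<And>l. l \<in> tower_index \<delta> \<Longrightarrow> elts k \<subseteq> elts l \<Longrightarrow> elts z \<subseteq> elts (H l) \<and> elts kappa \<subseteq> elts (H l)"
    by (rule index_for[OF assms]) blast
  have "Ord z" using assms Ord_elt[OF Ord_\<delta>] by blast
  then show ?thesis unfolding bounded_pred_def using k eps_int col_int by (intro bexI[of _ k]) auto
qed

lemma not_presaturated: "\<not> presaturated \<delta> TI"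
proof -
  have dJ: "D (\<lambda>e. (\<forall>a\<in>elts (e 0). ap (e 1) a \<in> elts omega1) \<and>
      (\<forall>a\<in>elts (e 0). \<forall>b\<in>elts (e 0). ap (e 1) a = ap (e 1) b \<longrightarrow> a = b))" by (intro dfn)
  have exJ: "\<exists>f. (\<forall>a\<in>elts g. ap f a \<in> elts omega1) \<and> (\<forall>a\<in>elts g. \<forall>b\<in>elts g. ap f a = ap f b \<longrightarrow> a = b)"
    if "g \<in> elts omega2" for g
    using that elts_omega2 card_le_iff[of g omega1] by blast
  obtain J where J: "\<And>g. g \<in> elts omega2 \<Longrightarrow> (\<forall>a\<in>elts g. ap (ap J g) a \<in> elts omega1) \<and>
      (\<forall>a\<in>elts g. \<forall>b\<in>elts g. ap (ap J g) a = ap (ap J g) b \<longrightarrow> a = b)"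
    by (rule AC_class[OF dJ exJ]) blast+
  \<comment> \<open>The chosen injection of \<open>eps M\<close> into omega_1 codes the order type
    of \<open>M \<inter> z\<close> by a countable ordinal; within a fixed good \<open>M\<close> it
    determines \<open>z\<close> among the ordinals below \<delta> in \<open>M\<close>.\<close>
  define c where "c z M = ap (ap J (eps M)) (col M z)" for z M
  have dc [THEN Dt_compose2, dfn]: "Dt (\<lambda>e. c (e 0) (e 1))" unfolding c_def by (intro dfn)
  have bc: "bounded_pred (\<lambda>M. c z M = x)" if "z \<in> elts \<delta>" for z x
    unfolding c_def by (rule bounded_pred_eps_col[OF that])
  \<comment> \<open>The function maps a code to the ordinal it codes. If no stronger condition
    decides such an ordinal, the value is \<open>emp\<close>, which makes the function
    total.\<close>
  define Th where "Th p x z \<longleftrightarrow> p \<in> elts PP \<and> z \<in> elts \<delta> \<and> (Fr p (\<lambda>M. c z M = x) \<or>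
    (z = emp \<and> (\<forall>z'\<in>elts \<delta>. \<forall>q\<in>bl p. \<not> Fr q (\<lambda>M. c z' M = x))))" for p x z
  have em: "emp \<in> elts \<delta>" using om_\<delta> om_0 Ord_trans[OF Ord_\<delta>] by blast
  have Fr_bl: "Fr q \<psi>" if "Fr p \<psi>" "q \<in> bl p" for p q \<psi> using Fr_le that by (simp add: bl_iff)
  obtain p where p: "p \<in> elts PP" by (rule PP_nonempty)
  have "\<not> fr (regular_f (chk \<delta>)) p"
  proof (rule not_forced_regular[where Th = Th, OF omega1_\<delta> _ _ _ _ _ p])
    show "D (\<lambda>e. Th (e 0) (e 1) (e 2))" unfolding Th_def Fr_def by (intro dfn)
    show "Th q x z" if "Th p x z" "q \<in> bl p" for p q x z
      using that Fr_bl bl_trans bl_P(1) unfolding Th_def by blast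
    show "\<exists>q\<in>bl p. \<exists>z\<in>elts \<delta>. Th q x z" if p: "p \<in> elts PP" for p x
    proof (cases "\<exists>z'\<in>elts \<delta>. \<exists>q\<in>bl p. Fr q (\<lambda>M. c z' M = x)")
      case True
      then show ?thesis unfolding Th_def using bl_P(1) by blast
    next
      case False
      then have "Th p x emp" unfolding Th_def using em p by blast
      then show ?thesis using bl_refl[OF p] em by blast
    qed
    show "z = z'" if "Th p x z" "Th p x z'" and p: "p \<in> elts PP" for p x z z'
    proof -
      have both: "z = z'" if F: "Fr p (\<lambda>M. c z M = x)" "Fr p (\<lambda>M. c z' M = x)" and z: "z \<in> elts \<delta>" "z' \<in> elts \<delta>"
      proof -
        have "Fr p (\<lambda>M. (c z M = x \<and> c z' M = x) \<and> z \<in> elts M \<and> z' \<in> elts M)"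
          using z \<delta>_sub_Vd by (intro Fr_conj F Fr_mem) blast+
        then obtain M where M: "meets M p" "c z M = x" "c z' M = x" "z \<in> elts M" "z' \<in> elts M" using Fr_ex[OF p] by blast
        then have G: "Good M" by (simp add: meets_def)
        have "col M z = col M z'"
          using J[OF Good_eps(1)[OF G], THEN conjunct2, rule_format, OF Good_eps(2)[OF G M(4) z(1)] Good_eps(2)[OF G M(5) z(2)]]
            M(2,3) unfolding c_def by simp
        then show ?thesis using col_inj M(4,5) z Ord_elt[OF Ord_\<delta>] by blast
      qed
      show ?thesis using that both bl_refl[OF p] unfolding Th_def by blast
    qed
    show "\<exists>q\<in>bl p. \<exists>x\<in>elts omega1. \<exists>z\<in>elts \<delta>. z \<notin> elts b \<and> Th q x z" if p: "p \<in> elts PP" and b: "b \<in> elts \<delta>" for p b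
    proof -
      \<comment> \<open>The value found outside \<open>b\<close> is \<open>b\<close> itself:
        pressing down on the countable code of \<open>b\<close> fixes its argument.\<close>
      have "Fr p (\<lambda>M. \<exists>x\<in>elts omega1. x \<in> elts M \<and> c b M = x)"
      proof (rule Fr_weaken[OF Fr_mem[of b]])
        show "b \<in> elts Vd" using b \<delta>_sub_Vd by blast
        fix M assume M: "meets M p" "b \<in> elts M"
        then have G: "Good M" by (simp add: meets_def)
        have "c b M \<in> elts omega1" using J[OF Good_eps(1)[OF G]] Good_eps(2)[OF G M(2) b] unfolding c_def by blast
        then show "\<exists>x\<in>elts omega1. x \<in> elts M \<and> c b M = x" using GoodD(4)[OF G] by blast
      qed
      moreover have "D (\<lambda>e. c b (e 1) = e 0)" by (intro dfn)
      moreover have "omega1 \<in> elts Vd" using omega1_\<delta> \<delta>_sub_Vd by blast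
      ultimately obtain x q where q: "x \<in> elts omega1" "le q p" "\<And>M. meets M q \<Longrightarrow> c b M = x"
        using press_down[where \<chi> = "\<lambda>x M. c b M = x", OF p _ bc[OF b]] by blast
      have "Fr q (\<lambda>M. c b M = x)" by (rule FrI[OF q(3)])
      then have "Th q x b" unfolding Th_def using b le_PP(1)[OF q(2)] by blast
      then show "\<exists>q\<in>bl p. \<exists>x\<in>elts omega1. \<exists>z\<in>elts \<delta>. z \<notin> elts b \<and> Th q x z"
        using q(1) b not_mem_self q(2)[folded bl_iff] by blast
    qed
  qed
  then show ?thesis unfolding presaturated_def PP_unfold forced_def check_chk using p by blast
qed

section \<open>Generic ultrapowers\<close>

abbreviation "B f \<equiv> bounded_support \<delta> f"
abbreviation "ult_forces \<equiv> ult_sat \<delta> TI"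

text \<open>The type of values is arbitrary, so that predicates, sets of values and finite
  assignments of the meta-logic are treated alike.\<close>

definition bounded_fun :: "('v \<Rightarrow> 'a) \<Rightarrow> bool" where
  "bounded_fun F \<longleftrightarrow> (\<exists>k\<in>tower_index \<delta>. \<forall>l\<in>tower_index \<delta>. elts k \<subseteq> elts l \<longrightarrow> (\<forall>M. Good M \<longrightarrow> F (int M (H l)) = F M))"

lemma bounded_pred_iff: "bounded_pred \<psi> \<longleftrightarrow> bounded_fun \<psi>" unfolding bounded_pred_def bounded_fun_def ..

lemma bounded_funE: assumes "bounded_fun F"
  obtains k where "k \<in> tower_index \<delta>" "\<And>l M. l \<in> tower_index \<delta> \<Longrightarrow> elts k \<subseteq> elts l \<Longrightarrow> Good M \<Longrightarrow> F (int M (H l)) = F M"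
  using assms unfolding bounded_fun_def by blast

lemma bounded_fun1: "bounded_fun F \<Longrightarrow> bounded_fun (\<lambda>M. h (F M))" unfolding bounded_fun_def by metis

lemma bounded_fun2: assumes "bounded_fun F" "bounded_fun G" shows "bounded_fun (\<lambda>M. h (F M) (G M))"
proof -
  obtain k where k: "k \<in> tower_index \<delta>" "\<And>l M. l \<in> tower_index \<delta> \<Longrightarrow> elts k \<subseteq> elts l \<Longrightarrow> Good M \<Longrightarrow> F (int M (H l)) = F M"
    by (rule bounded_funE[OF assms(1)]) blast
  obtain k' where k': "k' \<in> tower_index \<delta>" "\<And>l M. l \<in> tower_index \<delta> \<Longrightarrow> elts k' \<subseteq> elts l \<Longrightarrow> Good M \<Longrightarrow> G (int M (H l)) = G M"
    by (rule bounded_funE[OF assms(2)]) blast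
  obtain m where m: "m \<in> tower_index \<delta>" "elts k \<subseteq> elts m" "elts k' \<subseteq> elts m" by (rule index_max[OF k(1) k'(1)])
  have "h (F (int M (H l))) (G (int M (H l))) = h (F M) (G M)" if "l \<in> tower_index \<delta>" "elts m \<subseteq> elts l" "Good M" for l M
    using k(2)[of l M] k'(2)[of l M] that m by auto
  then show ?thesis unfolding bounded_fun_def using m(1) by blast
qed

lemma B_opair: assumes "B f" shows "bounded_fun (\<lambda>M. {u. opair M u \<in> elts f})"
proof -
  obtain k where k: "k \<in> tower_index \<delta>" and e: "\<forall>x\<in>elts Vd. \<forall>x'\<in>elts Vd.
      elts x \<inter> elts (H k) = elts x' \<inter> elts (H k) \<longrightarrow> (\<forall>y. opair x y \<in> elts f \<longleftrightarrow> opair x' y \<in> elts f)"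
    using assms[unfolded bounded_support_def Vlevel_\<delta>, THEN conjunct2, THEN conjunct2] by (rule bexE)
  have "opair (int M (H l)) y \<in> elts f \<longleftrightarrow> opair M y \<in> elts f" if l: "l \<in> tower_index \<delta>" "elts k \<subseteq> elts l" and M: "Good M" for l M y
  proof (rule e[rule_format])
    show "M \<in> elts Vd" using GoodD(6)[OF M] .
    then show "int M (H l) \<in> elts Vd" by (rule Vd_subset) simp
    show "elts (int M (H l)) \<inter> elts (H k) = elts M \<inter> elts (H k)"
      using arg_cong[OF int_H[OF k l(1,2), of M], of elts] by simp
  qed
  then show ?thesis unfolding bounded_fun_def using k by blast
qed

lemma B_fun: "B f \<Longrightarrow> opair M u \<in> elts f \<Longrightarrow> ap f M = u"
  by (rule ap_unique) (auto simp: bounded_support_def)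

lemma B_ap: assumes "B f" shows "bounded_fun (ap f)"
proof -
  have "(\<lambda>M. ap f M) = (\<lambda>M. if \<exists>!y. y \<in> {u. opair M u \<in> elts f} then THE y. y \<in> {u. opair M u \<in> elts f} else emp)"
    unfolding ap_def mem_Collect_eq ..
  then show ?thesis
    using bounded_fun1[OF B_opair[OF assms], of "\<lambda>A. if \<exists>!y. y \<in> A then THE y. y \<in> A else emp"] by simp
qed

definition defined_at :: "'v \<Rightarrow> 'v \<Rightarrow> bool" where "defined_at f M \<longleftrightarrow> (\<exists>u. opair M u \<in> elts f)"

lemma defined_at_ap: "B f \<Longrightarrow> defined_at f M \<Longrightarrow> opair M u \<in> elts f \<longleftrightarrow> u = ap f M"
  using B_fun unfolding defined_at_def by blast

lemma D_B [THEN D_compose1, dfn]: "D (\<lambda>e. B (e 0))"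
  unfolding bounded_support_def Vlevel_\<delta> Bex_def[of "tower_index \<delta>"] set_eq_iff Int_iff by (intro dfn)

lemma Fr_cong: "Fr p \<psi> \<Longrightarrow> (\<And>M. meets M p \<Longrightarrow> \<psi> M \<Longrightarrow> \<chi> M = \<chi>' M) \<Longrightarrow> Fr p \<chi> \<longleftrightarrow> Fr p \<chi>'"
  using Fr_weaken[OF Fr_conj, of p \<psi> \<chi> \<chi>'] Fr_weaken[OF Fr_conj, of p \<psi> \<chi>' \<chi>] by blast

section \<open>Relations of the ultrapower as statements about almost all good sets\<close>

lemma FM_cond: assumes p: "p \<in> elts PP" and l: "l \<in> tower_index \<delta>" and d: "D (\<lambda>e. \<psi> (e 0))"
  shows "FM p (chk (opair l (vset {M \<in> elts (Z l). \<psi> M}))) (generic_name PP) \<longleftrightarrow> Fr p (\<lambda>M. \<psi> (int M (H l)))"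
proof -
  define A where "A = vset {M \<in> elts (Z l). \<psi> M}"
  have A: "elts A = {M \<in> elts (Z l). \<psi> M}" unfolding A_def by (rule elts_vset, rule small_sep[OF d])
  have me: "meets M (opair l A) \<longleftrightarrow> Good M \<and> \<psi> (int M (H l))" for M
    using trace_Z by (auto simp: meets_def A)
  have d': "D (\<lambda>e. \<psi> (int (e 0) (H l)))" by (rule D_compose1[OF d]) (intro dfn)
  have "bounded_pred (\<lambda>M. \<psi> (int M (H l)))" unfolding bounded_pred_def using int_H[OF l] l by (intro bexI[OF _ l]) auto
  note b = this
  have "(\<forall>q\<in>bl p. \<exists>r\<in>bl q. r \<in> bl (opair l A)) \<longleftrightarrow> Fr p (\<lambda>M. \<psi> (int M (H l)))"
  proof
    assume h: "\<forall>q\<in>bl p. \<exists>r\<in>bl q. r \<in> bl (opair l A)"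
    show "Fr p (\<lambda>M. \<psi> (int M (H l)))"
    proof (rule Fr_dense[OF p b d'])
      fix q assume "le q p"
      then obtain r where r: "le r q" "le r (opair l A)" using h unfolding bl_iff[symmetric] by blast
      have "Fr r (\<lambda>M. \<psi> (int M (H l)))" by (rule FrI) (use le_meets[OF r(2)] me in blast)
      then show "\<exists>r. le r q \<and> Fr r (\<lambda>M. \<psi> (int M (H l)))" using r(1) by blast
    qed
  next
    assume F: "Fr p (\<lambda>M. \<psi> (int M (H l)))"
    show "\<forall>q\<in>bl p. \<exists>r\<in>bl q. r \<in> bl (opair l A)"
    proof
      fix q assume "q \<in> bl p"
      then have q: "le q p" "q \<in> elts PP" using bl_P(1) by (auto simp: bl_iff)
      have Fq: "Fr q (\<lambda>M. \<psi> (int M (H l)))" by (rule Fr_le[OF F q(1)])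
      obtain m where m: "m \<in> tower_index \<delta>" "elts l \<subseteq> elts m" "elts (pfst q) \<subseteq> elts m"
        by (rule index_max[OF l PP_index[OF q(2)]])
      define S where "S = sep (Z m) (\<lambda>N. int N (H (pfst q)) \<in> elts (psnd q) \<and> int N (H l) \<in> elts A)"
      have S: "elts S = {N \<in> elts (Z m). int N (H (pfst q)) \<in> elts (psnd q) \<and> int N (H l) \<in> elts A}"
        unfolding S_def by (rule elts_sep) (intro dfn)
      have mS: "meets M (opair m S) \<longleftrightarrow> meets M q \<and> \<psi> (int M (H l))" for M
      proof (cases "Good M")
        case True
        then show ?thesis
          using int_H[OF PP_index[OF q(2)] m(1,3)] int_H[OF l m(1,2)] trace_Z[OF True]
          by (auto simp: meets_def S A)
      qed (simp add: meets_def)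
      have ex: "\<exists>M. a \<in> elts M \<and> meets M (opair m S)" if "a \<in> elts Vd" for a
        using Fr_ex[OF q(2) Fr_conj[OF Fq Fr_mem[OF that]]] mS by blast
      have r: "opair m S \<in> elts PP"
        unfolding PP_iff using ex m(1) S by blast
      have s: "opair l A \<in> elts PP"
        unfolding PP_iff
      proof
        show "\<exists>l' S. opair l A = opair l' S \<and> l' \<in> tower_index \<delta> \<and> elts S \<subseteq> elts (Z l')" using l A by blast
        show "\<forall>a\<in>elts Vd. \<exists>M. a \<in> elts M \<and> meets M (opair l A)" using ex mS me unfolding meets_def by blast
      qed
      have "le (opair m S) q" unfolding LL_iff using r q(2) m(3) S by auto
      moreover have "le (opair m S) (opair l A)" unfolding LL_iff using r s m(2) S by auto
      ultimately show "\<exists>r\<in>bl q. r \<in> bl (opair l A)" by (intro bexI[of _ "opair m S"]) (simp_all only: bl_iff)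
    qed
  qed
  then show ?thesis unfolding FM_generic[OF p] A_def .
qed

text \<open>All levels beyond one that decides \<psi> give the same statement, and the density in
  the forced quantifier is absorbed by \<open>Fr_dense\<close>.\<close>

lemma ult_eventually_iff: assumes p: "p \<in> elts PP" and b: "bounded_pred \<psi>" and d: "D (\<lambda>e. \<psi> (e 0))"
  shows "ult_eventually \<delta> TI (\<lambda>l. {M \<in> elts (Z l). \<psi> M}) p \<longleftrightarrow> Fr p \<psi>"
proof -
  obtain k where k: "k \<in> tower_index \<delta>" "\<And>l M. l \<in> tower_index \<delta> \<Longrightarrow> elts k \<subseteq> elts l \<Longrightarrow> Good M \<Longrightarrow>
      \<psi> (int M (H l)) = \<psi> M" using b unfolding bounded_pred_def by blast
  have kF: "Fr q (\<lambda>M. \<psi> (int M (H l))) \<longleftrightarrow> Fr q \<psi>" if l: "l \<in> tower_index \<delta>" "elts k \<subseteq> elts l" for l q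
    unfolding Fr_def meets_def using k(2)[OF l] by blast
  have sep: "(\<forall>x\<in>{l \<in> T. Q l}. \<phi> x) \<longleftrightarrow> (\<forall>l\<in>T. Q l \<longrightarrow> \<phi> l)" for T :: "'v set" and Q \<phi> by blast
  have e: "ult_eventually \<delta> TI (\<lambda>l. {M \<in> elts (Z l). \<psi> M}) p \<longleftrightarrow>
    (\<forall>q\<in>bl p. \<exists>l0\<in>tower_index \<delta>. \<exists>r\<in>bl q. \<forall>l\<in>tower_index \<delta>. elts l0 \<subseteq> elts l \<longrightarrow>
      FM r (chk (opair l (vset {M \<in> elts (Z l). \<psi> M}))) (generic_name PP))"
    unfolding ult_eventually_def Let_def PP_unfold check_chk fex_def fneg_def fall_def sep by simp
  show ?thesis
    unfolding e
  proof
    assume h: "\<forall>q\<in>bl p. \<exists>l0\<in>tower_index \<delta>. \<exists>r\<in>bl q. \<forall>l\<in>tower_index \<delta>. elts l0 \<subseteq> elts l \<longrightarrow>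
      FM r (chk (opair l (vset {M \<in> elts (Z l). \<psi> M}))) (generic_name PP)"
    show "Fr p \<psi>"
    proof (rule Fr_dense[OF p b d])
      fix q assume "le q p"
      then obtain l0 r where r: "l0 \<in> tower_index \<delta>" "le r q" "\<And>l. l \<in> tower_index \<delta> \<Longrightarrow> elts l0 \<subseteq> elts l \<Longrightarrow>
          FM r (chk (opair l (vset {M \<in> elts (Z l). \<psi> M}))) (generic_name PP)"
        using h unfolding bl_iff[symmetric] by blast
      obtain l where l: "l \<in> tower_index \<delta>" "elts k \<subseteq> elts l" "elts l0 \<subseteq> elts l" by (rule index_max[OF k(1) r(1)])
      have "Fr r \<psi>" using r(3)[OF l(1,3)] FM_cond[OF le_PP(1)[OF r(2)] l(1) d] kF[OF l(1,2)] by blast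
      then show "\<exists>r. le r q \<and> Fr r \<psi>" using r(2) by blast
    qed
  next
    assume F: "Fr p \<psi>"
    show "\<forall>q\<in>bl p. \<exists>l0\<in>tower_index \<delta>. \<exists>r\<in>bl q. \<forall>l\<in>tower_index \<delta>. elts l0 \<subseteq> elts l \<longrightarrow>
      FM r (chk (opair l (vset {M \<in> elts (Z l). \<psi> M}))) (generic_name PP)"
    proof
      fix q assume q: "q \<in> bl p"
      have "Fr q \<psi>" using Fr_le[OF F] q by (simp add: bl_iff)
      then have "FM q (chk (opair l (vset {M \<in> elts (Z l). \<psi> M}))) (generic_name PP)"
        if "l \<in> tower_index \<delta>" "elts k \<subseteq> elts l" for l
        using FM_cond[OF bl_P(1)[OF q] that(1) d] kF[OF that] by blast
      then show "\<exists>l0\<in>tower_index \<delta>. \<exists>r\<in>bl q. \<forall>l\<in>tower_index \<delta>. elts l0 \<subseteq> elts l \<longrightarrow>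
          FM r (chk (opair l (vset {M \<in> elts (Z l). \<psi> M}))) (generic_name PP)"
        using k(1) bl_refl[OF bl_P(1)[OF q]] by blast
    qed
  qed
qed

lemma ult_eq_iff: assumes p: "p \<in> elts PP" and f: "B f" "B g"
  shows "ult_eq \<delta> TI f g p \<longleftrightarrow> Fr p (\<lambda>M. defined_at f M \<and> defined_at g M \<and> ap f M = ap g M)"
proof -
  have b: "bounded_pred (\<lambda>M. \<exists>u. opair M u \<in> elts f \<and> opair M u \<in> elts g)"
    using bounded_fun2[OF B_opair[OF f(1)] B_opair[OF f(2)], of "\<lambda>X Y. \<exists>u. u \<in> X \<and> u \<in> Y"] unfolding bounded_pred_iff by simp
  have d: "D (\<lambda>e. \<exists>u. opair (e 0) u \<in> elts f \<and> opair (e 0) u \<in> elts g)" by (intro dfn)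
  have "(\<exists>u. opair M u \<in> elts f \<and> opair M u \<in> elts g) \<longleftrightarrow> defined_at f M \<and> defined_at g M \<and> ap f M = ap g M" for M
    using defined_at_ap[OF f(1)] defined_at_ap[OF f(2)] unfolding defined_at_def by metis
  then show ?thesis unfolding ult_eq_def ult_eventually_iff[OF p b d] by simp
qed

lemma ult_mem_iff: assumes p: "p \<in> elts PP" and f: "B f" "B g"
  shows "ult_mem \<delta> TI f g p \<longleftrightarrow> Fr p (\<lambda>M. defined_at f M \<and> defined_at g M \<and> ap f M \<in> elts (ap g M))"
proof -
  have b: "bounded_pred (\<lambda>M. \<exists>u v. opair M u \<in> elts f \<and> opair M v \<in> elts g \<and> u \<in> elts v)"
    using bounded_fun2[OF B_opair[OF f(1)] B_opair[OF f(2)], of "\<lambda>X Y. \<exists>u v. u \<in> X \<and> v \<in> Y \<and> u \<in> elts v"]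
    unfolding bounded_pred_iff by simp
  have d: "D (\<lambda>e. \<exists>u v. opair (e 0) u \<in> elts f \<and> opair (e 0) v \<in> elts g \<and> u \<in> elts v)" by (intro dfn)
  have "(\<exists>u v. opair M u \<in> elts f \<and> opair M v \<in> elts g \<and> u \<in> elts v) \<longleftrightarrow> defined_at f M \<and> defined_at g M \<and> ap f M \<in> elts (ap g M)" for M
    using defined_at_ap[OF f(1)] defined_at_ap[OF f(2)] unfolding defined_at_def by metis
  then show ?thesis unfolding ult_mem_def ult_eventually_iff[OF p b d] by simp
qed

lemma ult_dom_iff: assumes p: "p \<in> elts PP" shows "ult_dom \<delta> TI f p \<longleftrightarrow> B f \<and> Fr p (defined_at f)"
  using ult_eq_iff[OF p, of f f] unfolding ult_dom_def fconj_def by auto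

text \<open>A choice function on the traces at a level deciding \<chi>, read on all of V_\<delta>
  through these traces; so it has bounded support and is defined at every good set. It represents
  witnesses in the ultrapower.\<close>

lemma select: assumes d: "D (\<lambda>e. \<chi> (e 0) (e 1))" and b: "bounded_fun \<chi>"
  obtains h where "B h" "\<And>p. Fr p (defined_at h)" "\<And>M u. Good M \<Longrightarrow> \<chi> M u \<Longrightarrow> \<chi> M (ap h M)"
proof -
  obtain m where m: "m \<in> tower_index \<delta>" "\<And>l M. l \<in> tower_index \<delta> \<Longrightarrow> elts m \<subseteq> elts l \<Longrightarrow> Good M \<Longrightarrow> \<chi> (int M (H l)) = \<chi> M"
    by (rule bounded_funE[OF b]) blast
  have R: "D (\<lambda>e. (\<exists>u. \<chi> (e 0) u) \<longrightarrow> \<chi> (e 0) (e 1))" by (intro dfn D_compose2[OF d])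
  obtain c where c: "\<And>N. N \<in> elts (Z m) \<Longrightarrow> (\<exists>u. \<chi> N u) \<longrightarrow> \<chi> N (ap c N)"
    by (rule AC_class[OF R]) blast+
  define F where "F N = ap c (int N (H m))" for N
  have dF: "Dt (\<lambda>e. F (e 0))" unfolding F_def by (intro dfn)
  have op: "opair M u \<in> elts (Lam Vd F) \<longleftrightarrow> M \<in> elts Vd \<and> u = F M" for M u
    by (auto simp: elts_Lam[OF dF])
  have F: "F x = F x'" if "elts x \<inter> elts (H m) = elts x' \<inter> elts (H m)" for x x'
  proof -
    have "int x (H m) = int x' (H m)" by (rule elts_eqI) (use that in simp)
    then show ?thesis by (simp add: F_def)
  qed
  have B: "B (Lam Vd F)"
    unfolding bounded_support_def Vlevel_\<delta> op
  proof (intro conjI)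
    show "\<forall>w\<in>elts (Lam Vd F). \<exists>x\<in>elts Vd. \<exists>y. w = opair x y" unfolding elts_Lam[OF dF] by blast
    show "\<forall>x y y'. (x \<in> elts Vd \<and> y = F x) \<and> x \<in> elts Vd \<and> y' = F x \<longrightarrow> y = y'" by blast
    show "\<exists>l\<in>tower_index \<delta>. \<forall>x\<in>elts Vd. \<forall>x'\<in>elts Vd. elts x \<inter> elts (H l) = elts x' \<inter> elts (H l) \<longrightarrow>
      (\<forall>y. (x \<in> elts Vd \<and> y = F x) = (x' \<in> elts Vd \<and> y = F x'))"
      using F by (intro bexI[OF _ m(1)] ballI impI allI) metis
  qed
  have "Fr p (defined_at (Lam Vd F))" for p
    by (rule FrI) (use GoodD(6) in \<open>auto simp: defined_at_def op meets_def\<close>)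
  moreover have "\<chi> M (ap (Lam Vd F) M)" if M: "Good M" "\<chi> M u" for M u
  proof -
    have e: "\<chi> (int M (H m)) = \<chi> M" by (rule m(2)[OF m(1) _ M(1)]) simp
    have "\<chi> (int M (H m)) (F M)" unfolding F_def using c[OF trace_Z[OF M(1)]] e M(2) by auto
    then show ?thesis using e ap_Lam[OF dF GoodD(6)[OF M(1)]] by simp
  qed
  ultimately show thesis using that B by blast
qed

lemma ult_forces_simps: "ult_forces (x \<^bold>\<in> y) p \<longleftrightarrow> ult_mem \<delta> TI x y p" "ult_forces (x \<^bold>= y) p \<longleftrightarrow> ult_eq \<delta> TI x y p"
  "ult_forces (\<^bold>\<not> \<phi>) p \<longleftrightarrow> (\<forall>q\<in>bl p. \<not> ult_forces \<phi> q)" "ult_forces (\<phi> \<^bold>\<and> \<psi>) p \<longleftrightarrow> ult_forces \<phi> p \<and> ult_forces \<psi> p"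
  "ult_forces (All \<chi>) p \<longleftrightarrow> (\<forall>x. \<forall>q\<in>bl p. ult_dom \<delta> TI x q \<longrightarrow> (\<exists>r\<in>bl q. ult_forces (\<chi> x) r))"
  unfolding ult_sat_def fsat.simps fneg_def fconj_def fall_def fimp_def PP_unfold by auto

text \<open>
  Since quantifiers of formulas range over functions of the meta-logic, Los's theorem is restricted to
  those formulas whose satisfaction is definable and depends on finitely many parameters.
\<close>

definition definable_sat :: "((nat \<Rightarrow> 'v) \<Rightarrow> 'v form) \<Rightarrow> bool" where
  "definable_sat \<chi> \<longleftrightarrow> (\<forall>t. (\<forall>i. Dt (t i)) \<longrightarrow> D (\<lambda>e. sat (\<chi> (\<lambda>i. t i e)))) \<and>
    (\<exists>n. \<forall>e e'. (\<forall>i<n. e i = e' i) \<longrightarrow> sat (\<chi> e) = sat (\<chi> e'))"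

definition adequate :: "(nat \<Rightarrow> 'v) \<Rightarrow> 'v \<Rightarrow> bool" where
  "adequate s p \<longleftrightarrow> p \<in> elts PP \<and> (\<forall>i. B (s i) \<and> Fr p (defined_at (s i)))"

definition vals :: "(nat \<Rightarrow> 'v) \<Rightarrow> 'v \<Rightarrow> nat \<Rightarrow> 'v" where "vals s M i = ap (s i) M"

definition Los :: "((nat \<Rightarrow> 'v) \<Rightarrow> 'v form) \<Rightarrow> bool" where
  "Los \<chi> \<longleftrightarrow> definable_sat \<chi> \<and> (\<forall>s p. adequate s p \<longrightarrow> ult_forces (\<chi> s) p \<longleftrightarrow> Fr p (\<lambda>M. sat (\<chi> (vals s M))))"

lemma definable_satD: "definable_sat \<chi> \<Longrightarrow> (\<And>i. Dt (t i)) \<Longrightarrow> D (\<lambda>e. sat (\<chi> (\<lambda>i. t i e)))" unfolding definable_sat_def by blast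

text \<open>Finitely many functions have a common level of support; infinitely many might not. This
  is why \<open>definable_sat\<close> includes dependence on finitely many parameters.\<close>

lemma bounded_fun_vals: assumes "\<And>i. B (s i)" shows "bounded_fun (\<lambda>M i. if i < (n::nat) then vals s M i else emp)"
proof (induction n)
  case 0
  show ?case unfolding bounded_fun_def using tower_index_above[OF om_\<delta>] by auto
next
  case (Suc n)
  have b: "bounded_fun (\<lambda>M. vals s M n)" unfolding vals_def using B_ap[OF assms] by simp
  have e: "(\<lambda>M i. if i < Suc n then vals s M i else emp) =
      (\<lambda>M. (\<lambda>i. if i < n then vals s M i else emp)(n := vals s M n))" by (auto simp: fun_eq_iff)
  show ?case unfolding e by (rule bounded_fun2[OF Suc b])
qed

lemma definable_sat_bounded: assumes "definable_sat \<chi>" "\<And>i. B (s i)" shows "bounded_fun (\<lambda>M. sat (\<chi> (vals s M)))"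
proof -
  obtain n where n: "\<And>e e'. (\<And>i. i < n \<Longrightarrow> e i = e' i) \<Longrightarrow> sat (\<chi> e) = sat (\<chi> e')"
    using assms(1) unfolding definable_sat_def by blast
  have "sat (\<chi> (vals s M)) = sat (\<chi> (\<lambda>i. if i < n then vals s M i else emp))" for M by (rule n) simp
  then show ?thesis using bounded_fun1[OF bounded_fun_vals[OF assms(2)], of "\<lambda>e. sat (\<chi> e)" n] by simp
qed

lemma definable_sat_D: assumes "definable_sat \<chi>" shows "D (\<lambda>e. sat (\<chi> (vals s (e 0))))"
proof -
  have "D (\<lambda>e. sat (\<chi> (\<lambda>i. ap (s i) (e 0))))" by (rule definable_satD[OF assms]) (intro dfn)
  then show ?thesis unfolding vals_def[abs_def] .
qed

lemma definable_sat_All: assumes "definable_sat (\<lambda>e. \<phi> (\<lambda>i. e (Suc i)) (e 0))" shows "definable_sat (\<lambda>e. All (\<phi> e))"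
proof -
  have "D (\<lambda>e. \<forall>x. sat (\<phi> (\<lambda>i. t i e) x))" if t: "\<And>i. Dt (t i)" for t
  proof -
    define t' where "t' = case_nat (\<lambda>e. e 0) (\<lambda>j e. t j (\<lambda>n. e (Suc n)))"
    have t': "Dt (t' i)" for i unfolding t'_def using Dt_shift[OF t] Dt_var by (auto split: nat.splits)
    show ?thesis using D_All[of "\<lambda>x e. sat (\<phi> (\<lambda>i. t i e) x)"] definable_satD[OF assms, of t', OF t']
      unfolding t'_def by simp
  qed
  moreover obtain n where n: "\<And>e e'. (\<And>i. i < n \<Longrightarrow> e i = e' i) \<Longrightarrow>
      sat (\<phi> (\<lambda>i. e (Suc i)) (e 0)) = sat (\<phi> (\<lambda>i. e' (Suc i)) (e' 0))"
    using assms unfolding definable_sat_def by blast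
  have "sat (\<phi> e x) = sat (\<phi> e' x)" if "\<forall>i<n. e i = e' i" for e e' x
    using n[of "case_nat x e" "case_nat x e'"] that by (auto split: nat.splits)
  then have "(\<forall>x. sat (\<phi> e x)) = (\<forall>x. sat (\<phi> e' x))" if "\<forall>i<n. e i = e' i" for e e' using that by blast
  ultimately show ?thesis unfolding definable_sat_def sat.simps by blast
qed

lemma Fr_bl: "Fr p \<psi> \<Longrightarrow> q \<in> bl p \<Longrightarrow> Fr q \<psi>"
  using Fr_le by (simp add: bl_iff)

lemma adequate_le: assumes "adequate s p" "q \<in> bl p" shows "adequate s q"
proof -
  have "Fr q (defined_at (s i))" for i by (rule Fr_bl[OF _ assms(2)]) (use assms(1) in \<open>simp add: adequate_def\<close>)
  then show ?thesis using assms bl_P(1) unfolding adequate_def by blast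
qed

named_theorems Los_intros

lemma Los_mem [Los_intros]: "Los (\<lambda>e. e i \<^bold>\<in> e j)"
  unfolding Los_def
proof (intro conjI allI impI)
  show "definable_sat (\<lambda>e. e i \<^bold>\<in> e j)" unfolding definable_sat_def sat.simps
    by (intro conjI allI impI exI[of _ "Suc (max i j)"] D_E) auto
next
  fix s p assume a: "adequate s p"
  then have F: "Fr p (\<lambda>M. defined_at (s i) M \<and> defined_at (s j) M)" by (intro Fr_conj) (auto simp: adequate_def)
  have "ult_forces (s i \<^bold>\<in> s j) p \<longleftrightarrow> Fr p (\<lambda>M. defined_at (s i) M \<and> defined_at (s j) M \<and> ap (s i) M \<in> elts (ap (s j) M))"
    unfolding ult_forces_simps by (rule ult_mem_iff) (use a in \<open>auto simp: adequate_def\<close>)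
  also have "\<dots> \<longleftrightarrow> Fr p (\<lambda>M. sat (vals s M i \<^bold>\<in> vals s M j))"
    by (rule Fr_cong[OF F]) (simp add: vals_def elts_def)
  finally show "ult_forces (s i \<^bold>\<in> s j) p \<longleftrightarrow> Fr p (\<lambda>M. sat (vals s M i \<^bold>\<in> vals s M j))" .
qed

lemma Los_eq [Los_intros]: "Los (\<lambda>e. e i \<^bold>= e j)"
  unfolding Los_def
proof (intro conjI allI impI)
  show "definable_sat (\<lambda>e. e i \<^bold>= e j)" unfolding definable_sat_def sat.simps
    by (intro conjI allI impI exI[of _ "Suc (max i j)"] D_eq) auto
next
  fix s p assume a: "adequate s p"
  then have F: "Fr p (\<lambda>M. defined_at (s i) M \<and> defined_at (s j) M)" by (intro Fr_conj) (auto simp: adequate_def)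
  have "ult_forces (s i \<^bold>= s j) p \<longleftrightarrow> Fr p (\<lambda>M. defined_at (s i) M \<and> defined_at (s j) M \<and> ap (s i) M = ap (s j) M)"
    unfolding ult_forces_simps by (rule ult_eq_iff) (use a in \<open>auto simp: adequate_def\<close>)
  also have "\<dots> \<longleftrightarrow> Fr p (\<lambda>M. sat (vals s M i \<^bold>= vals s M j))"
    by (rule Fr_cong[OF F]) (simp add: vals_def)
  finally show "ult_forces (s i \<^bold>= s j) p \<longleftrightarrow> Fr p (\<lambda>M. sat (vals s M i \<^bold>= vals s M j))" .
qed

lemma Los_neg [Los_intros]: assumes L: "Los \<chi>" shows "Los (\<lambda>e. \<^bold>\<not> \<chi> e)"
  unfolding Los_def
proof (intro conjI allI impI)
  have dc: "definable_sat \<chi>" using L unfolding Los_def by blast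
  show "definable_sat (\<lambda>e. \<^bold>\<not> \<chi> e)" using dc unfolding definable_sat_def sat.simps by (auto intro: D_not)
  fix s p assume a: "adequate s p"
  have b: "bounded_pred (\<lambda>M. sat (\<chi> (vals s M)))"
    unfolding bounded_pred_iff by (rule definable_sat_bounded[OF dc]) (use a in \<open>simp add: adequate_def\<close>)
  have p: "p \<in> elts PP" using a by (simp add: adequate_def)
  have "ult_forces (\<^bold>\<not> \<chi> s) p \<longleftrightarrow> (\<forall>q\<in>bl p. \<not> Fr q (\<lambda>M. sat (\<chi> (vals s M))))"
    unfolding ult_forces_simps using L adequate_le[OF a] unfolding Los_def by blast
  also have "\<dots> \<longleftrightarrow> Fr p (\<lambda>M. \<not> sat (\<chi> (vals s M)))"
  proof
    assume h: "\<forall>q\<in>bl p. \<not> Fr q (\<lambda>M. sat (\<chi> (vals s M)))"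
    show "Fr p (\<lambda>M. \<not> sat (\<chi> (vals s M)))"
    proof (rule ccontr)
      assume "\<not> Fr p (\<lambda>M. \<not> sat (\<chi> (vals s M)))"
      then obtain q where q: "le q p" "\<And>M. meets M q \<Longrightarrow> sat (\<chi> (vals s M))"
        by (rule strengthen[OF p b definable_sat_D[OF dc]]) blast
      have "Fr q (\<lambda>M. sat (\<chi> (vals s M)))" by (rule FrI) (rule q(2))
      then show False using h q(1) unfolding bl_iff[symmetric] by blast
    qed
  next
    assume F: "Fr p (\<lambda>M. \<not> sat (\<chi> (vals s M)))"
    show "\<forall>q\<in>bl p. \<not> Fr q (\<lambda>M. sat (\<chi> (vals s M)))"
    proof (intro ballI notI)
      fix q assume q: "q \<in> bl p" "Fr q (\<lambda>M. sat (\<chi> (vals s M)))"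
      show False by (rule Fr_not[OF bl_P(1)[OF q(1)] q(2) Fr_bl[OF F q(1)]])
    qed
  qed
  finally show "ult_forces (\<^bold>\<not> \<chi> s) p \<longleftrightarrow> Fr p (\<lambda>M. sat (\<^bold>\<not> \<chi> (vals s M)))" by simp
qed

lemma Los_conj [Los_intros]: assumes L: "Los \<chi>" "Los \<phi>" shows "Los (\<lambda>e. \<chi> e \<^bold>\<and> \<phi> e)"
  unfolding Los_def
proof (intro conjI allI impI)
  have c: "definable_sat \<chi>" "definable_sat \<phi>" using L unfolding Los_def by auto
  obtain n where n: "\<And>e e'. (\<forall>i<n. e i = e' i) \<Longrightarrow> sat (\<chi> e) = sat (\<chi> e')" using c(1) unfolding definable_sat_def by blast
  obtain m where m: "\<And>e e'. (\<forall>i<m. e i = e' i) \<Longrightarrow> sat (\<phi> e) = sat (\<phi> e')" using c(2) unfolding definable_sat_def by blast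
  have "(sat (\<chi> e) \<and> sat (\<phi> e)) = (sat (\<chi> e') \<and> sat (\<phi> e'))" if "\<forall>i<max n m. e i = e' i" for e e'
    using n[of e e'] m[of e e'] that by auto
  then show "definable_sat (\<lambda>e. \<chi> e \<^bold>\<and> \<phi> e)" using c definable_satD D_conj unfolding definable_sat_def sat.simps by blast
  fix s p assume a: "adequate s p"
  have "ult_forces (\<chi> s \<^bold>\<and> \<phi> s) p \<longleftrightarrow> Fr p (\<lambda>M. sat (\<chi> (vals s M))) \<and> Fr p (\<lambda>M. sat (\<phi> (vals s M)))"
    unfolding ult_forces_simps using L a unfolding Los_def by blast
  also have "\<dots> \<longleftrightarrow> Fr p (\<lambda>M. sat (\<chi> (vals s M) \<^bold>\<and> \<phi> (vals s M)))"
  proof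
    assume h: "Fr p (\<lambda>M. sat (\<chi> (vals s M))) \<and> Fr p (\<lambda>M. sat (\<phi> (vals s M)))"
    show "Fr p (\<lambda>M. sat (\<chi> (vals s M) \<^bold>\<and> \<phi> (vals s M)))"
      using Fr_conj[OF h[THEN conjunct1] h[THEN conjunct2]] by simp
  next
    assume h: "Fr p (\<lambda>M. sat (\<chi> (vals s M) \<^bold>\<and> \<phi> (vals s M)))"
    show "Fr p (\<lambda>M. sat (\<chi> (vals s M))) \<and> Fr p (\<lambda>M. sat (\<phi> (vals s M)))"
      by (intro conjI; rule Fr_weaken[OF h]; simp)
  qed
  finally show "ult_forces (\<chi> s \<^bold>\<and> \<phi> s) p \<longleftrightarrow> Fr p (\<lambda>M. sat (\<chi> (vals s M) \<^bold>\<and> \<phi> (vals s M)))" .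
qed

lemma Los_All [Los_intros]: assumes L: "Los (\<lambda>e. \<phi> (\<lambda>i. e (Suc i)) (e 0))" shows "Los (\<lambda>e. All (\<phi> e))"
  unfolding Los_def
proof (intro conjI allI impI)
  have c: "definable_sat (\<lambda>e. \<phi> (\<lambda>i. e (Suc i)) (e 0))" using L unfolding Los_def by blast
  show cA: "definable_sat (\<lambda>e. All (\<phi> e))" by (rule definable_sat_All[OF c])
  fix s p assume a: "adequate s p"
  have p: "p \<in> elts PP" and Bs: "\<And>i. B (s i)" using a by (auto simp: adequate_def)
  have adx: "adequate (case_nat x s) q" if "q \<in> bl p" "B x" "Fr q (defined_at x)" for x q
    using adequate_le[OF a that(1)] that(2,3) unfolding adequate_def by (auto split: nat.splits)
  have vx: "(\<lambda>i. vals (case_nat x s) M (Suc i)) = vals s M" "vals (case_nat x s) M 0 = ap x M" for x M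
    by (auto simp: vals_def[abs_def])
  have Lx: "ult_forces (\<phi> s x) q \<longleftrightarrow> Fr q (\<lambda>M. sat (\<phi> (vals s M) (ap x M)))" if "q \<in> bl p" "B x" "Fr q (defined_at x)" for x q
    using L[unfolded Los_def, THEN conjunct2, rule_format, OF adx[OF that]] unfolding vx by simp
  show "ult_forces (All (\<phi> s)) p \<longleftrightarrow> Fr p (\<lambda>M. sat (All (\<phi> (vals s M))))"
  proof
    assume u: "ult_forces (All (\<phi> s)) p"
    show "Fr p (\<lambda>M. sat (All (\<phi> (vals s M))))"
    proof (rule ccontr)
      assume n: "\<not> Fr p (\<lambda>M. sat (All (\<phi> (vals s M))))"
      have b: "bounded_pred (\<lambda>M. sat (All (\<phi> (vals s M))))" unfolding bounded_pred_iff by (rule definable_sat_bounded[OF cA Bs])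
      obtain q where q: "le q p" "\<And>M. meets M q \<Longrightarrow> \<not> sat (All (\<phi> (vals s M)))"
        by (rule not_Fr[OF p b definable_sat_D[OF cA] n]) blast
      have bx: "bounded_fun (\<lambda>M u. \<not> sat (\<phi> (vals s M) u))"
      proof -
        obtain n where n: "\<And>e e'. (\<And>i. i < n \<Longrightarrow> e i = e' i) \<Longrightarrow>
            sat (\<phi> (\<lambda>i. e (Suc i)) (e 0)) = sat (\<phi> (\<lambda>i. e' (Suc i)) (e' 0))"
          using c unfolding definable_sat_def by blast
        have nx: "sat (\<phi> e x) = sat (\<phi> e' x)" if "\<And>i. i < n \<Longrightarrow> e i = e' i" for e e' x
          using n[of "case_nat x e" "case_nat x e'"] that by (auto split: nat.splits)
        have "sat (\<phi> (vals s M) u) = sat (\<phi> (\<lambda>i. if i < n then vals s M i else emp) u)" for M u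
          by (rule nx) simp
        then show ?thesis using bounded_fun1[OF bounded_fun_vals[of s, OF Bs], of "\<lambda>e u. \<not> sat (\<phi> e u)" n] by simp
      qed
      have dx: "D (\<lambda>e. \<not> sat (\<phi> (vals s (e 0)) (e 1)))"
      proof (rule D_not)
        define t' where "t' = case_nat (\<lambda>e. e (1::nat)) (\<lambda>j e. ap (s j) (e 0))"
        have t': "Dt (t' i)" for i unfolding t'_def by (cases i) (simp_all, (intro dfn)+)
        show "D (\<lambda>e. sat (\<phi> (vals s (e 0)) (e 1)))"
          using definable_satD[OF c, of t', OF t'] unfolding t'_def vals_def[abs_def] by simp
      qed
      \<comment> \<open>One function picks a counterexample wherever there is one; as an element of
        the ultrapower it contradicts the forced universal statement.\<close>
      obtain h where h: "B h" "\<And>p. Fr p (defined_at h)" "\<And>M u. Good M \<Longrightarrow> \<not> sat (\<phi> (vals s M) u) \<Longrightarrow> \<not> sat (\<phi> (vals s M) (ap h M))"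
        by (rule select[OF dx bx]) blast
      have qb: "q \<in> bl p" using q(1) by (simp add: bl_iff)
      have "ult_dom \<delta> TI h q" using ult_dom_iff[OF bl_P(1)[OF qb]] h by blast
      then obtain r where r: "r \<in> bl q" "ult_forces (\<phi> s h) r" using u qb unfolding ult_forces_simps by blast
      have F: "Fr r (\<lambda>M. sat (\<phi> (vals s M) (ap h M)))" using Lx[OF bl_trans[OF r(1) qb] h(1,2)] r(2) by blast
      have "Fr r (\<lambda>M. \<not> sat (\<phi> (vals s M) (ap h M)))"
      proof (rule FrI)
        fix M assume M: "meets M r"
        have "meets M q" using le_meets M r(1) by (simp add: bl_iff)
        then have "\<not> sat (All (\<phi> (vals s M)))" by (rule q(2))
        then obtain u where "\<not> sat (\<phi> (vals s M) u)" by auto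
        then show "\<not> sat (\<phi> (vals s M) (ap h M))" using h(3) M by (simp add: meets_def)
      qed
      then show False using Fr_not[OF bl_P(1)[OF r(1)] F] by blast
    qed
  next
    assume F: "Fr p (\<lambda>M. sat (All (\<phi> (vals s M))))"
    show "ult_forces (All (\<phi> s)) p"
      unfolding ult_forces_simps
    proof (intro allI ballI impI)
      fix x q assume q: "q \<in> bl p" "ult_dom \<delta> TI x q"
      have qP: "q \<in> elts PP" by (rule bl_P(1)[OF q(1)])
      have x: "B x" "Fr q (defined_at x)" using q(2) ult_dom_iff[OF qP] by auto
      have "Fr q (\<lambda>M. sat (All (\<phi> (vals s M))))" using Fr_le[OF F] q(1) by (simp add: bl_iff)
      then have "Fr q (\<lambda>M. sat (\<phi> (vals s M) (ap x M)))" by (rule Fr_weaken) simp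
      then show "\<exists>r\<in>bl q. ult_forces (\<phi> s x) r" using Lx[OF q(1) x] bl_refl[OF qP] by blast
    qed
  qed
qed

lemma Los_regular: assumes p: "p \<in> elts PP" and f: "B f" "Fr p (defined_at f)" and u: "ult_forces (regular_f f) p"
  shows "Fr p (\<lambda>M. regular (ap f M))"
proof -
  have L: "Los (\<lambda>e. regular_f (e 0))"
    unfolding regular_f_def limit_f_def ord_f_def trans_f_def sub_f_def fun_f_def rel_f_def opair_f_def upair_f_def
    by (intro Los_intros)
  have "adequate (\<lambda>_. f) p" using p f by (simp add: adequate_def)
  then have "Fr p (\<lambda>M. sat (regular_f (vals (\<lambda>_. f) M 0)))" using L u unfolding Los_def by blast
  then show ?thesis by (simp add: vals_def regular_def)
qed

section \<open>The tower fails to have the weak Chang property\<close>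

text \<open>Ordinals below omega_2 have size at most omega_1, while a regular cardinal above omega_1
  does not inject into omega_1.\<close>

lemma regular_omega2_sub: assumes "regular k" "omega1 \<in> elts k" shows "elts omega2 \<subseteq> elts k"
proof
  fix e assume e: "e \<in> elts omega2"
  then have o: "Ord e" "card_le e omega1" by (auto simp: elts_omega2)
  have k: "Ord k" by (rule regular_Ord[OF assms(1)])
  show "e \<in> elts k"
  proof (rule ccontr)
    assume "e \<notin> elts k"
    then have "k = e \<or> k \<in> elts e" using Ord_linear[OF o(1) k] by blast
    then have "elts k \<subseteq> elts e" using Ord_subset_iff[OF k o(1)] by blast
    then have "card_le k omega1" using card_le_subset card_le_trans o(2) by blast
    then show False using regular_not_le[OF assms] by blast
  qed
qed

lemma bounded_fun_col: assumes z: "z \<in> elts \<delta>" shows "bounded_fun (\<lambda>M. col M z)"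
proof -
  obtain k where k: "k \<in> tower_index \<delta>"
    "\<And>l. l \<in> tower_index \<delta> \<Longrightarrow> elts k \<subseteq> elts l \<Longrightarrow> elts z \<subseteq> elts (H l) \<and> elts kappa \<subseteq> elts (H l)"
    by (rule index_for[OF z]) blast
  show ?thesis
    unfolding bounded_fun_def
  proof (intro bexI[OF _ k(1)] ballI impI allI)
    fix l M assume "l \<in> tower_index \<delta>" "elts k \<subseteq> elts l"
    then show "col (int M (H l)) z = col M z" using col_int[OF Ord_elt[OF Ord_\<delta> z]] k(2) by blast
  qed
qed

lemma fex_E: assumes "fex PP LL A \<phi> p" "p \<in> elts PP"
  obtains x q where "x \<in> A" "q \<in> bl p" "\<phi> x q"
  using assms bl_refl unfolding fex_def fneg_def fall_def by blast

lemma fimp_E: assumes "fimp PP LL \<phi> \<psi> p" "q \<in> bl p" "\<phi> q"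
  obtains r where "r \<in> bl q" "\<psi> r"
  using assms unfolding fimp_def fneg_def fconj_def by blast

lemma not_weak_Chang: "\<not> weak_Chang \<delta> TI"
proof
  assume wC: "weak_Chang \<delta> TI"
  obtain p where p: "p \<in> elts PP" by (rule PP_nonempty)
  have "fex PP LL {f. B f} (\<lambda>f. fconj (ult_dom \<delta> TI f) (fconj (ult_collapses_to \<delta> TI f) (ult_forces (regular_f f)))) p"
    using wC p unfolding weak_Chang_def PP_unfold by blast
  then obtain f q where q: "B f" "q \<in> bl p" "ult_dom \<delta> TI f q" "ult_collapses_to \<delta> TI f q" "ult_forces (regular_f f) q"
    unfolding fconj_def by (rule fex_E[OF _ p]) blast
  have qP: "q \<in> elts PP" by (rule bl_P(1)[OF q(2)])
  have fF: "Fr q (defined_at f)" using q(3) ult_dom_iff[OF qP] by blast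
  have reg: "Fr q (\<lambda>M. regular (ap f M))" by (rule Los_regular[OF qP q(1) fF q(5)])
  define T where "T = insert \<delta> (elts \<delta>)"
  obtain R r0 where R: "nm R" and r0: "r0 \<in> bl q"
    and c: "FM r0 (chk (opair \<delta> f)) R" "fall T (\<lambda>z. fex PP LL {g. B g} (\<lambda>g r. FM r (chk (opair z g)) R)) r0"
     "fall T (\<lambda>z. fall {g. B g} (\<lambda>g. fimp PP LL (\<lambda>r. FM r (chk (opair z g)) R)
        (fconj (ult_dom \<delta> TI g)
          (fall {g. B g} (\<lambda>g'. fimp PP LL (ult_dom \<delta> TI g')
            (fiff PP LL (ult_mem \<delta> TI g' g)
              (fex PP LL (elts z) (\<lambda>z'. fex PP LL {g. B g} (\<lambda>g''.
                fconj (\<lambda>r. FM r (chk (opair z' g'')) R) (ult_eq \<delta> TI g' g'')))))))))) r0"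
    using q(4) unfolding ult_collapses_to_def Let_def PP_unfold check_chk T_def[symmetric] fconj_def[of "force_mem _ _ _ _"]
      fconj_def[of "fall _ _"] by (rule fex_E[OF _ qP]) blast
  have r0P: "r0 \<in> elts PP" by (rule bl_P(1)[OF r0])
  \<comment> \<open>\<open>rel r z g\<close> means that \<open>r\<close> forces the class of
    \<open>g\<close> to be sent to \<open>z\<close> by the collapse that the name \<open>R\<close>
    describes.\<close>
  define rel where "rel r z g \<longleftrightarrow> FM r (chk (opair z g)) R" for r z g
  have rel_bl: "rel s z g" if "rel r z g" "s \<in> bl r" for r s z g
    using FM_below[OF nm_chk R _ that(2)] that(1) unfolding rel_def by blast
  have \<delta>T: "\<delta> \<in> T" and zT: "\<And>z. z \<in> elts \<delta> \<Longrightarrow> z \<in> T" by (auto simp: T_def)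
  have witness: "\<exists>s\<in>bl r. \<exists>g. B g \<and> rel s z g" if "r \<in> bl r0" "z \<in> T" for r z
  proof -
    have "fex PP LL {g. B g} (\<lambda>g r. FM r (chk (opair z g)) R) r0" using c(2) that(2) unfolding fall_def by blast
    then have "\<forall>r\<in>bl r0. \<exists>g s. B g \<and> s \<in> bl r \<and> FM s (chk (opair z g)) R"
      unfolding fex_def fneg_def fall_def by blast
    then show ?thesis using that(1) unfolding rel_def by blast
  qed
  have main: "\<exists>s\<in>bl r. ult_dom \<delta> TI g s \<and> (\<forall>g'. B g' \<longrightarrow> fimp PP LL (ult_dom \<delta> TI g')
            (fiff PP LL (ult_mem \<delta> TI g' g)
              (fex PP LL (elts z) (\<lambda>z'. fex PP LL {g. B g} (\<lambda>g''.
                fconj (\<lambda>r. FM r (chk (opair z' g'')) R) (ult_eq \<delta> TI g' g''))))) s)"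
    if "r \<in> bl r0" "z \<in> T" "B g" "rel r z g" for r z g
  proof -
    have 1: "fimp PP LL (\<lambda>r. FM r (chk (opair z g)) R)
        (fconj (ult_dom \<delta> TI g)
          (fall {g. B g} (\<lambda>g'. fimp PP LL (ult_dom \<delta> TI g')
            (fiff PP LL (ult_mem \<delta> TI g' g)
              (fex PP LL (elts z) (\<lambda>z'. fex PP LL {g. B g} (\<lambda>g''.
                fconj (\<lambda>r. FM r (chk (opair z' g'')) R) (ult_eq \<delta> TI g' g'')))))))) r0"
      using c(3) that(2,3) unfolding fall_def by blast
    show ?thesis
      by (rule fimp_E[OF 1 that(1) that(4)[unfolded rel_def]]) (unfold fconj_def fall_def, blast)
  qed
  have rel_df: "Fr r (defined_at g)" if r: "r \<in> bl r0" "z \<in> T" "B g" "rel r z g" for r z g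
  proof (rule Fr_dense[OF bl_P(1)[OF r(1)]])
    show "bounded_pred (defined_at g)" unfolding bounded_pred_iff defined_at_def[abs_def]
      using bounded_fun1[OF B_opair[OF r(3)], of "\<lambda>X. \<exists>u. u \<in> X"] by simp
    show "D (\<lambda>e. defined_at g (e 0))" unfolding defined_at_def by (intro dfn)
    fix s assume "le s r"
    then have s: "s \<in> bl r" by (simp add: bl_iff)
    obtain t where t: "t \<in> bl s" "ult_dom \<delta> TI g t"
      using main[OF bl_trans[OF s r(1)] r(2,3) rel_bl[OF r(4) s]] by blast
    then have "Fr t (defined_at g)" using ult_dom_iff[OF bl_P(1)[OF t(1)]] by blast
    then show "\<exists>t. le t s \<and> Fr t (defined_at g)" using t(1) by (auto simp: bl_iff)
  qed
  have iff: "\<exists>s\<in>bl r. fimp PP LL (ult_mem \<delta> TI g' g) Y s \<and> fimp PP LL Y (ult_mem \<delta> TI g' g) s"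
    if r: "r \<in> bl r0" "z \<in> T" "B g" "rel r z g" and g': "B g'" "Fr r (defined_at g')"
      and Y: "Y = fex PP LL (elts z) (\<lambda>z'. fex PP LL {g. B g} (\<lambda>g''.
                fconj (\<lambda>r. FM r (chk (opair z' g'')) R) (ult_eq \<delta> TI g' g'')))" for r z g g' Y
  proof -
    obtain s where s: "s \<in> bl r" "fimp PP LL (ult_dom \<delta> TI g') (fiff PP LL (ult_mem \<delta> TI g' g) Y) s"
      using main[OF r] g'(1) unfolding Y by blast
    have "ult_dom \<delta> TI g' s" using ult_dom_iff[OF bl_P(1)[OF s(1)]] g'(1) Fr_bl[OF g'(2) s(1)] by blast
    then obtain t where t: "t \<in> bl s" "fiff PP LL (ult_mem \<delta> TI g' g) Y t"
      by (rule fimp_E[OF s(2) bl_refl[OF bl_P(1)[OF s(1)]]])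
    then show ?thesis using bl_trans[OF t(1) s(1)] unfolding fiff_def fconj_def[of "fimp _ _ _ _"] by blast
  qed
  \<comment> \<open>After strengthening, every element of the class of \<open>g\<close> is
    represented by some \<open>g''\<close> that belongs to a smaller ordinal.\<close>
  have down: "\<exists>s\<in>bl r. \<exists>z'\<in>elts z. \<exists>g''. B g'' \<and> rel s z' g'' \<and> Fr s (\<lambda>M. ap g' M = ap g'' M)"
    if r: "r \<in> bl r0" "z \<in> T" "B g" "rel r z g" and g': "B g'" "Fr r (defined_at g')" "Fr r (\<lambda>M. ap g' M \<in> elts (ap g M))"
    for r z g g'
  proof -
    let ?Y = "fex PP LL (elts z) (\<lambda>z'. fex PP LL {g. B g} (\<lambda>g''.
                fconj (\<lambda>r. FM r (chk (opair z' g'')) R) (ult_eq \<delta> TI g' g'')))"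
    obtain s where s: "s \<in> bl r" "fimp PP LL (ult_mem \<delta> TI g' g) ?Y s" using iff[OF r g'(1,2) refl] by blast
    have sP: "s \<in> elts PP" by (rule bl_P(1)[OF s(1)])
    have "Fr s (\<lambda>M. defined_at g' M \<and> defined_at g M \<and> ap g' M \<in> elts (ap g M))"
      by (intro Fr_conj Fr_bl[OF _ s(1)] g'(2,3) rel_df[OF r])
    then have "ult_mem \<delta> TI g' g s" using ult_mem_iff[OF sP g'(1) r(3)] by blast
    then obtain t where t: "t \<in> bl s" "?Y t" by (rule fimp_E[OF s(2) bl_refl[OF sP]])
    obtain z' t1 where z: "z' \<in> elts z" "t1 \<in> bl t" "fex PP LL {g. B g} (\<lambda>g''.
                fconj (\<lambda>r. FM r (chk (opair z' g'')) R) (ult_eq \<delta> TI g' g'')) t1"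
      by (rule fex_E[OF t(2) bl_P(1)[OF t(1)]])
    obtain g'' t2 where g'': "B g''" "t2 \<in> bl t1" "FM t2 (chk (opair z' g'')) R" "ult_eq \<delta> TI g' g'' t2"
      by (rule fex_E[OF z(3) bl_P(1)[OF z(2)]]) (auto simp: fconj_def)
    have "Fr t2 (\<lambda>M. ap g' M = ap g'' M)"
      using g''(4) unfolding ult_eq_iff[OF bl_P(1)[OF g''(2)] g'(1) g''(1)] by (rule Fr_weaken) simp
    moreover have "t2 \<in> bl r" using bl_trans g''(2) z(2) t(1) s(1) by blast
    ultimately show ?thesis using z(1) g''(1,3) unfolding rel_def by blast
  qed
  \<comment> \<open>Conversely, a representative of a smaller ordinal is an element of the class of
    \<open>g\<close> below a stronger condition.\<close>
  have up: "\<exists>s\<in>bl r. Fr s (\<lambda>M. ap g' M \<in> elts (ap g M))"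
    if r: "r \<in> bl r0" "z \<in> T" "B g" "rel r z g" and z': "z' \<in> elts z" and g': "B g'" "rel r z' g'" "Fr r (defined_at g')"
    for r z g z' g'
  proof -
    let ?Y = "fex PP LL (elts z) (\<lambda>z'. fex PP LL {g. B g} (\<lambda>g''.
                fconj (\<lambda>r. FM r (chk (opair z' g'')) R) (ult_eq \<delta> TI g' g'')))"
    obtain s where s: "s \<in> bl r" "fimp PP LL ?Y (ult_mem \<delta> TI g' g) s" using iff[OF r g'(1,3) refl] by blast
    have sP: "s \<in> elts PP" by (rule bl_P(1)[OF s(1)])
    have e: "fconj (\<lambda>r. FM r (chk (opair z' g')) R) (ult_eq \<delta> TI g' g') t" if t: "t \<in> bl s" for t
      using rel_bl[OF g'(2) bl_trans[OF t s(1)]] ult_eq_iff[OF bl_P(1)[OF t] g'(1,1)]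
        Fr_bl[OF g'(3) bl_trans[OF t s(1)]] unfolding fconj_def rel_def by simp
    have "fex PP LL {g. B g} (\<lambda>g''. fconj (\<lambda>r. FM r (chk (opair z' g'')) R) (ult_eq \<delta> TI g' g'')) t" if t: "t \<in> bl s" for t
      unfolding fex_def fneg_def fall_def using e[OF bl_trans[OF _ t]] g'(1) bl_refl bl_P(1) by blast
    then have "?Y s" using z' bl_refl bl_P(1) unfolding fex_def[of _ _ "elts z"] fneg_def fall_def by blast
    then obtain t where t: "t \<in> bl s" "ult_mem \<delta> TI g' g t" by (rule fimp_E[OF s(2) bl_refl[OF sP]])
    have "Fr t (\<lambda>M. ap g' M \<in> elts (ap g M))"
      using t(2) unfolding ult_mem_iff[OF bl_P(1)[OF t(1)] g'(1) r(3)] by (rule Fr_weaken) simp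
    then show ?thesis using bl_trans[OF t(1) s(1)] by blast
  qed
  \<comment> \<open>Extensionality and induction. A surplus element of \<open>ap g M\<close> is made
    into a function by \<open>select\<close> and traced to a smaller ordinal by \<open>down\<close>.
    A missing \<open>col M w\<close> gets a constant \<open>w\<close> by \<open>press_down\<close>,
    and \<open>witness\<close> and \<open>up\<close> show that it is present.\<close>
  have "z \<in> elts \<delta> \<longrightarrow> (\<forall>g. B g \<longrightarrow> (\<forall>r\<in>bl r0. rel r z g \<longrightarrow> Fr r (\<lambda>M. ap g M = col M z)))" for z
  proof (induction z rule: eps_induct)
    case D
    show ?case unfolding rel_def Fr_def by (intro dfn)
  next
    case (step z)
    show ?case
    proof (intro impI allI ballI)
      fix g r assume z: "z \<in> elts \<delta>" and g: "B g" and r: "r \<in> bl r0" and rel: "rel r z g"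
      have rP: "r \<in> elts PP" by (rule bl_P(1)[OF r])
      have bc: "bounded_fun (\<lambda>M. col M z)" by (rule bounded_fun_col[OF z])
      have IH: "Fr s (\<lambda>M. ap g' M = col M z' \<and> z' \<in> elts M)"
        if s: "s \<in> bl r0" and z': "z' \<in> elts z" and g': "B g'" "rel s z' g'" for s z' g'
      proof (rule Fr_conj)
        have z'\<delta>: "z' \<in> elts \<delta>" using Ord_trans[OF Ord_\<delta> z] z' by blast
        then show "Fr s (\<lambda>M. ap g' M = col M z')" using step[OF z'] g' s by blast
        show "Fr s (\<lambda>M. z' \<in> elts M)" using Fr_mem z'\<delta> \<delta>_sub_Vd by blast
      qed
      show "Fr r (\<lambda>M. ap g M = col M z)"
      proof (rule ccontr)
        assume n: "\<not> Fr r (\<lambda>M. ap g M = col M z)"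
        have b: "bounded_pred (\<lambda>M. ap g M = col M z)" unfolding bounded_pred_iff by (rule bounded_fun2[OF B_ap[OF g] bc])
        have d: "D (\<lambda>e. ap g (e 0) = col (e 0) z)" by (intro dfn)
        obtain r1 where r1: "le r1 r" "\<And>M. meets M r1 \<Longrightarrow> ap g M \<noteq> col M z" by (rule not_Fr[OF rP b d n]) blast
        have r1b: "r1 \<in> bl r" "r1 \<in> bl r0" using r1(1) r bl_trans by (auto simp: bl_iff)
        have r1P: "r1 \<in> elts PP" by (rule bl_P(1)[OF r1b(1)])
        have b1: "bounded_pred (\<lambda>M. \<exists>x\<in>elts (ap g M). x \<notin> elts (col M z))" unfolding bounded_pred_iff
          by (rule bounded_fun2[OF B_ap[OF g] bc, where h = "\<lambda>X Y. \<exists>x\<in>elts X. x \<notin> elts Y"])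
        have d1: "D (\<lambda>e. \<exists>x\<in>elts (ap g (e 0)). x \<notin> elts (col (e 0) z))" by (intro dfn)
        show False
        proof (cases "Fr r1 (\<lambda>M. \<not> (\<exists>x\<in>elts (ap g M). x \<notin> elts (col M z)))")
          case False
          then obtain r2 where r2: "le r2 r1" "\<And>M. meets M r2 \<Longrightarrow> \<exists>x\<in>elts (ap g M). x \<notin> elts (col M z)"
            by (rule strengthen[OF r1P b1 d1]) blast
          have r2b: "r2 \<in> bl r1" using r2(1) by (simp add: bl_iff)
          have r2r0: "r2 \<in> bl r0" by (rule bl_trans[OF r2b r1b(2)])
          have dc: "D (\<lambda>e. e 1 \<in> elts (ap g (e 0)) \<and> e 1 \<notin> elts (col (e 0) z))" by (intro dfn)
          have bb: "bounded_fun (\<lambda>M u. u \<in> elts (ap g M) \<and> u \<notin> elts (col M z))"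
            by (rule bounded_fun2[OF B_ap[OF g] bc, where h = "\<lambda>X Y u. u \<in> elts X \<and> u \<notin> elts Y"])
          obtain h where h: "B h" "\<And>p. Fr p (defined_at h)" "\<And>M u. Good M \<Longrightarrow> u \<in> elts (ap g M) \<and> u \<notin> elts (col M z) \<Longrightarrow>
              ap h M \<in> elts (ap g M) \<and> ap h M \<notin> elts (col M z)"
            by (rule select[OF dc bb]) blast
          have hr: "ap h M \<in> elts (ap g M) \<and> ap h M \<notin> elts (col M z)" if "meets M r2" for M
            using r2(2)[OF that] h(3)[of M] that unfolding meets_def by blast
          have "Fr r2 (\<lambda>M. ap h M \<in> elts (ap g M))" by (rule FrI) (use hr in blast)
          then obtain s z' g'' where s: "s \<in> bl r2" "z' \<in> elts z" "B g''" "rel s z' g''" "Fr s (\<lambda>M. ap h M = ap g'' M)"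
            using down[OF r2r0 zT[OF z] g rel_bl[OF rel bl_trans[OF r2b r1b(1)]] h(1,2)] by blast
          obtain M where M: "meets M s" "ap h M = ap g'' M" "ap g'' M = col M z'" "z' \<in> elts M"
            using Fr_ex[OF bl_P(1)[OF s(1)] Fr_conj[OF s(5) IH[OF bl_trans[OF s(1) r2r0] s(2,3,4)]]] by blast
          have "meets M r2" using le_meets M(1) s(1) by (simp add: bl_iff)
          then have "ap h M \<notin> elts (col M z)" using hr by blast
          then show False using col_mem[OF s(2) M(4)] M(2,3) by simp
        next
          case True
          have "Fr r1 (\<lambda>M. \<exists>w\<in>elts z. w \<in> elts M \<and> col M w \<notin> elts (ap g M))"
          proof (rule Fr_weaken[OF True])
            fix M assume M: "meets M r1" "\<not> (\<exists>x\<in>elts (ap g M). x \<notin> elts (col M z))"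
            then have "\<not> elts (col M z) \<subseteq> elts (ap g M)" using r1(2)[OF M(1)] elts_eqI by blast
            then show "\<exists>w\<in>elts z. w \<in> elts M \<and> col M w \<notin> elts (ap g M)" unfolding elts_col by blast
          qed
          moreover have "z \<in> elts Vd" using z \<delta>_sub_Vd by blast
          moreover have "bounded_pred (\<lambda>M. col M w \<notin> elts (ap g M))" if w: "w \<in> elts z" for w
          proof -
            have w\<delta>: "w \<in> elts \<delta>" using Ord_trans[OF Ord_\<delta> z] w by blast
            have "bounded_fun (\<lambda>M. col M w)" by (rule bounded_fun_col[OF w\<delta>])
            then show ?thesis unfolding bounded_pred_iff
              by (rule bounded_fun2[OF _ B_ap[OF g], where h = "\<lambda>X Y. X \<notin> elts Y"])
          qed
          moreover have "D (\<lambda>e. col (e 1) (e 0) \<notin> elts (ap g (e 1)))" by (intro dfn)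
          ultimately obtain w r2 where w: "w \<in> elts z" "le r2 r1" "\<And>M. meets M r2 \<Longrightarrow> col M w \<notin> elts (ap g M)"
            using press_down[where \<chi> = "\<lambda>w M. col M w \<notin> elts (ap g M)", OF r1P] by blast
          have r2b: "r2 \<in> bl r1" using w(2) by (simp add: bl_iff)
          have r2r0: "r2 \<in> bl r0" by (rule bl_trans[OF r2b r1b(2)])
          have wT: "w \<in> T" using Ord_trans[OF Ord_\<delta> z] w(1) zT by blast
          obtain s g'' where s: "s \<in> bl r2" "B g''" "rel s w g''" using witness[OF r2r0 wT] by blast
          have sr0: "s \<in> bl r0" by (rule bl_trans[OF s(1) r2r0])
          have sr: "rel s z g" by (rule rel_bl[OF rel bl_trans[OF s(1) bl_trans[OF r2b r1b(1)]]])
          obtain t where t: "t \<in> bl s" "Fr t (\<lambda>M. ap g'' M \<in> elts (ap g M))"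
            using up[OF sr0 zT[OF z] g sr w(1) s(2,3) rel_df[OF sr0 wT s(2,3)]] by blast
          have tP: "t \<in> elts PP" by (rule bl_P(1)[OF t(1)])
          obtain M where M: "meets M t" "ap g'' M \<in> elts (ap g M)" "ap g'' M = col M w"
            using Fr_ex[OF tP Fr_conj[OF t(2) Fr_bl[OF IH[OF sr0 w(1) s(2,3)] t(1)]]] by blast
          have "meets M r2" using le_meets M(1) bl_trans[OF t(1) s(1)] by (simp add: bl_iff)
          then show False using w(3) M(2,3) by auto
        qed
      qed
    qed
  qed
  note collapse = this[rule_format]
  \<comment> \<open>The ordinal \<open>omega1\<close> has a representative, with value
    \<open>omega1\<close> almost everywhere since the collapse fixes it. It is an element of the
    class of \<open>f\<close>, so the regular values of \<open>f\<close> include all of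
    omega_2.\<close>
  obtain s g where s: "s \<in> bl r0" "B g" "rel s omega1 g"
    using witness[OF bl_refl[OF r0P] zT[OF omega1_\<delta>]] by blast
  have rf: "rel s \<delta> f" using rel_bl[OF _ s(1)] c(1) unfolding rel_def by blast
  obtain t where t: "t \<in> bl s" "Fr t (\<lambda>M. ap g M \<in> elts (ap f M))"
    using up[OF s(1) \<delta>T q(1) rf omega1_\<delta> s(2,3) rel_df[OF s(1) zT[OF omega1_\<delta>] s(2,3)]] by blast
  have tr0: "t \<in> bl r0" by (rule bl_trans[OF t(1) s(1)])
  have tq: "t \<in> bl q" by (rule bl_trans[OF tr0 r0])
  have eps_f: "Fr t (\<lambda>M. eps M \<in> elts (ap f M))"
  proof (rule Fr_weaken[OF Fr_conj[OF Fr_conj[OF t(2) Fr_bl[OF collapse[OF omega1_\<delta> s(2) s(1) s(3)] t(1)]] Fr_bl[OF reg tq]]])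
    fix M assume M: "meets M t" "(ap g M \<in> elts (ap f M) \<and> ap g M = col M omega1) \<and> regular (ap f M)"
    then have G: "Good M" by (simp add: meets_def)
    have "omega1 \<in> elts (ap f M)" using M(2) col_omega1[OF GoodD(4)[OF G]] by auto
    then show "eps M \<in> elts (ap f M)" using regular_omega2_sub M(2) Good_eps(1)[OF G] by blast
  qed
  have de: "D (\<lambda>e. e 1 = eps (e 0))" by (intro dfn)
  have be: "bounded_fun (\<lambda>M u. u = eps M)"
  proof -
    obtain k where k: "k \<in> tower_index \<delta>"
      "\<And>l. l \<in> tower_index \<delta> \<Longrightarrow> elts k \<subseteq> elts l \<Longrightarrow> elts om \<subseteq> elts (H l) \<and> elts kappa \<subseteq> elts (H l)"
      by (rule index_for[OF om_\<delta>]) blast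
    have "bounded_fun eps"
      unfolding bounded_fun_def
    proof (intro bexI[OF _ k(1)] ballI impI allI)
      fix l M assume "l \<in> tower_index \<delta>" "elts k \<subseteq> elts l"
      then show "eps (int M (H l)) = eps M" using eps_int k(2) by blast
    qed
    then show ?thesis by (rule bounded_fun1[where h = "\<lambda>X u. u = X"])
  qed
  \<comment> \<open>Represents \<open>eps\<close> by a function of bounded support, so that
    \<open>down\<close> can be applied to it.\<close>
  obtain h where h: "B h" "\<And>p. Fr p (defined_at h)" "\<And>M u. Good M \<Longrightarrow> u = eps M \<Longrightarrow> ap h M = eps M"
    by (rule select[OF de be]) blast
  have "Fr t (\<lambda>M. ap h M \<in> elts (ap f M))"
    by (rule Fr_weaken[OF eps_f]) (use h(3) in \<open>simp add: meets_def\<close>)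
  then obtain v z g' where v: "v \<in> bl t" "z \<in> elts \<delta>" "B g'" "rel v z g'" "Fr v (\<lambda>M. ap h M = ap g' M)"
    using down[OF tr0 \<delta>T q(1) rel_bl[OF rf t(1)] h(1,2)] by blast
  have vr0: "v \<in> bl r0" by (rule bl_trans[OF v(1) tr0])
  have "z \<in> elts Vd" using v(2) \<delta>_sub_Vd by blast
  then obtain M where M: "meets M v" "ap h M = ap g' M" "ap g' M = col M z" "z \<in> elts M"
    using Fr_ex[OF bl_P(1)[OF v(1)] Fr_conj[OF Fr_conj[OF v(5) collapse[OF v(2,3) vr0 v(4)]] Fr_mem]] by blast
  then have G: "Good M" by (simp add: meets_def)
  have "col M z = eps M" using h(3)[OF G refl] M(2,3) by simp
  then show False using Good_eps(2)[OF G M(4) v(2)] not_mem_self by simp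
qed

end

theorem theorem2:
  fixes E :: "'v \<Rightarrow> 'v \<Rightarrow> bool" and \<delta> :: 'v
  assumes "zfc E"
    and "zfc.PFA_plus E \<or> zfc.MM E"
    and "zfc.inaccessible E \<delta>"
  shows "\<exists>I. zfc.tower E \<delta> I \<and> zfc.critical_point E \<delta> I (zfc.omega2 E) \<and>
    \<not> zfc.presaturated E \<delta> I \<and> \<not> zfc.weak_Chang E \<delta> I"
proof -
  interpret zfc_inaccessible E \<delta>
    using assms(1,3) by (simp add: zfc_inaccessible_def zfc_inaccessible_axioms_def)
  show ?thesis using tower_TI critical_point_TI not_presaturated not_weak_Chang by blast
qed

end
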